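(* Let $u^0$ be an admissible blowup solution. There exists a constant $C>0$, depending only on $u^0$ (through its mass), such that the following holds for every tuple $(\epsilon_1,\epsilon_2,\epsilon_3)$ admissible for $u^0$, every integer $k_0\ge20$ and every $T_0>0$ with $\int_0^{T_0}\int_{\mathbb{R}^2}|u^0|^4dxdt=2^{k_0}$: set $\lambda=\epsilon_32^{k_0}/\int_0^{T_0}N^0(t)^3dt$ (where $N^0$ is the frequency scale function of $u^0$), let $u(t,x)=\lambda u^0(\lambda^2t,\lambda x)$ be the rescaled solution, with frequency center function $\xi(t)$, and $T=\lambda^{-2}T_0$. For any integers $0\le l_2\le i-10$, $20\le i<j$, $20\le j\le k_0$; any intervals $J_l\subset G^i_\alpha\subset G^j_\kappa\subset[0,T]$ with $J_l$ small; any integer $k\le l_2+2$ and any $v_0\in\mathcal{S}(\mathbb{R}^2)$ with Fourier support in a cube of side length $2^k$ intersecting the annulus $\{2^{i-6}\le|\xi-\xi(G^i_\alpha)|\le2^{i+6}\}$, we have $$\begin{aligned}\|(e^{it\Delta}v_0)(P_{\xi(t),\le l_2}u)\|^2_{L^2_{t,x}(J_l\times\mathbb{R}^2)}\le{}&C2^{k-i}\|v_0\|^2_{L^2(\mathbb{R}^2)}\\&+C2^{k-l_2-i}\|v_0\|^2_{L^2(\mathbb{R}^2)}\int_{J_l}|\xi'(t)|\sum_{l_1\le l_2}2^{\frac{l_1-l_2}{2}}\|P_{\xi(t),l_1}u(t)\|_{L^2_x(\mathbb{R}^2)}\|P_{\xi(t),l_2}u(t)\|_{L^2_x(\mathbb{R}^2)}dt.\end{aligned}$$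 The same estimate holds with $P_{\xi(t),\le l_2}$ replaced by $P_{\xi(t),l_2}$ on the left-hand side.
   Context: Equation and solutions. $\mu\in\{\pm1\}$, $\mathcal{E}=\partial_1^2/\Delta$ is the Fourier multiplier on $\mathbb{R}^2$ with symbol $\xi_1^2/|\xi|^2$, and the equation is $(i\partial_t+\Delta)u=F(u):=(\mu|u|^2-\mathcal{E}(|u|^2))u$. A solution on an interval $I$ is $u\in C^0_{t,loc}L^2_x\cap L^4_{t,loc}L^4_x(I\times\mathbb{R}^2)$ satisfying Duhamel's formula $u(t_1)=e^{i(t_1-t_0)\Delta}u(t_0)-i\int_{t_0}^{t_1}e^{i(t_1-t)\Delta}F(u(t))dt$ for all $t_0,t_1\in I$; maximal lifespan means not extendable. $M(u)=\int|u(t)|^2dx$ (conserved). $u$ blows up forward (backward) if $\int\int|u|^4=\infty$ over $[t_0,\sup I)\times\mathbb{R}^2$ (over $(\inf I,t_0]\times\mathbb{R}^2$) for some $t_0$. For $\mu=-1$, $\mathcal{L}=\mathrm{Id}+\mathcal{E}$ and $Q>0$ solves $\Delta Q-Q+\mathcal{L}(Q^2)Q=0$ with $2/M(Q)$ the optimal constant $C$ in $|\langle\mathcal{L}(|f|^2),|f|^2\rangle|\le C\|f\|_{L^2}^2\|\nabla f\|_{L^2}^2$. $L(M)=\sup\{\int_I\int|u|^4:u\text{ a solution on }I,\ M(u)\le M\}$ ($M\in[0,\infty)$ if $\mu=1$, $M\in[0,M(Q)]$ if $\mu=-1$), $M_c=\sup\{M:L(M)<\infty\}$; standing assumption $M_c<\infty$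 if $\mu=1$, $M_c<M(Q)$ if $\mu=-1$. Admissible blowup solution. A maximal-lifespan solution $u:I\times\mathbb{R}^2\to\mathbb{C}$ with mass $M_c$, blowing up forward and backward, for which there are $x,\xi:I\to\mathbb{R}^2$, $N:I\to(0,\infty)$ (frequency scale function), $C:(0,\infty)\to[0,\infty)$ with $\int_{|x-x(t)|\ge C(\eta)/N(t)}|u(t,x)|^2dx+\int_{|\xi-\xi(t)|\ge C(\eta)N(t)}|\hat u(t,\xi)|^2d\xi\le\eta$ for all $\eta>0$, $t\in I$, and such that $[0,\infty)\subset I$; $N\le1$ on $[0,\infty)$, $x(0)=\xi(0)=0$; $N,\xi\in C^1_{loc}([0,\infty))$ and $|N'|+|\xi'|\le c(u)N^3$ on $[0,\infty)$. Here $\hat f(\xi)=\int f(x)e^{-ix\cdot\xi}dx$. The rescaled solution $\lambda u^0(\lambda^2t,\lambda x)$ carries the parameters $\lambda^{-1}x^0(\lambda^2t)$, $\xi(t)=\lambda\xi^0(\lambda^2t)$, $N(t)=\lambda N^0(\lambda^2t)$. Admissible tuple. $(\epsilon_1,\epsilon_2,\epsilon_3)$ with $0<\epsilon_3<\epsilon_2<\epsilon_1\le2^{-100}$ is admissible for a solution $u$ (with parameters $x,\xi,N$) if: (i) $|\xi'(t)|+|N'(t)|\le2^{-20}\epsilon_1^{-1/2}N(t)^3$ for $t\ge0$; (ii) $\int_{|x-x(t)|\ge2^{-20}\epsilon_3^{-1/4}/N(t)}|u(t,x)|^2dx+\int_{|\xi-\xi(t)|\ge2^{-20}\epsilon_3^{-1/4}N(t)}|\hat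 u(t,\xi)|^2d\xi\le\epsilon_2^2$ for $t\ge0$; (iii) $\epsilon_3<\epsilon_2^{10}<\epsilon_1^{10}$. Littlewood–Paley projections. Fix a radial nonincreasing $\phi\in C_c^\infty(\mathbb{R}^2)$, $0\le\phi\le1$, $\phi=1$ on $|x|\le1$, $\phi=0$ on $|x|>2$. $P_0=\phi(D)$, $P_j=\phi(2^{-j}D)-\phi(2^{-j+1}D)$ for $j\ge1$, $P_j=0$ for $j<0$ ($D=-i\nabla$), $P_{\le j}=\sum_{j'\le j}P_{j'}$, and for $\xi_0\in\mathbb{R}^2$, $P_{\xi_0,*}f=e^{ix\cdot\xi_0}P_*(e^{-ix\cdot\xi_0}f)$. $\mathcal{S}$ is the Schwartz space. Intervals. With $u,\xi,N,T$ the rescaled objects, $\int_0^T\int|u|^4=2^{k_0}$ and $\int_0^TN^3=\epsilon_32^{k_0}$. $J_l\subset[0,T]$ is a small interval if $\|u\|_{L^4_{t,x}(J_l\times\mathbb{R}^2)}=1$. Partition $[0,T]$ into $2^{k_0}$ consecutive intervals $J^\alpha$, $0\le\alpha<2^{k_0}$, with $\int_{J^\alpha}(N(t)^3+\epsilon_3\|u(t)\|_{L^4_x}^4)dt=2\epsilon_3$. For $0\le j\le k_0$, $0\le\kappa<2^{k_0-j}$, $G^j_\kappa=\bigcup_{\alpha=\kappa2^j}^{(\kappa+1)2^j-1}J^\alpha$ and $\xi(G^j_\kappa)=\xi(t_0)$ with $t_0$ the left endpoint of $G^j_\kappa$. *)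

theory Defs
  imports "HOL-Analysis.Analysis"
begin

type_synonym plane = "real ^ 2"

text \<open>\<open>Lpow p f\<close> and \<open>Lpow_st p J u\<close> are the \<open>p\<close>-th powers of the norms of \<open>L\<^sup>p\<close> of the plane and
  of \<open>L\<^sup>p(J \<times> plane)\<close>.  The space-time norm is an iterated integral, so that it does not see
  changes of \<open>u t\<close> on a null set that depends on \<open>t\<close>; operators below act on each
  \<open>u t\<close> and return a representative of an \<open>L\<^sup>2\<close> class.\<close>

definition Lpow :: "nat \<Rightarrow> (plane \<Rightarrow> complex) \<Rightarrow> ennreal" where
  "Lpow p f = (\<integral>\<^sup>+ x. ennreal (cmod (f x) ^ p) \<partial>lborel)"

definition Lpow_st :: "nat \<Rightarrow> real set \<Rightarrow> (real \<Rightarrow> plane \<Rightarrow> complex) \<Rightarrow> ennreal" where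
  "Lpow_st p J u = (\<integral>\<^sup>+ t\<in>J. Lpow p (u t) \<partial>lborel)"

definition L2 :: "(plane \<Rightarrow> complex) set" where
  "L2 = {f. f \<in> borel_measurable lborel \<and> Lpow 2 f < \<infinity>}"

definition mass :: "(plane \<Rightarrow> complex) \<Rightarrow> real" where
  "mass f = (LINT x|lborel. (cmod (f x))\<^sup>2)"

definition L2_norm :: "(plane \<Rightarrow> complex) \<Rightarrow> real" where
  "L2_norm f = sqrt (mass f)"

fun iter_partial :: "2 list \<Rightarrow> (plane \<Rightarrow> 'b::real_normed_vector) \<Rightarrow> plane \<Rightarrow> 'b" where
  "iter_partial [] f = f"
| "iter_partial (a # as) f = (\<lambda>x. frechet_derivative (iter_partial as f) (at x) (axis a 1))"

definition smooth_fun :: "(plane \<Rightarrow> 'b::real_normed_vector) \<Rightarrow> bool" where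
  "smooth_fun f \<longleftrightarrow> (\<forall>as. iter_partial as f differentiable_on UNIV)"

definition schwartz :: "(plane \<Rightarrow> complex) set" where
  "schwartz = {f. smooth_fun f \<and>
     (\<forall>as n. \<exists>B. \<forall>x. (1 + norm x) ^ n * cmod (iter_partial as f x) \<le> B)}"

definition fourier :: "(plane \<Rightarrow> complex) \<Rightarrow> plane \<Rightarrow> complex" where
  "fourier f \<xi> = (LINT x|lborel. f x * cis (- (x \<bullet> \<xi>)))"

text \<open>The Fourier-Plancherel transform of \<open>f \<in> L2\<close>: the limit in \<open>L\<^sup>2\<close> of the transforms of the
  truncations of \<open>f\<close> to balls, a representative being chosen.\<close>

definition fourier_L2 :: "(plane \<Rightarrow> complex) \<Rightarrow> plane \<Rightarrow> complex" where
  "fourier_L2 f = (SOME g. g \<in> L2 \<and>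
     ((\<lambda>R. Lpow 2 (\<lambda>\<xi>. fourier (\<lambda>x. indicator (cball 0 R) x * f x) \<xi> - g \<xi>)) \<longlongrightarrow> 0) at_top)"

definition inv_fourier_L2 :: "(plane \<Rightarrow> complex) \<Rightarrow> plane \<Rightarrow> complex" where
  "inv_fourier_L2 g = (\<lambda>x. fourier_L2 g (- x) / of_real ((2 * pi)\<^sup>2))"

definition multiplier ::
  "(plane \<Rightarrow> complex) \<Rightarrow> (plane \<Rightarrow> complex) \<Rightarrow> plane \<Rightarrow> complex" where
  "multiplier m f = inv_fourier_L2 (\<lambda>\<xi>. m \<xi> * fourier_L2 f \<xi>)"

definition schrodinger :: "real \<Rightarrow> (plane \<Rightarrow> complex) \<Rightarrow> plane \<Rightarrow> complex" where
  "schrodinger t = multiplier (\<lambda>\<xi>. cis (- (t * (norm \<xi>)\<^sup>2)))"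

definition E_op :: "(plane \<Rightarrow> complex) \<Rightarrow> plane \<Rightarrow> complex" where
  "E_op = multiplier (\<lambda>\<xi>. of_real ((\<xi> $ 1)\<^sup>2 / (norm \<xi>)\<^sup>2))"

definition L_op :: "(plane \<Rightarrow> complex) \<Rightarrow> plane \<Rightarrow> complex" where
  "L_op f = (\<lambda>x. f x + E_op f x)"

definition laplacian :: "(plane \<Rightarrow> complex) \<Rightarrow> plane \<Rightarrow> complex" where
  "laplacian = multiplier (\<lambda>\<xi>. of_real (- (norm \<xi>)\<^sup>2))"

definition partial_op :: "2 \<Rightarrow> (plane \<Rightarrow> complex) \<Rightarrow> plane \<Rightarrow> complex" where
  "partial_op a = multiplier (\<lambda>\<xi>. \<i> * of_real (\<xi> $ a))"

definition sobolev :: "nat \<Rightarrow> (plane \<Rightarrow> complex) set" where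
  "sobolev s = {f \<in> L2. (\<lambda>\<xi>. of_real (norm \<xi> ^ s) * fourier_L2 f \<xi>) \<in> L2}"

definition grad_norm_sq :: "(plane \<Rightarrow> complex) \<Rightarrow> real" where
  "grad_norm_sq f = (\<Sum>a\<in>UNIV. mass (partial_op a f))"

definition lp_cutoff :: "(plane \<Rightarrow> real) \<Rightarrow> bool" where
  "lp_cutoff \<phi> \<longleftrightarrow> smooth_fun \<phi> \<and> (\<forall>x. 0 \<le> \<phi> x \<and> \<phi> x \<le> 1) \<and>
     (\<forall>x y. norm x = norm y \<longrightarrow> \<phi> x = \<phi> y) \<and> (\<forall>x y. norm x \<le> norm y \<longrightarrow> \<phi> y \<le> \<phi> x) \<and>
     (\<forall>x. norm x \<le> 1 \<longrightarrow> \<phi> x = 1) \<and> (\<forall>x. norm x > 2 \<longrightarrow> \<phi> x = 0)"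

definition lp_symbol :: "(plane \<Rightarrow> real) \<Rightarrow> int \<Rightarrow> plane \<Rightarrow> real" where
  "lp_symbol \<phi> j \<xi> =
     (if j < 0 then 0 else if j = 0 then \<phi> \<xi>
      else \<phi> ((2 powi (- j)) *\<^sub>R \<xi>) - \<phi> ((2 powi (- j + 1)) *\<^sub>R \<xi>))"

definition lp_proj :: "(plane \<Rightarrow> real) \<Rightarrow> int \<Rightarrow> (plane \<Rightarrow> complex) \<Rightarrow> plane \<Rightarrow> complex" where
  "lp_proj \<phi> j = multiplier (\<lambda>\<xi>. of_real (lp_symbol \<phi> j \<xi>))"

text \<open>The projections with negative index vanish, so the sum over all \<open>j' \<le> j\<close> starts at \<open>0\<close>.\<close>

definition lp_le :: "(plane \<Rightarrow> real) \<Rightarrow> int \<Rightarrow> (plane \<Rightarrow> complex) \<Rightarrow> plane \<Rightarrow> complex" where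
  "lp_le \<phi> j f = (\<lambda>x. \<Sum>j'\<in>{0..j}. lp_proj \<phi> j' f x)"

definition shifted ::
  "plane \<Rightarrow> ((plane \<Rightarrow> complex) \<Rightarrow> plane \<Rightarrow> complex) \<Rightarrow> (plane \<Rightarrow> complex) \<Rightarrow> plane \<Rightarrow> complex" where
  "shifted \<xi>\<^sub>0 P f = (\<lambda>x. cis (x \<bullet> \<xi>\<^sub>0) * P (\<lambda>y. cis (- (y \<bullet> \<xi>\<^sub>0)) * f y) x)"

definition nonlin :: "real \<Rightarrow> (plane \<Rightarrow> complex) \<Rightarrow> plane \<Rightarrow> complex" where
  "nonlin \<mu> f = (\<lambda>x. (of_real (\<mu> * (cmod (f x))\<^sup>2)
      - E_op (\<lambda>y. of_real ((cmod (f y))\<^sup>2)) x) * f x)"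

text \<open>\<open>w\<close> is the integral of \<open>schrodinger (t1 - t) (F (u t))\<close> over \<open>t\<close> from \<open>t0\<close> to \<open>t1\<close>.
  For \<open>u\<close> in \<open>L\<^sup>4\<close>, \<open>F (u t)\<close> lies only in \<open>L\<^bsup>4/3\<^esup>\<close> for almost all \<open>t\<close>, so the propagator acts on it by
  duality; after pairing with a Schwartz function the integral converges absolutely, by
  Strichartz.  The interval integral is signed when \<open>t1 < t0\<close>.\<close>

definition duhamel_integral ::
  "real \<Rightarrow> (real \<Rightarrow> plane \<Rightarrow> complex) \<Rightarrow> real \<Rightarrow> real \<Rightarrow> (plane \<Rightarrow> complex) \<Rightarrow> bool" where
  "duhamel_integral \<mu> u t0 t1 w \<longleftrightarrow> w \<in> L2 \<and>
     (\<forall>g\<in>schwartz. (LINT x|lborel. w x * cnj (g x)) =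
        (LBINT t=ereal t0..ereal t1.
           (LINT x|lborel. nonlin \<mu> (u t) x * cnj (schrodinger (t - t1) g x))))"

definition solution :: "real \<Rightarrow> real set \<Rightarrow> (real \<Rightarrow> plane \<Rightarrow> complex) \<Rightarrow> bool" where
  "solution \<mu> I u \<longleftrightarrow>
     is_interval I \<and> I \<noteq> {} \<and>
     set_borel_measurable lborel (I \<times> UNIV) (\<lambda>(t, x). u t x) \<and>
     (\<forall>t\<in>I. u t \<in> L2) \<and>
     (\<forall>t\<in>I. ((\<lambda>s. Lpow 2 (\<lambda>x. u s x - u t x)) \<longlongrightarrow> 0) (at t within I)) \<and>
     (\<forall>K. compact K \<and> K \<subseteq> I \<longrightarrow> Lpow_st 4 K u < \<infinity>) \<and>
     (\<forall>t0\<in>I. \<forall>t1\<in>I. \<exists>w. duhamel_integral \<mu> u t0 t1 w \<and>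
        (AE x in lborel. u t1 x = schrodinger (t1 - t0) (u t0) x - \<i> * w x))"

definition maximal_solution :: "real \<Rightarrow> real set \<Rightarrow> (real \<Rightarrow> plane \<Rightarrow> complex) \<Rightarrow> bool" where
  "maximal_solution \<mu> I u \<longleftrightarrow> solution \<mu> I u \<and>
     \<not> (\<exists>I' v. I \<subset> I' \<and> solution \<mu> I' v \<and> (\<forall>t\<in>I. AE x in lborel. v t x = u t x))"

definition blows_up_forward :: "real set \<Rightarrow> (real \<Rightarrow> plane \<Rightarrow> complex) \<Rightarrow> bool" where
  "blows_up_forward I u \<longleftrightarrow> (\<exists>t0\<in>I. Lpow_st 4 (I \<inter> {t0..}) u = \<infinity>)"

definition blows_up_backward :: "real set \<Rightarrow> (real \<Rightarrow> plane \<Rightarrow> complex) \<Rightarrow> bool" where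
  "blows_up_backward I u \<longleftrightarrow> (\<exists>t0\<in>I. Lpow_st 4 (I \<inter> {..t0}) u = \<infinity>)"

definition gn_inequality :: "real \<Rightarrow> bool" where
  "gn_inequality C \<longleftrightarrow> (\<forall>f\<in>sobolev 1.
     cmod (LINT x|lborel. L_op (\<lambda>y. of_real ((cmod (f y))\<^sup>2)) x * of_real ((cmod (f x))\<^sup>2))
       \<le> C * (L2_norm f)\<^sup>2 * grad_norm_sq f)"

text \<open>The equation for \<open>Q\<close> is read for \<open>Q\<close> in the Sobolev space of order 2, where the Laplacian
  is a Fourier multiplier with values in \<open>L\<^sup>2\<close>; finite energy solutions have this
  regularity.\<close>

definition ground_state :: "(plane \<Rightarrow> real) \<Rightarrow> bool" where
  "ground_state Q \<longleftrightarrow>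
     (let q = (\<lambda>x. complex_of_real (Q x)) in
      (\<forall>x. 0 < Q x) \<and> q \<in> sobolev 2 \<and>
      (AE x in lborel. laplacian q x - q x + L_op (\<lambda>y. (q y)\<^sup>2) x * q x = 0) \<and>
      gn_inequality (2 / mass q) \<and> (\<forall>C. gn_inequality C \<longrightarrow> 2 / mass q \<le> C))"

definition L_fun :: "real \<Rightarrow> real \<Rightarrow> ennreal" where
  "L_fun \<mu> M = (SUP (I, u) \<in> {(I, u). solution \<mu> I u \<and> (\<forall>t\<in>I. mass (u t) \<le> M)}. Lpow_st 4 I u)"

text \<open>\<open>Q\<close> plays no role in the next two definitions when \<open>\<mu> = 1\<close>.\<close>

definition critical_mass :: "real \<Rightarrow> (plane \<Rightarrow> real) \<Rightarrow> ennreal" where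
  "critical_mass \<mu> Q = Sup {ennreal M | M. 0 \<le> M \<and>
     (\<mu> = -1 \<longrightarrow> M \<le> mass (\<lambda>x. complex_of_real (Q x))) \<and> L_fun \<mu> M < \<infinity>}"

definition standing_assumption :: "real \<Rightarrow> (plane \<Rightarrow> real) \<Rightarrow> bool" where
  "standing_assumption \<mu> Q \<longleftrightarrow>
     (\<mu> = 1 \<longrightarrow> critical_mass \<mu> Q < \<infinity>) \<and>
     (\<mu> = -1 \<longrightarrow> critical_mass \<mu> Q < ennreal (mass (\<lambda>x. complex_of_real (Q x))))"

abbreviation deriv0 :: "(real \<Rightarrow> 'b::real_normed_vector) \<Rightarrow> real \<Rightarrow> 'b" where
  "deriv0 f t \<equiv> vector_derivative f (at t within {0..})"

definition C1_halfline :: "(real \<Rightarrow> 'b::real_normed_vector) \<Rightarrow> bool" where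
  "C1_halfline f \<longleftrightarrow> f differentiable_on {0..} \<and> continuous_on {0..} (deriv0 f)"

definition tail_mass :: "(plane \<Rightarrow> complex) \<Rightarrow> plane \<Rightarrow> real \<Rightarrow> ennreal" where
  "tail_mass f x\<^sub>0 r = (\<integral>\<^sup>+ x\<in>{x. norm (x - x\<^sub>0) \<ge> r}. ennreal ((cmod (f x))\<^sup>2) \<partial>lborel)"

definition admissible_blowup ::
  "real \<Rightarrow> (plane \<Rightarrow> real) \<Rightarrow> real set \<Rightarrow> (real \<Rightarrow> plane \<Rightarrow> complex) \<Rightarrow>
   (real \<Rightarrow> plane) \<Rightarrow> (real \<Rightarrow> plane) \<Rightarrow> (real \<Rightarrow> real) \<Rightarrow> bool" where
  "admissible_blowup \<mu> Q I u x \<xi> N \<longleftrightarrow>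
     maximal_solution \<mu> I u \<and>
     (\<forall>t\<in>I. ennreal (mass (u t)) = critical_mass \<mu> Q) \<and>
     blows_up_forward I u \<and> blows_up_backward I u \<and>
     (\<forall>t\<in>I. 0 < N t) \<and>
     (\<exists>C. (\<forall>\<eta>>0. 0 \<le> C \<eta>) \<and>
        (\<forall>\<eta>>0. \<forall>t\<in>I. tail_mass (u t) (x t) (C \<eta> / N t)
            + tail_mass (fourier_L2 (u t)) (\<xi> t) (C \<eta> * N t) \<le> ennreal \<eta>)) \<and>
     {0..} \<subseteq> I \<and> (\<forall>t\<ge>0. N t \<le> 1) \<and> x 0 = 0 \<and> \<xi> 0 = 0 \<and>
     C1_halfline N \<and> C1_halfline \<xi> \<and>
     (\<exists>c. \<forall>t\<ge>0. \<bar>deriv0 N t\<bar> + norm (deriv0 \<xi> t) \<le> c * N t ^ 3)"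

definition admissible_tuple ::
  "(real \<Rightarrow> plane \<Rightarrow> complex) \<Rightarrow> (real \<Rightarrow> plane) \<Rightarrow> (real \<Rightarrow> plane) \<Rightarrow> (real \<Rightarrow> real) \<Rightarrow>
   real \<Rightarrow> real \<Rightarrow> real \<Rightarrow> bool" where
  "admissible_tuple u x \<xi> N \<epsilon>1 \<epsilon>2 \<epsilon>3 \<longleftrightarrow>
     0 < \<epsilon>3 \<and> \<epsilon>3 < \<epsilon>2 \<and> \<epsilon>2 < \<epsilon>1 \<and> \<epsilon>1 \<le> 2 powi (-100) \<and>
     (\<forall>t\<ge>0. norm (deriv0 \<xi> t) + \<bar>deriv0 N t\<bar> \<le> 2 powi (-20) * \<epsilon>1 powr (-1/2) * N t ^ 3) \<and>
     (\<forall>t\<ge>0. tail_mass (u t) (x t) (2 powi (-20) * \<epsilon>3 powr (-1/4) / N t)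
        + tail_mass (fourier_L2 (u t)) (\<xi> t) (2 powi (-20) * \<epsilon>3 powr (-1/4) * N t)
          \<le> ennreal (\<epsilon>2\<^sup>2)) \<and>
     \<epsilon>3 < \<epsilon>2 ^ 10 \<and> \<epsilon>2 ^ 10 < \<epsilon>1 ^ 10"

definition rescale ::
  "real \<Rightarrow> (real \<Rightarrow> plane \<Rightarrow> complex) \<Rightarrow> real \<Rightarrow> plane \<Rightarrow> complex" where
  "rescale r u = (\<lambda>t x. of_real r * u (r\<^sup>2 * t) (r *\<^sub>R x))"

definition small_interval ::
  "(real \<Rightarrow> plane \<Rightarrow> complex) \<Rightarrow> real \<Rightarrow> real set \<Rightarrow> bool" where
  "small_interval u T J \<longleftrightarrow> is_interval J \<and> J \<subseteq> {0..T} \<and> Lpow_st 4 J u = 1"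

text \<open>The intervals \<open>J\<^sup>\<alpha>\<close> are given by their endpoints: \<open>J\<^sup>\<alpha>\<close> runs from \<open>\<tau> \<alpha>\<close> to \<open>\<tau> (\<alpha> + 1)\<close>.
  The endpoints are determined uniquely, since \<open>N\<close> is positive.\<close>

definition interval_partition ::
  "(real \<Rightarrow> plane \<Rightarrow> complex) \<Rightarrow> (real \<Rightarrow> real) \<Rightarrow> real \<Rightarrow> real \<Rightarrow> nat \<Rightarrow> (nat \<Rightarrow> real) \<Rightarrow> bool" where
  "interval_partition u N \<epsilon>3 T k0 \<tau> \<longleftrightarrow>
     \<tau> 0 = 0 \<and> \<tau> (2 ^ k0) = T \<and> (\<forall>a < 2 ^ k0. \<tau> a \<le> \<tau> (Suc a)) \<and>
     (\<forall>a < 2 ^ k0. (\<integral>\<^sup>+ t\<in>{\<tau> a..\<tau> (Suc a)}. (ennreal (N t ^ 3) + ennreal \<epsilon>3 * Lpow 4 (u t)) \<partial>lborel)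
         = ennreal (2 * \<epsilon>3))"

definition G_int :: "(nat \<Rightarrow> real) \<Rightarrow> nat \<Rightarrow> nat \<Rightarrow> real set" where
  "G_int \<tau> j \<kappa> = (\<Union>a\<in>{\<kappa> * 2 ^ j..<(\<kappa> + 1) * 2 ^ j}. {\<tau> a..\<tau> (Suc a)})"

definition center :: "(real \<Rightarrow> plane) \<Rightarrow> real set \<Rightarrow> plane" where
  "center \<xi> G = \<xi> (Inf G)"

definition fourier_support :: "(plane \<Rightarrow> complex) \<Rightarrow> plane set" where
  "fourier_support f = closure {\<xi>. fourier f \<xi> \<noteq> 0}"

definition is_cube :: "real \<Rightarrow> plane set \<Rightarrow> bool" where
  "is_cube s K \<longleftrightarrow> (\<exists>a. K = cbox a (a + s *\<^sub>R One))"

definition annulus :: "plane \<Rightarrow> real \<Rightarrow> real \<Rightarrow> plane set" where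
  "annulus \<xi>\<^sub>0 r R = {\<xi>. r \<le> norm (\<xi> - \<xi>\<^sub>0) \<and> norm (\<xi> - \<xi>\<^sub>0) \<le> R}"

definition bilinear_bound ::
  "(plane \<Rightarrow> real) \<Rightarrow> (real \<Rightarrow> plane \<Rightarrow> complex) \<Rightarrow> (real \<Rightarrow> plane) \<Rightarrow> real \<Rightarrow>
   int \<Rightarrow> int \<Rightarrow> int \<Rightarrow> real set \<Rightarrow> (plane \<Rightarrow> complex) \<Rightarrow> ennreal" where
  "bilinear_bound \<phi> u \<xi> C k i l2 J v\<^sub>0 =
     ennreal (C * 2 powi (k - i) * (L2_norm v\<^sub>0)\<^sup>2)
     + ennreal (C * 2 powi (k - l2 - i) * (L2_norm v\<^sub>0)\<^sup>2)
       * (\<integral>\<^sup>+ t\<in>J. ennreal (norm (deriv0 \<xi> t) *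
            (\<Sum>l1\<in>{0..l2}. 2 powr (real_of_int (l1 - l2) / 2)
               * L2_norm (shifted (\<xi> t) (lp_proj \<phi> l1) (u t))
               * L2_norm (shifted (\<xi> t) (lp_proj \<phi> l2) (u t)))) \<partial>lborel)"

end

theory Submission
  imports Defs "HOL-Probability.Characteristic_Functions" "HOL-Probability.Sinc_Integral"
begin

text \<open>Conjugated with the free flow, the Fourier transform of a solution is a curve in \<open>L\<^sup>2\<close>.  By
  Duhamel's formula and Strichartz its increment over \<open>[s, t]\<close> is at most a constant times the
  cube of the \<open>L\<^sup>4\<close> norm of \<open>u\<close> on \<open>[s, t]\<close>.  On a small interval the curve therefore has bounded
  \<open>4/3\<close>-variation: it is a sum over \<open>n\<close> of step functions with \<open>4\<^sup>n\<close> steps of squared size at most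
  \<open>C / 8\<^sup>n\<close>, and this decay sums the bilinear estimate for free waves over all steps.

  For two free waves with frequencies \<open>p - q\<close> and \<open>p + q\<close> the phase is \<open>2 t (|p|\<^sup>2 + |q|\<^sup>2)\<close>;
  Bessel's inequality in \<open>x\<close>, and then in \<open>t\<close> for the quadratic phase, bounds the product by the
  angle under which the admissible \<open>q\<close> are seen from the origin.  These lie in a square of side
  \<open>2\<^sup>k\<close> at distance comparable to \<open>2\<^sup>i\<close>.

  The moving centre \<open>\<xi> t\<close> costs nothing, because the projection around \<open>\<xi> t\<close> is dominated by an average over
  translations whose weight does not depend on \<open>\<xi> t\<close>.\<close>

section \<open>Integration on the plane\<close>

text \<open>The variation bound comes from an exponent above 1: if h is the fourth power of the L^4
  norm of u on a time piece, the squared increment of the curve there is of order h^(3/2). Measuring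
  time by h makes a small interval a clock of length 1; 4^n clock pieces of length 4^-n then carry a
  total squared variation of order 4^n * 8^-n = 2^-n, and this margin pays for the weights of
  Cauchy-Schwarz between the levels n.

  Two obstacles shape the analysis. The transform of an L2 function is a chosen representative of a
  limit, so its rules hold almost everywhere, and an oscillatory integral exists pointwise only for
  an integrable amplitude; cutting to bounded frequency sets supplies the integrability. Secondly,
  the Duhamel term is known only through pairings with Schwartz functions, so test functions are
  manufactured by smoothing truncated functions with a heat kernel. The same smoothing proves
  Fourier inversion. Plancherel is used only as an upper bound, and constants such as 16 pi^2 are
  generous.\<close>

definition pl :: "real \<Rightarrow> real \<Rightarrow> plane" where
  "pl a b = vector [a, b]"

lemma pl_nth [simp]: "pl a b $ 1 = a" "pl a b $ 2 = b"
  by (simp_all add: pl_def)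

lemma pl_eta [simp]: "pl (x $ 1) (x $ 2) = x"
  by (simp add: vec_eq_iff forall_2)

lemma pl_inner: "x \<bullet> y = x $ 1 * y $ 1 + x $ 2 * (y :: plane) $ 2"
  by (simp add: inner_vec_def sum_2)

lemma pl_norm_sq: "(norm x)\<^sup>2 = (x $ 1)\<^sup>2 + ((x :: plane) $ 2)\<^sup>2"
  by (simp only: power2_norm_eq_inner pl_inner) (simp add: power2_eq_square)

lemma Basis_plane: "(Basis :: plane set) = {axis 1 1, axis 2 1}"
  by (auto simp: Basis_vec_def UNIV_2)

lemma pl_axis: "x \<bullet> axis i 1 = (x :: plane) $ i"
  by (simp add: inner_axis)

lemma pl_eq_axis: "pl a b = a *\<^sub>R axis 1 1 + b *\<^sub>R axis 2 1"
  by (simp add: vec_eq_iff forall_2 axis_def)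

lemma measurable_pl [measurable]:
  "(\<lambda>x. pl (f x) (g x)) \<in> borel_measurable M" if "f \<in> borel_measurable M" "g \<in> borel_measurable M"
  unfolding pl_eq_axis using that by measurable

lemma measurable_pl_nth [measurable]:
  "(\<lambda>x. (f x :: plane) $ i) \<in> borel_measurable M" if "f \<in> borel_measurable M"
proof -
  have "(\<lambda>x. f x \<bullet> axis i 1) \<in> borel_measurable M" using that by measurable
  thus ?thesis by (simp add: pl_axis)
qed

lemma axis_neq_plane: "axis 1 1 \<noteq> (axis 2 1 :: plane)"
  by (simp add: axis_eq_axis)

text \<open>Lebesgue measure is determined by its values on boxes, and on a box both sides are the
  product of the two side lengths. As \<open>real ^ 2\<close> is not a product type, this is the
  source of all iterated integrals over the plane.\<close>

lemma lborel_plane: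
  "(lborel :: plane measure) = distr (lborel \<Otimes>\<^sub>M lborel) borel (\<lambda>(a, b). pl a b)"
proof (rule lborel_eqI)
  fix l u :: plane
  assume le: "\<And>b. b \<in> Basis \<Longrightarrow> l \<bullet> b \<le> u \<bullet> b"
  have 1: "l $ 1 \<le> u $ 1" "l $ 2 \<le> u $ 2"
    using le[of "axis 1 1"] le[of "axis 2 1"] by (auto simp: Basis_plane pl_axis)
  have "(\<lambda>(a, b). pl a b) -` box l u = {l$1<..<u$1} \<times> {l$2<..<u$2}"
    by (auto simp: box_def Basis_plane pl_axis)
  then show "emeasure (distr (lborel \<Otimes>\<^sub>M lborel) borel (\<lambda>(a, b). pl a b)) (box l u)
      = ennreal (\<Prod>b\<in>Basis. (u - l) \<bullet> b)"
    using 1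
    by (simp add: emeasure_distr space_pair_measure lborel.emeasure_pair_measure_Times
        Basis_plane axis_neq_plane pl_axis ennreal_mult[symmetric])
qed simp

lemma nn_integral_plane:
  assumes [measurable]: "f \<in> borel_measurable borel"
  shows "(\<integral>\<^sup>+ x. f (x :: plane) \<partial>lborel) = (\<integral>\<^sup>+ a. \<integral>\<^sup>+ b. f (pl a b) \<partial>lborel \<partial>lborel)"
proof -
  have "(\<integral>\<^sup>+ x. f (x :: plane) \<partial>lborel) = (\<integral>\<^sup>+ z. f (pl (fst z) (snd z)) \<partial>(lborel \<Otimes>\<^sub>M lborel))"
    by (subst lborel_plane) (simp add: nn_integral_distr case_prod_beta')
  also have "\<dots> = (\<integral>\<^sup>+ a. \<integral>\<^sup>+ b. f (pl a b) \<partial>lborel \<partial>lborel)"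
    by (subst lborel.nn_integral_fst[symmetric]) auto
  finally show ?thesis .
qed

lemma nn_integral_plane_swap:
  assumes [measurable]: "f \<in> borel_measurable borel"
  shows "(\<integral>\<^sup>+ x. f (x :: plane) \<partial>lborel) = (\<integral>\<^sup>+ b. \<integral>\<^sup>+ a. f (pl a b) \<partial>lborel \<partial>lborel)"
  by (subst lborel_pair.Fubini') (simp_all add: nn_integral_plane)

lemma integrable_plane_iff:
  fixes f :: "plane \<Rightarrow> 'b :: {banach, second_countable_topology}"
  assumes [measurable]: "f \<in> borel_measurable borel"
  shows "integrable lborel f \<longleftrightarrow> integrable (lborel \<Otimes>\<^sub>M lborel) (\<lambda>(a, b). f (pl a b))"
  by (subst lborel_plane) (simp add: integrable_distr_eq case_prod_beta')

lemma integral_plane: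
  fixes f :: "plane \<Rightarrow> 'b :: {banach, second_countable_topology}"
  assumes "integrable lborel f"
  shows "(LINT x|lborel. f x) = (LINT a|lborel. (LINT b|lborel. f (pl a b)))"
proof -
  have [measurable]: "f \<in> borel_measurable borel"
    using assms by auto
  have i: "integrable (lborel \<Otimes>\<^sub>M lborel) (\<lambda>(a, b). f (pl a b))"
    using assms integrable_plane_iff[of f] by simp
  have "(LINT x|lborel. f x) = (LINT z|(lborel \<Otimes>\<^sub>M lborel). f (pl (fst z) (snd z)))"
    by (subst lborel_plane) (simp add: integral_distr case_prod_beta')
  then show ?thesis
    using lborel_pair.integral_fst[OF i] by (simp add: case_prod_beta')
qed

lemma integral_plane_swap:
  fixes f :: "plane \<Rightarrow> 'b :: {banach, second_countable_topology}"
  assumes "integrable lborel f"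
  shows "(LINT x|lborel. f x) = (LINT b|lborel. (LINT a|lborel. f (pl a b)))"
proof -
  have [measurable]: "f \<in> borel_measurable borel"
    using assms by auto
  have i: "integrable (lborel \<Otimes>\<^sub>M lborel) (\<lambda>(a, b). f (pl a b))"
    using assms integrable_plane_iff[of f] by simp
  show ?thesis
    using lborel_pair.Fubini_integral[OF i] integral_plane[OF assms] by (simp add: case_prod_beta')
qed

lemma AE_integrable_plane:
  fixes f :: "plane \<Rightarrow> 'b :: {banach, second_countable_topology}"
  assumes "integrable lborel f"
  shows "AE a in lborel. integrable lborel (\<lambda>b. f (pl a b))"
    and "AE b in lborel. integrable lborel (\<lambda>a. f (pl a b))"
proof -
  have [measurable]: "f \<in> borel_measurable borel"
    using assms by auto
  have i: "integrable (lborel \<Otimes>\<^sub>M lborel) (\<lambda>(a, b). f (pl a b))"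
    using assms integrable_plane_iff[of f] by simp
  show "AE a in lborel. integrable lborel (\<lambda>b. f (pl a b))"
    using lborel_pair.AE_integrable_fst[OF i] by (simp add: case_prod_beta')
  show "AE b in lborel. integrable lborel (\<lambda>a. f (pl a b))"
    using lborel_pair.AE_integrable_snd[OF i] by (simp add: case_prod_beta')
qed

section \<open>Affine changes of variables\<close>

lemma nn_integral_lborel_affine:
  fixes f :: "'a :: euclidean_space \<Rightarrow> ennreal"
  assumes [measurable]: "f \<in> borel_measurable borel" and "c \<noteq> 0"
  shows "(\<integral>\<^sup>+ x. f x \<partial>lborel) = ennreal (\<bar>c\<bar> ^ DIM('a)) * (\<integral>\<^sup>+ x. f (t + c *\<^sub>R x) \<partial>lborel)"
  by (subst lborel_affine[OF assms(2), of t])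
     (simp add: nn_integral_density nn_integral_distr nn_integral_cmult)

lemma nn_integral_lborel_translate:
  fixes f :: "'a :: euclidean_space \<Rightarrow> ennreal"
  assumes [measurable]: "f \<in> borel_measurable borel"
  shows "(\<integral>\<^sup>+ x. f (t + x) \<partial>lborel) = (\<integral>\<^sup>+ x. f x \<partial>lborel)"
  using nn_integral_lborel_affine[of f 1 t] by simp

lemma nn_integral_lborel_reflect:
  fixes f :: "'a :: euclidean_space \<Rightarrow> ennreal"
  assumes [measurable]: "f \<in> borel_measurable borel"
  shows "(\<integral>\<^sup>+ x. f (t - x) \<partial>lborel) = (\<integral>\<^sup>+ x. f x \<partial>lborel)"
  using nn_integral_lborel_affine[of f "-1" t] by simp

lemma integral_lborel_affine:
  fixes f :: "'a :: euclidean_space \<Rightarrow> 'b :: {banach, second_countable_topology}"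
  assumes [measurable]: "f \<in> borel_measurable borel" and "c \<noteq> 0"
  shows "(LINT x|lborel. f x) = (\<bar>c\<bar> ^ DIM('a)) *\<^sub>R (LINT x|lborel. f (t + c *\<^sub>R x))"
  by (subst lborel_affine[OF assms(2), of t])
     (simp add: integral_density integral_distr)

lemma integrable_lborel_affine:
  fixes f :: "'a :: euclidean_space \<Rightarrow> 'b :: {banach, second_countable_topology}"
  assumes f: "integrable lborel f" and c: "c \<noteq> 0"
  shows "integrable lborel (\<lambda>x. f (t + c *\<^sub>R x))"
proof -
  have [measurable]: "f \<in> borel_measurable borel" using f by auto
  have "ennreal (\<bar>c\<bar> ^ DIM('a)) * (\<integral>\<^sup>+ x. ennreal (norm (f (t + c *\<^sub>R x))) \<partial>lborel) < \<infinity>"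
    using f nn_integral_lborel_affine[of "\<lambda>x. ennreal (norm (f x))" c t] c
    by (auto simp: integrable_iff_bounded)
  then show ?thesis
    using c by (auto simp: integrable_iff_bounded ennreal_mult_less_top)
qed

lemma integral_lborel_translate:
  fixes f :: "'a :: euclidean_space \<Rightarrow> 'b :: {banach, second_countable_topology}"
  assumes [measurable]: "f \<in> borel_measurable borel"
  shows "(LINT x|lborel. f (t + x)) = (LINT x|lborel. f x)"
  using integral_lborel_affine[of f 1 t] by simp

lemma integral_lborel_reflect:
  fixes f :: "'a :: euclidean_space \<Rightarrow> 'b :: {banach, second_countable_topology}"
  assumes [measurable]: "f \<in> borel_measurable borel"
  shows "(LINT x|lborel. f (t - x)) = (LINT x|lborel. f x)"
  using integral_lborel_affine[of f "-1" t] by simp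

lemma integrable_lborel_translate:
  fixes f :: "'a :: euclidean_space \<Rightarrow> 'b :: {banach, second_countable_topology}"
  assumes "integrable lborel f"
  shows "integrable lborel (\<lambda>x. f (t + x))"
  using integrable_lborel_affine[OF assms, of 1 t] by simp

lemma integrable_lborel_reflect:
  fixes f :: "'a :: euclidean_space \<Rightarrow> 'b :: {banach, second_countable_topology}"
  assumes "integrable lborel f"
  shows "integrable lborel (\<lambda>x. f (t - x))"
  using integrable_lborel_affine[OF assms, of "-1" t] by simp

lemma integrable_cis_mult [simp]:
  fixes f :: "'a \<Rightarrow> complex"
  assumes "integrable M f" and [measurable]: "g \<in> borel_measurable M"
  shows "integrable M (\<lambda>x. f x * cis (g x))" "integrable M (\<lambda>x. cis (g x) * f x)"
proof -
  have [measurable]: "f \<in> borel_measurable M" using assms by auto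
  have [measurable]: "cis \<in> borel_measurable borel"
    by (intro borel_measurable_continuous_onI continuous_intros)
  show "integrable M (\<lambda>x. f x * cis (g x))" "integrable M (\<lambda>x. cis (g x) * f x)"
    by (rule Bochner_Integration.integrable_bound[OF assms(1)]; simp add: norm_mult)+
qed

section \<open>Bessel inequalities\<close>

lemma borel_measurable_cis [measurable]: "cis \<in> borel_measurable borel"
  by (intro borel_measurable_continuous_onI continuous_intros)

lemma borel_measurable_cnj [measurable]: "cnj \<in> borel_measurable borel"
  by (intro borel_measurable_continuous_onI continuous_intros)

text \<open>The exchange of integrals behind all the pairings of Fourier integrals: a bounded kernel
  is dominated by C |f| |g|, which is integrable on the product. It is applied to oscillating phases
  and to the heat kernel.\<close>

lemma integrable_product_kernel:
  fixes f :: "'a \<Rightarrow> complex" and g :: "'b \<Rightarrow> complex"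
  assumes "sigma_finite_measure M1" "sigma_finite_measure M2"
    and f: "integrable M1 f" and g: "integrable M2 g"
    and K [measurable]: "(\<lambda>(x, y). K x y) \<in> borel_measurable (M1 \<Otimes>\<^sub>M M2)"
    and bd: "\<And>x y. cmod (K x y) \<le> C"
  shows "integrable (M1 \<Otimes>\<^sub>M M2) (\<lambda>(x, y). f x * (g y * K x y))"
    and "(LINT x|M1. f x * (LINT y|M2. g y * K x y)) = (LINT y|M2. g y * (LINT x|M1. f x * K x y))"
proof -
  interpret M1: sigma_finite_measure M1 by fact
  interpret M2: sigma_finite_measure M2 by fact
  interpret pair_sigma_finite M1 M2 ..
  have [measurable]: "f \<in> borel_measurable M1" "g \<in> borel_measurable M2"
    using f g by auto
  \<comment> \<open>The bound at a single point forces C to be nonnegative; \<open>undefined\<close>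
    serves as that point.\<close>
  have C0: "0 \<le> C" using bd[of undefined undefined] norm_ge_zero order_trans by blast
  have "(\<integral>\<^sup>+ z. ennreal (norm (case z of (x, y) \<Rightarrow> f x * (g y * K x y))) \<partial>(M1 \<Otimes>\<^sub>M M2))
     \<le> (\<integral>\<^sup>+ z. ennreal C * (ennreal (cmod (f (fst z))) * ennreal (cmod (g (snd z)))) \<partial>(M1 \<Otimes>\<^sub>M M2))"
  proof (rule nn_integral_mono)
    fix z
    have "cmod (f (fst z)) * (cmod (g (snd z)) * cmod (K (fst z) (snd z)))
        \<le> cmod (f (fst z)) * (cmod (g (snd z)) * C)"
      by (intro mult_left_mono bd) auto
    then show "ennreal (norm (case z of (x, y) \<Rightarrow> f x * (g y * K x y)))
        \<le> ennreal C * (ennreal (cmod (f (fst z))) * ennreal (cmod (g (snd z))))"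
      using C0 by (auto simp: case_prod_beta' norm_mult ennreal_mult[symmetric] mult_ac intro!: ennreal_leI)
  qed
  also have "\<dots> = ennreal C * ((\<integral>\<^sup>+ x. ennreal (cmod (f x)) \<partial>M1) * (\<integral>\<^sup>+ y. ennreal (cmod (g y)) \<partial>M2))"
    by (subst M2.nn_integral_fst[symmetric]) (simp_all add: nn_integral_cmult nn_integral_multc)
  also have "\<dots> < \<infinity>"
    using f g by (auto simp: integrable_iff_bounded ennreal_mult_less_top)
  finally show i: "integrable (M1 \<Otimes>\<^sub>M M2) (\<lambda>(x, y). f x * (g y * K x y))"
    by (auto simp: integrable_iff_bounded)
  have "(LINT x|M1. (LINT y|M2. f x * (g y * K x y))) = (LINT y|M2. (LINT x|M1. f x * (g y * K x y)))"
    using Fubini_integral[OF i] by simp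
  moreover have "(LINT x|M1. f x * (g y * K x y)) = g y * (LINT x|M1. f x * K x y)" for y
    by (subst integral_mult_right_zero[symmetric]) (simp add: mult_ac)
  moreover have "(LINT y|M2. f x * (g y * K x y)) = f x * (LINT y|M2. g y * K x y)" for x
    by (rule integral_mult_right_zero)
  ultimately show "(LINT x|M1. f x * (LINT y|M2. g y * K x y)) = (LINT y|M2. g y * (LINT x|M1. f x * K x y))"
    by simp
qed

section \<open>Gaussian integrals on the line\<close>

lemma gauss_integrable: "0 < e \<Longrightarrow> integrable lborel (\<lambda>x::real. exp (- (e * x\<^sup>2 / 2)))"
proof -
  assume e: "0 < e"
  have "integrable lborel (\<lambda>x::real. sqrt (2 * pi) * std_normal_density x)"
    using integrable_std_normal_moment[of 0] by simp
  then have "integrable lborel (\<lambda>x::real. exp (- (x\<^sup>2 / 2)))"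
    by (simp add: std_normal_density_def)
  from integrable_lborel_affine[OF this, of "sqrt e" 0] show ?thesis
    using e by (simp add: power_mult_distrib)
qed

text \<open>The characteristic function of the standard normal distribution is the case e = 1;
  dilation by \<open>sqrt e\<close> gives the rest.\<close>

lemma gauss_fourier:
  assumes e: "0 < e"
  shows "(LINT x|lborel. complex_of_real (exp (- (e * x\<^sup>2 / 2))) * cis (- (t * x)))
     = complex_of_real (sqrt (2 * pi / e) * exp (- (t\<^sup>2 / (2 * e))))"
proof -
  have 1: "(LINT x|lborel. complex_of_real (exp (- (x\<^sup>2 / 2))) * cis (t * x))
     = complex_of_real (sqrt (2 * pi) * exp (- (t\<^sup>2 / 2)))" for t :: real
  proof -
    have "complex_of_real (exp (- t\<^sup>2 / 2)) = char std_normal_distribution t"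
      by (simp add: char_std_normal_distribution)
    also have "\<dots> = (LINT x|lborel. std_normal_density x *\<^sub>R cis (t * x))"
      unfolding char_def by (subst integral_density) (auto simp: cis_conv_exp mult_ac)
    also have "\<dots> = (LINT x|lborel. complex_of_real (1 / sqrt (2 * pi)) *
        (complex_of_real (exp (- (x\<^sup>2 / 2))) * cis (t * x)))"
      by (simp add: std_normal_density_def scaleR_conv_of_real mult_ac)
    also have "\<dots> = complex_of_real (1 / sqrt (2 * pi)) *
        (LINT x|lborel. complex_of_real (exp (- (x\<^sup>2 / 2))) * cis (t * x))"
      by (rule integral_mult_right_zero)
    finally have "complex_of_real (sqrt (2 * pi)) * complex_of_real (exp (- t\<^sup>2 / 2))
      = (complex_of_real (sqrt (2 * pi)) * complex_of_real (1 / sqrt (2 * pi)))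
          * (LINT x|lborel. complex_of_real (exp (- (x\<^sup>2 / 2))) * cis (t * x))"
      by simp
    also have "complex_of_real (sqrt (2 * pi)) * complex_of_real (1 / sqrt (2 * pi)) = 1"
      unfolding of_real_mult[symmetric] by simp
    finally show ?thesis by simp
  qed
  have "(LINT x|lborel. complex_of_real (exp (- (x\<^sup>2 / 2))) * cis (- (t / sqrt e) * x))
     = complex_of_real (sqrt e) * (LINT x|lborel. complex_of_real (exp (- (e * x\<^sup>2 / 2))) * cis (- (t * x)))"
    by (subst integral_lborel_affine[of _ "sqrt e" 0])
       (use e in \<open>auto simp: power_mult_distrib scaleR_conv_of_real\<close>)
  also have "(LINT x|lborel. complex_of_real (exp (- (x\<^sup>2 / 2))) * cis (- (t / sqrt e) * x))
     = complex_of_real (sqrt (2 * pi) * exp (- (t\<^sup>2 / (2 * e))))"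
    using e by (subst 1) (simp add: power_divide mult.commute)
  finally have X: "complex_of_real (sqrt (2 * pi) * exp (- (t\<^sup>2 / (2 * e))))
     = complex_of_real (sqrt e) * (LINT x|lborel. complex_of_real (exp (- (e * x\<^sup>2 / 2))) * cis (- (t * x)))" .
  have "complex_of_real (inverse (sqrt e)) * complex_of_real (sqrt (2 * pi) * exp (- (t\<^sup>2 / (2 * e))))
     = (complex_of_real (inverse (sqrt e)) * complex_of_real (sqrt e))
        * (LINT x|lborel. complex_of_real (exp (- (e * x\<^sup>2 / 2))) * cis (- (t * x)))"
    by (simp only: X mult.assoc)
  also have "complex_of_real (inverse (sqrt e)) * complex_of_real (sqrt e) = 1"
    unfolding of_real_mult[symmetric] using e by simp
  finally have Y: "complex_of_real (inverse (sqrt e)) * complex_of_real (sqrt (2 * pi) * exp (- (t\<^sup>2 / (2 * e))))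
     = (LINT x|lborel. complex_of_real (exp (- (e * x\<^sup>2 / 2))) * cis (- (t * x)))"
    by (simp only: mult_1_left)
  have "inverse (sqrt e) * (sqrt (2 * pi) * exp (- (t\<^sup>2 / (2 * e)))) = sqrt (2 * pi / e) * exp (- (t\<^sup>2 / (2 * e)))"
    using e by (simp add: real_sqrt_divide field_simps)
  then show ?thesis
    unfolding Y[symmetric] of_real_mult[symmetric] by (simp only:)
qed

lemma gauss_nn_integral:
  assumes e: "0 < e"
  shows "(\<integral>\<^sup>+ x. ennreal (exp (- (e * x\<^sup>2 / 2))) \<partial>lborel) = ennreal (sqrt (2 * pi / e))"
proof -
  have "complex_of_real (LINT x|lborel. exp (- (e * x\<^sup>2 / 2))) = complex_of_real (sqrt (2 * pi / e))"
    using gauss_fourier[OF e, of 0] by (simp flip: integral_complex_of_real)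
  then have "(LINT x|lborel. exp (- (e * x\<^sup>2 / 2))) = sqrt (2 * pi / e)"
    using of_real_eq_iff by blast
  then show ?thesis
    using nn_integral_eq_integral[OF gauss_integrable[OF e]] by simp
qed

text \<open>A function that is not integrable has Bochner integral 0, so the inequality holds in
  that case as well.\<close>

lemma norm_integral_le_nn:
  fixes f :: "'a \<Rightarrow> 'b :: {banach, second_countable_topology}"
  shows "ennreal (norm (LINT x|M. f x)) \<le> (\<integral>\<^sup>+ x. ennreal (norm (f x)) \<partial>M)"
proof (cases "integrable M f")
  case True
  then show ?thesis by (rule integral_norm_bound_ennreal)
next
  case False
  then show ?thesis by (simp add: not_integrable_integral_eq)
qed

text \<open>The Gaussian weight makes Fubini applicable; its transform \<open>G\<close> is positive with
  integral \<open>2 \<pi>\<close>, and the double integral is bounded by \<open>2 |f x| |f y| \<le> |f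
  x|\<^sup>2 + |f y|\<^sup>2\<close>.\<close>

lemma bessel_1d_weighted:
  fixes f :: "real \<Rightarrow> complex"
  assumes f: "integrable lborel f" and e: "0 < e"
  shows "(\<integral>\<^sup>+ t. ennreal (exp (- (e * t\<^sup>2 / 2)) * (cmod (LINT s|lborel. f s * cis (- (t * s))))\<^sup>2) \<partial>lborel)
     \<le> ennreal (2 * pi) * (\<integral>\<^sup>+ s. ennreal ((cmod (f s))\<^sup>2) \<partial>lborel)"
proof -
  have [measurable]: "f \<in> borel_measurable borel" using f by auto
  define w where "w = (\<lambda>t::real. exp (- (e * t\<^sup>2 / 2)))"
  define F where "F = (\<lambda>t::real. LINT s|lborel. f s * cis (- (t * s)))"
  define G where "G = (\<lambda>x::real. sqrt (2 * pi / e) * exp (- (x\<^sup>2 / (2 * e))))"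
  define A where "A = (LINT s|lborel. cmod (f s))"
  have wm [measurable]: "w \<in> borel_measurable borel" by (simp add: w_def)
  have Fm [measurable]: "F \<in> borel_measurable borel" unfolding F_def by measurable
  have Gm [measurable]: "G \<in> borel_measurable borel" by (simp add: G_def)
  have G0: "0 \<le> G x" for x using e by (simp add: G_def)
  have Fb: "cmod (F t) \<le> A" for t
    unfolding F_def A_def using integral_norm_bound[of lborel "\<lambda>s. f s * cis (- (t * s))"]
    by (simp add: norm_mult)
  have wi: "integrable lborel (\<lambda>t. complex_of_real (w t))"
    using gauss_integrable[OF e] by (simp add: w_def)
  have wF: "integrable lborel (\<lambda>t. complex_of_real (w t) * cnj (F t))"
  proof (rule Bochner_Integration.integrable_bound)
    show "integrable lborel (\<lambda>t. complex_of_real A * complex_of_real (w t))" using wi by simp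
    show "AE t in lborel. cmod (complex_of_real (w t) * cnj (F t)) \<le> cmod (complex_of_real A * complex_of_real (w t))"
      using mult_left_mono[OF Fb abs_ge_zero] order_trans[OF norm_ge_zero Fb]
      by (intro AE_I2) (simp add: norm_mult mult.commute)
  qed auto
  have cf: "integrable lborel (\<lambda>y. cnj (f y))" using f by simp
  have eq: "complex_of_real (w t * (cmod (F t))\<^sup>2) = (complex_of_real (w t) * cnj (F t)) * F t" for t
    by (simp only: of_real_mult complex_norm_square) (simp add: mult_ac)
  \<comment> \<open>Fubini for the conjugated factor of |F|^2 = cnj F * F: the weight
    \<open>w\<close> turns into its transform \<open>G\<close>, evaluated at x - y. The factor F
    itself is exchanged with the t-integral afterwards.\<close>
  have inner: "(LINT t|lborel. (complex_of_real (w t) * cnj (F t)) * cis (- (t * x)))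
      = (LINT y|lborel. cnj (f y) * complex_of_real (G (x - y)))" for x
  proof -
    have cF: "cnj (F t) = (LINT y|lborel. cnj (f y) * cis (t * y))" for t
      unfolding F_def by (subst Bochner_Integration.integral_cnj[symmetric]) (simp add: cis_cnj)
    have "(LINT t|lborel. (complex_of_real (w t) * cnj (F t)) * cis (- (t * x)))
        = (LINT t|lborel. complex_of_real (w t) * (LINT y|lborel. cnj (f y) * cis (t * y - t * x)))"
    proof (intro Bochner_Integration.integral_cong refl)
      fix t
      have "cnj (F t) * cis (- (t * x)) = (LINT y|lborel. cnj (f y) * cis (t * y - t * x))"
        unfolding cF by (subst integral_mult_left_zero[symmetric]) (simp add: cis_mult mult.assoc)
      then show "(complex_of_real (w t) * cnj (F t)) * cis (- (t * x))
          = complex_of_real (w t) * (LINT y|lborel. cnj (f y) * cis (t * y - t * x))"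
        by (simp add: mult.assoc)
    qed
    also have "\<dots> = (LINT y|lborel. cnj (f y) * (LINT t|lborel. complex_of_real (w t) * cis (t * y - t * x)))"
      by (rule integrable_product_kernel(2)[OF _ _ wi cf, where C = 1])
         (auto intro: sigma_finite_lborel)
    also have "\<dots> = (LINT y|lborel. cnj (f y) * complex_of_real (G (x - y)))"
    proof (intro Bochner_Integration.integral_cong refl)
      fix y
      have "cis (t * y - t * x) = cis (- ((x - y) * t))" for t by (simp add: algebra_simps)
      then show "cnj (f y) * (LINT t|lborel. complex_of_real (w t) * cis (t * y - t * x)) = cnj (f y) * complex_of_real (G (x - y))"
        using gauss_fourier[OF e, of "x - y"] by (simp add: w_def G_def)
    qed
    finally show ?thesis .
  qed
  have "(LINT t|lborel. complex_of_real (w t * (cmod (F t))\<^sup>2))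
     = (LINT t|lborel. (complex_of_real (w t) * cnj (F t)) * (LINT x|lborel. f x * cis (- (t * x))))"
    by (simp only: eq) (simp add: F_def)
  also have "\<dots> = (LINT x|lborel. f x * (LINT t|lborel. (complex_of_real (w t) * cnj (F t)) * cis (- (t * x))))"
    by (rule integrable_product_kernel(2)[OF _ _ wF f, where C = 1]) (auto intro: sigma_finite_lborel)
  finally have main: "(LINT t|lborel. complex_of_real (w t * (cmod (F t))\<^sup>2))
      = (LINT x|lborel. f x * (LINT y|lborel. cnj (f y) * complex_of_real (G (x - y))))"
    by (simp only: inner)
  have wFF: "integrable lborel (\<lambda>t. complex_of_real (w t * (cmod (F t))\<^sup>2))"
  proof (rule Bochner_Integration.integrable_bound)
    show "integrable lborel (\<lambda>t. complex_of_real (A\<^sup>2) * complex_of_real (w t))" using wi by simp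
    show "AE t in lborel. cmod (complex_of_real (w t * (cmod (F t))\<^sup>2)) \<le> cmod (complex_of_real (A\<^sup>2) * complex_of_real (w t))"
      using mult_left_mono[OF power_mono[OF Fb norm_ge_zero] abs_ge_zero, of _ _ 2]
      by (intro AE_I2) (simp add: norm_mult norm_power mult.commute)
  qed auto
  have "(\<integral>\<^sup>+ t. ennreal (w t * (cmod (F t))\<^sup>2) \<partial>lborel) = ennreal (LINT t|lborel. w t * (cmod (F t))\<^sup>2)"
    using wFF unfolding complex_of_real_integrable_eq
    by (rule nn_integral_eq_integral) (simp add: w_def)
  also have "\<dots> \<le> ennreal (cmod (LINT t|lborel. complex_of_real (w t * (cmod (F t))\<^sup>2)))"
    by (simp only: integral_complex_of_real norm_of_real) (simp add: ennreal_leI)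
  also have "\<dots> \<le> (\<integral>\<^sup>+ x. ennreal (norm (f x * (LINT y|lborel. cnj (f y) * complex_of_real (G (x - y))))) \<partial>lborel)"
    unfolding main by (rule norm_integral_le_nn)
  also have "\<dots> \<le> (\<integral>\<^sup>+ x. \<integral>\<^sup>+ y. ennreal (((cmod (f x))\<^sup>2 + (cmod (f y))\<^sup>2) / 2 * G (x - y)) \<partial>lborel \<partial>lborel)"
  proof (rule nn_integral_mono)
    fix x
    have "ennreal (norm (f x * (LINT y|lborel. cnj (f y) * complex_of_real (G (x - y)))))
       \<le> ennreal (cmod (f x)) * (\<integral>\<^sup>+ y. ennreal (norm (cnj (f y) * complex_of_real (G (x - y)))) \<partial>lborel)"
      unfolding norm_mult[of "f x"] by (simp add: ennreal_mult) (intro mult_left_mono norm_integral_le_nn; simp)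
    also have "\<dots> = (\<integral>\<^sup>+ y. ennreal (cmod (f x) * cmod (f y) * G (x - y)) \<partial>lborel)"
      by (subst nn_integral_cmult[symmetric]) (auto simp: norm_mult ennreal_mult G0 mult_ac)
    also have "\<dots> \<le> (\<integral>\<^sup>+ y. ennreal (((cmod (f x))\<^sup>2 + (cmod (f y))\<^sup>2) / 2 * G (x - y)) \<partial>lborel)"
    proof (intro nn_integral_mono ennreal_leI mult_right_mono G0)
      fix y show "cmod (f x) * cmod (f y) \<le> ((cmod (f x))\<^sup>2 + (cmod (f y))\<^sup>2) / 2"
        using sum_squares_bound[of "cmod (f x)" "cmod (f y)"] by simp
    qed
    finally show "ennreal (norm (f x * (LINT y|lborel. cnj (f y) * complex_of_real (G (x - y)))))
      \<le> (\<integral>\<^sup>+ y. ennreal (((cmod (f x))\<^sup>2 + (cmod (f y))\<^sup>2) / 2 * G (x - y)) \<partial>lborel)" .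
  qed
  also have "\<dots> = (\<integral>\<^sup>+ x. \<integral>\<^sup>+ y. ennreal ((cmod (f x))\<^sup>2 / 2) * ennreal (G (x - y)) \<partial>lborel \<partial>lborel)
      + (\<integral>\<^sup>+ x. \<integral>\<^sup>+ y. ennreal ((cmod (f y))\<^sup>2 / 2) * ennreal (G (x - y)) \<partial>lborel \<partial>lborel)"
    by (subst nn_integral_add[symmetric], measurable, subst nn_integral_add[symmetric])
       (auto simp: ennreal_mult[symmetric] ennreal_plus[symmetric] G0 add_divide_distrib distrib_right
         simp del: ennreal_plus)
  also have "(\<integral>\<^sup>+ x. \<integral>\<^sup>+ y. ennreal ((cmod (f y))\<^sup>2 / 2) * ennreal (G (x - y)) \<partial>lborel \<partial>lborel)
     = (\<integral>\<^sup>+ y. \<integral>\<^sup>+ x. ennreal ((cmod (f y))\<^sup>2 / 2) * ennreal (G (x - y)) \<partial>lborel \<partial>lborel)"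
    by (rule lborel_pair.Fubini'[symmetric]) measurable
  also have "(\<integral>\<^sup>+ x. \<integral>\<^sup>+ y. ennreal ((cmod (f x))\<^sup>2 / 2) * ennreal (G (x - y)) \<partial>lborel \<partial>lborel)
     = (\<integral>\<^sup>+ x. ennreal ((cmod (f x))\<^sup>2 / 2) * (\<integral>\<^sup>+ y. ennreal (G y) \<partial>lborel) \<partial>lborel)"
    by (simp add: nn_integral_cmult nn_integral_lborel_reflect[of "\<lambda>y. ennreal (G y)"])
  also have "(\<integral>\<^sup>+ y. \<integral>\<^sup>+ x. ennreal ((cmod (f y))\<^sup>2 / 2) * ennreal (G (x - y)) \<partial>lborel \<partial>lborel)
     = (\<integral>\<^sup>+ x. ennreal ((cmod (f x))\<^sup>2 / 2) * (\<integral>\<^sup>+ y. ennreal (G y) \<partial>lborel) \<partial>lborel)"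
    using nn_integral_lborel_translate[of "\<lambda>y. ennreal (G y)" "- _"] by (simp add: nn_integral_cmult)
  \<comment> \<open>The total mass of \<open>G\<close> is 2 pi whatever e is, so the bound is
    uniform in e and survives the limit e to 0.\<close>
  also have "(\<integral>\<^sup>+ y. ennreal (G y) \<partial>lborel) = ennreal (2 * pi)"
  proof -
    have "(\<integral>\<^sup>+ y. ennreal (G y) \<partial>lborel)
        = ennreal (sqrt (2 * pi / e)) * (\<integral>\<^sup>+ y. ennreal (exp (- (1 / e * y\<^sup>2 / 2))) \<partial>lborel)"
      using e by (subst nn_integral_cmult[symmetric]) (auto simp: G_def ennreal_mult[symmetric] mult.commute)
    also have "\<dots> = ennreal (sqrt (2 * pi / e) * sqrt (2 * pi * e))"
      using e by (subst gauss_nn_integral) (auto simp: ennreal_mult)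
    also have "sqrt (2 * pi / e) * sqrt (2 * pi * e) = 2 * pi"
    proof -
      have "sqrt (2 * pi / e) * sqrt (2 * pi * e) = sqrt ((2 * pi)\<^sup>2)"
        unfolding real_sqrt_mult[symmetric] using e by (simp add: power2_eq_square)
      also have "\<dots> = 2 * pi"
        by (simp only: real_sqrt_abs) simp
      finally show ?thesis .
    qed
    finally show ?thesis .
  qed
  also have "(\<integral>\<^sup>+ x. ennreal ((cmod (f x))\<^sup>2 / 2) * ennreal (2 * pi) \<partial>lborel)
        + (\<integral>\<^sup>+ x. ennreal ((cmod (f x))\<^sup>2 / 2) * ennreal (2 * pi) \<partial>lborel)
      = ennreal (2 * pi) * (\<integral>\<^sup>+ x. ennreal ((cmod (f x))\<^sup>2) \<partial>lborel)"
    by (subst nn_integral_add[symmetric])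
       (auto simp: nn_integral_cmult[symmetric] ennreal_mult[symmetric] ennreal_plus[symmetric]
         simp del: ennreal_plus intro!: nn_integral_cong arg_cong[where f = ennreal])
  finally show ?thesis by (simp add: w_def F_def)
qed

text \<open>Fatou's lemma removes the Gaussian weight along e = 1 / (n + 1).\<close>

lemma bessel_1d:
  fixes f :: "real \<Rightarrow> complex"
  assumes f: "integrable lborel f"
  shows "(\<integral>\<^sup>+ t. ennreal ((cmod (LINT s|lborel. f s * cis (- (t * s))))\<^sup>2) \<partial>lborel)
     \<le> ennreal (2 * pi) * (\<integral>\<^sup>+ s. ennreal ((cmod (f s))\<^sup>2) \<partial>lborel)"
proof -
  have [measurable]: "f \<in> borel_measurable borel" using f by auto
  define F where "F = (\<lambda>t::real. LINT s|lborel. f s * cis (- (t * s)))"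
  have Fm [measurable]: "F \<in> borel_measurable borel" unfolding F_def by measurable
  define g where "g = (\<lambda>n t::real. ennreal (exp (- (1 / real (Suc n) * t\<^sup>2 / 2)) * (cmod (F t))\<^sup>2))"
  have lim: "(\<lambda>n. g n t) \<longlonglongrightarrow> ennreal ((cmod (F t))\<^sup>2)" for t
  proof -
    have "(\<lambda>n. - (1 / real (Suc n) * t\<^sup>2 / 2)) \<longlonglongrightarrow> - (0 * t\<^sup>2 / 2)"
      using LIMSEQ_Suc[OF lim_1_over_n]
      by (intro tendsto_minus tendsto_divide tendsto_mult tendsto_const) simp_all
    then have "(\<lambda>n. exp (- (1 / real (Suc n) * t\<^sup>2 / 2)) * (cmod (F t))\<^sup>2) \<longlonglongrightarrow> exp (- (0 * t\<^sup>2 / 2)) * (cmod (F t))\<^sup>2"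
      by (intro tendsto_mult tendsto_exp tendsto_const)
    then show ?thesis unfolding g_def by (intro tendsto_ennrealI) simp
  qed
  have "(\<integral>\<^sup>+ t. ennreal ((cmod (F t))\<^sup>2) \<partial>lborel) = (\<integral>\<^sup>+ t. liminf (\<lambda>n. g n t) \<partial>lborel)"
    using lim by (intro nn_integral_cong lim_imp_Liminf[symmetric]) auto
  also have "\<dots> \<le> liminf (\<lambda>n. \<integral>\<^sup>+ t. g n t \<partial>lborel)"
    by (rule nn_integral_liminf) (auto simp: g_def)
  also have "\<dots> \<le> ennreal (2 * pi) * (\<integral>\<^sup>+ s. ennreal ((cmod (f s))\<^sup>2) \<partial>lborel)"
  proof (rule Liminf_le)
    show "\<forall>\<^sub>F n in sequentially. (\<integral>\<^sup>+ t. g n t \<partial>lborel) \<le> ennreal (2 * pi) * (\<integral>\<^sup>+ s. ennreal ((cmod (f s))\<^sup>2) \<partial>lborel)"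
      unfolding g_def F_def by (intro always_eventually allI bessel_1d_weighted[OF f]) simp
  qed simp
  finally show ?thesis by (simp add: F_def)
qed

lemma fourier_measurable [measurable]:
  "f \<in> borel_measurable borel \<Longrightarrow> fourier f \<in> borel_measurable borel"
proof -
  assume [measurable]: "f \<in> borel_measurable borel"
  have "(\<lambda>(\<xi>, x). f x * cis (- (x \<bullet> \<xi>))) \<in> borel_measurable (borel \<Otimes>\<^sub>M lborel)"
    by measurable
  then show ?thesis
    unfolding fourier_def by (rule lborel.borel_measurable_lebesgue_integral)
qed

text \<open>The inequality on the line is used twice: in the first coordinate for each second
  frequency, then, after exchanging the order of integration, in the second coordinate for each
  a.\<close>

lemma bessel_plane:
  assumes f: "integrable lborel f"
  shows "Lpow 2 (fourier f) \<le> ennreal ((2 * pi)\<^sup>2) * Lpow 2 f"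
proof -
  have [measurable]: "f \<in> borel_measurable borel" using f by auto
  define g where "g = (\<lambda>\<xi>2 a. LINT b|lborel. f (pl a b) * cis (- (\<xi>2 * b)))"
  have gm [measurable]: "(\<lambda>(\<xi>2, a). g \<xi>2 a) \<in> borel_measurable (borel \<Otimes>\<^sub>M borel)"
    unfolding g_def by measurable
  have gm2 [measurable]: "(\<lambda>z. g (fst z) (snd z)) \<in> borel_measurable (borel \<Otimes>\<^sub>M borel)"
    using gm by (simp add: case_prod_beta')
  have [measurable]: "(\<lambda>a. g \<xi>2 a) \<in> borel_measurable borel" for \<xi>2
    unfolding g_def by measurable
  have intg: "integrable lborel (g \<xi>2)" for \<xi>2
  proof -
    have "integrable lborel (\<lambda>x. f x * cis (- (\<xi>2 * x $ 2)))" using f by simp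
    then have "integrable (lborel \<Otimes>\<^sub>M lborel) (\<lambda>(a, b). f (pl a b) * cis (- (\<xi>2 * b)))"
      by (subst (asm) integrable_plane_iff) auto
    from lborel_pair.integrable_fst[OF this] show ?thesis
      by (simp add: g_def)
  qed
  have fe: "fourier f (pl \<xi>1 \<xi>2) = (LINT a|lborel. g \<xi>2 a * cis (- (\<xi>1 * a)))" for \<xi>1 \<xi>2
  proof -
    have "fourier f (pl \<xi>1 \<xi>2) = (LINT a|lborel. (LINT b|lborel. f (pl a b) * cis (- (pl a b \<bullet> pl \<xi>1 \<xi>2))))"
      unfolding fourier_def using f by (intro integral_plane) auto
    also have "\<dots> = (LINT a|lborel. g \<xi>2 a * cis (- (\<xi>1 * a)))"
    proof (intro Bochner_Integration.integral_cong refl)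
      fix a
      have "(LINT b|lborel. f (pl a b) * cis (- (pl a b \<bullet> pl \<xi>1 \<xi>2)))
          = (LINT b|lborel. (f (pl a b) * cis (- (\<xi>2 * b))) * cis (- (\<xi>1 * a)))"
        by (intro Bochner_Integration.integral_cong refl) (simp add: mult.assoc cis_mult pl_inner mult.commute minus_diff_commute)
      then show "(LINT b|lborel. f (pl a b) * cis (- (pl a b \<bullet> pl \<xi>1 \<xi>2))) = g \<xi>2 a * cis (- (\<xi>1 * a))"
        by (simp only: g_def integral_mult_left_zero)
    qed
    finally show ?thesis .
  qed
  have "Lpow 2 (fourier f) = (\<integral>\<^sup>+ \<xi>2. \<integral>\<^sup>+ \<xi>1. ennreal ((cmod (fourier f (pl \<xi>1 \<xi>2)))\<^sup>2) \<partial>lborel \<partial>lborel)"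
    unfolding Lpow_def by (subst nn_integral_plane_swap) auto
  also have "\<dots> \<le> (\<integral>\<^sup>+ \<xi>2. ennreal (2 * pi) * (\<integral>\<^sup>+ a. ennreal ((cmod (g \<xi>2 a))\<^sup>2) \<partial>lborel) \<partial>lborel)"
    unfolding fe by (intro nn_integral_mono bessel_1d intg)
  also have "\<dots> = ennreal (2 * pi) * (\<integral>\<^sup>+ \<xi>2. \<integral>\<^sup>+ a. ennreal ((cmod (g \<xi>2 a))\<^sup>2) \<partial>lborel \<partial>lborel)"
    by (rule nn_integral_cmult) measurable
  finally have 1: "Lpow 2 (fourier f) \<le> ennreal (2 * pi) * (\<integral>\<^sup>+ \<xi>2. \<integral>\<^sup>+ a. ennreal ((cmod (g \<xi>2 a))\<^sup>2) \<partial>lborel \<partial>lborel)" .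
  have "(\<integral>\<^sup>+ \<xi>2. \<integral>\<^sup>+ a. ennreal ((cmod (g \<xi>2 a))\<^sup>2) \<partial>lborel \<partial>lborel)
     = (\<integral>\<^sup>+ a. \<integral>\<^sup>+ \<xi>2. ennreal ((cmod (g \<xi>2 a))\<^sup>2) \<partial>lborel \<partial>lborel)"
    by (rule lborel_pair.Fubini'[symmetric]) measurable
  \<comment> \<open>The slice of \<open>f\<close> at a is integrable only for almost every a,
    whereas its partial transform \<open>g\<close> is integrable for every second frequency.\<close>
  also have "\<dots> \<le> (\<integral>\<^sup>+ a. ennreal (2 * pi) * (\<integral>\<^sup>+ b. ennreal ((cmod (f (pl a b)))\<^sup>2) \<partial>lborel) \<partial>lborel)"
    using AE_integrable_plane(1)[OF f] unfolding g_def
    by (intro nn_integral_mono_AE) (auto elim!: eventually_mono intro: bessel_1d)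
  also have "\<dots> = ennreal (2 * pi) * Lpow 2 f"
    unfolding Lpow_def by (subst nn_integral_plane) (auto simp: nn_integral_cmult)
  finally have "ennreal (2 * pi) * (\<integral>\<^sup>+ \<xi>2. \<integral>\<^sup>+ a. ennreal ((cmod (g \<xi>2 a))\<^sup>2) \<partial>lborel \<partial>lborel)
      \<le> ennreal (2 * pi) * (ennreal (2 * pi) * Lpow 2 f)"
    by (intro mult_left_mono) auto
  note order_trans[OF 1 this]
  also have "\<dots> = ennreal ((2 * pi)\<^sup>2) * Lpow 2 f"
    unfolding power2_eq_square mult.assoc[symmetric] by (subst ennreal_mult[symmetric]) (auto simp: mult.assoc)
  finally show ?thesis .
qed

section \<open>Square integrable functions on the plane\<close>

lemma L2D: assumes "f \<in> L2" shows "f \<in> borel_measurable borel" "Lpow 2 f < \<infinity>"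
  using assms by (auto simp: L2_def)

lemma L2I: "f \<in> borel_measurable borel \<Longrightarrow> Lpow 2 f < \<infinity> \<Longrightarrow> f \<in> L2"
  by (auto simp: L2_def)

lemma Lpow_cong_AE: "AE x in lborel. f x = g x \<Longrightarrow> Lpow p f = Lpow p g"
  unfolding Lpow_def by (rule nn_integral_cong_AE) auto

lemma Lpow_mono: "(\<And>x. cmod (f x) \<le> cmod (g x)) \<Longrightarrow> Lpow p f \<le> Lpow p g"
  unfolding Lpow_def by (intro nn_integral_mono ennreal_leI power_mono) auto

lemma Lpow2_zero [simp]: "Lpow 2 (\<lambda>x. 0) = 0"
  by (simp add: Lpow_def)

text \<open>From (a + b)^2 <= 2 a^2 + 2 b^2. It stands in for Minkowski's inequality: being linear
  in \<open>Lpow 2\<close>, it avoids square roots in \<open>ennreal\<close>, at the price of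
  factors 2.\<close>

lemma Lpow2_add:
  assumes [measurable]: "f \<in> borel_measurable borel" "g \<in> borel_measurable borel"
  shows "Lpow 2 (\<lambda>x. f x + g x) \<le> 2 * Lpow 2 f + 2 * Lpow 2 g"
proof -
  have "Lpow 2 (\<lambda>x. f x + g x) \<le> (\<integral>\<^sup>+ x. (2 * ennreal ((cmod (f x))\<^sup>2) + 2 * ennreal ((cmod (g x))\<^sup>2)) \<partial>lborel)"
    unfolding Lpow_def
  proof (rule nn_integral_mono)
    fix x
    have "(cmod (f x + g x))\<^sup>2 \<le> (cmod (f x) + cmod (g x))\<^sup>2"
      by (intro power_mono norm_triangle_ineq) auto
    also have "\<dots> \<le> 2 * (cmod (f x))\<^sup>2 + 2 * (cmod (g x))\<^sup>2"
      using sum_squares_bound[of "cmod (f x)" "cmod (g x)"] by (simp add: power2_sum)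
    finally have "ennreal ((cmod (f x + g x))\<^sup>2) \<le> ennreal (2 * (cmod (f x))\<^sup>2 + 2 * (cmod (g x))\<^sup>2)"
      by (rule ennreal_leI)
    then show "ennreal ((cmod (f x + g x))\<^sup>2) \<le> 2 * ennreal ((cmod (f x))\<^sup>2) + 2 * ennreal ((cmod (g x))\<^sup>2)"
      by (simp add: ennreal_mult)
  qed
  also have "\<dots> = 2 * Lpow 2 f + 2 * Lpow 2 g"
    unfolding Lpow_def by (simp add: nn_integral_add nn_integral_cmult)
  finally show ?thesis .
qed

lemma Lpow2_uminus: "Lpow 2 (\<lambda>x. - f x) = Lpow 2 f"
  by (simp add: Lpow_def)

lemma Lpow2_minus_commute: "Lpow 2 (\<lambda>x. f x - g x) = Lpow 2 (\<lambda>x. g x - f x)"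
  by (simp add: Lpow_def norm_minus_commute)

lemma Lpow2_diff:
  assumes "f \<in> borel_measurable borel" "g \<in> borel_measurable borel"
  shows "Lpow 2 (\<lambda>x. f x - g x) \<le> 2 * Lpow 2 f + 2 * Lpow 2 g"
  using Lpow2_add[of f "\<lambda>x. - g x"] assms by (simp add: Lpow2_uminus)

lemma Lpow2_triangle:
  assumes [measurable]: "f \<in> borel_measurable borel" "g \<in> borel_measurable borel" "h \<in> borel_measurable borel"
  shows "Lpow 2 (\<lambda>x. f x - h x) \<le> 2 * Lpow 2 (\<lambda>x. f x - g x) + 2 * Lpow 2 (\<lambda>x. g x - h x)"
  using Lpow2_add[of "\<lambda>x. f x - g x" "\<lambda>x. g x - h x"] by simp

lemma Lpow2_mult_le:
  assumes [measurable]: "f \<in> borel_measurable borel"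
    and "AE x in lborel. cmod (m x) \<le> C"
  shows "Lpow 2 (\<lambda>x. m x * f x) \<le> ennreal (C\<^sup>2) * Lpow 2 f"
proof -
  have "Lpow 2 (\<lambda>x. m x * f x) \<le> (\<integral>\<^sup>+ x. ennreal (C\<^sup>2) * ennreal ((cmod (f x))\<^sup>2) \<partial>lborel)"
    unfolding Lpow_def using assms(2)
    by (intro nn_integral_mono_AE)
       (auto elim!: eventually_mono simp: norm_mult power_mult_distrib ennreal_mult[symmetric]
          intro!: ennreal_leI mult_right_mono power_mono)
  then show ?thesis by (simp add: Lpow_def nn_integral_cmult)
qed

lemma Lpow_cmult:
  assumes [measurable]: "f \<in> borel_measurable borel"
  shows "Lpow p (\<lambda>x. c * f x) = ennreal (cmod c ^ p) * Lpow p f"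
  unfolding Lpow_def by (subst nn_integral_cmult[symmetric]) (auto simp: norm_mult power_mult_distrib ennreal_mult)

lemma L2_mult:
  assumes "f \<in> L2" and [measurable]: "m \<in> borel_measurable borel" and "\<And>x. cmod (m x) \<le> C"
  shows "(\<lambda>x. m x * f x) \<in> L2"
proof (rule L2I)
  have [measurable]: "f \<in> borel_measurable borel" using L2D[OF assms(1)] by simp
  show "(\<lambda>x. m x * f x) \<in> borel_measurable borel" by measurable
  have "Lpow 2 (\<lambda>x. m x * f x) \<le> ennreal (C\<^sup>2) * Lpow 2 f"
    using assms by (intro Lpow2_mult_le) auto
  also have "\<dots> < \<infinity>" using L2D[OF assms(1)] by (simp add: ennreal_mult_less_top)
  finally show "Lpow 2 (\<lambda>x. m x * f x) < \<infinity>" .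
qed

lemma L2_add:
  assumes "f \<in> L2" "g \<in> L2"
  shows "(\<lambda>x. f x + g x) \<in> L2"
proof (rule L2I)
  note m = L2D[OF assms(1)] L2D[OF assms(2)]
  show "(\<lambda>x. f x + g x) \<in> borel_measurable borel" using m by auto
  have "Lpow 2 (\<lambda>x. f x + g x) \<le> 2 * Lpow 2 f + 2 * Lpow 2 g"
    using m by (intro Lpow2_add)
  also have "\<dots> < \<infinity>" using m by (simp add: ennreal_mult_less_top)
  finally show "Lpow 2 (\<lambda>x. f x + g x) < \<infinity>" .
qed

lemma L2_cmult: "f \<in> L2 \<Longrightarrow> (\<lambda>x. c * f x) \<in> L2"
  by (rule L2_mult[where m = "\<lambda>_. c" and C = "cmod c"]) auto

lemma L2_diff: "f \<in> L2 \<Longrightarrow> g \<in> L2 \<Longrightarrow> (\<lambda>x. f x - g x) \<in> L2"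
  using L2_add[of f "\<lambda>x. (- 1) * g x"] L2_cmult[of g "- 1"] by simp

lemma Lpow2_eq_0_AE:
  assumes [measurable]: "f \<in> borel_measurable borel" and "Lpow 2 f = 0"
  shows "AE x in lborel. f x = 0"
  using assms(2) unfolding Lpow_def by (subst (asm) nn_integral_0_iff_AE) auto

text \<open>On a set of finite measure L2 is contained in L1, because r <= 1 + r^2.\<close>

lemma L2_indicator_integrable:
  assumes f: "f \<in> L2" and A [measurable]: "A \<in> sets borel" and fin: "emeasure lborel A < \<infinity>"
  shows "integrable lborel (\<lambda>x. indicator A x * f x :: complex)"
proof (rule integrableI_bounded)
  have [measurable]: "f \<in> borel_measurable borel" using L2D[OF f] by simp
  show "(\<lambda>x. indicator A x * f x :: complex) \<in> borel_measurable lborel" by measurable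
  have "(\<integral>\<^sup>+ x. ennreal (norm (indicator A x * f x)) \<partial>lborel)
      \<le> (\<integral>\<^sup>+ x. (indicator A x + ennreal ((cmod (f x))\<^sup>2)) \<partial>lborel)"
  proof (rule nn_integral_mono)
    fix x
    have "cmod (f x) \<le> 1 + (cmod (f x))\<^sup>2"
      using self_le_power[of "cmod (f x)" 2] by (cases "cmod (f x) \<le> 1") (auto intro: add_increasing2)
    then show "ennreal (norm (indicator A x * f x)) \<le> indicator A x + ennreal ((cmod (f x))\<^sup>2)"
      by (auto simp: indicator_def ennreal_plus[symmetric] ennreal_1[symmetric] simp del: ennreal_plus ennreal_1 intro!: ennreal_leI)
  qed
  also have "\<dots> = emeasure lborel A + Lpow 2 f"
    by (simp add: nn_integral_add Lpow_def)
  also have "\<dots> < \<infinity>" using fin L2D[OF f] by simp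
  finally show "(\<integral>\<^sup>+ x. ennreal (norm (indicator A x * f x)) \<partial>lborel) < \<infinity>" .
qed

section \<open>Truncation to balls and completeness of L2\<close>

definition trunc :: "real \<Rightarrow> (plane \<Rightarrow> complex) \<Rightarrow> plane \<Rightarrow> complex" where
  "trunc R f = (\<lambda>x. indicator (cball 0 R) x * f x)"

lemma trunc_measurable [measurable]: "f \<in> borel_measurable borel \<Longrightarrow> trunc R f \<in> borel_measurable borel"
  unfolding trunc_def by (intro borel_measurable_times borel_measurable_indicator) auto

lemma trunc_L2: "f \<in> L2 \<Longrightarrow> trunc R f \<in> L2"
  unfolding trunc_def by (rule L2_mult[where C = 1]) (auto simp: indicator_def)

lemma trunc_integrable: "f \<in> L2 \<Longrightarrow> integrable lborel (trunc R f)"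
  unfolding trunc_def
  using emeasure_bounded_finite[OF bounded_cball, of 0 R] by (intro L2_indicator_integrable) auto

text \<open>Limits at \<open>at_top\<close> are decided by sequences tending to infinity, and along
  each of them dominated convergence applies.\<close>

lemma nn_integral_tendsto_0_real:
  fixes F :: "real \<Rightarrow> 'a \<Rightarrow> ennreal"
  assumes [measurable]: "\<And>r. F r \<in> borel_measurable M" and w: "w \<in> borel_measurable M"
    "(\<integral>\<^sup>+ x. w x \<partial>M) < \<infinity>" and le: "\<And>r x. F r x \<le> w x"
    and lim: "\<And>x. ((\<lambda>r. F r x) \<longlongrightarrow> 0) at_top"
  shows "((\<lambda>r. \<integral>\<^sup>+ x. F r x \<partial>M) \<longlongrightarrow> 0) at_top"
proof (rule tendsto_at_topI_sequentially)
  fix X :: "nat \<Rightarrow> real" assume X: "filterlim X at_top sequentially"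
  have "(\<lambda>n. \<integral>\<^sup>+ x. F (X n) x \<partial>M) \<longlonglongrightarrow> (\<integral>\<^sup>+ x. 0 \<partial>M)"
    by (rule nn_integral_dominated_convergence[where w = w])
       (use w le in \<open>auto intro!: AE_I2 filterlim_compose[OF lim X]\<close>)
  then show "(\<lambda>n. \<integral>\<^sup>+ x. F (X n) x \<partial>M) \<longlonglongrightarrow> 0" by simp
qed

lemma trunc_tendsto:
  assumes f: "f \<in> L2"
  shows "((\<lambda>R. Lpow 2 (\<lambda>x. trunc R f x - f x)) \<longlongrightarrow> 0) at_top"
  unfolding Lpow_def
proof (rule nn_integral_tendsto_0_real[where w = "\<lambda>x. ennreal ((cmod (f x))\<^sup>2)"])
  have [measurable]: "f \<in> borel_measurable borel" using L2D[OF f] by simp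
  show "(\<lambda>x. ennreal ((cmod (trunc r f x - f x))\<^sup>2)) \<in> borel_measurable lborel" for r
    by measurable
  show "(\<lambda>x. ennreal ((cmod (f x))\<^sup>2)) \<in> borel_measurable lborel" by measurable
  show "(\<integral>\<^sup>+ x. ennreal ((cmod (f x))\<^sup>2) \<partial>lborel) < \<infinity>" using L2D[OF f] by (simp add: Lpow_def)
  show "ennreal ((cmod (trunc r f x - f x))\<^sup>2) \<le> ennreal ((cmod (f x))\<^sup>2)" for r x
    by (auto simp: trunc_def indicator_def)
  show "((\<lambda>r. ennreal ((cmod (trunc r f x - f x))\<^sup>2)) \<longlongrightarrow> 0) at_top" for x
  proof (rule tendsto_eventually)
    show "\<forall>\<^sub>F r in at_top. ennreal ((cmod (trunc r f x - f x))\<^sup>2) = 0"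
      using eventually_ge_at_top[of "norm x"] by eventually_elim (auto simp: trunc_def indicator_def)
  qed
qed

text \<open>Squared increments of order 4^-n leave room for a weight 2^n: the sum of the 2^n |d n|^2
  has finite integral, so it is finite almost everywhere. There 2 d <= 2^-n + 2^n d^2 makes the
  increments summable.\<close>

lemma L2_complete:
  fixes f :: "nat \<Rightarrow> plane \<Rightarrow> complex"
  assumes f: "\<And>n. f n \<in> borel_measurable borel"
    and d: "\<And>n. Lpow 2 (\<lambda>x. f (Suc n) x - f n x) \<le> ennreal (A * (1 / 4) ^ n)" and A: "0 \<le> A"
  shows "\<exists>g\<in>borel_measurable borel. AE x in lborel. (\<lambda>n. f n x) \<longlonglongrightarrow> g x"
proof (intro bexI)
  note [measurable] = f
  show "(\<lambda>x. lim (\<lambda>n. f n x)) \<in> borel_measurable borel" by measurable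
  define d where "d = (\<lambda>n x. cmod (f (Suc n) x - f n x))"
  have [measurable]: "d n \<in> borel_measurable borel" for n unfolding d_def by measurable
  have "(\<integral>\<^sup>+ x. (\<Sum>n. ennreal (2 ^ n * (d n x)\<^sup>2)) \<partial>lborel) = (\<Sum>n. \<integral>\<^sup>+ x. ennreal (2 ^ n * (d n x)\<^sup>2) \<partial>lborel)"
    by (rule nn_integral_suminf) measurable
  also have "\<dots> \<le> (\<Sum>n. ennreal (A * (1 / 2) ^ n))"
  proof (rule suminf_le)
    fix n
    have "(\<integral>\<^sup>+ x. ennreal (2 ^ n * (d n x)\<^sup>2) \<partial>lborel) = ennreal (2 ^ n) * Lpow 2 (\<lambda>x. f (Suc n) x - f n x)"
      unfolding Lpow_def by (subst nn_integral_cmult[symmetric]) (auto simp: d_def ennreal_mult)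
    also have "\<dots> \<le> ennreal (2 ^ n) * ennreal (A * (1 / 4) ^ n)"
      by (intro mult_left_mono assms) auto
    also have "\<dots> = ennreal (A * (1 / 2) ^ n)"
      using A by (subst ennreal_mult[symmetric])
        (auto simp: power_mult_distrib[symmetric] mult.left_commute[of _ A])
    finally show "(\<integral>\<^sup>+ x. ennreal (2 ^ n * (d n x)\<^sup>2) \<partial>lborel) \<le> ennreal (A * (1 / 2) ^ n)" .
  qed auto
  also have "\<dots> = ennreal (\<Sum>n. A * (1 / 2) ^ n)"
    using A by (intro suminf_ennreal2) (auto intro!: summable_mult summable_geometric)
  also have "\<dots> < \<infinity>" by simp
  finally have "AE x in lborel. (\<Sum>n. ennreal (2 ^ n * (d n x)\<^sup>2)) \<noteq> \<infinity>"
    by (intro nn_integral_PInf_AE) auto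
  then show "AE x in lborel. (\<lambda>n. f n x) \<longlonglongrightarrow> lim (\<lambda>n. f n x)"
  proof eventually_elim
    fix x assume "(\<Sum>n. ennreal (2 ^ n * (d n x)\<^sup>2)) \<noteq> \<infinity>"
    then have s: "summable (\<lambda>n. 2 ^ n * (d n x)\<^sup>2)"
      by (intro summable_suminf_not_top) auto
    have "summable (\<lambda>n. norm (f (Suc n) x - f n x))"
    proof (rule summable_comparison_test)
      show "summable (\<lambda>n. (1 / 2) ^ n + 2 ^ n * (d n x)\<^sup>2)"
        by (intro summable_add s summable_geometric) auto
      show "\<exists>N. \<forall>n\<ge>N. norm (norm (f (Suc n) x - f n x)) \<le> (1 / 2) ^ n + 2 ^ n * (d n x)\<^sup>2"
      proof (intro exI allI impI)
        fix n
        have d0: "0 \<le> d n x" by (simp add: d_def)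
        have "0 \<le> (1 / 2) ^ n * (1 - 2 ^ n * d n x)\<^sup>2" by simp
        also have "\<dots> = (1 / 2) ^ n * (1 - 2 * (2 ^ n * d n x) + 2 ^ n * (2 ^ n * (d n x)\<^sup>2))"
          by (simp add: power2_eq_square algebra_simps)
        also have "\<dots> = (1 / 2) ^ n + 2 ^ n * (d n x)\<^sup>2 - 2 * d n x"
          by (simp add: power_one_over field_simps)
        finally have "2 * d n x \<le> (1 / 2) ^ n + 2 ^ n * (d n x)\<^sup>2" by simp
        then have "d n x \<le> (1 / 2) ^ n + 2 ^ n * (d n x)\<^sup>2"
          using d0 by linarith
        then show "norm (norm (f (Suc n) x - f n x)) \<le> (1 / 2) ^ n + 2 ^ n * (d n x)\<^sup>2"
          by (simp add: d_def)
      qed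
    qed
    then have "summable (\<lambda>n. f (Suc n) x - f n x)" by (rule summable_norm_cancel)
    then have "convergent (\<lambda>n. \<Sum>i<n. f (Suc i) x - f i x)"
      by (simp add: summable_iff_convergent)
    then have "convergent (\<lambda>n. f n x - f 0 x)"
      unfolding sum_lessThan_telescope[of "\<lambda>i. f i x"] .
    then have "convergent (\<lambda>n. f n x)"
      using convergent_add[of "\<lambda>n. f n x - f 0 x" "\<lambda>n. f 0 x"] by (simp add: convergent_const)
    then show "(\<lambda>n. f n x) \<longlonglongrightarrow> lim (\<lambda>n. f n x)"
      by (simp add: convergent_LIMSEQ_iff)
  qed
qed

lemma Lpow2_Fatou:
  assumes [measurable]: "\<And>n. f n \<in> borel_measurable borel" "g \<in> borel_measurable borel"
    and "AE x in lborel. (\<lambda>n. f n x) \<longlonglongrightarrow> g x"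
  shows "Lpow 2 g \<le> liminf (\<lambda>n. Lpow 2 (f n))"
proof -
  have "Lpow 2 g = (\<integral>\<^sup>+ x. liminf (\<lambda>n. ennreal ((cmod (f n x))\<^sup>2)) \<partial>lborel)"
    unfolding Lpow_def
  proof (rule nn_integral_cong_AE)
    show "AE x in lborel. ennreal ((cmod (g x))\<^sup>2) = liminf (\<lambda>n. ennreal ((cmod (f n x))\<^sup>2))"
      using assms(3)
    proof eventually_elim
      fix x assume "(\<lambda>n. f n x) \<longlonglongrightarrow> g x"
      then have "(\<lambda>n. ennreal ((cmod (f n x))\<^sup>2)) \<longlonglongrightarrow> ennreal ((cmod (g x))\<^sup>2)"
        by (intro tendsto_ennrealI tendsto_power tendsto_norm)
      then show "ennreal ((cmod (g x))\<^sup>2) = liminf (\<lambda>n. ennreal ((cmod (f n x))\<^sup>2))"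
        by (intro lim_imp_Liminf[symmetric]) auto
    qed
  qed
  also have "\<dots> \<le> liminf (\<lambda>n. Lpow 2 (f n))"
    unfolding Lpow_def by (rule nn_integral_liminf) measurable
  finally show ?thesis .
qed

text \<open>Completeness for a family indexed by real radii. A sequence of radii along which the
  error e is at most 4^-n has an almost everywhere limit, and Fatou's lemma carries the Cauchy bound
  over to the distance from that limit for every R.\<close>

lemma L2_Cauchy_limit:
  fixes A :: "real \<Rightarrow> plane \<Rightarrow> complex"
  assumes A: "\<And>R. A R \<in> L2" and e: "(e \<longlongrightarrow> 0) at_top"
    and AA: "\<And>R R'. Lpow 2 (\<lambda>x. A R x - A R' x) \<le> ennreal C * (e R + e R')" and C: "0 \<le> C"
  shows "\<exists>g\<in>L2. ((\<lambda>R. Lpow 2 (\<lambda>x. A R x - g x)) \<longlongrightarrow> 0) at_top"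
proof -
  have [measurable]: "A R \<in> borel_measurable borel" for R using L2D[OF A] by simp
  have "\<exists>R0. \<forall>R\<ge>R0. e R < ennreal ((1 / 4) ^ n)" for n
    using order_tendstoD(2)[OF e, of "ennreal ((1 / 4) ^ n)"] by (simp add: eventually_at_top_linorder)
  then obtain S where S: "\<And>n R. S n \<le> R \<Longrightarrow> e R < ennreal ((1 / 4) ^ n)" by metis
  define f where "f = (\<lambda>n. A (max (S n) (real n)))"
  have eS: "e (max (S n) (real n)) \<le> ennreal ((1 / 4) ^ n)" for n
    using S[of n "max (S n) (real n)"] by auto
  have "Lpow 2 (\<lambda>x. f (Suc n) x - f n x) \<le> ennreal (2 * C * (1 / 4) ^ n)" for n
  proof -
    have "Lpow 2 (\<lambda>x. f (Suc n) x - f n x) \<le> ennreal C * (ennreal ((1 / 4) ^ Suc n) + ennreal ((1 / 4) ^ n))"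
      unfolding f_def by (rule order_trans[OF AA]) (intro mult_left_mono add_mono eS; simp)
    also have "\<dots> \<le> ennreal C * (ennreal ((1 / 4) ^ n) + ennreal ((1 / 4) ^ n))"
      by (intro mult_left_mono add_mono ennreal_leI) auto
    also have "\<dots> = ennreal (2 * C * (1 / 4) ^ n)"
      using C by (simp add: ennreal_plus[symmetric] ennreal_mult[symmetric] del: ennreal_plus)
    finally show ?thesis .
  qed
  then obtain g where g [measurable]: "g \<in> borel_measurable borel"
    and lim: "AE x in lborel. (\<lambda>n. f n x) \<longlonglongrightarrow> g x"
    using L2_complete[of f "2 * C"] C unfolding f_def by auto
  have bd: "Lpow 2 (\<lambda>x. A R x - g x) \<le> ennreal C * e R" for R
  proof -
    have "Lpow 2 (\<lambda>x. A R x - g x) \<le> liminf (\<lambda>n. Lpow 2 (\<lambda>x. A R x - f n x))"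
      using lim by (intro Lpow2_Fatou) (auto simp: f_def elim!: eventually_mono intro: tendsto_diff)
    also have "\<dots> \<le> liminf (\<lambda>n. ennreal C * (e R + ennreal ((1 / 4) ^ n)))"
      unfolding f_def
      by (intro Liminf_mono always_eventually allI order_trans[OF AA] mult_left_mono add_mono eS) auto
    also have "\<dots> = ennreal C * (e R + 0)"
    proof (intro lim_imp_Liminf)
      have "(\<lambda>n. ennreal ((1 / 4) ^ n)) \<longlonglongrightarrow> ennreal 0"
        by (intro tendsto_ennrealI LIMSEQ_realpow_zero) auto
      then have "(\<lambda>n. e R + ennreal ((1 / 4) ^ n)) \<longlonglongrightarrow> e R + 0"
        by (intro tendsto_add) auto
      then show "(\<lambda>n. ennreal C * (e R + ennreal ((1 / 4) ^ n))) \<longlonglongrightarrow> ennreal C * (e R + 0)"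
        by (intro ennreal_tendsto_cmult) auto
    qed auto
    finally show ?thesis by simp
  qed
  have lim0: "((\<lambda>R. Lpow 2 (\<lambda>x. A R x - g x)) \<longlongrightarrow> 0) at_top"
  proof (rule tendsto_sandwich[OF _ _ tendsto_const])
    have "((\<lambda>R. ennreal C * e R) \<longlongrightarrow> ennreal C * 0) at_top"
      by (intro ennreal_tendsto_cmult e) auto
    then show "((\<lambda>R. ennreal C * e R) \<longlongrightarrow> 0) at_top" by simp
  qed (use bd in auto)
  then have "\<forall>\<^sub>F R in at_top. Lpow 2 (\<lambda>x. A R x - g x) < 1"
    by (rule order_tendstoD) simp
  then obtain R where R: "Lpow 2 (\<lambda>x. A R x - g x) < 1"
    by (auto simp: eventually_at_top_linorder)
  have "(\<lambda>x. A R x - g x) \<in> L2"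
    using R by (intro L2I) (auto intro: less_trans)
  from L2_diff[OF A[of R] this] have "g \<in> L2" by simp
  with lim0 show ?thesis by blast
qed

section \<open>The Fourier--Plancherel transform\<close>

lemma fourier_add:
  assumes "integrable lborel f" "integrable lborel g"
  shows "fourier (\<lambda>x. f x + g x) \<xi> = fourier f \<xi> + fourier g \<xi>"
  unfolding fourier_def using assms by (subst Bochner_Integration.integral_add[symmetric]) (auto simp: distrib_right)

lemma fourier_diff:
  assumes "integrable lborel f" "integrable lborel g"
  shows "fourier (\<lambda>x. f x - g x) \<xi> = fourier f \<xi> - fourier g \<xi>"
  unfolding fourier_def using assms by (subst Bochner_Integration.integral_diff[symmetric]) (auto simp: left_diff_distrib)

lemma fourier_cmult: "fourier (\<lambda>x. c * f x) \<xi> = c * fourier f \<xi>"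
  unfolding fourier_def by (simp add: mult.assoc)

lemma fourier_cong_AE:
  assumes "f \<in> borel_measurable borel" "g \<in> borel_measurable borel" "AE x in lborel. f x = g x"
  shows "fourier f = fourier g"
proof
  note [measurable] = assms(1,2)
  fix \<xi> show "fourier f \<xi> = fourier g \<xi>"
    unfolding fourier_def using assms(3) by (intro integral_cong_AE) auto
qed

lemma fourier_bound:
  assumes "integrable lborel f"
  shows "cmod (fourier f \<xi>) \<le> (LINT x|lborel. cmod (f x))"
  unfolding fourier_def using integral_norm_bound[of lborel "\<lambda>x. f x * cis (- (x \<bullet> \<xi>))"]
  by (simp add: norm_mult)

lemma fourier_L2_mem: "integrable lborel f \<Longrightarrow> f \<in> L2 \<Longrightarrow> fourier f \<in> L2"
proof (rule L2I)
  assume f: "integrable lborel f" "f \<in> L2"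
  show "fourier f \<in> borel_measurable borel" using L2D[OF f(2)] by simp
  have "Lpow 2 (fourier f) \<le> ennreal ((2 * pi)\<^sup>2) * Lpow 2 f" by (rule bessel_plane[OF f(1)])
  also have "\<dots> < \<infinity>" using L2D[OF f(2)] by (auto simp: ennreal_mult_less_top)
  finally show "Lpow 2 (fourier f) < \<infinity>" .
qed

text \<open>The convergence demanded by the choice in \<open>fourier_L2\<close>, written with
  \<open>trunc\<close>.\<close>

abbreviation ft_limit :: "(plane \<Rightarrow> complex) \<Rightarrow> (plane \<Rightarrow> complex) \<Rightarrow> bool" where
  "ft_limit f g \<equiv> ((\<lambda>R. Lpow 2 (\<lambda>\<xi>. fourier (trunc R f) \<xi> - g \<xi>)) \<longlongrightarrow> 0) at_top"

lemma tendsto_0_ennreal_bound: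
  fixes f g h :: "'a \<Rightarrow> ennreal"
  assumes "\<And>x. f x \<le> ennreal A * g x + ennreal B * h x" "(g \<longlongrightarrow> 0) F" "(h \<longlongrightarrow> 0) F"
  shows "(f \<longlongrightarrow> 0) F"
proof (rule tendsto_sandwich[OF _ _ tendsto_const])
  have "((\<lambda>x. ennreal A * g x + ennreal B * h x) \<longlongrightarrow> ennreal A * 0 + ennreal B * 0) F"
    using assms by (intro tendsto_add ennreal_tendsto_cmult) auto
  then show "((\<lambda>x. ennreal A * g x + ennreal B * h x) \<longlongrightarrow> 0) F" by simp
qed (use assms in auto)

text \<open>Bessel's inequality makes the transforms of the truncations a Cauchy family, so the
  choice in \<open>fourier_L2\<close> has something to choose from.\<close>

lemma fourier_L2_spec:
  assumes f: "f \<in> L2"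
  shows "fourier_L2 f \<in> L2" and "ft_limit f (fourier_L2 f)"
proof -
  define e where "e = (\<lambda>R. Lpow 2 (\<lambda>x. trunc R f x - f x))"
  have fm [measurable]: "f \<in> borel_measurable borel" using L2D[OF f] by simp
  note ti = trunc_integrable[OF f]
  have "\<exists>g\<in>L2. ft_limit f g"
  proof (rule L2_Cauchy_limit[where e = e and C = "(2 * pi)\<^sup>2 * 2"])
    show "fourier (trunc R f) \<in> L2" for R by (intro fourier_L2_mem ti trunc_L2 f)
    show "(e \<longlongrightarrow> 0) at_top" unfolding e_def by (rule trunc_tendsto[OF f])
    fix R R'
    have "Lpow 2 (\<lambda>x. fourier (trunc R f) x - fourier (trunc R' f) x)
        = Lpow 2 (fourier (\<lambda>x. trunc R f x - trunc R' f x))"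
      by (rule arg_cong[where f = "Lpow 2"]) (simp add: fun_eq_iff fourier_diff[OF ti ti])
    also have "\<dots> \<le> ennreal ((2 * pi)\<^sup>2) * Lpow 2 (\<lambda>x. trunc R f x - trunc R' f x)"
      by (intro bessel_plane Bochner_Integration.integrable_diff ti)
    also have "\<dots> \<le> ennreal ((2 * pi)\<^sup>2) * (2 * e R + 2 * e R')"
      unfolding e_def using Lpow2_triangle[of "trunc R f" f "trunc R' f"]
      by (intro mult_left_mono) (auto simp: Lpow2_minus_commute[of f])
    also have "\<dots> = ennreal ((2 * pi)\<^sup>2 * 2) * (e R + e R')"
    proof -
      have "2 * e R + 2 * e R' = ennreal 2 * (e R + e R')" by (simp add: distrib_left)
      moreover have "ennreal ((2 * pi)\<^sup>2 * 2) = ennreal ((2 * pi)\<^sup>2) * ennreal 2"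
        by (rule ennreal_mult) auto
      ultimately show ?thesis by (simp only: mult.assoc)
    qed
    finally show "Lpow 2 (\<lambda>x. fourier (trunc R f) x - fourier (trunc R' f) x)
      \<le> ennreal ((2 * pi)\<^sup>2 * 2) * (e R + e R')" .
  qed simp
  then have "\<exists>g. g \<in> L2 \<and> ((\<lambda>R. Lpow 2 (\<lambda>\<xi>. fourier (\<lambda>x. indicator (cball 0 R) x * f x) \<xi> - g \<xi>)) \<longlongrightarrow> 0) at_top"
    by (auto simp: trunc_def)
  from someI_ex[OF this] show "fourier_L2 f \<in> L2" "ft_limit f (fourier_L2 f)"
    unfolding fourier_L2_def trunc_def by auto
qed

lemma fourier_L2_measurable: "f \<in> L2 \<Longrightarrow> fourier_L2 f \<in> borel_measurable borel"
  using fourier_L2_spec(1) L2D by blast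

text \<open>Two limits of the same truncated transforms differ by a constant function of R that
  tends to 0. As the representative is arbitrary, every computation rule for
  \<open>fourier_L2\<close> is obtained by naming a limit and appealing to this lemma.\<close>

lemma fourier_L2_eqI:
  assumes f: "f \<in> L2" and g: "g \<in> L2" and lim: "ft_limit f g"
  shows "AE \<xi> in lborel. fourier_L2 f \<xi> = g \<xi>"
proof -
  have [measurable]: "f \<in> borel_measurable borel" "g \<in> borel_measurable borel" "fourier_L2 f \<in> borel_measurable borel"
    using L2D[OF f] L2D[OF g] fourier_L2_measurable[OF f] by auto
  have "((\<lambda>R::real. Lpow 2 (\<lambda>\<xi>. fourier_L2 f \<xi> - g \<xi>)) \<longlongrightarrow> 0) at_top"
  proof (rule tendsto_0_ennreal_bound)
    fix R
    show "Lpow 2 (\<lambda>\<xi>. fourier_L2 f \<xi> - g \<xi>) \<le>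
      ennreal 2 * Lpow 2 (\<lambda>\<xi>. fourier (trunc R f) \<xi> - fourier_L2 f \<xi>)
      + ennreal 2 * Lpow 2 (\<lambda>\<xi>. fourier (trunc R f) \<xi> - g \<xi>)"
      using Lpow2_triangle[of "fourier_L2 f" "fourier (trunc R f)" g]
      by (simp add: Lpow2_minus_commute[of "fourier_L2 f"])
  qed (use lim fourier_L2_spec[OF f] in auto)
  then have "Lpow 2 (\<lambda>\<xi>. fourier_L2 f \<xi> - g \<xi>) = 0"
    using tendsto_const_iff[of "at_top :: real filter"] by auto
  then have "AE \<xi> in lborel. fourier_L2 f \<xi> - g \<xi> = 0"
    by (intro Lpow2_eq_0_AE) auto
  then show ?thesis by simp
qed

lemma fourier_L2_eq_fourier:
  assumes f: "f \<in> L2" and i: "integrable lborel f"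
  shows "AE \<xi> in lborel. fourier_L2 f \<xi> = fourier f \<xi>"
proof (rule fourier_L2_eqI[OF f fourier_L2_mem[OF i f]])
  note ti = trunc_integrable[OF f]
  show "ft_limit f (fourier f)"
  proof (rule tendsto_0_ennreal_bound)
    fix R
    have "Lpow 2 (\<lambda>\<xi>. fourier (trunc R f) \<xi> - fourier f \<xi>) = Lpow 2 (fourier (\<lambda>x. trunc R f x - f x))"
      by (rule arg_cong[where f = "Lpow 2"]) (simp add: fun_eq_iff fourier_diff[OF ti i])
    also have "\<dots> \<le> ennreal ((2 * pi)\<^sup>2) * Lpow 2 (\<lambda>x. trunc R f x - f x)"
      by (intro bessel_plane Bochner_Integration.integrable_diff ti i)
    finally show "Lpow 2 (\<lambda>\<xi>. fourier (trunc R f) \<xi> - fourier f \<xi>) \<le>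
      ennreal ((2 * pi)\<^sup>2) * Lpow 2 (\<lambda>x. trunc R f x - f x) + ennreal 0 * 0" by simp
  qed (use trunc_tendsto[OF f] in auto)
qed

text \<open>Here the conclusion is equality of functions, not only almost everywhere: the transforms
  of the truncations are integrals and coincide pointwise, so the choice operator is applied to one
  and the same predicate.\<close>

lemma fourier_L2_cong:
  assumes f: "f \<in> L2" and g: "g \<in> L2" and "AE x in lborel. f x = g x"
  shows "fourier_L2 f = fourier_L2 g"
proof -
  have [measurable]: "f \<in> borel_measurable borel" "g \<in> borel_measurable borel"
    using L2D[OF f] L2D[OF g] by auto
  have "fourier (trunc R f) = fourier (trunc R g)" for R
    using assms(3) by (intro fourier_cong_AE trunc_measurable) (auto simp: trunc_def elim: eventually_mono)
  then show ?thesis unfolding fourier_L2_def trunc_def by simp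
qed

lemma fourier_L2_add:
  assumes f: "f \<in> L2" and g: "g \<in> L2"
  shows "AE \<xi> in lborel. fourier_L2 (\<lambda>x. f x + g x) \<xi> = fourier_L2 f \<xi> + fourier_L2 g \<xi>"
proof (rule fourier_L2_eqI)
  have [measurable]: "f \<in> borel_measurable borel" "g \<in> borel_measurable borel"
    "fourier_L2 f \<in> borel_measurable borel" "fourier_L2 g \<in> borel_measurable borel"
    using L2D[OF f] L2D[OF g] fourier_L2_measurable[OF f] fourier_L2_measurable[OF g] by auto
  show "ft_limit (\<lambda>x. f x + g x) (\<lambda>\<xi>. fourier_L2 f \<xi> + fourier_L2 g \<xi>)"
  proof (rule tendsto_0_ennreal_bound)
    fix R
    have t: "trunc R (\<lambda>x. f x + g x) = (\<lambda>x. trunc R f x + trunc R g x)"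
      by (simp add: trunc_def distrib_left)
    have "Lpow 2 (\<lambda>\<xi>. fourier (trunc R (\<lambda>x. f x + g x)) \<xi> - (fourier_L2 f \<xi> + fourier_L2 g \<xi>))
       = Lpow 2 (\<lambda>\<xi>. (fourier (trunc R f) \<xi> - fourier_L2 f \<xi>) + (fourier (trunc R g) \<xi> - fourier_L2 g \<xi>))"
      unfolding t by (simp add: fourier_add trunc_integrable f g algebra_simps)
    also have "\<dots> \<le> 2 * Lpow 2 (\<lambda>\<xi>. fourier (trunc R f) \<xi> - fourier_L2 f \<xi>)
       + 2 * Lpow 2 (\<lambda>\<xi>. fourier (trunc R g) \<xi> - fourier_L2 g \<xi>)"
      by (rule Lpow2_add) measurable
    finally show "Lpow 2 (\<lambda>\<xi>. fourier (trunc R (\<lambda>x. f x + g x)) \<xi> - (fourier_L2 f \<xi> + fourier_L2 g \<xi>))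
      \<le> ennreal 2 * Lpow 2 (\<lambda>\<xi>. fourier (trunc R f) \<xi> - fourier_L2 f \<xi>)
       + ennreal 2 * Lpow 2 (\<lambda>\<xi>. fourier (trunc R g) \<xi> - fourier_L2 g \<xi>)" by simp
  qed (use fourier_L2_spec f g in auto)
qed (use f g L2_add fourier_L2_spec in auto)

lemma fourier_L2_cmult:
  assumes f: "f \<in> L2"
  shows "AE \<xi> in lborel. fourier_L2 (\<lambda>x. c * f x) \<xi> = c * fourier_L2 f \<xi>"
proof (rule fourier_L2_eqI)
  have [measurable]: "f \<in> borel_measurable borel" "fourier_L2 f \<in> borel_measurable borel"
    using L2D[OF f] fourier_L2_measurable[OF f] by auto
  show "ft_limit (\<lambda>x. c * f x) (\<lambda>\<xi>. c * fourier_L2 f \<xi>)"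
  proof (rule tendsto_0_ennreal_bound)
    fix R
    have t: "trunc R (\<lambda>x. c * f x) = (\<lambda>x. c * trunc R f x)"
      by (simp add: trunc_def fun_eq_iff mult_ac)
    have "Lpow 2 (\<lambda>\<xi>. fourier (trunc R (\<lambda>x. c * f x)) \<xi> - c * fourier_L2 f \<xi>)
       = Lpow 2 (\<lambda>\<xi>. c * (fourier (trunc R f) \<xi> - fourier_L2 f \<xi>))"
      unfolding t by (simp add: fourier_cmult algebra_simps)
    also have "\<dots> = ennreal ((cmod c)\<^sup>2) * Lpow 2 (\<lambda>\<xi>. fourier (trunc R f) \<xi> - fourier_L2 f \<xi>)"
      by (rule Lpow_cmult) measurable
    finally show "Lpow 2 (\<lambda>\<xi>. fourier (trunc R (\<lambda>x. c * f x)) \<xi> - c * fourier_L2 f \<xi>)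
      \<le> ennreal ((cmod c)\<^sup>2) * Lpow 2 (\<lambda>\<xi>. fourier (trunc R f) \<xi> - fourier_L2 f \<xi>) + ennreal 0 * 0" by simp
  qed (use fourier_L2_spec f in auto)
qed (use f L2_cmult fourier_L2_spec in auto)

lemma fourier_L2_diff:
  assumes f: "f \<in> L2" and g: "g \<in> L2"
  shows "AE \<xi> in lborel. fourier_L2 (\<lambda>x. f x - g x) \<xi> = fourier_L2 f \<xi> - fourier_L2 g \<xi>"
proof -
  have "AE \<xi> in lborel. fourier_L2 (\<lambda>x. f x + (- 1) * g x) \<xi> = fourier_L2 f \<xi> + fourier_L2 (\<lambda>x. (- 1) * g x) \<xi>"
    by (intro fourier_L2_add f L2_cmult g)
  moreover have "AE \<xi> in lborel. fourier_L2 (\<lambda>x. (- 1) * g x) \<xi> = (- 1) * fourier_L2 g \<xi>"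
    by (rule fourier_L2_cmult[OF g])
  ultimately show ?thesis by eventually_elim simp
qed

text \<open>The triangle inequality for squares turns the constant (2 pi)^2 of the truncations into
  8 pi^2 in the limit, rounded up to 16 pi^2.\<close>

lemma fourier_L2_bound:
  assumes f: "f \<in> L2"
  shows "Lpow 2 (fourier_L2 f) \<le> ennreal (16 * pi\<^sup>2) * Lpow 2 f"
proof -
  have [measurable]: "f \<in> borel_measurable borel" "fourier_L2 f \<in> borel_measurable borel"
    using L2D[OF f] fourier_L2_measurable[OF f] by auto
  define d where "d = (\<lambda>R. Lpow 2 (\<lambda>\<xi>. fourier (trunc R f) \<xi> - fourier_L2 f \<xi>))"
  have "Lpow 2 (fourier_L2 f) \<le> 2 * d R + ennreal (16 * pi\<^sup>2) * Lpow 2 f" for R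
  proof -
    have "Lpow 2 (fourier_L2 f) \<le> 2 * d R + 2 * Lpow 2 (fourier (trunc R f))"
      unfolding d_def using Lpow2_triangle[of "fourier_L2 f" "fourier (trunc R f)" "\<lambda>_. 0"]
      by (simp add: Lpow2_minus_commute[of "fourier_L2 f"])
    also have "\<dots> \<le> 2 * d R + 2 * (ennreal ((2 * pi)\<^sup>2) * Lpow 2 f)"
    proof (intro add_left_mono mult_left_mono)
      have "Lpow 2 (fourier (trunc R f)) \<le> ennreal ((2 * pi)\<^sup>2) * Lpow 2 (trunc R f)"
        by (rule bessel_plane[OF trunc_integrable[OF f]])
      also have "\<dots> \<le> ennreal ((2 * pi)\<^sup>2) * Lpow 2 f"
        by (intro mult_left_mono Lpow_mono) (auto simp: trunc_def indicator_def)
      finally show "Lpow 2 (fourier (trunc R f)) \<le> ennreal ((2 * pi)\<^sup>2) * Lpow 2 f" .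
    qed auto
    also have "2 * (ennreal ((2 * pi)\<^sup>2) * Lpow 2 f) \<le> ennreal (16 * pi\<^sup>2) * Lpow 2 f"
    proof -
      have "2 * (ennreal ((2 * pi)\<^sup>2) * Lpow 2 f) = ennreal (2 * (2 * pi)\<^sup>2) * Lpow 2 f"
        by (subst ennreal_mult) (auto simp: mult.assoc)
      also have "\<dots> \<le> ennreal (16 * pi\<^sup>2) * Lpow 2 f"
        by (intro mult_right_mono ennreal_leI) (auto simp: power_mult_distrib)
      finally show ?thesis .
    qed
    finally show ?thesis by (auto simp: add_left_mono)
  qed
  moreover have "((\<lambda>R. 2 * d R + ennreal (16 * pi\<^sup>2) * Lpow 2 f) \<longlongrightarrow> 2 * 0 + ennreal (16 * pi\<^sup>2) * Lpow 2 f) at_top"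
    unfolding d_def by (intro tendsto_add ennreal_tendsto_cmult fourier_L2_spec f tendsto_const) auto
  ultimately show ?thesis
    using tendsto_lowerbound[of "\<lambda>R. 2 * d R + ennreal (16 * pi\<^sup>2) * Lpow 2 f" _ "at_top :: real filter"] by auto
qed

lemma fourier_L2_diff_bound:
  assumes f: "f \<in> L2" and g: "g \<in> L2"
  shows "Lpow 2 (\<lambda>\<xi>. fourier_L2 f \<xi> - fourier_L2 g \<xi>) \<le> ennreal (16 * pi\<^sup>2) * Lpow 2 (\<lambda>x. f x - g x)"
proof -
  have "Lpow 2 (\<lambda>\<xi>. fourier_L2 f \<xi> - fourier_L2 g \<xi>) = Lpow 2 (fourier_L2 (\<lambda>x. f x - g x))"
    using fourier_L2_diff[OF f g] by (intro Lpow_cong_AE) (auto elim: eventually_mono)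
  then show ?thesis using fourier_L2_bound[OF L2_diff[OF f g]] by simp
qed

section \<open>Translation, modulation and dilation\<close>

lemma Lpow_affine:
  assumes [measurable]: "f \<in> borel_measurable borel" and "c \<noteq> 0"
  shows "Lpow p f = ennreal (c\<^sup>2) * Lpow p (\<lambda>x. f (a + c *\<^sub>R x))"
  unfolding Lpow_def by (subst nn_integral_lborel_affine[OF _ assms(2), of _ a]) auto

lemma Lpow_translate:
  assumes [measurable]: "f \<in> borel_measurable borel"
  shows "Lpow p (\<lambda>x. f (a + x)) = Lpow p f"
  using Lpow_affine[of f 1 p a] by simp

lemma L2_affine:
  assumes f: "f \<in> L2" and c: "c \<noteq> 0"
  shows "(\<lambda>x. f (a + c *\<^sub>R x)) \<in> L2"
proof (rule L2I)
  have [measurable]: "f \<in> borel_measurable borel" using L2D[OF f] by simp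
  show "(\<lambda>x. f (a + c *\<^sub>R x)) \<in> borel_measurable borel" by measurable
  show "Lpow 2 (\<lambda>x. f (a + c *\<^sub>R x)) < \<infinity>"
    using Lpow_affine[of f c 2 a] c L2D[OF f] by (auto simp: ennreal_mult_less_top)
qed

lemma fourier_L2_modulate:
  assumes f: "f \<in> L2"
  shows "AE \<xi> in lborel. fourier_L2 (\<lambda>y. cis (- (y \<bullet> a)) * f y) \<xi> = fourier_L2 f (a + \<xi>)"
proof (rule fourier_L2_eqI)
  have [measurable]: "f \<in> borel_measurable borel" "fourier_L2 f \<in> borel_measurable borel"
    using L2D[OF f] fourier_L2_measurable[OF f] by auto
  show "(\<lambda>y. cis (- (y \<bullet> a)) * f y) \<in> L2"
    by (rule L2_mult[OF f, where C = 1]) auto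
  show "(\<lambda>\<xi>. fourier_L2 f (a + \<xi>)) \<in> L2"
    using L2_affine[OF fourier_L2_spec(1)[OF f], of 1] by simp
  have c: "cis (- (x \<bullet> (a + \<xi>))) = cis (- (x \<bullet> a)) * cis (- (x \<bullet> \<xi>))" for x \<xi>
    by (simp add: cis_mult inner_add_right)
  have "fourier (trunc R (\<lambda>y. cis (- (y \<bullet> a)) * f y)) \<xi> = fourier (trunc R f) (a + \<xi>)" for R \<xi>
    unfolding fourier_def trunc_def
    by (intro Bochner_Integration.integral_cong refl)
       (simp add: c mult_ac)
  then have "(\<lambda>R. Lpow 2 (\<lambda>\<xi>. fourier (trunc R (\<lambda>y. cis (- (y \<bullet> a)) * f y)) \<xi> - fourier_L2 f (a + \<xi>)))
    = (\<lambda>R. Lpow 2 (\<lambda>\<xi>. fourier (trunc R f) \<xi> - fourier_L2 f \<xi>))"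
    by (simp add: Lpow_translate[of "\<lambda>\<xi>. fourier (trunc _ f) \<xi> - fourier_L2 f \<xi>"])
  then show "ft_limit (\<lambda>y. cis (- (y \<bullet> a)) * f y) (\<lambda>\<xi>. fourier_L2 f (a + \<xi>))"
    using fourier_L2_spec(2)[OF f] by simp
qed

lemma fourier_scale:
  assumes [measurable]: "f \<in> borel_measurable borel" and c: "c \<noteq> 0"
  shows "fourier (\<lambda>x. f (c *\<^sub>R x)) \<xi> = complex_of_real (1 / c\<^sup>2) * fourier f ((1 / c) *\<^sub>R \<xi>)"
proof -
  have "fourier f ((1 / c) *\<^sub>R \<xi>) = (c\<^sup>2) *\<^sub>R fourier (\<lambda>x. f (c *\<^sub>R x)) \<xi>"
    unfolding fourier_def by (subst integral_lborel_affine[OF _ c, of _ 0]) (use c in auto)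
  then show ?thesis using c by (simp add: scaleR_conv_of_real)
qed

text \<open>Truncating x -> f (c x) at radius R is truncating f at radius |c| R, so the defining
  limit is that of f along dilated radii.\<close>

lemma fourier_L2_scale:
  assumes f: "f \<in> L2" and c: "c \<noteq> 0"
  shows "AE \<xi> in lborel. fourier_L2 (\<lambda>x. f (c *\<^sub>R x)) \<xi> = complex_of_real (1 / c\<^sup>2) * fourier_L2 f ((1 / c) *\<^sub>R \<xi>)"
proof (rule fourier_L2_eqI)
  have [measurable]: "f \<in> borel_measurable borel" "fourier_L2 f \<in> borel_measurable borel"
    using L2D[OF f] fourier_L2_measurable[OF f] by auto
  have c': "1 / c \<noteq> 0" using c by simp
  show "(\<lambda>x. f (c *\<^sub>R x)) \<in> L2" using L2_affine[OF f c, of 0] by simp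
  show "(\<lambda>\<xi>. complex_of_real (1 / c\<^sup>2) * fourier_L2 f ((1 / c) *\<^sub>R \<xi>)) \<in> L2"
    using L2_cmult[OF L2_affine[OF fourier_L2_spec(1)[OF f] c', of 0], of "complex_of_real (1 / c\<^sup>2)"]
    by (simp only: add_0_left)
  have t: "trunc R (\<lambda>x. f (c *\<^sub>R x)) = (\<lambda>x. trunc (\<bar>c\<bar> * R) f (c *\<^sub>R x))" for R
    using c by (auto simp: trunc_def indicator_def fun_eq_iff)
  define h where "h = (\<lambda>R \<xi>. fourier (trunc R f) \<xi> - fourier_L2 f \<xi>)"
  have [measurable]: "h R \<in> borel_measurable borel" for R unfolding h_def by measurable
  have "Lpow 2 (\<lambda>\<xi>. fourier (trunc R (\<lambda>x. f (c *\<^sub>R x))) \<xi> - complex_of_real (1 / c\<^sup>2) * fourier_L2 f ((1 / c) *\<^sub>R \<xi>))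
      \<le> ennreal ((1 / c\<^sup>2)\<^sup>2 * c\<^sup>2) * Lpow 2 (h (\<bar>c\<bar> * R)) + ennreal 0 * 0" for R
  proof -
    have "fourier (trunc R (\<lambda>x. f (c *\<^sub>R x))) \<xi> - complex_of_real (1 / c\<^sup>2) * fourier_L2 f ((1 / c) *\<^sub>R \<xi>)
      = complex_of_real (1 / c\<^sup>2) * h (\<bar>c\<bar> * R) ((1 / c) *\<^sub>R \<xi>)" for \<xi>
      unfolding t by (subst fourier_scale[OF _ c]) (auto simp: h_def right_diff_distrib)
    then have "Lpow 2 (\<lambda>\<xi>. fourier (trunc R (\<lambda>x. f (c *\<^sub>R x))) \<xi> - complex_of_real (1 / c\<^sup>2) * fourier_L2 f ((1 / c) *\<^sub>R \<xi>))
      = ennreal ((1 / c\<^sup>2)\<^sup>2) * Lpow 2 (\<lambda>\<xi>. h (\<bar>c\<bar> * R) ((1 / c) *\<^sub>R \<xi>))"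
      by (simp only:) (subst Lpow_cmult, measurable, simp only: norm_of_real power2_abs)
    also have "Lpow 2 (\<lambda>\<xi>. h (\<bar>c\<bar> * R) ((1 / c) *\<^sub>R \<xi>)) = ennreal (c\<^sup>2) * Lpow 2 (h (\<bar>c\<bar> * R))"
      using Lpow_affine[of "\<lambda>\<xi>. h (\<bar>c\<bar> * R) ((1 / c) *\<^sub>R \<xi>)" c 2 0] c by simp
    finally show ?thesis by (simp add: ennreal_mult mult.assoc)
  qed
  then show "ft_limit (\<lambda>x. f (c *\<^sub>R x)) (\<lambda>\<xi>. complex_of_real (1 / c\<^sup>2) * fourier_L2 f ((1 / c) *\<^sub>R \<xi>))"
  proof (rule tendsto_0_ennreal_bound)
    have "filterlim (\<lambda>R. \<bar>c\<bar> * R) at_top at_top"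
      using c by (intro filterlim_tendsto_pos_mult_at_top[OF tendsto_const] filterlim_ident) auto
    from filterlim_compose[OF fourier_L2_spec(2)[OF f] this]
    show "((\<lambda>R. Lpow 2 (h (\<bar>c\<bar> * R))) \<longlongrightarrow> 0) at_top"
      by (simp add: h_def)
  qed auto
qed

section \<open>Gaussian regularisation and Fourier inversion\<close>

definition gauss :: "real \<Rightarrow> plane \<Rightarrow> complex" where
  "gauss e x = complex_of_real (exp (- (e * (norm x)\<^sup>2 / 2)))"

lemma gauss_measurable [measurable]: "gauss e \<in> borel_measurable borel"
  unfolding gauss_def by measurable

lemma gauss_pl: "gauss e (pl a b)
    = complex_of_real (exp (- (e * a\<^sup>2 / 2))) * complex_of_real (exp (- (e * b\<^sup>2 / 2)))"
  by (simp add: gauss_def pl_norm_sq of_real_mult[symmetric] exp_add[symmetric] algebra_simps add_divide_distrib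
      del: of_real_mult)

lemma norm_gauss: "cmod (gauss e x) = exp (- (e * (norm x)\<^sup>2 / 2))"
  unfolding gauss_def by (simp only: norm_of_real) simp

lemma norm_gauss_le: "0 \<le> e \<Longrightarrow> cmod (gauss e x) \<le> 1"
  by (simp add: norm_gauss)

lemma integrable_gauss: "0 < e \<Longrightarrow> integrable lborel (gauss e)"
proof -
  assume e: "0 < e"
  have i: "integrable lborel (\<lambda>x. complex_of_real (exp (- (e * x\<^sup>2 / 2))))"
    using gauss_integrable[OF e] by simp
  show ?thesis
    using integrable_product_kernel(1)[OF sigma_finite_lborel sigma_finite_lborel i i, of "\<lambda>_ _. 1" 1]
    by (subst integrable_plane_iff) (auto simp: gauss_pl)
qed

lemma fourier_gauss:
  assumes e: "0 < e"
  shows "fourier (gauss e) \<xi> = complex_of_real (2 * pi / e) * gauss (1 / e) \<xi>"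
proof -
  let ?g = "\<lambda>x. complex_of_real (exp (- (e * x\<^sup>2 / 2)))"
  have "fourier (gauss e) \<xi> = (LINT a|lborel. (LINT b|lborel. gauss e (pl a b) * cis (- (pl a b \<bullet> \<xi>))))"
    unfolding fourier_def using integrable_gauss[OF e] by (intro integral_plane) auto
  also have "\<dots> = (LINT a|lborel. (LINT b|lborel. (?g a * cis (- (\<xi> $ 1 * a))) * (?g b * cis (- (\<xi> $ 2 * b)))))"
  proof (intro Bochner_Integration.integral_cong refl)
    fix a b
    have "cis (- (pl a b \<bullet> \<xi>)) = cis (- (\<xi> $ 1 * a)) * cis (- (\<xi> $ 2 * b))"
      by (simp add: pl_inner cis_mult mult.commute)
    then show "gauss e (pl a b) * cis (- (pl a b \<bullet> \<xi>)) = (?g a * cis (- (\<xi> $ 1 * a))) * (?g b * cis (- (\<xi> $ 2 * b)))"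
      by (simp only: gauss_pl mult_ac)
  qed
  also have "\<dots> = (LINT a|lborel. ?g a * cis (- (\<xi> $ 1 * a))) * (LINT b|lborel. ?g b * cis (- (\<xi> $ 2 * b)))"
    by simp
  also have "\<dots> = complex_of_real (sqrt (2 * pi / e) * exp (- ((\<xi> $ 1)\<^sup>2 / (2 * e))))
      * complex_of_real (sqrt (2 * pi / e) * exp (- ((\<xi> $ 2)\<^sup>2 / (2 * e))))"
    by (simp only: gauss_fourier[OF e])
  also have "\<dots> = complex_of_real ((sqrt (2 * pi / e) * sqrt (2 * pi / e)) *
      (exp (- ((\<xi> $ 1)\<^sup>2 / (2 * e))) * exp (- ((\<xi> $ 2)\<^sup>2 / (2 * e)))))"
    by (simp only: of_real_mult mult_ac)
  also have "sqrt (2 * pi / e) * sqrt (2 * pi / e) = 2 * pi / e"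
    using e by simp
  also have "exp (- ((\<xi> $ 1)\<^sup>2 / (2 * e))) * exp (- ((\<xi> $ 2)\<^sup>2 / (2 * e))) = exp (- (1 / e * (norm \<xi>)\<^sup>2 / 2))"
    by (simp add: exp_add[symmetric] pl_norm_sq add_divide_distrib mult.commute)
  finally show ?thesis by (simp add: gauss_def[of "1 / e"])
qed

section \<open>The heat kernel\<close>

text \<open>The Gaussian probability density on the plane with variance e in each
  coordinate.\<close>

definition heat :: "real \<Rightarrow> plane \<Rightarrow> complex" where
  "heat e x = complex_of_real (1 / (2 * pi * e)) * gauss (1 / e) x"

definition conv_heat :: "real \<Rightarrow> (plane \<Rightarrow> complex) \<Rightarrow> plane \<Rightarrow> complex" where
  "conv_heat e f x = (LINT y|lborel. f y * heat e (x - y))"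

lemma heat_measurable [measurable]: "heat e \<in> borel_measurable borel"
  unfolding heat_def by measurable

lemma conv_heat_measurable [measurable]:
  "f \<in> borel_measurable borel \<Longrightarrow> conv_heat e f \<in> borel_measurable borel"
proof -
  assume [measurable]: "f \<in> borel_measurable borel"
  have "(\<lambda>(x, y). f y * heat e (x - y)) \<in> borel_measurable (borel \<Otimes>\<^sub>M lborel)"
    by measurable
  then show ?thesis
    unfolding conv_heat_def by (rule lborel.borel_measurable_lebesgue_integral)
qed

lemma heat_bound: "0 < e \<Longrightarrow> cmod (heat e x) \<le> 1 / (2 * pi * e)"
  using norm_gauss_le[of "1 / e" x] by (simp add: heat_def norm_mult norm_divide divide_right_mono)

lemma fourier_gauss_heat: "0 < e \<Longrightarrow> fourier (gauss e) \<xi> = complex_of_real ((2 * pi)\<^sup>2) * heat e \<xi>"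
  by (simp add: fourier_gauss heat_def power2_eq_square)

lemma integrable_heat: "0 < e \<Longrightarrow> integrable lborel (heat e)"
  unfolding heat_def using integrable_gauss[of "1 / e"] by simp

lemma integral_heat: "0 < e \<Longrightarrow> (LINT x|lborel. heat e x) = 1"
  using fourier_gauss[of "1 / e" 0]
  by (simp add: heat_def fourier_def gauss_def)

lemma nn_integral_heat: "0 < e \<Longrightarrow> (\<integral>\<^sup>+ x. ennreal (cmod (heat e x)) \<partial>lborel) = 1"
proof -
  assume e: "0 < e"
  have h: "heat e x = complex_of_real (cmod (heat e x))" for x
    using e by (simp add: heat_def norm_mult norm_divide norm_gauss) (simp add: gauss_def)
  have "complex_of_real (LINT x|lborel. cmod (heat e x)) = 1"
    using integral_heat[OF e] h by (simp flip: integral_complex_of_real)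
  then have "(LINT x|lborel. cmod (heat e x)) = 1"
    by (metis of_real_eq_1_iff)
  then show ?thesis
    using nn_integral_eq_integral[of lborel "\<lambda>x. cmod (heat e x)"] integrable_heat[OF e] by auto
qed

text \<open>The inversion formula in regularised form. The Gaussian factor makes the double integral
  absolutely convergent, and Fubini sets its transform, a multiple of the heat kernel, against
  g.\<close>

lemma fourier_gauss_fourier:
  assumes e: "0 < e" and g: "integrable lborel g"
  shows "fourier (\<lambda>x. gauss e x * fourier g (- x)) \<xi> = complex_of_real ((2 * pi)\<^sup>2) * conv_heat e g \<xi>"
proof -
  have [measurable]: "g \<in> borel_measurable borel" using g by auto
  have c: "cis (x \<bullet> y) * cis (- (x \<bullet> \<xi>)) = cis (- (x \<bullet> (\<xi> - y)))" for x y
    by (simp add: cis_mult inner_diff_right)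
  have "fourier (\<lambda>x. gauss e x * fourier g (- x)) \<xi>
      = (LINT x|lborel. gauss e x * (LINT y|lborel. g y * cis (- (x \<bullet> (\<xi> - y)))))"
    unfolding fourier_def
    by (intro Bochner_Integration.integral_cong refl)
       (simp add: mult.assoc inner_commute flip: integral_mult_left_zero c)
  also have "\<dots> = (LINT y|lborel. g y * (LINT x|lborel. gauss e x * cis (- (x \<bullet> (\<xi> - y)))))"
    by (rule integrable_product_kernel(2)[OF sigma_finite_lborel sigma_finite_lborel integrable_gauss[OF e] g,
          where C = 1]) auto
  also have "\<dots> = (LINT y|lborel. g y * (complex_of_real ((2 * pi)\<^sup>2) * heat e (\<xi> - y)))"
    by (simp only: fourier_def[symmetric] fourier_gauss_heat[OF e])
  also have "\<dots> = complex_of_real ((2 * pi)\<^sup>2) * conv_heat e g \<xi>"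
    unfolding conv_heat_def by (subst integral_mult_right_zero[symmetric]) (simp add: mult_ac)
  finally show ?thesis .
qed

text \<open>The dependence on e moves from the kernel into the argument of f, so that limits in e
  can be taken with the fixed integrable majorant \<open>heat 1\<close>.\<close>

lemma conv_heat_rescale:
  assumes e: "0 < e" and [measurable]: "f \<in> borel_measurable borel"
  shows "conv_heat e f x = (LINT z|lborel. f (x - sqrt e *\<^sub>R z) * heat 1 z)"
proof -
  have "conv_heat e f x = \<bar>- sqrt e\<bar> ^ 2 *\<^sub>R (LINT z|lborel. f (x + (- sqrt e) *\<^sub>R z) * heat e (x - (x + (- sqrt e) *\<^sub>R z)))"
    unfolding conv_heat_def by (subst integral_lborel_affine[of _ "- sqrt e" x]) (use e in auto)
  also have "\<dots> = (LINT z|lborel. e *\<^sub>R (f (x - sqrt e *\<^sub>R z) * heat e (sqrt e *\<^sub>R z)))"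
    using e by simp
  also have "\<dots> = (LINT z|lborel. f (x - sqrt e *\<^sub>R z) * heat 1 z)"
  proof (intro Bochner_Integration.integral_cong refl)
    fix z :: plane
    have "e *\<^sub>R heat e (sqrt e *\<^sub>R z) = heat 1 z"
      using e by (simp add: heat_def gauss_def power_mult_distrib) (simp add: scaleR_conv_of_real)
    then show "e *\<^sub>R (f (x - sqrt e *\<^sub>R z) * heat e (sqrt e *\<^sub>R z)) = f (x - sqrt e *\<^sub>R z) * heat 1 z"
      by (simp only: mult_scaleR_right[symmetric])
  qed
  finally show ?thesis .
qed

section \<open>Weak convergence of the heat regularisation, tested on boxes\<close>

abbreviation box_ind :: "plane \<Rightarrow> plane \<Rightarrow> plane \<Rightarrow> complex" where
  "box_ind a b \<equiv> indicator (box a b)"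

lemma box_ind_of_real: "box_ind a b = (\<lambda>x. complex_of_real (indicat_real (box a b) x))"
  by (auto simp: fun_eq_iff indicator_def)

lemma emeasure_box_finite: "emeasure lborel (box a b :: plane set) < \<infinity>"
  by (rule emeasure_bounded_finite[OF bounded_box])

lemma conv_heat_box_le: "0 < e \<Longrightarrow> cmod (conv_heat e (box_ind a b) x) \<le> 1"
proof -
  assume e: "0 < e"
  have "ennreal (cmod (conv_heat e (box_ind a b) x))
      \<le> (\<integral>\<^sup>+ z. ennreal (cmod (box_ind a b (x - sqrt e *\<^sub>R z) * heat 1 z)) \<partial>lborel)"
    using e by (simp only: conv_heat_rescale borel_measurable_indicator borel_open open_box norm_integral_le_nn)
  also have "\<dots> \<le> (\<integral>\<^sup>+ z. ennreal (cmod (heat 1 z)) \<partial>lborel)"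
    by (intro nn_integral_mono ennreal_leI) (auto simp: norm_mult indicator_def)
  finally show ?thesis by (simp add: nn_integral_heat flip: ennreal_1)
qed

lemma conv_heat_box_tendsto:
  assumes "x \<notin> frontier (box a b)"
  shows "(\<lambda>n. conv_heat (1 / real (Suc n)) (box_ind a b) x) \<longlonglongrightarrow> box_ind a b x"
proof -
  have c: "isCont (box_ind a b) x"
    unfolding box_ind_of_real using assms isCont_indicator[of x "box a b"] by (intro isCont_of_real) simp
  have "(\<lambda>n. LINT z|lborel. box_ind a b (x - sqrt (1 / real (Suc n)) *\<^sub>R z) * heat 1 z)
      \<longlonglongrightarrow> (LINT z|lborel. box_ind a b x * heat 1 z)"
  proof (rule integral_dominated_convergence[where w = "\<lambda>z. cmod (heat 1 z)"])
    show "AE z in lborel. (\<lambda>n. box_ind a b (x - sqrt (1 / real (Suc n)) *\<^sub>R z) * heat 1 z) \<longlonglongrightarrow> box_ind a b x * heat 1 z"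
    proof (intro AE_I2 tendsto_mult tendsto_const isCont_tendsto_compose[OF c])
      fix z
      have "(\<lambda>n. x - sqrt (1 / real (Suc n)) *\<^sub>R z) \<longlonglongrightarrow> x - sqrt 0 *\<^sub>R z"
        using LIMSEQ_Suc[OF lim_1_over_n]
        by (intro tendsto_diff tendsto_scaleR tendsto_real_sqrt tendsto_const) simp_all
      then show "(\<lambda>n. x - sqrt (1 / real (Suc n)) *\<^sub>R z) \<longlonglongrightarrow> x" by simp
    qed
  qed (use integrable_heat[of 1] in \<open>auto simp: norm_mult indicator_def\<close>)
  moreover have "conv_heat (1 / real (Suc n)) (box_ind a b) x
      = (LINT z|lborel. box_ind a b (x - sqrt (1 / real (Suc n)) *\<^sub>R z) * heat 1 z)" for n
    by (intro conv_heat_rescale) auto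
  ultimately show ?thesis
    by (simp only: integral_mult_right_zero integral_heat zero_less_one mult_1_right)
qed

text \<open>The heat kernel is even, so smoothing moves from g to the indicator of the box, where
  its convergence is elementary.\<close>

lemma conv_heat_pairing:
  assumes e: "0 < e" and g: "integrable lborel g"
  shows "(LINT x|lborel. box_ind a b x * conv_heat e g x) = (LINT y|lborel. g y * conv_heat e (box_ind a b) y)"
proof -
  have b: "integrable lborel (box_ind a b)"
    unfolding box_ind_of_real complex_of_real_integrable_eq using emeasure_box_finite
    by (intro integrable_real_indicator) auto
  have s: "heat e (x - y) = heat e (y - x)" for x y
    by (simp add: heat_def gauss_def norm_minus_commute)
  have "(LINT x|lborel. box_ind a b x * (LINT y|lborel. g y * heat e (x - y)))
     = (LINT y|lborel. g y * (LINT x|lborel. box_ind a b x * heat e (x - y)))"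
    by (rule integrable_product_kernel(2)[OF sigma_finite_lborel sigma_finite_lborel b g,
          where C = "1 / (2 * pi * e)"]) (use heat_bound[OF e] in auto)
  then show ?thesis
    unfolding conv_heat_def by (simp only: s)
qed

lemma negligible_AE:
  fixes N :: "plane set"
  assumes "negligible N" "N \<in> sets borel"
  shows "AE x in lborel. x \<notin> N"
proof -
  have "N \<in> null_sets lborel"
    using assms by (auto simp: negligible_iff_null_sets null_sets_completion_iff)
  then show ?thesis by (rule AE_not_in)
qed

text \<open>Smoothed indicators are bounded by 1 and converge off the frontier of the box, a null
  set; |g| is the majorant.\<close>

lemma conv_heat_weak:
  assumes g: "integrable lborel g"
  shows "(\<lambda>n. LINT x|lborel. box_ind a b x * conv_heat (1 / real (Suc n)) g x)
     \<longlonglongrightarrow> (LINT x|lborel. box_ind a b x * g x)"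
proof -
  have [measurable]: "g \<in> borel_measurable borel" using g by auto
  have fr: "AE x in lborel. x \<notin> frontier (box a b)"
    by (rule negligible_AE) (auto intro: negligible_convex_frontier convex_box)
  have "(\<lambda>n. LINT y|lborel. g y * conv_heat (1 / real (Suc n)) (box_ind a b) y)
     \<longlonglongrightarrow> (LINT y|lborel. g y * box_ind a b y)"
  proof (rule integral_dominated_convergence[where w = "\<lambda>y. cmod (g y)"])
    show "AE y in lborel. (\<lambda>n. g y * conv_heat (1 / real (Suc n)) (box_ind a b) y) \<longlonglongrightarrow> g y * box_ind a b y"
      using fr by eventually_elim (intro tendsto_mult tendsto_const conv_heat_box_tendsto)
    show "AE y in lborel. cmod (g y * conv_heat (1 / real (Suc n)) (box_ind a b) y) \<le> cmod (g y)" for n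
      using conv_heat_box_le[of "1 / real (Suc n)"] by (intro AE_I2) (auto simp: norm_mult mult_left_le)
  qed (use g in auto)
  then show ?thesis
    by (subst conv_heat_pairing[OF _ g]) (auto simp: mult.commute)
qed

text \<open>The positive and the negative part of r are densities of measures that agree on boxes, a
  generator stable under intersection. Hence the densities agree almost everywhere, and a number
  with equal positive and negative part is 0.\<close>

lemma AE_zero_if_box_integrals_zero_real:
  fixes r :: "plane \<Rightarrow> real"
  assumes [measurable]: "r \<in> borel_measurable borel"
    and i: "\<And>a b. integrable lborel (\<lambda>x. indicator (box a b) x * r x)"
    and z: "\<And>a b. (LINT x|lborel. indicator (box a b) x * r x) = 0"
  shows "AE x in lborel. r x = 0"
proof -
  define p where "p = (\<lambda>x. max 0 (r x))"
  define m where "m = (\<lambda>x. max 0 (- r x))"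
  have [measurable]: "p \<in> borel_measurable borel" "m \<in> borel_measurable borel"
    by (auto simp: p_def m_def)
  have ip: "integrable lborel (\<lambda>x. indicator (box a b) x * p x)" for a b
    by (rule Bochner_Integration.integrable_bound[OF i[of a b]]) (auto simp: p_def indicator_def)
  have im: "integrable lborel (\<lambda>x. indicator (box a b) x * m x)" for a b
    by (rule Bochner_Integration.integrable_bound[OF i[of a b]]) (auto simp: m_def indicator_def)
  have pm: "(LINT x|lborel. indicator (box a b) x * p x) = (LINT x|lborel. indicator (box a b) x * m x)" for a b
  proof -
    have "(LINT x|lborel. indicator (box a b) x * p x) - (LINT x|lborel. indicator (box a b) x * m x)
       = (LINT x|lborel. indicator (box a b) x * r x)"
      by (subst Bochner_Integration.integral_diff[OF ip im, symmetric])
         (auto intro!: Bochner_Integration.integral_cong simp: p_def m_def indicator_def)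
    then show ?thesis using z by simp
  qed
  have em: "emeasure (density lborel (\<lambda>x. ennreal (p x))) (box a b) = ennreal (LINT x|lborel. indicator (box a b) x * p x)" for a b
    by (subst nn_integral_eq_integral[OF ip[of a b], symmetric])
       (auto simp: emeasure_density p_def intro!: nn_integral_cong split: split_indicator)
  have em': "emeasure (density lborel (\<lambda>x. ennreal (m x))) (box a b) = ennreal (LINT x|lborel. indicator (box a b) x * m x)" for a b
    by (subst nn_integral_eq_integral[OF im[of a b], symmetric])
       (auto simp: emeasure_density m_def intro!: nn_integral_cong split: split_indicator)
  have "density lborel (\<lambda>x. ennreal (p x)) = density lborel (\<lambda>x. ennreal (m x))"
  proof (rule measure_eqI_generator_eq)
    let ?E = "range (\<lambda>(a, b). box a b :: plane set)"
    show "Int_stable ?E" by (auto simp: Int_stable_def box_Int_box)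
    show "?E \<subseteq> Pow UNIV" "sets (density lborel (\<lambda>x. ennreal (p x))) = sigma_sets UNIV ?E"
      "sets (density lborel (\<lambda>x. ennreal (m x))) = sigma_sets UNIV ?E"
      by (simp_all add: borel_eq_box)
    let ?A = "\<lambda>n::nat. box (- (real n *\<^sub>R One)) (real n *\<^sub>R One) :: plane set"
    show "range ?A \<subseteq> ?E" "(\<Union>i. ?A i) = UNIV"
      unfolding UN_box_eq_UNIV by auto
    show "emeasure (density lborel (\<lambda>x. ennreal (p x))) (?A i) \<noteq> \<infinity>" for i
      by (simp only: em) simp
    show "emeasure (density lborel (\<lambda>x. ennreal (p x))) X = emeasure (density lborel (\<lambda>x. ennreal (m x))) X" if "X \<in> ?E" for X
      using that by (auto simp: em em' pm)
  qed
  then have "AE x in lborel. ennreal (p x) = ennreal (m x)"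
    by (intro sigma_finite_measure.density_unique[OF sigma_finite_lborel]) auto
  then show ?thesis
    by eventually_elim (auto simp: p_def m_def max_def split: if_splits)
qed

lemma AE_zero_if_box_integrals_zero:
  assumes f: "f \<in> L2" and z: "\<And>a b. (LINT x|lborel. box_ind a b x * f x) = 0"
  shows "AE x in lborel. f x = 0"
proof -
  have [measurable]: "f \<in> borel_measurable borel" using L2D[OF f] by simp
  have i: "integrable lborel (\<lambda>x. box_ind a b x * f x)" for a b
    by (rule L2_indicator_integrable[OF f _ emeasure_box_finite]) auto
  have r: "Re (box_ind a b x * f x) = indicator (box a b) x * Re (f x)"
    "Im (box_ind a b x * f x) = indicator (box a b) x * Im (f x)" for a b x
    by (auto simp: indicator_def)
  have "AE x in lborel. Re (f x) = 0"
    using integrable_Re[OF i] integral_Re[OF i] unfolding r z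
    by (intro AE_zero_if_box_integrals_zero_real) auto
  moreover have "AE x in lborel. Im (f x) = 0"
    using integrable_Im[OF i] integral_Im[OF i] unfolding r z
    by (intro AE_zero_if_box_integrals_zero_real) auto
  ultimately show ?thesis by eventually_elim (auto simp: complex_eq_iff)
qed

section \<open>Fourier inversion\<close>

lemma L2_pairing:
  assumes [measurable]: "f \<in> borel_measurable borel" "g \<in> borel_measurable borel"
  shows "(ennreal (cmod (LINT x|lborel. f x * g x)))\<^sup>2 \<le> Lpow 2 f * Lpow 2 g"
proof -
  have "ennreal (cmod (LINT x|lborel. f x * g x)) \<le> (\<integral>\<^sup>+ x. ennreal (cmod (f x)) * ennreal (cmod (g x)) \<partial>lborel)"
    by (rule order_trans[OF norm_integral_le_nn]) (simp add: norm_mult ennreal_mult)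
  then have "(ennreal (cmod (LINT x|lborel. f x * g x)))\<^sup>2
      \<le> (\<integral>\<^sup>+ x. ennreal (cmod (f x)) * ennreal (cmod (g x)) \<partial>lborel)\<^sup>2"
    by (rule power_mono) simp
  also have "\<dots> \<le> Lpow 2 f * Lpow 2 g"
    unfolding Lpow_def by (rule order_trans[OF Cauchy_Schwarz_nn_integral]) (auto simp: ennreal_power)
  finally show ?thesis .
qed

lemma gauss_mult_tendsto:
  assumes h: "h \<in> L2"
  shows "(\<lambda>n. Lpow 2 (\<lambda>x. gauss (1 / real (Suc n)) x * h x - h x)) \<longlonglongrightarrow> 0"
proof -
  have [measurable]: "h \<in> borel_measurable borel" using L2D[OF h] by simp
  have "(\<lambda>n. \<integral>\<^sup>+ x. ennreal ((cmod (gauss (1 / real (Suc n)) x * h x - h x))\<^sup>2) \<partial>lborel)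
     \<longlonglongrightarrow> (\<integral>\<^sup>+ x. 0 \<partial>(lborel :: plane measure))"
  proof (rule nn_integral_dominated_convergence[where w = "\<lambda>x. ennreal ((cmod (h x))\<^sup>2)"])
    show "(\<integral>\<^sup>+ x. ennreal ((cmod (h x))\<^sup>2) \<partial>lborel) < \<infinity>"
      using L2D[OF h] by (simp add: Lpow_def)
    fix n
    show "AE x in lborel. ennreal ((cmod (gauss (1 / real (Suc n)) x * h x - h x))\<^sup>2) \<le> ennreal ((cmod (h x))\<^sup>2)"
    proof (intro AE_I2 ennreal_leI power_mono)
      fix x :: plane
      define r where "r = exp (- (1 / real (Suc n) * (norm x)\<^sup>2 / 2))"
      have r: "0 < r" "r \<le> 1" by (auto simp: r_def)
      have "gauss (1 / real (Suc n)) x * h x - h x = complex_of_real (r - 1) * h x"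
        by (simp add: gauss_def r_def left_diff_distrib)
      then have "cmod (gauss (1 / real (Suc n)) x * h x - h x) = \<bar>r - 1\<bar> * cmod (h x)"
        by (simp only: norm_mult norm_of_real)
      also have "\<dots> \<le> 1 * cmod (h x)" using r by (intro mult_right_mono) auto
      finally show "cmod (gauss (1 / real (Suc n)) x * h x - h x) \<le> cmod (h x)" by simp
    qed simp
  next
    show "AE x in lborel. (\<lambda>n. ennreal ((cmod (gauss (1 / real (Suc n)) x * h x - h x))\<^sup>2)) \<longlonglongrightarrow> 0"
    proof (intro AE_I2)
      fix x :: plane
      have "(\<lambda>n. gauss (1 / real (Suc n)) x) \<longlonglongrightarrow> complex_of_real (exp (- (0 * (norm x)\<^sup>2 / 2)))"
        unfolding gauss_def using LIMSEQ_Suc[OF lim_1_over_n]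
        by (intro tendsto_of_real tendsto_exp tendsto_minus tendsto_divide tendsto_mult tendsto_const) simp_all
      then have "(\<lambda>n. ennreal ((cmod (gauss (1 / real (Suc n)) x * h x - h x))\<^sup>2))
         \<longlonglongrightarrow> ennreal ((cmod (complex_of_real (exp (- (0 * (norm x)\<^sup>2 / 2))) * h x - h x))\<^sup>2)"
        by (intro tendsto_ennrealI tendsto_power tendsto_norm tendsto_diff tendsto_mult tendsto_const)
      then show "(\<lambda>n. ennreal ((cmod (gauss (1 / real (Suc n)) x * h x - h x))\<^sup>2)) \<longlonglongrightarrow> 0" by simp
    qed
  qed auto
  then show ?thesis by (simp add: Lpow_def)
qed

lemma tendsto_0_ennreal_bound1:
  fixes f g :: "'a \<Rightarrow> ennreal"
  assumes "\<And>x. f x \<le> ennreal A * g x" "(g \<longlongrightarrow> 0) F"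
  shows "(f \<longlongrightarrow> 0) F"
  by (rule tendsto_0_ennreal_bound[of f A g 0 "\<lambda>_. 0"]) (use assms in auto)

text \<open>The regularisations \<open>conv_heat e g\<close> have two limits: in L2 they tend to a
  multiple of the transform of h, because Gaussian cutoffs converge in L2, and against boxes they
  tend to g. Comparing the limits identifies the transform of h.\<close>

lemma inversion_integrable:
  assumes g: "g \<in> L2" and i: "integrable lborel g"
  defines "h \<equiv> \<lambda>x. fourier g (- x)"
  shows "h \<in> L2"
    and "AE x in lborel. fourier_L2 h x = complex_of_real ((2 * pi)\<^sup>2) * g x"
    and "(\<lambda>n. Lpow 2 (\<lambda>x. conv_heat (1 / real (Suc n)) g x - g x)) \<longlonglongrightarrow> 0"
    and "0 < e \<Longrightarrow> conv_heat e g \<in> L2"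
    and "0 < e \<Longrightarrow> Lpow 2 (conv_heat e g) \<le> Lpow 2 g"
proof -
  have [measurable]: "g \<in> borel_measurable borel" using i by auto
  show h: "h \<in> L2"
    unfolding h_def using L2_affine[OF fourier_L2_mem[OF i g], of "-1" 0] by simp
  have [measurable]: "h \<in> borel_measurable borel" using L2D[OF h] by simp
  define c where "c = complex_of_real ((2 * pi)\<^sup>2)"
  have c0: "c \<noteq> 0" by (simp add: c_def)
  have hb: "cmod (h x) \<le> (LINT x|lborel. cmod (g x))" for x
    unfolding h_def by (rule fourier_bound[OF i])
  have gi: "integrable lborel (\<lambda>x. gauss e x * h x)" if "0 < e" for e
  proof (rule Bochner_Integration.integrable_bound)
    show "integrable lborel (\<lambda>x. complex_of_real (LINT x|lborel. cmod (g x)) * gauss e x)"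
      using integrable_gauss[OF that] by simp
    show "AE x in lborel. cmod (gauss e x * h x) \<le> cmod (complex_of_real (LINT x|lborel. cmod (g x)) * gauss e x)"
    proof (rule AE_I2)
      fix x
      have "cmod (gauss e x) * cmod (h x) \<le> cmod (gauss e x) * (LINT x|lborel. cmod (g x))"
        by (intro mult_left_mono hb) auto
      then show "cmod (gauss e x * h x) \<le> cmod (complex_of_real (LINT x|lborel. cmod (g x)) * gauss e x)"
        using order_trans[OF norm_ge_zero hb[of x]] by (simp add: norm_mult mult.commute)
    qed
  qed auto
  have gL: "(\<lambda>x. gauss e x * h x) \<in> L2" if "0 < e" for e
    using that norm_gauss_le[of e] by (intro L2_mult[OF h, where C = 1]) auto
  have ce: "conv_heat e g = (\<lambda>x. (1 / c) * fourier (\<lambda>x. gauss e x * h x) x)" if "0 < e" for e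
    unfolding h_def fourier_gauss_fourier[OF that i] c_def[symmetric] using c0 by simp
  show cL: "conv_heat e g \<in> L2" if "0 < e" for e
    unfolding ce[OF that] by (intro L2_cmult fourier_L2_mem gi gL that)
  show "Lpow 2 (conv_heat e g) \<le> Lpow 2 g" if "0 < e"
  proof -
    have "Lpow 2 (conv_heat e g) = ennreal ((cmod (1 / c))\<^sup>2) * Lpow 2 (fourier (\<lambda>x. gauss e x * h x))"
      unfolding ce[OF that] by (rule Lpow_cmult) measurable
    \<comment> \<open>Bessel is applied to the weighted h and once more to g; the two factors (2
      pi)^2 cancel exactly against |1 / c|^2.\<close>
    also have "\<dots> \<le> ennreal ((cmod (1 / c))\<^sup>2) * (ennreal ((2 * pi)\<^sup>2) * (ennreal ((2 * pi)\<^sup>2) * Lpow 2 g))"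
    proof (intro mult_left_mono order_trans[OF bessel_plane[OF gi[OF that]]])
      have "Lpow 2 (\<lambda>x. gauss e x * h x) \<le> Lpow 2 h"
        using norm_gauss_le[of e] that by (intro Lpow_mono) (auto simp: norm_mult mult_left_le_one_le)
      also have "\<dots> = Lpow 2 (fourier g)"
        unfolding h_def using Lpow_affine[of "fourier g" "-1" 2 0] by simp
      also have "\<dots> \<le> ennreal ((2 * pi)\<^sup>2) * Lpow 2 g" by (rule bessel_plane[OF i])
      finally show "Lpow 2 (\<lambda>x. gauss e x * h x) \<le> ennreal ((2 * pi)\<^sup>2) * Lpow 2 g" .
    qed auto
    also have "\<dots> = ennreal ((cmod (1 / c))\<^sup>2 * ((2 * pi)\<^sup>2 * (2 * pi)\<^sup>2)) * Lpow 2 g"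
      by (simp only: ennreal_mult zero_le_power2 mult_nonneg_nonneg mult.assoc)
    also have "(cmod (1 / c))\<^sup>2 * ((2 * pi)\<^sup>2 * (2 * pi)\<^sup>2) = 1"
      unfolding c_def norm_divide norm_of_real by (simp add: power2_eq_square)
    finally show ?thesis by simp
  qed
  define D where "D = (\<lambda>x. (1 / c) * fourier_L2 h x)"
  have D: "D \<in> L2" unfolding D_def by (intro L2_cmult fourier_L2_spec h)
  have [measurable]: "D \<in> borel_measurable borel" using L2D[OF D] by simp
  have lim: "(\<lambda>n. Lpow 2 (\<lambda>x. conv_heat (1 / real (Suc n)) g x - D x)) \<longlonglongrightarrow> 0"
  proof (rule tendsto_0_ennreal_bound1[OF _ gauss_mult_tendsto[OF h]])
    fix n
    define e where "e = 1 / real (Suc n)"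
    have e: "0 < e" by (simp add: e_def)
    have "Lpow 2 (\<lambda>x. conv_heat e g x - D x)
        = Lpow 2 (\<lambda>x. (1 / c) * (fourier (\<lambda>x. gauss e x * h x) x - fourier_L2 h x))"
      unfolding D_def ce[OF e] by (simp only: right_diff_distrib)
    also have "\<dots> = Lpow 2 (\<lambda>x. (1 / c) * (fourier_L2 (\<lambda>x. gauss e x * h x) x - fourier_L2 h x))"
      using fourier_L2_eq_fourier[OF gL[OF e] gi[OF e]]
      by (intro Lpow_cong_AE, eventually_elim) simp
    also have "\<dots> = ennreal ((cmod (1 / c))\<^sup>2) * Lpow 2 (\<lambda>x. fourier_L2 (\<lambda>x. gauss e x * h x) x - fourier_L2 h x)"
      using L2D[OF L2_diff[OF fourier_L2_spec(1)[OF gL[OF e]] fourier_L2_spec(1)[OF h]]]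
      by (intro Lpow_cmult) auto
    also have "\<dots> \<le> ennreal ((cmod (1 / c))\<^sup>2) * (ennreal (16 * pi\<^sup>2) * Lpow 2 (\<lambda>x. gauss e x * h x - h x))"
      by (intro mult_left_mono fourier_L2_diff_bound gL h e) auto
    also have "\<dots> = ennreal ((cmod (1 / c))\<^sup>2 * (16 * pi\<^sup>2)) * Lpow 2 (\<lambda>x. gauss e x * h x - h x)"
      by (subst ennreal_mult) (auto simp: mult.assoc)
    finally show "Lpow 2 (\<lambda>x. conv_heat (1 / real (Suc n)) g x - D x)
      \<le> ennreal ((cmod (1 / c))\<^sup>2 * (16 * pi\<^sup>2)) * Lpow 2 (\<lambda>x. gauss (1 / real (Suc n)) x * h x - h x)"
      unfolding e_def .
  qed
  \<comment> \<open>D is the L2 limit. Cauchy-Schwarz with the indicator of a box turns L2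
    convergence into convergence of box integrals, whose limits are already known for g.\<close>
  have "AE x in lborel. g x - D x = 0"
  proof (rule AE_zero_if_box_integrals_zero[OF L2_diff[OF g D]])
    fix a b
    define J where "J = (\<lambda>f. LINT x|lborel. box_ind a b x * f x)"
    have bi: "integrable lborel (\<lambda>x. box_ind a b x * f x)" if "f \<in> L2" for f
      by (rule L2_indicator_integrable[OF that _ emeasure_box_finite]) auto
    have B: "Lpow 2 (box_ind a b) = emeasure lborel (box a b)"
    proof -
      have "Lpow 2 (box_ind a b) = (\<integral>\<^sup>+ x. indicator (box a b) x \<partial>lborel)"
        unfolding Lpow_def by (intro nn_integral_cong) (simp split: split_indicator)
      then show ?thesis by simp
    qed
    have "(\<lambda>n. (ennreal (cmod (J (conv_heat (1 / real (Suc n)) g) - J D)))\<^sup>2) \<longlonglongrightarrow> 0"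
    proof (rule tendsto_0_ennreal_bound1[OF _ lim])
      fix n
      have "J (conv_heat (1 / real (Suc n)) g) - J D
         = (LINT x|lborel. box_ind a b x * (conv_heat (1 / real (Suc n)) g x - D x))"
        unfolding J_def right_diff_distrib
        by (rule Bochner_Integration.integral_diff[symmetric]) (intro bi cL D; simp)+
      then have "(ennreal (cmod (J (conv_heat (1 / real (Suc n)) g) - J D)))\<^sup>2
        \<le> emeasure lborel (box a b) * Lpow 2 (\<lambda>x. conv_heat (1 / real (Suc n)) g x - D x)"
        using L2_pairing[of "box_ind a b" "\<lambda>x. conv_heat (1 / real (Suc n)) g x - D x"] by (simp add: B)
      also have "emeasure lborel (box a b) = ennreal (measure lborel (box a b))"
        using emeasure_box_finite[of a b] by (simp add: emeasure_eq_ennreal_measure)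
      finally show "(ennreal (cmod (J (conv_heat (1 / real (Suc n)) g) - J D)))\<^sup>2
        \<le> ennreal (measure lborel (box a b)) * Lpow 2 (\<lambda>x. conv_heat (1 / real (Suc n)) g x - D x)" .
    qed
    then have "(\<lambda>n. ennreal ((cmod (J (conv_heat (1 / real (Suc n)) g) - J D))\<^sup>2)) \<longlonglongrightarrow> ennreal 0"
      by (simp add: ennreal_power)
    then have "(\<lambda>n. (cmod (J (conv_heat (1 / real (Suc n)) g) - J D))\<^sup>2) \<longlonglongrightarrow> 0"
      by (subst (asm) tendsto_ennreal_iff) auto
    then have "(\<lambda>n. sqrt ((cmod (J (conv_heat (1 / real (Suc n)) g) - J D))\<^sup>2)) \<longlonglongrightarrow> sqrt 0"
      by (rule tendsto_real_sqrt)
    then have "(\<lambda>n. J (conv_heat (1 / real (Suc n)) g)) \<longlonglongrightarrow> J D"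
      by (simp add: LIM_zero_iff[of _ "J D", symmetric] tendsto_norm_zero_iff)
    moreover have "(\<lambda>n. J (conv_heat (1 / real (Suc n)) g)) \<longlonglongrightarrow> J g"
      unfolding J_def by (rule conv_heat_weak[OF i])
    ultimately have "J g = J D" using LIMSEQ_unique by blast
    then show "(LINT x|lborel. box_ind a b x * (g x - D x)) = 0"
      unfolding J_def right_diff_distrib by (subst Bochner_Integration.integral_diff) (auto intro: bi g D)
  qed
  then have gD: "AE x in lborel. D x = g x" by eventually_elim simp
  then show "AE x in lborel. fourier_L2 h x = complex_of_real ((2 * pi)\<^sup>2) * g x"
    unfolding c_def[symmetric] D_def using c0 by (auto elim!: eventually_mono simp: field_simps)
  show "(\<lambda>n. Lpow 2 (\<lambda>x. conv_heat (1 / real (Suc n)) g x - g x)) \<longlonglongrightarrow> 0"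
  proof -
    have "Lpow 2 (\<lambda>x. conv_heat (1 / real (Suc n)) g x - D x) = Lpow 2 (\<lambda>x. conv_heat (1 / real (Suc n)) g x - g x)" for n
      using gD by (intro Lpow_cong_AE) (auto elim: eventually_mono)
    then show ?thesis using lim by simp
  qed
qed

lemma L2_reflect: "f \<in> L2 \<Longrightarrow> (\<lambda>x. f (- x)) \<in> L2"
  using L2_affine[of f "-1" 0] by simp

lemma Lpow_reflect: "f \<in> borel_measurable borel \<Longrightarrow> Lpow p (\<lambda>x. f (- x)) = Lpow p f"
  using Lpow_affine[of f "-1" p 0] by simp

lemma AE_affine_plane:
  fixes P :: "plane \<Rightarrow> bool"
  assumes P: "AE x in lborel. P x" and c: "c \<noteq> 0"
  shows "AE x in lborel. P (a + c *\<^sub>R x)"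
proof -
  from AE_E3[OF P] obtain N where N: "\<And>x. x \<in> space lborel - N \<Longrightarrow> P x" "N \<in> null_sets (lborel :: plane measure)"
    by blast
  have [measurable]: "N \<in> sets borel" using N(2) by (auto simp: null_sets_def)
  have "(\<integral>\<^sup>+ x. indicator N x \<partial>lborel) = 0" using N(2) by (simp add: null_sets_def)
  then have "(\<integral>\<^sup>+ x. indicator N (a + c *\<^sub>R x) \<partial>lborel) = (0::ennreal)"
    using c by (subst (asm) nn_integral_lborel_affine[OF _ c, of _ a]) auto
  then have "AE x in lborel. indicator N (a + c *\<^sub>R x) = (0::ennreal)"
    by (subst (asm) nn_integral_0_iff_AE) auto
  then show ?thesis
    by eventually_elim (use N(1) in \<open>auto simp: indicator_def split: if_splits\<close>)
qed

lemma AE_reflect_plane: "AE x in lborel. P (x :: plane) \<Longrightarrow> AE x in lborel. P (- x)"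
  using AE_affine_plane[of P "-1" 0] by simp

text \<open>The identity holds for the truncations of g, which are integrable and square integrable.
  Both sides are bounded on L2, so it passes to the limit.\<close>

lemma fourier_L2_inversion:
  assumes g: "g \<in> L2"
  shows "AE x in lborel. fourier_L2 (\<lambda>y. fourier_L2 g (- y)) x = complex_of_real ((2 * pi)\<^sup>2) * g x"
proof -
  define c where "c = complex_of_real ((2 * pi)\<^sup>2)"
  define L where "L = (\<lambda>g. fourier_L2 (\<lambda>y. fourier_L2 g (- y)))"
  have LL: "L f \<in> L2" if "f \<in> L2" for f
    unfolding L_def by (intro fourier_L2_spec L2_reflect that)
  have [measurable]: "g \<in> borel_measurable borel" "L g \<in> borel_measurable borel"
    using L2D[OF g] L2D[OF LL[OF g]] by auto
  have tr: "AE x in lborel. L (trunc R g) x = c * trunc R g x" for R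
  proof -
    note t = trunc_L2[OF g, of R] trunc_integrable[OF g, of R]
    have "fourier_L2 (\<lambda>y. fourier_L2 (trunc R g) (- y)) = fourier_L2 (\<lambda>y. fourier (trunc R g) (- y))"
      using AE_reflect_plane[OF fourier_L2_eq_fourier[OF t]]
      by (intro fourier_L2_cong L2_reflect fourier_L2_spec fourier_L2_mem t)
    then show ?thesis using inversion_integrable(2)[OF t] by (simp add: L_def c_def)
  qed
  have "((\<lambda>R::real. Lpow 2 (\<lambda>x. L g x - c * g x)) \<longlongrightarrow> 0) at_top"
  proof (rule tendsto_0_ennreal_bound1[OF _ trunc_tendsto[OF g]])
    fix R
    define T where "T = trunc R g"
    have T: "T \<in> L2" unfolding T_def by (rule trunc_L2[OF g])
    have [measurable]: "T \<in> borel_measurable borel" "L T \<in> borel_measurable borel"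
      using L2D[OF T] L2D[OF LL[OF T]] by auto
    have 1: "Lpow 2 (\<lambda>x. L T x - L g x) \<le> ennreal (16 * pi\<^sup>2) * (ennreal (16 * pi\<^sup>2) * Lpow 2 (\<lambda>x. T x - g x))"
    proof -
      have "Lpow 2 (\<lambda>x. L T x - L g x) \<le> ennreal (16 * pi\<^sup>2) * Lpow 2 (\<lambda>y. fourier_L2 T (- y) - fourier_L2 g (- y))"
        unfolding L_def by (intro fourier_L2_diff_bound L2_reflect fourier_L2_spec T g)
      also have "Lpow 2 (\<lambda>y. fourier_L2 T (- y) - fourier_L2 g (- y)) = Lpow 2 (\<lambda>y. fourier_L2 T y - fourier_L2 g y)"
        using fourier_L2_measurable[OF T] fourier_L2_measurable[OF g]
        by (intro Lpow_reflect[of "\<lambda>y. fourier_L2 T y - fourier_L2 g y"]) auto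
      also have "ennreal (16 * pi\<^sup>2) * \<dots> \<le> ennreal (16 * pi\<^sup>2) * (ennreal (16 * pi\<^sup>2) * Lpow 2 (\<lambda>x. T x - g x))"
        by (intro mult_left_mono fourier_L2_diff_bound T g) auto
      finally show ?thesis .
    qed
    have 2: "Lpow 2 (\<lambda>x. L T x - c * g x) = ennreal ((cmod c)\<^sup>2) * Lpow 2 (\<lambda>x. T x - g x)"
    proof -
      have "Lpow 2 (\<lambda>x. L T x - c * g x) = Lpow 2 (\<lambda>x. c * (T x - g x))"
        using tr[of R] unfolding T_def by (intro Lpow_cong_AE) (auto elim!: eventually_mono simp: right_diff_distrib)
      then show ?thesis by (subst (asm) Lpow_cmult) auto
    qed
    have "Lpow 2 (\<lambda>x. L g x - c * g x) \<le> 2 * Lpow 2 (\<lambda>x. L T x - L g x) + 2 * Lpow 2 (\<lambda>x. L T x - c * g x)"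
      using Lpow2_triangle[of "L g" "L T" "\<lambda>x. c * g x"] by (simp add: Lpow2_minus_commute[of "L g"])
    also have "\<dots> \<le> 2 * (ennreal (16 * pi\<^sup>2) * (ennreal (16 * pi\<^sup>2) * Lpow 2 (\<lambda>x. T x - g x)))
       + 2 * (ennreal ((cmod c)\<^sup>2) * Lpow 2 (\<lambda>x. T x - g x))"
      unfolding 2 by (intro add_mono mult_left_mono 1) auto
    also have "\<dots> = (2 * (ennreal (16 * pi\<^sup>2) * ennreal (16 * pi\<^sup>2)) + 2 * ennreal ((cmod c)\<^sup>2)) * Lpow 2 (\<lambda>x. T x - g x)"
      by (simp only: distrib_right mult.assoc)
    also have "2 * (ennreal (16 * pi\<^sup>2) * ennreal (16 * pi\<^sup>2)) + 2 * ennreal ((cmod c)\<^sup>2)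
       = ennreal (2 * (16 * pi\<^sup>2 * (16 * pi\<^sup>2)) + 2 * (cmod c)\<^sup>2)"
      by (simp only: ennreal_plus ennreal_mult zero_le_power2 mult_nonneg_nonneg zero_le_numeral ennreal_numeral)
    finally show "Lpow 2 (\<lambda>x. L g x - c * g x)
      \<le> ennreal (2 * (16 * pi\<^sup>2 * (16 * pi\<^sup>2)) + 2 * (cmod c)\<^sup>2) * Lpow 2 (\<lambda>x. trunc R g x - g x)"
      unfolding T_def .
  qed
  then have "Lpow 2 (\<lambda>x. L g x - c * g x) = 0"
    using tendsto_const_iff[of "at_top :: real filter"] by auto
  then have "AE x in lborel. L g x - c * g x = 0"
    by (intro Lpow2_eq_0_AE) auto
  then show ?thesis by (simp add: L_def c_def)
qed

lemma inv_fourier_L2_mem: "f \<in> L2 \<Longrightarrow> inv_fourier_L2 f \<in> L2"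
proof -
  assume f: "f \<in> L2"
  have "(\<lambda>x. (1 / complex_of_real ((2 * pi)\<^sup>2)) * fourier_L2 f (- x)) \<in> L2"
    by (intro L2_cmult L2_reflect fourier_L2_spec f)
  then show ?thesis by (simp add: inv_fourier_L2_def)
qed

lemma fourier_L2_inv_fourier_L2:
  assumes f: "f \<in> L2"
  shows "AE x in lborel. fourier_L2 (inv_fourier_L2 f) x = f x"
proof -
  define c where "c = complex_of_real ((2 * pi)\<^sup>2)"
  have c0: "c \<noteq> 0" by (simp add: c_def)
  have e: "inv_fourier_L2 f = (\<lambda>x. (1 / c) * fourier_L2 f (- x))"
    by (simp add: inv_fourier_L2_def c_def fun_eq_iff)
  have "AE x in lborel. fourier_L2 (inv_fourier_L2 f) x = (1 / c) * fourier_L2 (\<lambda>x. fourier_L2 f (- x)) x"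
    unfolding e by (intro fourier_L2_cmult L2_reflect fourier_L2_spec f)
  with fourier_L2_inversion[OF f] show ?thesis
    by eventually_elim (use c0 in \<open>simp add: c_def\<close>)
qed

lemma inv_fourier_L2_cong:
  "f \<in> L2 \<Longrightarrow> g \<in> L2 \<Longrightarrow> AE x in lborel. f x = g x \<Longrightarrow> inv_fourier_L2 f = inv_fourier_L2 g"
  by (simp add: inv_fourier_L2_def fourier_L2_cong[of f g])

text \<open>The constant 16 pi^2 / (2 pi)^4 = 1 / pi^2 is below 1.\<close>

lemma inv_fourier_L2_bound:
  assumes f: "f \<in> L2"
  shows "Lpow 2 (inv_fourier_L2 f) \<le> Lpow 2 f"
proof -
  note m = fourier_L2_measurable[OF f]
  have [measurable]: "(\<lambda>x. fourier_L2 f (- x)) \<in> borel_measurable borel"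
    using L2D[OF L2_reflect[OF fourier_L2_spec(1)[OF f]]] by simp
  have "Lpow 2 (inv_fourier_L2 f) = Lpow 2 (\<lambda>x. complex_of_real (1 / (2 * pi)\<^sup>2) * fourier_L2 f (- x))"
    by (simp add: inv_fourier_L2_def)
  also have "\<dots> = ennreal ((1 / (2 * pi)\<^sup>2)\<^sup>2) * Lpow 2 (\<lambda>x. fourier_L2 f (- x))"
    by (subst Lpow_cmult, measurable, simp only: norm_of_real power2_abs)
  also have "\<dots> \<le> ennreal ((1 / (2 * pi)\<^sup>2)\<^sup>2) * (ennreal (16 * pi\<^sup>2) * Lpow 2 f)"
    unfolding Lpow_reflect[OF m] by (intro mult_left_mono fourier_L2_bound f) auto
  also have "\<dots> = ennreal ((1 / (2 * pi)\<^sup>2)\<^sup>2 * (16 * pi\<^sup>2)) * Lpow 2 f"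
    by (subst ennreal_mult) (auto simp: mult.assoc)
  also have "\<dots> \<le> ennreal 1 * Lpow 2 f"
  proof (intro mult_right_mono ennreal_leI)
    have "1 \<le> pi\<^sup>2" using pi_ge_two by (intro one_le_power) auto
    then show "(1 / (2 * pi)\<^sup>2)\<^sup>2 * (16 * pi\<^sup>2) \<le> 1"
      by (simp add: field_simps power2_eq_square)
  qed auto
  finally show ?thesis by simp
qed

section \<open>Multipliers with bounded symbol and pointwise inverse transforms\<close>

lemma multiplier_props:
  assumes f: "f \<in> L2" and m: "m \<in> borel_measurable borel" and b: "\<And>x. cmod (m x) \<le> 1"
  shows "multiplier m f \<in> L2"
    and "AE \<xi> in lborel. fourier_L2 (multiplier m f) \<xi> = m \<xi> * fourier_L2 f \<xi>"
    and "Lpow 2 (multiplier m f) \<le> ennreal (16 * pi\<^sup>2) * Lpow 2 f"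
proof -
  have mf: "(\<lambda>\<xi>. m \<xi> * fourier_L2 f \<xi>) \<in> L2"
    by (rule L2_mult[OF fourier_L2_spec(1)[OF f] m b])
  show "multiplier m f \<in> L2" unfolding multiplier_def by (rule inv_fourier_L2_mem[OF mf])
  show "AE \<xi> in lborel. fourier_L2 (multiplier m f) \<xi> = m \<xi> * fourier_L2 f \<xi>"
    unfolding multiplier_def by (rule fourier_L2_inv_fourier_L2[OF mf])
  have "Lpow 2 (multiplier m f) \<le> Lpow 2 (\<lambda>\<xi>. m \<xi> * fourier_L2 f \<xi>)"
    unfolding multiplier_def by (rule inv_fourier_L2_bound[OF mf])
  also have "\<dots> \<le> Lpow 2 (fourier_L2 f)"
    using b by (intro Lpow_mono) (auto simp: norm_mult mult_left_le_one_le)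
  also have "\<dots> \<le> ennreal (16 * pi\<^sup>2) * Lpow 2 f" by (rule fourier_L2_bound[OF f])
  finally show "Lpow 2 (multiplier m f) \<le> ennreal (16 * pi\<^sup>2) * Lpow 2 f" .
qed

text \<open>The inverse transform as an actual integral, meaningful for integrable b; it is what
  gives pointwise access to \<open>inv_fourier_L2\<close>.\<close>

definition ift :: "(plane \<Rightarrow> complex) \<Rightarrow> plane \<Rightarrow> complex" where
  "ift b x = fourier b (- x) / complex_of_real ((2 * pi)\<^sup>2)"

lemma inv_fourier_L2_eq_ift:
  assumes "b \<in> L2" "integrable lborel b"
  shows "AE x in lborel. inv_fourier_L2 b x = ift b x"
  using AE_reflect_plane[OF fourier_L2_eq_fourier[OF assms]]
  by eventually_elim (simp add: inv_fourier_L2_def ift_def)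

section \<open>Oscillatory integrals with quadratic phase\<close>

text \<open>An equality of measures, so that s = c q^2 can be substituted in nonnegative and in
  complex integrals alike. The substitution rule treats bounded intervals and monotone convergence
  exhausts the half-line.\<close>

lemma square_substitution_measure:
  assumes c: "0 < c"
  shows "distr (density lborel (\<lambda>q. indicator {0..} q * ennreal (2 * c * q))) borel (\<lambda>q. c * q\<^sup>2)
     = density lborel (indicator {0::real..})" (is "?L = ?R")
proof (rule measure_eqI)
  fix A assume "A \<in> sets ?L"
  then have A [measurable]: "A \<in> sets borel" by simp
  \<comment> \<open>The cutoffs correspond under s = c q^2: q runs up to n while s runs up to c
    n^2.\<close>
  define F where "F = (\<lambda>(n::nat) q. ennreal (indicator A (c * q\<^sup>2) * (2 * c * q) * indicator {0..real n} q))"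
  define G where "G = (\<lambda>(n::nat) s. ennreal (indicator A s * indicator {0..c * (real n)\<^sup>2} s))"
  have FG: "(\<integral>\<^sup>+ s. G n s \<partial>lborel) = (\<integral>\<^sup>+ q. F n q \<partial>lborel)" for n
  proof -
    have der: "((\<lambda>q. c * q\<^sup>2) has_real_derivative 2 * c * x) (at x)" for x
      by (auto intro!: derivative_eq_intros)
    show ?thesis
      using nn_integral_substitution[of "\<lambda>q. c * q\<^sup>2" 0 "real n" "indicator A" "\<lambda>q. 2 * c * q"] c der
      by (auto simp: F_def G_def set_borel_measurable_def intro!: continuous_intros)
  qed
  have "F m q \<le> F n q" if "m \<le> n" for m n q
    using that c by (cases "q \<in> {0..real m}") (simp_all add: F_def indicator_def)
  then have incF: "incseq F" by (simp add: incseq_def le_fun_def)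
  have "G m s \<le> G n s" if "m \<le> n" for m n s
  proof (cases "s \<in> {0..c * (real m)\<^sup>2}")
    case True
    have "c * (real m)\<^sup>2 \<le> c * (real n)\<^sup>2" using that c by (intro mult_left_mono power_mono) auto
    with True have "s \<in> {0..c * (real n)\<^sup>2}" by simp
    with True show ?thesis by (simp add: G_def)
  qed (simp add: G_def)
  then have incG: "incseq G" by (simp add: incseq_def le_fun_def)
  have supF: "(SUP n. F n q) = indicator A (c * q\<^sup>2) * (indicator {0..} q * ennreal (2 * c * q))" for q
  proof (rule LIMSEQ_unique[OF LIMSEQ_SUP])
    show "incseq (\<lambda>n. F n q)" using incF by (auto simp: incseq_def le_fun_def)
    have "\<forall>\<^sub>F n in sequentially. F n q = indicator A (c * q\<^sup>2) * (indicator {0..} q * ennreal (2 * c * q))"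
      using eventually_ge_at_top[of "nat \<lceil>\<bar>q\<bar>\<rceil>"]
    proof eventually_elim
      case (elim n)
      then have "q \<le> real n" by linarith
      then show ?case by (auto simp: F_def indicator_def)
    qed
    then show "(\<lambda>n. F n q) \<longlonglongrightarrow> indicator A (c * q\<^sup>2) * (indicator {0..} q * ennreal (2 * c * q))"
      by (rule tendsto_eventually)
  qed
  have supG: "(SUP n. G n s) = indicator A s * indicator {0..} s" for s
  proof (rule LIMSEQ_unique[OF LIMSEQ_SUP])
    show "incseq (\<lambda>n. G n s)" using incG by (auto simp: incseq_def le_fun_def)
    have "\<forall>\<^sub>F n in sequentially. G n s = indicator A s * indicator {0..} s"
      using eventually_ge_at_top[of "nat \<lceil>\<bar>s\<bar> / c\<rceil> + 1"]
    proof eventually_elim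
      case (elim n)
      then have n: "\<bar>s\<bar> / c \<le> real n" "1 \<le> real n" by linarith+
      have "s \<le> c * real n" using n(1) c by (simp add: field_simps)
      also have "\<dots> \<le> c * (real n)\<^sup>2" using n(2) c by (intro mult_left_mono self_le_power) auto
      finally show ?case by (auto simp: G_def indicator_def)
    qed
    then show "(\<lambda>n. G n s) \<longlonglongrightarrow> indicator A s * indicator {0..} s"
      by (rule tendsto_eventually)
  qed
  have "emeasure ?L A = (\<integral>\<^sup>+ q. indicator A (c * q\<^sup>2) * (indicator {0..} q * ennreal (2 * c * q)) \<partial>lborel)"
  proof -
    have "emeasure ?L A = (\<integral>\<^sup>+ q. indicator A q \<partial>?L)" by simp
    also have "\<dots> = (\<integral>\<^sup>+ q. (indicator {0..} q * ennreal (2 * c * q)) * indicator A (c * q\<^sup>2) \<partial>lborel)"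
      by (subst nn_integral_distr) (auto simp: nn_integral_density)
    finally show ?thesis by (simp add: mult.commute)
  qed
  also have "\<dots> = (SUP n. \<integral>\<^sup>+ q. F n q \<partial>lborel)"
    unfolding supF[symmetric] using incF by (intro nn_integral_monotone_convergence_SUP) (auto simp: F_def)
  also have "\<dots> = (\<integral>\<^sup>+ s. indicator A s * indicator {0..} s \<partial>lborel)"
    unfolding FG[symmetric] supG[symmetric] using incG
    by (intro nn_integral_monotone_convergence_SUP[symmetric]) (auto simp: G_def)
  also have "\<dots> = emeasure ?R A"
    by (simp add: emeasure_density mult.commute)
  finally show "emeasure ?L A = emeasure ?R A" .
qed simp

text \<open>Substituting s = c q^2 makes the phase linear, and \<open>bessel_1d\<close> applies to
  \<open>g\<close>. The weight q in the amplitude is the Jacobian 2 c q up to a constant; the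
  constant pi / c is 2 pi times the remaining 1 / (2 c).\<close>

lemma bessel_square_phase:
  fixes F :: "real \<Rightarrow> complex"
  assumes c: "0 < c" and [measurable]: "F \<in> borel_measurable borel"
    and i: "integrable lborel (\<lambda>q. complex_of_real (indicator {0..} q * q) * F q)"
  shows "(\<integral>\<^sup>+ t. ennreal ((cmod (LINT q|lborel. complex_of_real (indicator {0..} q * q) * F q * cis (- (t * (c * q\<^sup>2)))))\<^sup>2) \<partial>lborel)
    \<le> ennreal (pi / c) * (\<integral>\<^sup>+ q. ennreal (indicator {0..} q * q * (cmod (F q))\<^sup>2) \<partial>lborel)"
proof -
  let ?M = "density lborel (\<lambda>q. indicator {0..} q * ennreal (2 * c * q))"
  define g where "g = (\<lambda>s. complex_of_real (indicator {0..} s / (2 * c)) * F (sqrt (s / c)))"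
  have [measurable]: "g \<in> borel_measurable borel" unfolding g_def by measurable
  have dens: "(\<lambda>q::real. indicator {0..} q * ennreal (2 * c * q)) = (\<lambda>q. ennreal (indicator {0..} q * (2 * c * q)))"
    using c by (auto simp: indicator_def fun_eq_iff)
  have push_int: "(LINT s|lborel. indicator {0..} s *\<^sub>R f s)
      = (LINT q|lborel. (indicator {0..} q * (2 * c * q)) *\<^sub>R f (c * q\<^sup>2))"
    if [measurable]: "f \<in> borel_measurable borel" for f :: "real \<Rightarrow> complex"
  proof -
    have "(LINT s|lborel. indicator {0..} s *\<^sub>R f s) = (LINT s|density lborel (indicator {0..}). f s)"
      using integral_density[of f lborel "indicator {0..}"] by (simp add: ennreal_indicator)
    also have "\<dots> = (LINT q|?M. f (c * q\<^sup>2))"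
      unfolding square_substitution_measure[OF c, symmetric] by (subst integral_distr) auto
    also have "\<dots> = (LINT q|lborel. (indicator {0..} q * (2 * c * q)) *\<^sub>R f (c * q\<^sup>2))"
      unfolding dens by (subst integral_density) (use c in \<open>auto simp: indicator_def\<close>)
    finally show ?thesis .
  qed
  have push_nn: "(\<integral>\<^sup>+ s. indicator {0..} s * f s \<partial>lborel)
      = (\<integral>\<^sup>+ q. indicator {0..} q * ennreal (2 * c * q) * f (c * q\<^sup>2) \<partial>lborel)"
    if [measurable]: "f \<in> borel_measurable borel" for f :: "real \<Rightarrow> ennreal"
  proof -
    have "(\<integral>\<^sup>+ s. indicator {0..} s * f s \<partial>lborel) = (\<integral>\<^sup>+ s. f s \<partial>density lborel (indicator {0..}))"
      by (subst nn_integral_density) auto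
    also have "\<dots> = (\<integral>\<^sup>+ q. f (c * q\<^sup>2) \<partial>?M)"
      unfolding square_substitution_measure[OF c, symmetric] by (subst nn_integral_distr) auto
    also have "\<dots> = (\<integral>\<^sup>+ q. indicator {0..} q * ennreal (2 * c * q) * f (c * q\<^sup>2) \<partial>lborel)"
      by (subst nn_integral_density) auto
    finally show ?thesis .
  qed
  have sq: "sqrt (c * q\<^sup>2 / c) = q" if "0 \<le> q" for q using c that by simp
  have gi: "integrable lborel g"
  proof (rule integrableI_bounded)
    have "(\<integral>\<^sup>+ s. ennreal (norm (g s)) \<partial>lborel)
       = (\<integral>\<^sup>+ s. indicator {0..} s * ennreal (1 / (2 * c) * cmod (F (sqrt (s / c)))) \<partial>lborel)"
      using c by (intro nn_integral_cong) (auto simp: g_def norm_mult norm_divide indicator_def)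
    also have "\<dots> = (\<integral>\<^sup>+ q. ennreal (norm (complex_of_real (indicator {0..} q * q) * F q)) \<partial>lborel)"
      by (subst push_nn) (use c in \<open>auto intro!: nn_integral_cong simp: sq norm_mult indicator_def ennreal_mult[symmetric]\<close>)
    also have "\<dots> < \<infinity>" using i by (simp add: integrable_iff_bounded)
    finally show "(\<integral>\<^sup>+ s. ennreal (norm (g s)) \<partial>lborel) < \<infinity>" .
  qed auto
  have "(LINT q|lborel. complex_of_real (indicator {0..} q * q) * F q * cis (- (t * (c * q\<^sup>2))))
      = (LINT s|lborel. g s * cis (- (t * s)))" for t
  proof -
    have "(LINT s|lborel. g s * cis (- (t * s)))
       = (LINT s|lborel. indicator {0..} s *\<^sub>R (complex_of_real (1 / (2 * c)) * F (sqrt (s / c)) * cis (- (t * s))))"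
      by (intro Bochner_Integration.integral_cong refl) (auto simp: g_def indicator_def)
    also have "\<dots> = (LINT q|lborel. complex_of_real (indicator {0..} q * q) * F q * cis (- (t * (c * q\<^sup>2))))"
      by (subst push_int)
         (use c in \<open>auto intro!: Bochner_Integration.integral_cong simp: sq indicator_def scaleR_conv_of_real\<close>)
    finally show ?thesis by simp
  qed
  then have "(\<integral>\<^sup>+ t. ennreal ((cmod (LINT q|lborel. complex_of_real (indicator {0..} q * q) * F q * cis (- (t * (c * q\<^sup>2)))))\<^sup>2) \<partial>lborel)
     \<le> ennreal (2 * pi) * (\<integral>\<^sup>+ s. ennreal ((cmod (g s))\<^sup>2) \<partial>lborel)"
    using bessel_1d[OF gi] by simp
  also have "(\<integral>\<^sup>+ s. ennreal ((cmod (g s))\<^sup>2) \<partial>lborel)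
     = (\<integral>\<^sup>+ s. indicator {0..} s * ennreal (1 / (4 * c\<^sup>2) * (cmod (F (sqrt (s / c))))\<^sup>2) \<partial>lborel)"
    using c by (intro nn_integral_cong) (auto simp: g_def norm_mult norm_divide indicator_def power_divide power_mult_distrib)
  also have "\<dots> = (\<integral>\<^sup>+ q. ennreal (1 / (2 * c)) * ennreal (indicator {0..} q * q * (cmod (F q))\<^sup>2) \<partial>lborel)"
    by (subst push_nn)
       (use c in \<open>auto intro!: nn_integral_cong simp: sq indicator_def ennreal_mult[symmetric] power2_eq_square\<close>)
  also have "\<dots> = ennreal (1 / (2 * c)) * (\<integral>\<^sup>+ q. ennreal (indicator {0..} q * q * (cmod (F q))\<^sup>2) \<partial>lborel)"
    by (rule nn_integral_cmult) measurable
  also have "ennreal (2 * pi) * (ennreal (1 / (2 * c)) * (\<integral>\<^sup>+ q. ennreal (indicator {0..} q * q * (cmod (F q))\<^sup>2) \<partial>lborel))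
      = ennreal (pi / c) * (\<integral>\<^sup>+ q. ennreal (indicator {0..} q * q * (cmod (F q))\<^sup>2) \<partial>lborel)"
    using c by (simp add: mult.assoc[symmetric] ennreal_mult[symmetric] del: ennreal_mult'' )
  finally show ?thesis .
qed

definition osc :: "(plane \<Rightarrow> complex) \<Rightarrow> real \<Rightarrow> complex" where
  "osc h t = (LINT q|lborel. h q * cis (- (2 * t * (norm q)\<^sup>2)))"

text \<open>An L2 bound in time for the quadratic phase, uniform over amplitudes living on S. The
  useful values of \<open>\<kappa>\<close> are proportional to the angle under which S is seen from
  the origin.\<close>

definition osc_bound :: "plane set \<Rightarrow> real \<Rightarrow> bool" where
  "osc_bound S \<kappa> \<longleftrightarrow> (\<forall>h. integrable lborel h \<longrightarrow> (\<forall>q. q \<notin> S \<longrightarrow> h q = 0) \<longrightarrow>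
     (\<integral>\<^sup>+ t. ennreal ((cmod (osc h t))\<^sup>2) \<partial>lborel) \<le> ennreal \<kappa> * Lpow 2 h)"

lemma osc_measurable [measurable]: "h \<in> borel_measurable borel \<Longrightarrow> osc h \<in> borel_measurable borel"
proof -
  assume [measurable]: "h \<in> borel_measurable borel"
  have "(\<lambda>(t, q). h q * cis (- (2 * t * (norm q)\<^sup>2))) \<in> borel_measurable (borel \<Otimes>\<^sub>M lborel)"
    by measurable
  then show ?thesis unfolding osc_def by (rule lborel.borel_measurable_lebesgue_integral)
qed

text \<open>In the coordinates \<open>q = (a, a y)\<close> the phase is \<open>2 t (1 + y\<^sup>2)
  a\<^sup>2\<close>: Cauchy--Schwarz in \<open>y\<close> with the weight \<open>1 / (1 + y\<^sup>2)\<close>,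
  and Bessel in \<open>t\<close> for each fixed \<open>y\<close>.\<close>

lemma osc_bound_sector:
  assumes Y [measurable]: "Y \<in> sets borel"
    and \<kappa>: "(\<integral>\<^sup>+ y. indicator Y y * ennreal (inverse (1 + y\<^sup>2)) \<partial>lborel) \<le> ennreal \<kappa>" "0 \<le> \<kappa>"
  shows "osc_bound {q. 0 < q $ 1 \<and> q $ 2 / q $ 1 \<in> Y} (\<kappa> * pi / 2)"
  unfolding osc_bound_def
proof (intro allI impI)
  fix h :: "plane \<Rightarrow> complex"
  assume h: "integrable lborel h" and z: "\<forall>q. q \<notin> {q. 0 < q $ 1 \<and> q $ 2 / q $ 1 \<in> Y} \<longrightarrow> h q = 0"
  have [measurable]: "h \<in> borel_measurable borel" using h by auto
  \<comment> \<open>The amplitude in the coordinates (a, a y), with the Jacobian a included.\<close>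
  define k where "k = (\<lambda>a y. complex_of_real (indicator {0..} a * a) * h (pl a (a * y)))"
  have kY: "k a y = 0" if "y \<notin> Y" for a y
    using z that by (auto simp: k_def indicator_def)
  have km [measurable]: "(\<lambda>(a, y). k a y) \<in> borel_measurable (lborel \<Otimes>\<^sub>M lborel)"
    unfolding k_def by measurable
  have slice_nn: "(\<integral>\<^sup>+ b. f (pl a b) \<partial>lborel) = (\<integral>\<^sup>+ y. ennreal (indicator {0..} a * a) * f (pl a (a * y)) \<partial>lborel)"
    if [measurable]: "f \<in> borel_measurable borel" and "\<And>q. q $ 1 \<le> 0 \<Longrightarrow> f q = 0" for f :: "plane \<Rightarrow> ennreal" and a
  proof (cases "0 < a")
    case True
    then show ?thesis
      by (subst nn_integral_real_affine[of _ a 0]) (auto simp: nn_integral_cmult)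
  qed (use that in \<open>auto simp: indicator_def\<close>)
  have slice_int: "(LINT b|lborel. h (pl a b) * cis (- (2 * t * (norm (pl a b))\<^sup>2)))
      = (LINT y|lborel. k a y * cis (- (t * (2 * (1 + y\<^sup>2) * a\<^sup>2))))" for a t
  proof (cases "0 < a")
    case True
    have "(LINT b|lborel. h (pl a b) * cis (- (2 * t * (norm (pl a b))\<^sup>2)))
      = \<bar>a\<bar> *\<^sub>R (LINT y|lborel. h (pl a (0 + a * y)) * cis (- (2 * t * (norm (pl a (0 + a * y)))\<^sup>2)))"
      using True by (intro lborel_integral_real_affine) auto
    also have "\<dots> = (LINT y|lborel. k a y * cis (- (t * (2 * (1 + y\<^sup>2) * a\<^sup>2))))"
      using True
      by (subst integral_scaleR_right[symmetric])
         (auto intro!: Bochner_Integration.integral_cong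
            simp: k_def indicator_def pl_norm_sq scaleR_conv_of_real power_mult_distrib algebra_simps)
    finally show ?thesis .
  next
    case False
    then have "h (pl a b) = 0" "k a b = 0" for b
      using z by (auto simp: k_def indicator_def)
    then show ?thesis by simp
  qed
  have ki: "integrable (lborel \<Otimes>\<^sub>M lborel) (\<lambda>(a, y). k a y)"
  proof (rule integrableI_bounded)
    have "(\<integral>\<^sup>+ z. ennreal (norm (case z of (a, y) \<Rightarrow> k a y)) \<partial>(lborel \<Otimes>\<^sub>M lborel))
       = (\<integral>\<^sup>+ a. \<integral>\<^sup>+ y. ennreal (norm (k a y)) \<partial>lborel \<partial>lborel)"
      by (subst lborel.nn_integral_fst[symmetric]) (auto simp: case_prod_beta')
    also have "\<dots> = (\<integral>\<^sup>+ a. \<integral>\<^sup>+ b. ennreal (norm (h (pl a b))) \<partial>lborel \<partial>lborel)"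
      by (subst slice_nn) (use z in \<open>auto intro!: nn_integral_cong simp: k_def norm_mult indicator_def ennreal_mult\<close>)
    also have "\<dots> < \<infinity>"
      using h by (subst nn_integral_plane[symmetric]) (auto simp: integrable_iff_bounded)
    finally show "(\<integral>\<^sup>+ z. ennreal (norm (case z of (a, y) \<Rightarrow> k a y)) \<partial>(lborel \<Otimes>\<^sub>M lborel)) < \<infinity>" .
  qed measurable
  define A where "A = (\<lambda>t y. LINT a|lborel. k a y * cis (- (t * (2 * (1 + y\<^sup>2) * a\<^sup>2))))"
  have Am [measurable]: "(\<lambda>(t, y). A t y) \<in> borel_measurable (borel \<Otimes>\<^sub>M borel)"
  proof -
    have "(\<lambda>(z, a). k a (snd z) * cis (- (fst z * (2 * (1 + (snd z)\<^sup>2) * a\<^sup>2)))) \<in> borel_measurable ((borel \<Otimes>\<^sub>M borel) \<Otimes>\<^sub>M lborel)"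
      unfolding k_def by measurable
    from lborel.borel_measurable_lebesgue_integral[OF this] show ?thesis
      by (simp add: A_def case_prod_beta')
  qed
  have Am' [measurable]: "(\<lambda>z. A (fst z) (snd z)) \<in> borel_measurable (borel \<Otimes>\<^sub>M borel)"
    using Am by (simp add: case_prod_beta')
  have [measurable]: "A t \<in> borel_measurable borel" "(\<lambda>t. A t y) \<in> borel_measurable borel" for t y
    using measurable_compose[OF measurable_Pair1' Am, of t] measurable_compose[OF measurable_Pair2' Am, of y]
    by auto
  have oA: "osc h t = (LINT y|lborel. A t y)" for t
  proof -
    have hi: "integrable lborel (\<lambda>q. h q * cis (- (2 * t * (norm q)\<^sup>2)))" using h by simp
    have kci: "integrable (lborel \<Otimes>\<^sub>M lborel) (\<lambda>(a, y). k a y * cis (- (t * (2 * (1 + y\<^sup>2) * a\<^sup>2))))"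
      using integrable_cis_mult(1)[OF ki, of "\<lambda>z. - (t * (2 * (1 + (snd z)\<^sup>2) * (fst z)\<^sup>2))"]
      by (simp add: case_prod_beta')
    have "osc h t = (LINT a|lborel. (LINT y|lborel. k a y * cis (- (t * (2 * (1 + y\<^sup>2) * a\<^sup>2)))))"
      unfolding osc_def integral_plane[OF hi] slice_int ..
    also have "\<dots> = (LINT y|lborel. A t y)"
      unfolding A_def using lborel_pair.Fubini_integral[OF kci] by simp
    finally show ?thesis .
  qed
  have AY: "A t y = 0" if "y \<notin> Y" for t y using kY[OF that] by (simp add: A_def)
  have pt: "ennreal ((cmod (osc h t))\<^sup>2) \<le> ennreal \<kappa> * (\<integral>\<^sup>+ y. ennreal ((1 + y\<^sup>2) * (cmod (A t y))\<^sup>2) \<partial>lborel)" for t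
  proof -
    have p: "0 < 1 + y\<^sup>2" for y :: real by (simp add: add_pos_nonneg)
    have "ennreal (cmod (osc h t)) \<le> (\<integral>\<^sup>+ y. ennreal (cmod (A t y)) \<partial>lborel)"
      unfolding oA by (rule norm_integral_le_nn)
    also have "\<dots> = (\<integral>\<^sup>+ y. (indicator Y y * ennreal (sqrt (inverse (1 + y\<^sup>2)))) * ennreal (sqrt (1 + y\<^sup>2) * cmod (A t y)) \<partial>lborel)"
    proof (intro nn_integral_cong)
      fix y
      have "sqrt (inverse (1 + y\<^sup>2)) * (sqrt (1 + y\<^sup>2) * cmod (A t y)) = cmod (A t y)"
        using p[of y] by (simp add: real_sqrt_inverse)
      then show "ennreal (cmod (A t y)) = (indicator Y y * ennreal (sqrt (inverse (1 + y\<^sup>2)))) * ennreal (sqrt (1 + y\<^sup>2) * cmod (A t y))"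
        using AY[of y t] by (auto simp: indicator_def ennreal_mult[symmetric])
    qed
    finally have "(ennreal (cmod (osc h t)))\<^sup>2 \<le>
        (\<integral>\<^sup>+ y. (indicator Y y * ennreal (sqrt (inverse (1 + y\<^sup>2)))) * ennreal (sqrt (1 + y\<^sup>2) * cmod (A t y)) \<partial>lborel)\<^sup>2"
      by (rule power_mono) simp
    also have "\<dots> \<le> (\<integral>\<^sup>+ y. (indicator Y y * ennreal (sqrt (inverse (1 + y\<^sup>2))))\<^sup>2 \<partial>lborel)
        * (\<integral>\<^sup>+ y. (ennreal (sqrt (1 + y\<^sup>2) * cmod (A t y)))\<^sup>2 \<partial>lborel)"
      by (rule Cauchy_Schwarz_nn_integral) measurable
    also have "\<dots> \<le> ennreal \<kappa> * (\<integral>\<^sup>+ y. ennreal ((1 + y\<^sup>2) * (cmod (A t y))\<^sup>2) \<partial>lborel)"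
    proof (rule mult_mono)
      have "(\<integral>\<^sup>+ y. (indicator Y y * ennreal (sqrt (inverse (1 + y\<^sup>2))))\<^sup>2 \<partial>lborel)
         = (\<integral>\<^sup>+ y. indicator Y y * ennreal (inverse (1 + y\<^sup>2)) \<partial>lborel)"
        using p by (intro nn_integral_cong) (auto simp: indicator_def ennreal_power less_imp_le)
      then show "(\<integral>\<^sup>+ y. (indicator Y y * ennreal (sqrt (inverse (1 + y\<^sup>2))))\<^sup>2 \<partial>lborel) \<le> ennreal \<kappa>"
        using \<kappa> by simp
      show "(\<integral>\<^sup>+ y. (ennreal (sqrt (1 + y\<^sup>2) * cmod (A t y)))\<^sup>2 \<partial>lborel)
        \<le> (\<integral>\<^sup>+ y. ennreal ((1 + y\<^sup>2) * (cmod (A t y))\<^sup>2) \<partial>lborel)"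
        using p by (intro nn_integral_mono) (auto simp: ennreal_power power_mult_distrib less_imp_le)
    qed auto
    finally show ?thesis by (simp add: ennreal_power)
  qed
  have "(\<integral>\<^sup>+ t. ennreal ((cmod (osc h t))\<^sup>2) \<partial>lborel)
      \<le> (\<integral>\<^sup>+ t. ennreal \<kappa> * (\<integral>\<^sup>+ y. ennreal ((1 + y\<^sup>2) * (cmod (A t y))\<^sup>2) \<partial>lborel) \<partial>lborel)"
    by (intro nn_integral_mono pt)
  also have "\<dots> = ennreal \<kappa> * (\<integral>\<^sup>+ t. \<integral>\<^sup>+ y. ennreal ((1 + y\<^sup>2) * (cmod (A t y))\<^sup>2) \<partial>lborel \<partial>lborel)"
    by (rule nn_integral_cmult) measurable
  finally have 1: "(\<integral>\<^sup>+ t. ennreal ((cmod (osc h t))\<^sup>2) \<partial>lborel)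
      \<le> ennreal \<kappa> * (\<integral>\<^sup>+ t. \<integral>\<^sup>+ y. ennreal ((1 + y\<^sup>2) * (cmod (A t y))\<^sup>2) \<partial>lborel \<partial>lborel)" .
  have "(\<integral>\<^sup>+ t. \<integral>\<^sup>+ y. ennreal ((1 + y\<^sup>2) * (cmod (A t y))\<^sup>2) \<partial>lborel \<partial>lborel)
      = (\<integral>\<^sup>+ y. \<integral>\<^sup>+ t. ennreal ((1 + y\<^sup>2) * (cmod (A t y))\<^sup>2) \<partial>lborel \<partial>lborel)"
    by (rule lborel_pair.Fubini'[symmetric]) measurable
  also have "\<dots> \<le> (\<integral>\<^sup>+ y. ennreal (pi / 2) * (\<integral>\<^sup>+ a. ennreal (indicator {0..} a * a * (cmod (h (pl a (a * y))))\<^sup>2) \<partial>lborel) \<partial>lborel)"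
  proof (rule nn_integral_mono_AE)
    have "AE y in lborel. integrable lborel (\<lambda>a. k a y)"
      using lborel_pair.AE_integrable_snd[OF ki] by simp
    then show "AE y in lborel. (\<integral>\<^sup>+ t. ennreal ((1 + y\<^sup>2) * (cmod (A t y))\<^sup>2) \<partial>lborel)
       \<le> ennreal (pi / 2) * (\<integral>\<^sup>+ a. ennreal (indicator {0..} a * a * (cmod (h (pl a (a * y))))\<^sup>2) \<partial>lborel)"
    proof eventually_elim
      fix y assume i: "integrable lborel (\<lambda>a. k a y)"
      have p: "0 < 1 + y\<^sup>2" by (simp add: add_pos_nonneg)
      have "(\<integral>\<^sup>+ t. ennreal ((1 + y\<^sup>2) * (cmod (A t y))\<^sup>2) \<partial>lborel) = ennreal (1 + y\<^sup>2) * (\<integral>\<^sup>+ t. ennreal ((cmod (A t y))\<^sup>2) \<partial>lborel)"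
        using p by (subst nn_integral_cmult[symmetric]) (auto simp: ennreal_mult)
      \<comment> \<open>Here c = 2 (1 + y^2): the constant pi / c of
        \<open>bessel_square_phase\<close> cancels the factor 1 + y^2 left by
        Cauchy-Schwarz.\<close>
      also have "\<dots> \<le> ennreal (1 + y\<^sup>2) * (ennreal (pi / (2 * (1 + y\<^sup>2))) *
          (\<integral>\<^sup>+ a. ennreal (indicator {0..} a * a * (cmod (h (pl a (a * y))))\<^sup>2) \<partial>lborel))"
        unfolding A_def k_def using p i
        by (intro mult_left_mono bessel_square_phase) (auto simp: k_def)
      also have "\<dots> = (ennreal (1 + y\<^sup>2) * ennreal (pi / (2 * (1 + y\<^sup>2)))) *
          (\<integral>\<^sup>+ a. ennreal (indicator {0..} a * a * (cmod (h (pl a (a * y))))\<^sup>2) \<partial>lborel)"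
        by (simp only: mult.assoc)
      also have "ennreal (1 + y\<^sup>2) * ennreal (pi / (2 * (1 + y\<^sup>2))) = ennreal (pi / 2)"
      proof -
        have "(1 + y\<^sup>2) * (pi / (2 * (1 + y\<^sup>2))) = pi / 2"
          using p by (simp add: field_simps)
        then show ?thesis using p by (subst ennreal_mult[symmetric]) auto
      qed
      finally show "(\<integral>\<^sup>+ t. ennreal ((1 + y\<^sup>2) * (cmod (A t y))\<^sup>2) \<partial>lborel)
       \<le> ennreal (pi / 2) * (\<integral>\<^sup>+ a. ennreal (indicator {0..} a * a * (cmod (h (pl a (a * y))))\<^sup>2) \<partial>lborel)" .
    qed
  qed
  also have "\<dots> = ennreal (pi / 2) * (\<integral>\<^sup>+ y. \<integral>\<^sup>+ a. ennreal (indicator {0..} a * a * (cmod (h (pl a (a * y))))\<^sup>2) \<partial>lborel \<partial>lborel)"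
    by (rule nn_integral_cmult) measurable
  also have "(\<integral>\<^sup>+ y. \<integral>\<^sup>+ a. ennreal (indicator {0..} a * a * (cmod (h (pl a (a * y))))\<^sup>2) \<partial>lborel \<partial>lborel)
     = (\<integral>\<^sup>+ a. \<integral>\<^sup>+ y. ennreal (indicator {0..} a * a * (cmod (h (pl a (a * y))))\<^sup>2) \<partial>lborel \<partial>lborel)"
    by (rule lborel_pair.Fubini') measurable
  also have "\<dots> = Lpow 2 h"
    unfolding Lpow_def
    by (subst nn_integral_plane, measurable, subst slice_nn)
       (use z in \<open>auto intro!: nn_integral_cong simp: indicator_def ennreal_mult\<close>)
  finally have "(\<integral>\<^sup>+ t. \<integral>\<^sup>+ y. ennreal ((1 + y\<^sup>2) * (cmod (A t y))\<^sup>2) \<partial>lborel \<partial>lborel) \<le> ennreal (pi / 2) * Lpow 2 h" .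
  then have "(\<integral>\<^sup>+ t. ennreal ((cmod (osc h t))\<^sup>2) \<partial>lborel) \<le> ennreal \<kappa> * (ennreal (pi / 2) * Lpow 2 h)"
    by (intro order_trans[OF 1] mult_left_mono) auto
  also have "\<dots> = ennreal (\<kappa> * pi / 2) * Lpow 2 h"
    using \<kappa>(2) by (simp add: mult.assoc[symmetric] ennreal_mult[symmetric])
  finally show "(\<integral>\<^sup>+ t. ennreal ((cmod (osc h t))\<^sup>2) \<partial>lborel) \<le> ennreal (\<kappa> * pi / 2) * Lpow 2 h" .
qed

section \<open>Operations on sets with an oscillation bound\<close>

lemma osc_bound_mono:
  assumes "osc_bound T \<kappa>" "S \<subseteq> T" "\<kappa> \<le> \<kappa>'"
  shows "osc_bound S \<kappa>'"
  unfolding osc_bound_def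
proof (intro allI impI)
  fix h :: "plane \<Rightarrow> complex"
  assume h: "integrable lborel h" and z: "\<forall>q. q \<notin> S \<longrightarrow> h q = 0"
  have "(\<integral>\<^sup>+ t. ennreal ((cmod (osc h t))\<^sup>2) \<partial>lborel) \<le> ennreal \<kappa> * Lpow 2 h"
    using assms(1,2) h z unfolding osc_bound_def by blast
  also have "\<dots> \<le> ennreal \<kappa>' * Lpow 2 h"
    using assms(3) by (intro mult_right_mono ennreal_leI) auto
  finally show "(\<integral>\<^sup>+ t. ennreal ((cmod (osc h t))\<^sup>2) \<partial>lborel) \<le> ennreal \<kappa>' * Lpow 2 h" .
qed

text \<open>The phase depends on the norm of q alone, so linear isometries preserve the bound.
  Reflection and the swap of coordinates reach all four quarter-planes.\<close>

lemma osc_bound_reflect: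
  assumes "osc_bound S \<kappa>"
  shows "osc_bound {q. - q \<in> S} \<kappa>"
  unfolding osc_bound_def
proof (intro allI impI)
  fix h :: "plane \<Rightarrow> complex"
  assume h: "integrable lborel h" and z: "\<forall>q. q \<notin> {q. - q \<in> S} \<longrightarrow> h q = 0"
  have [measurable]: "h \<in> borel_measurable borel" using h by auto
  have "integrable lborel (\<lambda>q. h (- q))" using integrable_lborel_reflect[OF h, of 0] by simp
  moreover have "\<forall>q. q \<notin> S \<longrightarrow> h (- q) = 0" using z by auto
  ultimately have "(\<integral>\<^sup>+ t. ennreal ((cmod (osc (\<lambda>q. h (- q)) t))\<^sup>2) \<partial>lborel) \<le> ennreal \<kappa> * Lpow 2 (\<lambda>q. h (- q))"
    using assms unfolding osc_bound_def by blast
  moreover have "osc (\<lambda>q. h (- q)) t = osc h t" for t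
    using integral_lborel_reflect[of "\<lambda>q. h q * cis (- (2 * t * (norm q)\<^sup>2))" 0] by (simp add: osc_def)
  ultimately show "(\<integral>\<^sup>+ t. ennreal ((cmod (osc h t))\<^sup>2) \<partial>lborel) \<le> ennreal \<kappa> * Lpow 2 h"
    by (simp add: Lpow_reflect)
qed

definition swap_plane :: "plane \<Rightarrow> plane" where
  "swap_plane q = pl (q $ 2) (q $ 1)"

lemma swap_plane_simps [simp]: "swap_plane q $ 1 = q $ 2" "swap_plane q $ 2 = q $ 1"
  "swap_plane (pl a b) = pl b a" "swap_plane (swap_plane q) = q" "norm (swap_plane q) = norm q"
proof -
  show "norm (swap_plane q) = norm q"
    by (rule power2_eq_imp_eq) (auto simp: pl_norm_sq swap_plane_def)
qed (auto simp: swap_plane_def)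

lemma swap_plane_measurable [measurable]: "swap_plane \<in> borel_measurable borel"
  unfolding swap_plane_def by measurable

lemma osc_bound_swap:
  assumes "osc_bound S \<kappa>"
  shows "osc_bound {q. swap_plane q \<in> S} \<kappa>"
  unfolding osc_bound_def
proof (intro allI impI)
  fix h :: "plane \<Rightarrow> complex"
  assume h: "integrable lborel h" and z: "\<forall>q. q \<notin> {q. swap_plane q \<in> S} \<longrightarrow> h q = 0"
  have [measurable]: "h \<in> borel_measurable borel" using h by auto
  have nn: "(\<integral>\<^sup>+ q. f (swap_plane q) \<partial>lborel) = (\<integral>\<^sup>+ q. f q \<partial>lborel)"
    if [measurable]: "f \<in> borel_measurable borel" for f :: "plane \<Rightarrow> ennreal"
  proof -
    have "(\<integral>\<^sup>+ q. f (swap_plane q) \<partial>lborel) = (\<integral>\<^sup>+ a. \<integral>\<^sup>+ b. f (swap_plane (pl a b)) \<partial>lborel \<partial>lborel)"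
      by (rule nn_integral_plane) measurable
    also have "\<dots> = (\<integral>\<^sup>+ q. f q \<partial>lborel)"
      by (subst nn_integral_plane_swap) simp_all
    finally show ?thesis .
  qed
  have si: "integrable lborel (\<lambda>q. f (swap_plane q))" if f: "integrable lborel f" for f :: "plane \<Rightarrow> complex"
  proof -
    have [measurable]: "f \<in> borel_measurable borel" using f by auto
    show ?thesis
      using f nn[of "\<lambda>q. ennreal (norm (f q))"] by (auto simp: integrable_iff_bounded)
  qed
  have oh: "osc (\<lambda>q. h (swap_plane q)) t = osc h t" for t
  proof -
    have hi: "integrable lborel (\<lambda>q. h q * cis (- (2 * t * (norm q)\<^sup>2)))" using h by simp
    from integral_plane[OF si[OF this]] integral_plane_swap[OF hi] show ?thesis
      by (simp add: osc_def)
  qed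
  have zs: "\<forall>q. q \<notin> S \<longrightarrow> h (swap_plane q) = 0" using z by auto
  have "(\<integral>\<^sup>+ t. ennreal ((cmod (osc g t))\<^sup>2) \<partial>lborel) \<le> ennreal \<kappa> * Lpow 2 g"
    if "integrable lborel g" "\<forall>q. q \<notin> S \<longrightarrow> g q = 0" for g
    using assms that unfolding osc_bound_def by blast
  from this[OF si[OF h] zs] oh
  have "(\<integral>\<^sup>+ t. ennreal ((cmod (osc h t))\<^sup>2) \<partial>lborel) \<le> ennreal \<kappa> * Lpow 2 (\<lambda>q. h (swap_plane q))"
    by simp
  also have "Lpow 2 (\<lambda>q. h (swap_plane q)) = Lpow 2 h"
    unfolding Lpow_def by (rule nn[of "\<lambda>q. ennreal ((cmod (h q))\<^sup>2)"]) measurable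
  finally show "(\<integral>\<^sup>+ t. ennreal ((cmod (osc h t))\<^sup>2) \<partial>lborel) \<le> ennreal \<kappa> * Lpow 2 h" .
qed

lemma osc_bound_union:
  assumes S: "osc_bound S \<kappa>1" and T: "osc_bound T \<kappa>2" and [measurable]: "S \<in> sets borel"
    and "0 \<le> \<kappa>1" "0 \<le> \<kappa>2"
  shows "osc_bound (S \<union> T) (2 * \<kappa>1 + 2 * \<kappa>2)"
  unfolding osc_bound_def
proof (intro allI impI)
  fix h :: "plane \<Rightarrow> complex"
  assume h: "integrable lborel h" and z: "\<forall>q. q \<notin> S \<union> T \<longrightarrow> h q = 0"
  have [measurable]: "h \<in> borel_measurable borel" using h by auto
  define h1 where "h1 = (\<lambda>q. indicator S q * h q)"
  define h2 where "h2 = (\<lambda>q. indicator (- S) q * h q)"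
  have [measurable]: "h1 \<in> borel_measurable borel" "h2 \<in> borel_measurable borel"
    unfolding h1_def h2_def by measurable
  have i: "integrable lborel h1" "integrable lborel h2"
    by (rule Bochner_Integration.integrable_bound[OF h]; simp add: h1_def h2_def indicator_def)+
  have L: "Lpow 2 h1 \<le> Lpow 2 h" "Lpow 2 h2 \<le> Lpow 2 h"
    by (intro Lpow_mono; simp add: h1_def h2_def indicator_def)+
  have hq: "h q = h1 q + h2 q" for q
    by (simp add: h1_def h2_def indicator_def)
  have o: "osc h t = osc h1 t + osc h2 t" for t
  proof -
    have "osc h t = (LINT q|lborel. h1 q * cis (- (2 * t * (norm q)\<^sup>2)) + h2 q * cis (- (2 * t * (norm q)\<^sup>2)))"
      unfolding osc_def by (simp only: hq distrib_right)
    also have "\<dots> = osc h1 t + osc h2 t"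
      unfolding osc_def using i by (intro Bochner_Integration.integral_add integrable_cis_mult) auto
    finally show ?thesis .
  qed
  have b1: "(\<integral>\<^sup>+ t. ennreal ((cmod (osc h1 t))\<^sup>2) \<partial>lborel) \<le> ennreal \<kappa>1 * Lpow 2 h"
    using S i(1) L(1) unfolding osc_bound_def
    by (intro order_trans[OF _ mult_left_mono[OF L(1)]]) (auto simp: h1_def indicator_def)
  have b2: "(\<integral>\<^sup>+ t. ennreal ((cmod (osc h2 t))\<^sup>2) \<partial>lborel) \<le> ennreal \<kappa>2 * Lpow 2 h"
  proof -
    have "\<forall>q. q \<notin> T \<longrightarrow> h2 q = 0" using z by (auto simp: h2_def indicator_def)
    with T i(2) have "(\<integral>\<^sup>+ t. ennreal ((cmod (osc h2 t))\<^sup>2) \<partial>lborel) \<le> ennreal \<kappa>2 * Lpow 2 h2"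
      unfolding osc_bound_def by blast
    also have "\<dots> \<le> ennreal \<kappa>2 * Lpow 2 h" using L(2) by (rule mult_left_mono) simp
    finally show ?thesis .
  qed
  have "(\<integral>\<^sup>+ t. ennreal ((cmod (osc h t))\<^sup>2) \<partial>lborel)
     \<le> (\<integral>\<^sup>+ t. (2 * ennreal ((cmod (osc h1 t))\<^sup>2) + 2 * ennreal ((cmod (osc h2 t))\<^sup>2)) \<partial>lborel)"
  proof (rule nn_integral_mono)
    fix t
    have "(cmod (osc h t))\<^sup>2 \<le> (cmod (osc h1 t) + cmod (osc h2 t))\<^sup>2"
      unfolding o by (intro power_mono norm_triangle_ineq) auto
    also have "\<dots> \<le> 2 * (cmod (osc h1 t))\<^sup>2 + 2 * (cmod (osc h2 t))\<^sup>2"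
      using sum_squares_bound[of "cmod (osc h1 t)" "cmod (osc h2 t)"] by (simp add: power2_sum)
    finally have "ennreal ((cmod (osc h t))\<^sup>2) \<le> ennreal (2 * (cmod (osc h1 t))\<^sup>2 + 2 * (cmod (osc h2 t))\<^sup>2)"
      by (rule ennreal_leI)
    then show "ennreal ((cmod (osc h t))\<^sup>2) \<le> 2 * ennreal ((cmod (osc h1 t))\<^sup>2) + 2 * ennreal ((cmod (osc h2 t))\<^sup>2)"
      by (simp add: ennreal_mult)
  qed
  also have "\<dots> = 2 * (\<integral>\<^sup>+ t. ennreal ((cmod (osc h1 t))\<^sup>2) \<partial>lborel) + 2 * (\<integral>\<^sup>+ t. ennreal ((cmod (osc h2 t))\<^sup>2) \<partial>lborel)"
    by (simp add: nn_integral_add nn_integral_cmult)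
  also have "\<dots> \<le> 2 * (ennreal \<kappa>1 * Lpow 2 h) + 2 * (ennreal \<kappa>2 * Lpow 2 h)"
    by (intro add_mono mult_left_mono b1 b2) auto
  also have "\<dots> = ennreal (2 * \<kappa>1 + 2 * \<kappa>2) * Lpow 2 h"
    using assms(4,5) by (simp add: ennreal_mult distrib_right mult.assoc)
  finally show "(\<integral>\<^sup>+ t. ennreal ((cmod (osc h t))\<^sup>2) \<partial>lborel) \<le> ennreal (2 * \<kappa>1 + 2 * \<kappa>2) * Lpow 2 h" .
qed

lemma nn_integral_inverse_1_plus_square:
  "(\<integral>\<^sup>+ y. ennreal (inverse (1 + y\<^sup>2)) \<partial>lborel) = ennreal pi"
proof -
  have e: "einterval (- \<infinity>) \<infinity> = UNIV" by (auto simp: einterval_def)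
  have "integrable lborel (\<lambda>y::real. inverse (1 + y\<^sup>2))"
    using integrable_inverse_1_plus_square by (simp add: set_integrable_def e)
  moreover have "(LINT y|lborel. inverse (1 + y\<^sup>2)) = pi"
    using LBINT_inverse_1_plus_square
    by (simp add: interval_lebesgue_integral_def set_lebesgue_integral_def e)
  ultimately show ?thesis
    by (subst nn_integral_eq_integral) (auto simp: add_nonneg_nonneg)
qed

text \<open>The right half-plane is the sector of all slopes, where the weight 1 / (1 + y^2) has
  integral pi; the left one is its reflection, and the line between them is null. This is the input
  for the Strichartz estimate.\<close>

lemma osc_bound_UNIV: "osc_bound UNIV (2 * pi\<^sup>2)"
proof -
  have p: "osc_bound {q. 0 < q $ 1 \<and> q $ 2 / q $ 1 \<in> UNIV} (pi * pi / 2)"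
    by (rule osc_bound_sector) (auto simp: nn_integral_inverse_1_plus_square)
  from osc_bound_union[OF p osc_bound_reflect[OF p]]
  have "osc_bound {q. q $ 1 \<noteq> 0} (2 * (pi * pi / 2) + 2 * (pi * pi / 2))"
    by (rule osc_bound_mono) auto
  then have b: "osc_bound {q. q $ 1 \<noteq> 0} (2 * pi\<^sup>2)"
    by (simp add: power2_eq_square)
  have ae: "AE q in lborel. (q :: plane) $ 1 \<noteq> 0"
  proof -
    have "AE q in lborel. q \<notin> {q :: plane. q $ 1 = 0}"
      by (rule negligible_AE) (auto intro: negligible_standard_hyperplane_cart)
    then show ?thesis by simp
  qed
  show ?thesis
    unfolding osc_bound_def
  proof (intro allI impI)
    fix h :: "plane \<Rightarrow> complex"
    assume h: "integrable lborel h"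
    have [measurable]: "h \<in> borel_measurable borel" using h by auto
    define h' where "h' = (\<lambda>q. indicator {q. q $ 1 \<noteq> 0} q * h q)"
    have [measurable]: "h' \<in> borel_measurable borel" unfolding h'_def by measurable
    have i: "integrable lborel h'"
      by (rule Bochner_Integration.integrable_bound[OF h]) (auto simp: h'_def indicator_def)
    have "osc h t = osc h' t" for t
      unfolding osc_def using ae by (intro integral_cong_AE) (auto elim!: eventually_mono simp: h'_def)
    moreover have "Lpow 2 h' \<le> Lpow 2 h" by (intro Lpow_mono) (auto simp: h'_def indicator_def)
    moreover have "(\<integral>\<^sup>+ t. ennreal ((cmod (osc h' t))\<^sup>2) \<partial>lborel) \<le> ennreal (2 * pi\<^sup>2) * Lpow 2 h'"
      using b i unfolding osc_bound_def by (auto simp: h'_def)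
    moreover have "ennreal (2 * pi\<^sup>2) * Lpow 2 h' \<le> ennreal (2 * pi\<^sup>2) * Lpow 2 h"
      using \<open>Lpow 2 h' \<le> Lpow 2 h\<close> by (rule mult_left_mono) simp
    ultimately show "(\<integral>\<^sup>+ t. ennreal ((cmod (osc h t))\<^sup>2) \<partial>lborel) \<le> ennreal (2 * pi\<^sup>2) * Lpow 2 h"
      by simp
  qed
qed

section \<open>Small sets far from the origin\<close>

text \<open>Around a point q0 close to the positive first axis the slope is a good angular
  coordinate. The slopes of S fill an interval of length at most 8 \<delta> / R, and pi / 2 < 2
  gives the factor 16.\<close>

lemma osc_bound_far_right:
  assumes R: "0 < R" and \<delta>: "0 < \<delta>" "8 * \<delta> \<le> R"
    and diam: "\<And>q q' i. q \<in> S \<Longrightarrow> q' \<in> S \<Longrightarrow> \<bar>q $ i - q' $ i\<bar> \<le> \<delta>"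
    and far: "\<And>q. q \<in> S \<Longrightarrow> R \<le> norm q"
    and q0: "q0 \<in> S" "\<bar>q0 $ 2\<bar> \<le> q0 $ 1"
  shows "osc_bound S (16 * \<delta> / R)"
proof -
  define m where "m = q0 $ 2 / q0 $ 1"
  define Y where "Y = {m - 4 * \<delta> / R..m + 4 * \<delta> / R}"
  \<comment> \<open>Since |q0| >= R and the first coordinate dominates, it is at least R / sqrt 2,
    and 7 / 10 is a rational number just below 1 / sqrt 2.\<close>
  have q01: "7 / 10 * R \<le> q0 $ 1"
  proof (rule ccontr)
    assume a: "\<not> ?thesis"
    have "R\<^sup>2 \<le> (norm q0)\<^sup>2" using far[OF q0(1)] R by (intro power_mono) auto
    also have "\<dots> = (q0 $ 1)\<^sup>2 + (q0 $ 2)\<^sup>2" by (rule pl_norm_sq)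
    also have "(q0 $ 2)\<^sup>2 \<le> (q0 $ 1)\<^sup>2" using q0(2) by (intro abs_le_square_iff[THEN iffD1]) auto
    also have "(q0 $ 1)\<^sup>2 \<le> (7 / 10 * R)\<^sup>2" using a q0(2) by (intro power_mono) auto
    finally have "R\<^sup>2 \<le> 98 / 100 * R\<^sup>2" by (simp add: power_mult_distrib power2_eq_square)
    then show False using R by simp
  qed
  have S: "0 < q $ 1 \<and> q $ 2 / q $ 1 \<in> Y" if q: "q \<in> S" for q
  proof -
    have d: "\<bar>q0 $ 1 - q $ 1\<bar> \<le> \<delta>" "\<bar>q $ 2 - q0 $ 2\<bar> \<le> \<delta>"
      using diam[OF q0(1) q, of 1] diam[OF q q0(1), of 2] by auto
    have q1: "R / 2 \<le> q $ 1" using d(1) q01 \<delta> R by linarith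
    have q2: "\<bar>q $ 2\<bar> \<le> 3 / 2 * q $ 1" using d q0(2) q1 \<delta> R by linarith
    have pos: "0 < q $ 1" "0 < q0 $ 1" using q1 q01 R by linarith+
    have "q $ 2 / q $ 1 - m = (q $ 2 * (q0 $ 1 - q $ 1) + q $ 1 * (q $ 2 - q0 $ 2)) / (q $ 1 * q0 $ 1)"
      using pos by (simp add: m_def field_simps)
    then have "\<bar>q $ 2 / q $ 1 - m\<bar> = \<bar>q $ 2 * (q0 $ 1 - q $ 1) + q $ 1 * (q $ 2 - q0 $ 2)\<bar> / (q $ 1 * q0 $ 1)"
      using pos by (simp add: abs_mult)
    also have "\<dots> \<le> (5 / 2 * q $ 1 * \<delta>) / (q $ 1 * q0 $ 1)"
    proof (rule divide_right_mono)
      have "\<bar>q $ 2 * (q0 $ 1 - q $ 1) + q $ 1 * (q $ 2 - q0 $ 2)\<bar>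
         \<le> \<bar>q $ 2\<bar> * \<bar>q0 $ 1 - q $ 1\<bar> + q $ 1 * \<bar>q $ 2 - q0 $ 2\<bar>"
        using pos by (intro order_trans[OF abs_triangle_ineq]) (simp add: abs_mult)
      also have "\<dots> \<le> (3 / 2 * q $ 1) * \<delta> + q $ 1 * \<delta>"
        using pos d q2 by (intro add_mono mult_mono) auto
      finally show "\<bar>q $ 2 * (q0 $ 1 - q $ 1) + q $ 1 * (q $ 2 - q0 $ 2)\<bar> \<le> 5 / 2 * q $ 1 * \<delta>"
        by (simp add: algebra_simps)
    qed (use pos in auto)
    also have "\<dots> = 5 / 2 * \<delta> / q0 $ 1" using pos by simp
    \<comment> \<open>The quotient (5 / 2) / (7 / 10) = 25 / 7 is below 4, the half-width used in
      \<open>Y\<close>.\<close>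
    also have "\<dots> \<le> 5 / 2 * \<delta> / (7 / 10 * R)" using pos \<delta> q01 R by (intro divide_left_mono) auto
    also have "\<dots> \<le> 4 * \<delta> / R" using \<delta> R by (simp add: field_simps)
    finally show ?thesis using pos unfolding Y_def by (simp add: abs_le_iff)
  qed
  have "(\<integral>\<^sup>+ y. indicator Y y * ennreal (inverse (1 + y\<^sup>2)) \<partial>lborel) \<le> (\<integral>\<^sup>+ y. indicator Y y \<partial>lborel)"
    by (intro nn_integral_mono) (auto simp: indicator_def inverse_le_1_iff)
  also have "\<dots> = ennreal (8 * \<delta> / R)"
    using \<delta> R by (simp add: Y_def)
  finally have "osc_bound {q. 0 < q $ 1 \<and> q $ 2 / q $ 1 \<in> Y} (8 * \<delta> / R * pi / 2)"
    using \<delta> R by (intro osc_bound_sector) (auto simp: Y_def)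
  then show ?thesis
  proof (rule osc_bound_mono)
    show "8 * \<delta> / R * pi / 2 \<le> 16 * \<delta> / R"
      using \<delta> R pi_less_4 by (simp add: field_simps)
  qed (use S in auto)
qed

text \<open>Some point of S lies in one of the four quarter-planes around the half-axes; a
  reflection or a swap moves that quarter-plane to the right.\<close>

lemma osc_bound_far:
  assumes R: "0 < R" and \<delta>: "0 < \<delta>" "8 * \<delta> \<le> R"
    and diam: "\<And>q q' i. q \<in> S \<Longrightarrow> q' \<in> S \<Longrightarrow> \<bar>q $ i - q' $ i\<bar> \<le> \<delta>"
    and far: "\<And>q. q \<in> S \<Longrightarrow> R \<le> norm q"
  shows "osc_bound S (16 * \<delta> / R)"
proof (cases "S = {}")
  case True
  have "osc_bound {q. 0 < q $ 1 \<and> q $ 2 / q $ 1 \<in> {}} (0 * pi / 2)"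
    by (rule osc_bound_sector) auto
  then show ?thesis by (rule osc_bound_mono) (use True \<delta> R in auto)
next
  case False
  then obtain q0 where q0: "q0 \<in> S" by auto
  have refl: "osc_bound S (16 * \<delta> / R)" if "osc_bound {q. - q \<in> S} (16 * \<delta> / R)" for S
    using osc_bound_reflect[OF that] by simp
  have swp: "osc_bound S (16 * \<delta> / R)" if "osc_bound {q. swap_plane q \<in> S} (16 * \<delta> / R)" for S
    using osc_bound_swap[OF that] by simp
  consider "\<bar>q0 $ 2\<bar> \<le> q0 $ 1" | "\<bar>q0 $ 2\<bar> \<le> - q0 $ 1" | "\<bar>q0 $ 1\<bar> \<le> q0 $ 2" | "\<bar>q0 $ 1\<bar> \<le> - q0 $ 2"
    by linarith
  then show ?thesis
  proof cases
    case 1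
    show ?thesis by (rule osc_bound_far_right[OF R \<delta> diam far q0 1])
  next
    case 2
    show ?thesis
    proof (rule refl, rule osc_bound_far_right[OF R \<delta>])
      show "- q0 \<in> {q. - q \<in> S}" "\<bar>(- q0) $ 2\<bar> \<le> (- q0) $ 1" using q0 2 by auto
      show "\<bar>q $ i - q' $ i\<bar> \<le> \<delta>" if "q \<in> {q. - q \<in> S}" "q' \<in> {q. - q \<in> S}" for q q' i
        using diam[of "- q'" "- q" i] that by simp
      show "R \<le> norm q" if "q \<in> {q. - q \<in> S}" for q
        using far[of "- q"] that by simp
    qed
  next
    case 3
    show ?thesis
    proof (rule swp, rule osc_bound_far_right[OF R \<delta>])
      show "swap_plane q0 \<in> {q. swap_plane q \<in> S}" "\<bar>swap_plane q0 $ 2\<bar> \<le> swap_plane q0 $ 1" using q0 3 by auto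
      show "\<bar>q $ i - q' $ i\<bar> \<le> \<delta>" if "q \<in> {q. swap_plane q \<in> S}" "q' \<in> {q. swap_plane q \<in> S}" for q q' i
        using diam[of "swap_plane q" "swap_plane q'" 1] diam[of "swap_plane q" "swap_plane q'" 2] that exhaust_2[of i]
        by auto
      show "R \<le> norm q" if "q \<in> {q. swap_plane q \<in> S}" for q
        using far[of "swap_plane q"] that by simp
    qed
  next
    case 4
    show ?thesis
    proof (rule swp, rule refl, rule osc_bound_far_right[OF R \<delta>])
      show "- swap_plane q0 \<in> {q. - q \<in> {q. swap_plane q \<in> S}}" "\<bar>(- swap_plane q0) $ 2\<bar> \<le> (- swap_plane q0) $ 1"
        using q0 4 by auto
      show "\<bar>q $ i - q' $ i\<bar> \<le> \<delta>"
        if "q \<in> {q. - q \<in> {q. swap_plane q \<in> S}}" "q' \<in> {q. - q \<in> {q. swap_plane q \<in> S}}" for q q' i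
        using diam[of "swap_plane (- q')" "swap_plane (- q)" 1] diam[of "swap_plane (- q')" "swap_plane (- q)" 2] that exhaust_2[of i]
        by auto
      show "R \<le> norm q" if "q \<in> {q. - q \<in> {q. swap_plane q \<in> S}}" for q
        using far[of "swap_plane (- q)"] that by simp
    qed
  qed
qed

section \<open>Bilinear estimate for the free evolution\<close>

text \<open>The free wave with frequency amplitude a, without the normalising 1 / (2 pi)^2. A
  time-independent amplitude means a free solution.\<close>

definition evol :: "(plane \<Rightarrow> complex) \<Rightarrow> real \<Rightarrow> plane \<Rightarrow> complex" where
  "evol a t x = (LINT \<eta>|lborel. a \<eta> * cis (x \<bullet> \<eta> - t * (norm \<eta>)\<^sup>2))"

lemma evol_measurable [measurable]:
  assumes [measurable]: "a \<in> borel_measurable borel"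
  shows "(\<lambda>(t, x). evol a t x) \<in> borel_measurable (borel \<Otimes>\<^sub>M borel)"
    and "(\<lambda>z. evol a (fst z) (snd z)) \<in> borel_measurable (borel \<Otimes>\<^sub>M borel)"
    and "evol a t \<in> borel_measurable borel"
proof -
  have "(\<lambda>(z, \<eta>). a \<eta> * cis (snd z \<bullet> \<eta> - fst z * (norm \<eta>)\<^sup>2)) \<in> borel_measurable ((borel \<Otimes>\<^sub>M borel) \<Otimes>\<^sub>M lborel)"
    by measurable
  from lborel.borel_measurable_lebesgue_integral[OF this]
  show 1: "(\<lambda>(t, x). evol a t x) \<in> borel_measurable (borel \<Otimes>\<^sub>M borel)"
    by (simp add: evol_def case_prod_beta')
  then show "(\<lambda>z. evol a (fst z) (snd z)) \<in> borel_measurable (borel \<Otimes>\<^sub>M borel)"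
    by (simp add: case_prod_beta')
  show "evol a t \<in> borel_measurable borel"
    using measurable_compose[OF measurable_Pair1' 1, of t] by simp
qed

lemma convolution_integrable:
  fixes a b :: "plane \<Rightarrow> complex"
  assumes a: "integrable lborel a" and b: "integrable lborel b"
  shows "integrable (lborel \<Otimes>\<^sub>M lborel) (\<lambda>(\<eta>, P). b \<eta> * a (P - \<eta>))"
proof (rule integrableI_bounded)
  have [measurable]: "a \<in> borel_measurable borel" "b \<in> borel_measurable borel" using a b by auto
  show "(\<lambda>(\<eta>, P). b \<eta> * a (P - \<eta>)) \<in> borel_measurable (lborel \<Otimes>\<^sub>M lborel)" by measurable
  have "(\<integral>\<^sup>+ z. ennreal (norm (case z of (\<eta>, P) \<Rightarrow> b \<eta> * a (P - \<eta>))) \<partial>(lborel \<Otimes>\<^sub>M lborel))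
     = (\<integral>\<^sup>+ \<eta>. \<integral>\<^sup>+ P. ennreal (cmod (b \<eta>)) * ennreal (cmod (a (P - \<eta>))) \<partial>lborel \<partial>lborel)"
    by (subst lborel.nn_integral_fst[symmetric]) (auto simp: case_prod_beta' norm_mult ennreal_mult)
  also have "\<dots> = (\<integral>\<^sup>+ \<eta>. ennreal (cmod (b \<eta>)) * (\<integral>\<^sup>+ P. ennreal (cmod (a P)) \<partial>lborel) \<partial>lborel)"
    using nn_integral_lborel_translate[of "\<lambda>P. ennreal (cmod (a P))" "- _"] by (simp add: nn_integral_cmult)
  also have "\<dots> = (\<integral>\<^sup>+ \<eta>. ennreal (cmod (b \<eta>)) \<partial>lborel) * (\<integral>\<^sup>+ P. ennreal (cmod (a P)) \<partial>lborel)"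
    by (simp add: nn_integral_multc)
  also have "\<dots> < \<infinity>" using a b by (auto simp: integrable_iff_bounded ennreal_mult_less_top)
  finally show "(\<integral>\<^sup>+ z. ennreal (norm (case z of (\<eta>, P) \<Rightarrow> b \<eta> * a (P - \<eta>))) \<partial>(lborel \<Otimes>\<^sub>M lborel)) < \<infinity>" .
qed

text \<open>The hypothesis is uniform in p because the outer integral runs over the sum P of the two
  frequencies, and for each P the amplitude of \<open>osc\<close> is supported on pairs with
  midpoint p = P / 2.\<close>

theorem bilinear_evol:
  assumes a: "integrable lborel a" and b: "integrable lborel b" and k0: "0 \<le> \<kappa>"
    and ob: "\<And>p. osc_bound {q. a (p - q) \<noteq> 0 \<and> b (p + q) \<noteq> 0} \<kappa>"
  shows "(\<integral>\<^sup>+ t. Lpow 2 (\<lambda>x. evol a t x * evol b t x) \<partial>lborel) \<le> ennreal ((2 * pi)\<^sup>2 * \<kappa>) * (Lpow 2 a * Lpow 2 b)"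
proof -
  have [measurable]: "a \<in> borel_measurable borel" "b \<in> borel_measurable borel" using a b by auto
  define h where "h = (\<lambda>P q. a ((1 / 2) *\<^sub>R P - q) * b ((1 / 2) *\<^sub>R P + q))"
  define c where "c = (\<lambda>t P. LINT \<eta>|lborel. b \<eta> * a (P - \<eta>) * cis (- (t * ((norm (P - \<eta>))\<^sup>2 + (norm \<eta>)\<^sup>2))))"
  note ci = convolution_integrable[OF a b]
  have ci': "integrable (lborel \<Otimes>\<^sub>M lborel) (\<lambda>(\<eta>, P). b \<eta> * a (P - \<eta>) * cis (- (t * ((norm (P - \<eta>))\<^sup>2 + (norm \<eta>)\<^sup>2))))" for t
    using integrable_cis_mult(1)[OF ci, of "\<lambda>z. - (t * ((norm (snd z - fst z))\<^sup>2 + (norm (fst z))\<^sup>2))"]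
    by (simp add: case_prod_beta')
  have cint: "integrable lborel (c t)" for t
    using lborel_pair.integrable_snd[OF ci'[of t]] by (simp add: c_def)
  have [measurable]: "(\<lambda>(t, P). c t P) \<in> borel_measurable (borel \<Otimes>\<^sub>M borel)"
  proof -
    have "(\<lambda>(z, \<eta>). b \<eta> * a (snd z - \<eta>) * cis (- (fst z * ((norm (snd z - \<eta>))\<^sup>2 + (norm \<eta>)\<^sup>2))))
        \<in> borel_measurable ((borel \<Otimes>\<^sub>M borel) \<Otimes>\<^sub>M lborel)"
      by measurable
    from lborel.borel_measurable_lebesgue_integral[OF this] show ?thesis
      by (simp add: c_def case_prod_beta')
  qed
  have prod: "evol a t x * evol b t x = fourier (c t) (- x)" for t x
  proof -
    have ci'': "integrable (lborel \<Otimes>\<^sub>M lborel) (\<lambda>(\<eta>, P). b \<eta> * a (P - \<eta>) * cis (- (t * ((norm (P - \<eta>))\<^sup>2 + (norm \<eta>)\<^sup>2))) * cis (x \<bullet> P))"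
      using integrable_cis_mult(1)[OF ci'[of t], of "\<lambda>z. x \<bullet> snd z"] by (simp add: case_prod_beta')
    have "evol a t x * evol b t x = (LINT \<eta>|lborel. b \<eta> * cis (x \<bullet> \<eta> - t * (norm \<eta>)\<^sup>2) * evol a t x)"
      by (simp add: evol_def[of b] mult.commute)
    also have "\<dots> = (LINT \<eta>|lborel. (LINT P|lborel. b \<eta> * a (P - \<eta>) * cis (- (t * ((norm (P - \<eta>))\<^sup>2 + (norm \<eta>)\<^sup>2))) * cis (x \<bullet> P)))"
    proof (intro Bochner_Integration.integral_cong refl)
      fix \<eta>
      have "evol a t x = (LINT P|lborel. a (P - \<eta>) * cis (x \<bullet> (P - \<eta>) - t * (norm (P - \<eta>))\<^sup>2))"
        unfolding evol_def
        using integral_lborel_translate[of "\<lambda>P. a P * cis (x \<bullet> P - t * (norm P)\<^sup>2)" "- \<eta>"] by simp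
      then have "b \<eta> * cis (x \<bullet> \<eta> - t * (norm \<eta>)\<^sup>2) * evol a t x
         = (LINT P|lborel. b \<eta> * cis (x \<bullet> \<eta> - t * (norm \<eta>)\<^sup>2) * (a (P - \<eta>) * cis (x \<bullet> (P - \<eta>) - t * (norm (P - \<eta>))\<^sup>2)))"
        by simp
      also have "\<dots> = (LINT P|lborel. b \<eta> * a (P - \<eta>) * cis (- (t * ((norm (P - \<eta>))\<^sup>2 + (norm \<eta>)\<^sup>2))) * cis (x \<bullet> P))"
      proof (intro Bochner_Integration.integral_cong refl)
        fix P
        have "cis (x \<bullet> \<eta> - t * (norm \<eta>)\<^sup>2) * cis (x \<bullet> (P - \<eta>) - t * (norm (P - \<eta>))\<^sup>2)
          = cis (- (t * ((norm (P - \<eta>))\<^sup>2 + (norm \<eta>)\<^sup>2))) * cis (x \<bullet> P)"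
          unfolding cis_mult by (rule arg_cong[where f = cis]) (simp add: inner_diff_right algebra_simps)
        then show "b \<eta> * cis (x \<bullet> \<eta> - t * (norm \<eta>)\<^sup>2) * (a (P - \<eta>) * cis (x \<bullet> (P - \<eta>) - t * (norm (P - \<eta>))\<^sup>2))
          = b \<eta> * a (P - \<eta>) * cis (- (t * ((norm (P - \<eta>))\<^sup>2 + (norm \<eta>)\<^sup>2))) * cis (x \<bullet> P)"
          by (simp only: mult_ac)
      qed
      finally show "b \<eta> * cis (x \<bullet> \<eta> - t * (norm \<eta>)\<^sup>2) * evol a t x
        = (LINT P|lborel. b \<eta> * a (P - \<eta>) * cis (- (t * ((norm (P - \<eta>))\<^sup>2 + (norm \<eta>)\<^sup>2))) * cis (x \<bullet> P))" .
    qed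
    also have "\<dots> = (LINT P|lborel. (LINT \<eta>|lborel. b \<eta> * a (P - \<eta>) * cis (- (t * ((norm (P - \<eta>))\<^sup>2 + (norm \<eta>)\<^sup>2))) * cis (x \<bullet> P)))"
      using lborel_pair.Fubini_integral[OF ci''] by simp
    also have "\<dots> = fourier (c t) (- x)"
      by (simp add: fourier_def c_def inner_commute)
    finally show ?thesis .
  qed
  \<comment> \<open>Centring at P / 2, the parallelogram law separates the phase: the term with
    |P|^2 does not depend on q and disappears from the modulus.\<close>
  have c_osc: "cmod (c t P) = cmod (osc (h P) t)" for t P
  proof -
    have "c t P = (LINT q|lborel. b ((1 / 2) *\<^sub>R P + q) * a (P - ((1 / 2) *\<^sub>R P + q)) *
        cis (- (t * ((norm (P - ((1 / 2) *\<^sub>R P + q)))\<^sup>2 + (norm ((1 / 2) *\<^sub>R P + q))\<^sup>2))))"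
      unfolding c_def by (rule integral_lborel_translate[symmetric]) measurable
    also have "\<dots> = (LINT q|lborel. h P q * cis (- (2 * t * (norm q)\<^sup>2)) * cis (- (t * (norm P)\<^sup>2 / 2)))"
    proof (intro Bochner_Integration.integral_cong refl)
      fix q
      have e: "P - ((1 / 2) *\<^sub>R P + q) = (1 / 2) *\<^sub>R P - q"
        by (simp add: algebra_simps scaleR_2[symmetric])
      have n: "(norm ((1 / 2) *\<^sub>R P - q))\<^sup>2 + (norm ((1 / 2) *\<^sub>R P + q))\<^sup>2 = (norm P)\<^sup>2 / 2 + 2 * (norm q)\<^sup>2"
        by (simp add: power2_norm_eq_inner inner_diff_left inner_diff_right inner_add_left inner_add_right inner_commute)
      show "b ((1 / 2) *\<^sub>R P + q) * a (P - ((1 / 2) *\<^sub>R P + q)) *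
        cis (- (t * ((norm (P - ((1 / 2) *\<^sub>R P + q)))\<^sup>2 + (norm ((1 / 2) *\<^sub>R P + q))\<^sup>2)))
        = h P q * cis (- (2 * t * (norm q)\<^sup>2)) * cis (- (t * (norm P)\<^sup>2 / 2))"
      proof -
        have "cis (- (2 * t * (norm q)\<^sup>2)) * cis (- (t * (norm P)\<^sup>2 / 2)) = cis (- (t * ((norm P)\<^sup>2 / 2 + 2 * (norm q)\<^sup>2)))"
          unfolding cis_mult by (rule arg_cong[where f = cis]) (simp add: algebra_simps)
        then show ?thesis
          unfolding e n h_def mult.assoc by (simp only: mult.left_commute)
      qed
    qed
    also have "\<dots> = osc (h P) t * cis (- (t * (norm P)\<^sup>2 / 2))"
      by (simp add: osc_def)
    finally show ?thesis by (simp add: norm_mult)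
  qed
  have hi: "AE P in lborel. integrable lborel (h P)"
  proof -
    have "AE P in lborel. integrable lborel (\<lambda>\<eta>. b \<eta> * a (P - \<eta>))"
      using lborel_pair.AE_integrable_snd[OF ci] by simp
    then show ?thesis
    proof eventually_elim
      fix P assume "integrable lborel (\<lambda>\<eta>. b \<eta> * a (P - \<eta>))"
      from integrable_lborel_translate[OF this, of "(1 / 2) *\<^sub>R P"]
      have "integrable lborel (\<lambda>q. b ((1 / 2) *\<^sub>R P + q) * a (P - ((1 / 2) *\<^sub>R P + q)))" .
      moreover have "P - ((1 / 2) *\<^sub>R P + q) = (1 / 2) *\<^sub>R P - q" for q
        by (simp add: algebra_simps scaleR_2[symmetric])
      ultimately show "integrable lborel (h P)" by (simp add: h_def mult.commute)
    qed
  qed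
  have "(\<integral>\<^sup>+ t. Lpow 2 (\<lambda>x. evol a t x * evol b t x) \<partial>lborel) \<le> (\<integral>\<^sup>+ t. ennreal ((2 * pi)\<^sup>2) * Lpow 2 (c t) \<partial>lborel)"
  proof (rule nn_integral_mono)
    fix t
    have [measurable]: "c t \<in> borel_measurable borel" using cint[of t] by auto
    have "Lpow 2 (\<lambda>x. evol a t x * evol b t x) = Lpow 2 (fourier (c t))"
      unfolding prod by (rule Lpow_reflect) measurable
    also have "\<dots> \<le> ennreal ((2 * pi)\<^sup>2) * Lpow 2 (c t)" by (rule bessel_plane[OF cint])
    finally show "Lpow 2 (\<lambda>x. evol a t x * evol b t x) \<le> ennreal ((2 * pi)\<^sup>2) * Lpow 2 (c t)" .
  qed
  also have "\<dots> = ennreal ((2 * pi)\<^sup>2) * (\<integral>\<^sup>+ t. \<integral>\<^sup>+ P. ennreal ((cmod (c t P))\<^sup>2) \<partial>lborel \<partial>lborel)"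
    unfolding Lpow_def by (rule nn_integral_cmult) measurable
  finally have 1: "(\<integral>\<^sup>+ t. Lpow 2 (\<lambda>x. evol a t x * evol b t x) \<partial>lborel)
     \<le> ennreal ((2 * pi)\<^sup>2) * (\<integral>\<^sup>+ t. \<integral>\<^sup>+ P. ennreal ((cmod (c t P))\<^sup>2) \<partial>lborel \<partial>lborel)" .
  have "(\<integral>\<^sup>+ t. \<integral>\<^sup>+ P. ennreal ((cmod (c t P))\<^sup>2) \<partial>lborel \<partial>lborel)
     = (\<integral>\<^sup>+ P. \<integral>\<^sup>+ t. ennreal ((cmod (c t P))\<^sup>2) \<partial>lborel \<partial>lborel)"
    by (rule pair_sigma_finite.Fubini'[symmetric]) (auto simp: pair_sigma_finite_def sigma_finite_lborel)
  also have "\<dots> \<le> (\<integral>\<^sup>+ P. ennreal \<kappa> * Lpow 2 (h P) \<partial>lborel)"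
  proof (rule nn_integral_mono_AE)
    show "AE P in lborel. (\<integral>\<^sup>+ t. ennreal ((cmod (c t P))\<^sup>2) \<partial>lborel) \<le> ennreal \<kappa> * Lpow 2 (h P)"
      using hi
    proof eventually_elim
      case (elim P)
      show ?case
        unfolding c_osc using ob[of "(1 / 2) *\<^sub>R P"] elim unfolding osc_bound_def
        by (auto simp: h_def)
    qed
  qed
  also have "\<dots> = ennreal \<kappa> * (\<integral>\<^sup>+ P. Lpow 2 (h P) \<partial>lborel)"
    unfolding Lpow_def h_def by (rule nn_integral_cmult) measurable
  \<comment> \<open>Passing from (P, q) to the two frequencies preserves Lebesgue measure: q is
    translated by P / 2, then P by the second frequency.\<close>
  also have "(\<integral>\<^sup>+ P. Lpow 2 (h P) \<partial>lborel) = Lpow 2 a * Lpow 2 b"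
  proof -
    have "(\<integral>\<^sup>+ P. Lpow 2 (h P) \<partial>lborel)
       = (\<integral>\<^sup>+ P. \<integral>\<^sup>+ \<eta>. ennreal ((cmod (a (P - \<eta>)))\<^sup>2) * ennreal ((cmod (b \<eta>))\<^sup>2) \<partial>lborel \<partial>lborel)"
    proof (intro nn_integral_cong)
      fix P :: plane
      have e: "P - ((1 / 2) *\<^sub>R P + q) = (1 / 2) *\<^sub>R P - q" for q
        by (simp add: algebra_simps scaleR_2[symmetric])
      have "Lpow 2 (h P) = (\<integral>\<^sup>+ q. ennreal ((cmod (a (P - ((1 / 2) *\<^sub>R P + q))))\<^sup>2) * ennreal ((cmod (b ((1 / 2) *\<^sub>R P + q)))\<^sup>2) \<partial>lborel)"
        unfolding Lpow_def h_def e by (simp add: norm_mult power_mult_distrib ennreal_mult)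
      also have "\<dots> = (\<integral>\<^sup>+ \<eta>. ennreal ((cmod (a (P - \<eta>)))\<^sup>2) * ennreal ((cmod (b \<eta>))\<^sup>2) \<partial>lborel)"
        by (rule nn_integral_lborel_translate) measurable
      finally show "Lpow 2 (h P) = (\<integral>\<^sup>+ \<eta>. ennreal ((cmod (a (P - \<eta>)))\<^sup>2) * ennreal ((cmod (b \<eta>))\<^sup>2) \<partial>lborel)" .
    qed
    also have "\<dots> = (\<integral>\<^sup>+ \<eta>. \<integral>\<^sup>+ P. ennreal ((cmod (a (P - \<eta>)))\<^sup>2) * ennreal ((cmod (b \<eta>))\<^sup>2) \<partial>lborel \<partial>lborel)"
      by (rule lborel_pair.Fubini') measurable
    also have "\<dots> = (\<integral>\<^sup>+ \<eta>. Lpow 2 a * ennreal ((cmod (b \<eta>))\<^sup>2) \<partial>lborel)"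
      using nn_integral_lborel_translate[of "\<lambda>P. ennreal ((cmod (a P))\<^sup>2)" "- _"]
      by (simp add: nn_integral_multc Lpow_def)
    also have "\<dots> = Lpow 2 a * Lpow 2 b"
      unfolding Lpow_def by (rule nn_integral_cmult) measurable
    finally show ?thesis .
  qed
  finally have "(\<integral>\<^sup>+ t. \<integral>\<^sup>+ P. ennreal ((cmod (c t P))\<^sup>2) \<partial>lborel \<partial>lborel) \<le> ennreal \<kappa> * (Lpow 2 a * Lpow 2 b)" .
  then have "(\<integral>\<^sup>+ t. Lpow 2 (\<lambda>x. evol a t x * evol b t x) \<partial>lborel)
     \<le> ennreal ((2 * pi)\<^sup>2) * (ennreal \<kappa> * (Lpow 2 a * Lpow 2 b))"
    by (intro order_trans[OF 1] mult_left_mono) auto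
  also have "\<dots> = ennreal ((2 * pi)\<^sup>2 * \<kappa>) * (Lpow 2 a * Lpow 2 b)"
    using k0 by (subst ennreal_mult) (auto simp: mult.assoc)
  finally show ?thesis .
qed

text \<open>The fourth power of a wave is the square of its product with itself; all frequencies are
  allowed, so the constant is that of \<open>osc_bound_UNIV\<close>.\<close>

corollary strichartz_evol:
  assumes a: "integrable lborel a"
  shows "(\<integral>\<^sup>+ t. Lpow 4 (evol a t) \<partial>lborel) \<le> ennreal (8 * pi ^ 4) * (Lpow 2 a)\<^sup>2"
proof -
  have e: "Lpow 4 (evol a t) = Lpow 2 (\<lambda>x. evol a t x * evol a t x)" for t
    unfolding Lpow_def by (simp add: norm_mult power_mult_distrib flip: power_add)
  have "(\<integral>\<^sup>+ t. Lpow 4 (evol a t) \<partial>lborel) \<le> ennreal ((2 * pi)\<^sup>2 * (2 * pi\<^sup>2)) * (Lpow 2 a * Lpow 2 a)"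
    unfolding e by (rule bilinear_evol[OF a a]) (auto intro: osc_bound_mono[OF osc_bound_UNIV])
  also have "(2 * pi)\<^sup>2 * (2 * pi\<^sup>2) = 8 * pi ^ 4"
    by (simp add: power_mult_distrib power2_eq_square power4_eq_xxxx)
  finally show ?thesis by (simp add: power2_eq_square)
qed

section \<open>Schwartz functions\<close>

text \<open>Polynomials times one fixed Gaussian. The class is closed under differentiation and
  decays faster than every power, which are the two demands that \<open>schwartz\<close>
  makes.\<close>

inductive gauss_poly :: "real \<Rightarrow> (plane \<Rightarrow> complex) \<Rightarrow> bool" for e where
  gauss: "gauss_poly e (gauss e)"
| coord: "gauss_poly e f \<Longrightarrow> gauss_poly e (\<lambda>x. complex_of_real (x $ i) * f x)"
| add: "gauss_poly e f \<Longrightarrow> gauss_poly e g \<Longrightarrow> gauss_poly e (\<lambda>x. f x + g x)"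
| cmult: "gauss_poly e f \<Longrightarrow> gauss_poly e (\<lambda>x. c * f x)"

text \<open>Use (1 + r)^n <= exp (n r); completing the square bounds n r - e r^2 / 2 by n^2 / (2
  e).\<close>

lemma gauss_decay:
  fixes n :: nat
  assumes e: "0 < e"
  shows "\<exists>B. \<forall>x. (1 + norm x) ^ n * cmod (gauss e x) \<le> B"
proof (intro exI allI)
  fix x :: plane
  define r where "r = norm x"
  have r: "0 \<le> r" by (simp add: r_def)
  have "(1 + r) ^ n \<le> exp (real n * r)"
    using power_mono[OF exp_ge_add_one_self[of r], of n] r by (simp add: exp_of_nat_mult)
  then have "(1 + r) ^ n * exp (- (e * r\<^sup>2 / 2)) \<le> exp (real n * r) * exp (- (e * r\<^sup>2 / 2))"
    by (intro mult_right_mono) auto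
  also have "\<dots> = exp (real n * r - e * r\<^sup>2 / 2)" by (simp add: exp_add[symmetric])
  also have "\<dots> \<le> exp ((real n)\<^sup>2 / (2 * e))"
  proof -
    have "0 \<le> (e * r - real n)\<^sup>2" by simp
    then have "2 * e * (real n * r) - e * (e * r\<^sup>2) \<le> (real n)\<^sup>2"
      by (simp add: power2_eq_square algebra_simps)
    then have "real n * r - e * r\<^sup>2 / 2 \<le> (real n)\<^sup>2 / (2 * e)"
      using e by (simp add: field_simps)
    then show ?thesis by simp
  qed
  finally show "(1 + norm x) ^ n * cmod (gauss e x) \<le> exp ((real n)\<^sup>2 / (2 * e))"
    by (simp add: norm_gauss r_def)
qed

lemma gauss_poly_decay:
  assumes e: "0 < e" and f: "gauss_poly e f"
  shows "\<exists>B. \<forall>x. (1 + norm x) ^ n * cmod (f x) \<le> B"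
  using f
proof (induction arbitrary: n)
  case gauss
  then show ?case by (rule gauss_decay[OF e])
next
  case (coord f i)
  then obtain B where B: "\<And>x. (1 + norm x) ^ Suc n * cmod (f x) \<le> B" by blast
  have "(1 + norm x) ^ n * cmod (complex_of_real (x $ i) * f x) \<le> B" for x
  proof -
    have "\<bar>x $ i\<bar> \<le> 1 + norm x" using component_le_norm_cart[of x i] by linarith
    then have "\<bar>x $ i\<bar> * ((1 + norm x) ^ n * cmod (f x)) \<le> (1 + norm x) * ((1 + norm x) ^ n * cmod (f x))"
      by (intro mult_right_mono) auto
    also have "\<dots> \<le> B" using B[of x] by (simp add: mult.assoc)
    finally show ?thesis by (simp add: norm_mult mult_ac)
  qed
  then show ?case by blast
next
  case (add f g)
  obtain B where B: "\<And>x. (1 + norm x) ^ n * cmod (f x) \<le> B" using add.IH(1) by blast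
  obtain B' where B': "\<And>x. (1 + norm x) ^ n * cmod (g x) \<le> B'" using add.IH(2) by blast
  have "(1 + norm x) ^ n * cmod (f x + g x) \<le> B + B'" for x
  proof -
    have "(1 + norm x) ^ n * cmod (f x + g x) \<le> (1 + norm x) ^ n * (cmod (f x) + cmod (g x))"
      by (intro mult_left_mono norm_triangle_ineq) auto
    then show ?thesis using B[of x] B'[of x] by (simp add: distrib_left)
  qed
  then show ?case by blast
next
  case (cmult f c)
  obtain B where B: "\<And>x. (1 + norm x) ^ n * cmod (f x) \<le> B" using cmult.IH by blast
  have "(1 + norm x) ^ n * cmod (c * f x) \<le> cmod c * B" for x
    using mult_left_mono[OF B[of x] norm_ge_zero[of c]] by (simp add: norm_mult mult_ac)
  then show ?case by blast
qed

lemma gauss_poly_bounded: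
  assumes "0 < e" "gauss_poly e f"
  obtains B where "0 \<le> B" "\<And>x. cmod (f x) \<le> B"
proof -
  from gauss_poly_decay[OF assms, of 0] obtain B where B: "\<forall>x. cmod (f x) \<le> B" by auto
  then have "0 \<le> B" using norm_ge_zero order_trans by blast
  with B that show ?thesis by blast
qed

abbreviation diff_with :: "(plane \<Rightarrow> complex) \<Rightarrow> (plane \<Rightarrow> complex) \<Rightarrow> (plane \<Rightarrow> complex) \<Rightarrow> plane \<Rightarrow> bool" where
  "diff_with f f1 f2 x \<equiv> (f has_derivative (\<lambda>v. complex_of_real (v $ 1) * f1 x + complex_of_real (v $ 2) * f2 x)) (at x)"

lemma has_derivative_nth: "((\<lambda>x. complex_of_real ((x :: plane) $ i)) has_derivative (\<lambda>v. complex_of_real (v $ i))) F"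
  by (intro has_derivative_of_real bounded_linear_imp_has_derivative bounded_linear_vec_nth)

lemma has_derivative_gauss:
  "diff_with (gauss e) (\<lambda>x. complex_of_real (- e) * (complex_of_real (x $ 1) * gauss e x))
     (\<lambda>x. complex_of_real (- e) * (complex_of_real (x $ 2) * gauss e x)) x"
proof -
  have "((\<lambda>x::plane. exp (- (e * (x \<bullet> x) / 2))) has_derivative
     (\<lambda>v. exp (- (e * (x \<bullet> x) / 2)) * (- (e * (x \<bullet> v + v \<bullet> x) / 2)))) (at x)"
    by (auto intro!: derivative_eq_intros simp: field_simps)
  then have "((\<lambda>x::plane. complex_of_real (exp (- (e * (x \<bullet> x) / 2)))) has_derivative
     (\<lambda>v. complex_of_real (exp (- (e * (x \<bullet> x) / 2)) * (- (e * (x \<bullet> v + v \<bullet> x) / 2))))) (at x)"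
    by (rule has_derivative_of_real)
  moreover have "(\<lambda>x::plane. complex_of_real (exp (- (e * (x \<bullet> x) / 2)))) = gauss e"
    by (simp add: gauss_def fun_eq_iff power2_norm_eq_inner)
  moreover have "(\<lambda>v. complex_of_real (exp (- (e * (x \<bullet> x) / 2)) * (- (e * (x \<bullet> v + v \<bullet> x) / 2))))
     = (\<lambda>v. complex_of_real (v $ 1) * (complex_of_real (- e) * (complex_of_real (x $ 1) * gauss e x))
          + complex_of_real (v $ 2) * (complex_of_real (- e) * (complex_of_real (x $ 2) * gauss e x)))"
  proof
    fix v
    have "exp (- (e * (x \<bullet> x) / 2)) * (- (e * (x \<bullet> v + v \<bullet> x) / 2))
       = v $ 1 * (- e * (x $ 1 * exp (- (e * (norm x)\<^sup>2 / 2)))) + v $ 2 * (- e * (x $ 2 * exp (- (e * (norm x)\<^sup>2 / 2))))"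
      unfolding power2_norm_eq_inner by (simp add: pl_inner[of x v] pl_inner[of v x] algebra_simps)
    then show "complex_of_real (exp (- (e * (x \<bullet> x) / 2)) * (- (e * (x \<bullet> v + v \<bullet> x) / 2)))
     = complex_of_real (v $ 1) * (complex_of_real (- e) * (complex_of_real (x $ 1) * gauss e x))
          + complex_of_real (v $ 2) * (complex_of_real (- e) * (complex_of_real (x $ 2) * gauss e x))"
      unfolding gauss_def of_real_mult[symmetric] of_real_add[symmetric] by (simp only:)
  qed
  ultimately show ?thesis by (simp only:)
qed

lemma gauss_poly_derivative:
  assumes f: "gauss_poly e f"
  shows "\<exists>f1 f2. gauss_poly e f1 \<and> gauss_poly e f2 \<and> (\<forall>x. diff_with f f1 f2 x)"
  using f
proof induction
  case gauss
  show ?case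
    by (intro exI conjI allI, rule gauss_poly.cmult[OF gauss_poly.coord[OF gauss_poly.gauss]],
        rule gauss_poly.cmult[OF gauss_poly.coord[OF gauss_poly.gauss]], rule has_derivative_gauss)
next
  case (coord f i)
  then obtain f1 f2 where d: "gauss_poly e f1" "gauss_poly e f2" "\<And>x. diff_with f f1 f2 x" by blast
  define \<delta> where "\<delta> = (\<lambda>j. if i = j then 1 else (0::complex))"
  have "diff_with (\<lambda>x. complex_of_real (x $ i) * f x) (\<lambda>x. \<delta> 1 * f x + complex_of_real (x $ i) * f1 x)
     (\<lambda>x. \<delta> 2 * f x + complex_of_real (x $ i) * f2 x) x" for x
  proof -
    have v: "complex_of_real (v $ i) = complex_of_real (v $ 1) * \<delta> 1 + complex_of_real (v $ 2) * \<delta> 2" for v :: plane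
      using exhaust_2[of i] by (auto simp: \<delta>_def)
    show ?thesis
      by (rule has_derivative_eq_rhs[OF has_derivative_mult[OF has_derivative_nth d(3)]])
         (simp add: fun_eq_iff v distrib_left distrib_right mult_ac)
  qed
  moreover have "gauss_poly e (\<lambda>x. \<delta> j * f x + complex_of_real (x $ i) * g x)" if "gauss_poly e g" for j g
    using coord.hyps that by (intro gauss_poly.intros)
  ultimately show ?case using d(1,2) by blast
next
  case (add f g)
  obtain f1 f2 where d: "gauss_poly e f1" "gauss_poly e f2" "\<And>x. diff_with f f1 f2 x" using add.IH(1) by blast
  obtain g1 g2 where d': "gauss_poly e g1" "gauss_poly e g2" "\<And>x. diff_with g g1 g2 x" using add.IH(2) by blast
  have "diff_with (\<lambda>x. f x + g x) (\<lambda>x. f1 x + g1 x) (\<lambda>x. f2 x + g2 x) x" for x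
    by (rule has_derivative_eq_rhs[OF has_derivative_add[OF d(3) d'(3)]]) (simp add: fun_eq_iff distrib_left)
  then show ?case using d(1,2) d'(1,2) by (blast intro: gauss_poly.add)
next
  case (cmult f c)
  obtain f1 f2 where d: "gauss_poly e f1" "gauss_poly e f2" "\<And>x. diff_with f f1 f2 x" using cmult.IH by blast
  have "diff_with (\<lambda>x. c * f x) (\<lambda>x. c * f1 x) (\<lambda>x. c * f2 x) x" for x
    by (rule has_derivative_eq_rhs[OF has_derivative_mult_right[OF d(3)]]) (simp add: fun_eq_iff distrib_left mult_ac)
  then show ?case using d(1,2) by (blast intro: gauss_poly.cmult)
qed

lemma diff_with_bound_lipschitz:
  assumes d: "\<And>x. diff_with f f1 f2 x" and B: "\<And>x. cmod (f1 x) \<le> B" "\<And>x. cmod (f2 x) \<le> B"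
  shows "cmod (f x - f y) \<le> 2 * B * norm (x - y)"
proof (rule differentiable_bound[of UNIV f "\<lambda>x v. complex_of_real (v $ 1) * f1 x + complex_of_real (v $ 2) * f2 x"])
  fix x
  show "onorm (\<lambda>v::plane. complex_of_real (v $ 1) * f1 x + complex_of_real (v $ 2) * f2 x) \<le> 2 * B"
  proof (rule onorm_le)
    fix v :: plane
    have "cmod (complex_of_real (v $ 1) * f1 x + complex_of_real (v $ 2) * f2 x)
       \<le> \<bar>v $ 1\<bar> * cmod (f1 x) + \<bar>v $ 2\<bar> * cmod (f2 x)"
      by (rule order_trans[OF norm_triangle_ineq]) (simp add: norm_mult)
    also have "\<dots> \<le> norm v * B + norm v * B"
      using component_le_norm_cart[of v] B by (intro add_mono mult_mono) auto
    finally show "cmod (complex_of_real (v $ 1) * f1 x + complex_of_real (v $ 2) * f2 x) \<le> 2 * B * norm v"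
      by simp
  qed
qed (use d in auto)

text \<open>The first derivatives are Lipschitz because the second ones are bounded. The remainder
  is uniform in z, which is what differentiation under a convolution integral asks for.\<close>

lemma gauss_poly_taylor:
  assumes e: "0 < e" and f: "gauss_poly e f1" "gauss_poly e f2" and d: "\<And>x. diff_with f f1 f2 x"
  shows "\<exists>B\<ge>0. \<forall>z v. cmod (f (z + v) - f z - (complex_of_real (v $ 1) * f1 z + complex_of_real (v $ 2) * f2 z)) \<le> B * (norm v)\<^sup>2"
proof -
  have lip: "\<exists>L\<ge>0. \<forall>x y. cmod (g x - g y) \<le> L * norm (x - y)" if g: "gauss_poly e g" for g
  proof -
    obtain g1 g2 where d: "gauss_poly e g1" "gauss_poly e g2" "\<And>x. diff_with g g1 g2 x"
      using gauss_poly_derivative[OF g] by blast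
    obtain B1 where B1: "0 \<le> B1" "\<And>x. cmod (g1 x) \<le> B1" using gauss_poly_bounded[OF e d(1)] by blast
    obtain B2 where B2: "0 \<le> B2" "\<And>x. cmod (g2 x) \<le> B2" using gauss_poly_bounded[OF e d(2)] by blast
    have "cmod (g x - g y) \<le> 2 * max B1 B2 * norm (x - y)" for x y
      by (rule diff_with_bound_lipschitz[OF d(3)]) (use B1 B2 in \<open>auto simp: le_max_iff_disj\<close>)
    then show ?thesis using B1(1) by (intro exI[of _ "2 * max B1 B2"]) auto
  qed
  obtain L1 where L1: "0 \<le> L1" "\<And>x y. cmod (f1 x - f1 y) \<le> L1 * norm (x - y)" using lip[OF f(1)] by blast
  obtain L2 where L2: "0 \<le> L2" "\<And>x y. cmod (f2 x - f2 y) \<le> L2 * norm (x - y)" using lip[OF f(2)] by blast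
  have "cmod (f (z + v) - f z - (complex_of_real (v $ 1) * f1 z + complex_of_real (v $ 2) * f2 z)) \<le> (L1 + L2) * (norm v)\<^sup>2" for z v
  proof -
    define F where "F = (\<lambda>x. f x - (complex_of_real (x $ 1) * f1 z + complex_of_real (x $ 2) * f2 z))"
    define F' where "F' = (\<lambda>x v. (complex_of_real (v $ 1) * f1 x + complex_of_real (v $ 2) * f2 x)
       - (complex_of_real ((v::plane) $ 1) * f1 z + complex_of_real (v $ 2) * f2 z))"
    have "cmod (F (z + v) - F z) \<le> ((L1 + L2) * norm v) * norm (z + v - z)"
    proof (rule differentiable_bound[of "cball z (norm v)" F F'])
      fix x assume x: "x \<in> cball z (norm v)"
      show "(F has_derivative F' x) (at x within cball z (norm v))"
        unfolding F_def F'_def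
        by (intro has_derivative_diff has_derivative_at_withinI[OF d] has_derivative_add has_derivative_mult_left has_derivative_nth)
      show "onorm (F' x) \<le> (L1 + L2) * norm v"
      proof (rule onorm_le)
        fix w :: plane
        have "F' x w = complex_of_real (w $ 1) * (f1 x - f1 z) + complex_of_real (w $ 2) * (f2 x - f2 z)"
          by (simp add: F'_def algebra_simps)
        then have "cmod (F' x w) \<le> \<bar>w $ 1\<bar> * cmod (f1 x - f1 z) + \<bar>w $ 2\<bar> * cmod (f2 x - f2 z)"
          by (simp only:) (rule order_trans[OF norm_triangle_ineq], simp add: norm_mult)
        also have "\<dots> \<le> norm w * (L1 * norm v) + norm w * (L2 * norm v)"
        proof (intro add_mono mult_mono)
          have n: "norm (x - z) \<le> norm v" using x by (simp add: dist_norm norm_minus_commute)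
          show "cmod (f1 x - f1 z) \<le> L1 * norm v" "cmod (f2 x - f2 z) \<le> L2 * norm v"
            using L1(2)[of x z] L2(2)[of x z] mult_left_mono[OF n L1(1)] mult_left_mono[OF n L2(1)] by linarith+
        qed (use component_le_norm_cart[of w] in auto)
        finally show "cmod (F' x w) \<le> (L1 + L2) * norm v * norm w" by (simp add: algebra_simps)
      qed
    qed (auto simp: dist_norm)
    moreover have "F (z + v) - F z = f (z + v) - f z - (complex_of_real (v $ 1) * f1 z + complex_of_real (v $ 2) * f2 z)"
      by (simp add: F_def algebra_simps)
    ultimately show ?thesis by (simp add: power2_eq_square mult.assoc)
  qed
  then show ?thesis using L1(1) L2(1) by (intro exI[of _ "L1 + L2"]) auto
qed

section \<open>Schwartz functions made by Gaussian convolution\<close>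

definition conv :: "(plane \<Rightarrow> complex) \<Rightarrow> (plane \<Rightarrow> complex) \<Rightarrow> plane \<Rightarrow> complex" where
  "conv h k x = (LINT y|lborel. h y * k (x - y))"

lemma gauss_poly_measurable: "gauss_poly e f \<Longrightarrow> f \<in> borel_measurable borel"
  by (induction rule: gauss_poly.induct) auto

lemma conv_integrable:
  assumes e: "0 < e" and h: "integrable lborel h" and k: "gauss_poly e k"
  shows "integrable lborel (\<lambda>y. h y * k (x - y))"
proof -
  note [measurable] = gauss_poly_measurable[OF k]
  have [measurable]: "h \<in> borel_measurable borel" using h by auto
  obtain B where B: "0 \<le> B" "\<And>x. cmod (k x) \<le> B" using gauss_poly_bounded[OF e k] by blast
  show ?thesis
  proof (rule Bochner_Integration.integrable_bound)
    show "integrable lborel (\<lambda>y. complex_of_real B * h y)" using h by simp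
    show "AE y in lborel. cmod (h y * k (x - y)) \<le> cmod (complex_of_real B * h y)"
      using B by (intro AE_I2) (simp add: norm_mult mult.commute[of B] mult_left_mono)
  qed measurable
qed

lemma norm_integral_le_integral:
  fixes f :: "'a \<Rightarrow> 'b :: {banach, second_countable_topology}"
  assumes w: "integrable M w" and fw: "AE x in M. norm (f x) \<le> w x"
  shows "norm (LINT x|M. f x) \<le> (LINT x|M. w x)"
proof -
  have w0: "AE x in M. 0 \<le> w x" using fw by eventually_elim (use norm_ge_zero order_trans in blast)
  have "ennreal (norm (LINT x|M. f x)) \<le> (\<integral>\<^sup>+ x. ennreal (norm (f x)) \<partial>M)"
    by (rule norm_integral_le_nn)
  also have "\<dots> \<le> (\<integral>\<^sup>+ x. ennreal (w x) \<partial>M)"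
    using fw by (intro nn_integral_mono_AE) (auto elim!: eventually_mono intro: ennreal_leI)
  also have "\<dots> = ennreal (LINT x|M. w x)"
    by (rule nn_integral_eq_integral[OF w w0])
  finally show ?thesis
    using integral_nonneg_AE[OF w0] by (subst (asm) ennreal_le_iff) auto
qed

text \<open>The uniform Taylor remainder of k, integrated against |h|, is quadratic in the
  increment.\<close>

lemma conv_diff_with:
  assumes e: "0 < e" and h: "integrable lborel h" and k: "gauss_poly e k" "gauss_poly e k1" "gauss_poly e k2"
    and d: "\<And>x. diff_with k k1 k2 x"
  shows "diff_with (conv h k) (conv h k1) (conv h k2) x"
proof -
  obtain B where B: "0 \<le> B"
    "\<And>z v. cmod (k (z + v) - k z - (complex_of_real (v $ 1) * k1 z + complex_of_real (v $ 2) * k2 z)) \<le> B * (norm v)\<^sup>2"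
    using gauss_poly_taylor[OF e k(2,3) d] by blast
  define A where "A = (LINT y|lborel. cmod (h y))"
  note ci = conv_integrable[OF e h]
  show ?thesis
  proof (rule has_derivativeI_sandwich[of 1 _ _ _ _ "\<lambda>y. A * B * norm (y - x)"])
    show "bounded_linear (\<lambda>v::plane. complex_of_real (v $ 1) * conv h k1 x + complex_of_real (v $ 2) * conv h k2 x)"
      using has_derivative_bounded_linear[OF has_derivative_add[OF
          has_derivative_mult_left[OF has_derivative_nth[of 1]] has_derivative_mult_left[OF has_derivative_nth[of 2]]]] .
    have "((\<lambda>y. A * B * norm (y - x)) \<longlongrightarrow> A * B * norm (x - x)) (at x)"
      by (intro tendsto_intros)
    then show "((\<lambda>y. A * B * norm (y - x)) \<longlongrightarrow> 0) (at x)" by simp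
    fix y assume y: "y \<noteq> x"
    define v where "v = y - x"
    define E where "E = (\<lambda>z. k (z + v) - k z - (complex_of_real (v $ 1) * k1 z + complex_of_real (v $ 2) * k2 z))"
    have yx: "y - w = (x - w) + v" for w by (simp add: v_def)
    have "conv h k y - conv h k x - (complex_of_real (v $ 1) * conv h k1 x + complex_of_real (v $ 2) * conv h k2 x)
       = (LINT w|lborel. h w * k (y - w) - h w * k (x - w)
           - (complex_of_real (v $ 1) * (h w * k1 (x - w)) + complex_of_real (v $ 2) * (h w * k2 (x - w))))"
      unfolding conv_def using ci[OF k(1)] ci[OF k(2)] ci[OF k(3)]
      by (simp only: Bochner_Integration.integral_diff Bochner_Integration.integral_add integral_mult_right_zero
          integrable_mult_right Bochner_Integration.integrable_diff Bochner_Integration.integrable_add)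
    also have "\<dots> = (LINT w|lborel. h w * E (x - w))"
      by (intro Bochner_Integration.integral_cong refl) (simp only: E_def yx right_diff_distrib distrib_left mult.left_commute)
    finally have "cmod (conv h k y - conv h k x - (complex_of_real (v $ 1) * conv h k1 x + complex_of_real (v $ 2) * conv h k2 x))
       = cmod (LINT w|lborel. h w * E (x - w))" by simp
    also have "\<dots> \<le> (LINT w|lborel. cmod (h w) * (B * (norm v)\<^sup>2))"
    proof (rule norm_integral_le_integral)
      show "integrable lborel (\<lambda>w. cmod (h w) * (B * (norm v)\<^sup>2))" using h by simp
      show "AE w in lborel. cmod (h w * E (x - w)) \<le> cmod (h w) * (B * (norm v)\<^sup>2)"
        using B(2) by (intro AE_I2) (simp add: norm_mult E_def mult_left_mono)
    qed
    also have "\<dots> = A * B * norm v * norm v" by (simp add: A_def power2_eq_square)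
    finally have "cmod (conv h k y - conv h k x - (complex_of_real (v $ 1) * conv h k1 x + complex_of_real (v $ 2) * conv h k2 x)) / norm v
       \<le> A * B * norm v"
      using y by (simp add: divide_le_eq v_def)
    then show "cmod (conv h k y - conv h k x -
        (complex_of_real ((y - x) $ 1) * conv h k1 x + complex_of_real ((y - x) $ 2) * conv h k2 x)) / norm (y - x)
       \<le> A * B * norm (y - x)" by (simp only: v_def)
  qed simp_all
qed

text \<open>Each derivative falls on the kernel and stays within \<open>gauss_poly\<close>, so
  smoothness and decay of all derivatives reduce to facts about one kernel.\<close>

lemma iter_partial_conv:
  assumes e: "0 < e" and h: "integrable lborel h" and k: "gauss_poly e k"
  shows "\<exists>k'. gauss_poly e k' \<and> iter_partial as (conv h k) = conv h k'"
proof (induction as)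
  case Nil
  then show ?case using k by auto
next
  case (Cons a as)
  then obtain k' where k': "gauss_poly e k'" "iter_partial as (conv h k) = conv h k'" by blast
  obtain k1 k2 where d: "gauss_poly e k1" "gauss_poly e k2" "\<And>x. diff_with k' k1 k2 x"
    using gauss_poly_derivative[OF k'(1)] by blast
  have "frechet_derivative (conv h k') (at x) = (\<lambda>v. complex_of_real (v $ 1) * conv h k1 x + complex_of_real (v $ 2) * conv h k2 x)" for x
    using frechet_derivative_at[OF conv_diff_with[OF e h k'(1) d]] by simp
  then have "iter_partial (a # as) (conv h k)
     = (\<lambda>x. complex_of_real ((axis a 1 :: plane) $ 1) * conv h k1 x + complex_of_real ((axis a 1 :: plane) $ 2) * conv h k2 x)"
    using k'(2) by simp
  also have "\<dots> = conv h (if a = 1 then k1 else k2)"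
    using exhaust_2[of a] by (auto simp: axis_def fun_eq_iff)
  finally show ?case using d(1,2) by (intro exI[of _ "if a = 1 then k1 else k2"]) auto
qed

text \<open>For |y| <= R one has 1 + |x| <= (1 + R) (1 + |x - y|), so the decay of the kernel passes
  to the convolution.\<close>

lemma conv_decay:
  assumes e: "0 < e" and h: "integrable lborel h" and supp: "\<And>y. R < norm y \<Longrightarrow> h y = 0" and k: "gauss_poly e k" and R: "0 \<le> R"
  shows "\<exists>B. \<forall>x. (1 + norm x) ^ n * cmod (conv h k x) \<le> B"
proof -
  obtain B where B: "\<And>x. (1 + norm x) ^ n * cmod (k x) \<le> B" using gauss_poly_decay[OF e k] by blast
  have "(1 + norm x) ^ n * cmod (conv h k x) \<le> (LINT y|lborel. cmod (h y) * ((1 + R) ^ n * B))" for x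
  proof -
    have "(1 + norm x) ^ n * cmod (conv h k x) = cmod (LINT y|lborel. complex_of_real ((1 + norm x) ^ n) * (h y * k (x - y)))"
      unfolding integral_mult_right_zero conv_def norm_mult norm_of_real by simp
    also have "\<dots> \<le> (LINT y|lborel. cmod (h y) * ((1 + R) ^ n * B))"
    proof (rule norm_integral_le_integral)
      show "integrable lborel (\<lambda>y. cmod (h y) * ((1 + R) ^ n * B))" using h by simp
      show "AE y in lborel. cmod (complex_of_real ((1 + norm x) ^ n) * (h y * k (x - y))) \<le> cmod (h y) * ((1 + R) ^ n * B)"
      proof (rule AE_I2)
        fix y
        show "cmod (complex_of_real ((1 + norm x) ^ n) * (h y * k (x - y))) \<le> cmod (h y) * ((1 + R) ^ n * B)"
        proof (cases "R < norm y")
          case False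
          have "norm x \<le> norm y + norm (x - y)" using norm_triangle_ineq[of y "x - y"] by simp
          moreover have "(1 + R) * (1 + norm (x - y)) = 1 + R + norm (x - y) + R * norm (x - y)"
            by (simp add: algebra_simps)
          moreover have "0 \<le> R * norm (x - y)" using R by simp
          ultimately have "1 + norm x \<le> (1 + R) * (1 + norm (x - y))"
            using False by linarith
          then have "(1 + norm x) ^ n \<le> (1 + R) ^ n * (1 + norm (x - y)) ^ n"
            using power_mono[of "1 + norm x" "(1 + R) * (1 + norm (x - y))" n] by (simp add: power_mult_distrib)
          then have "(1 + norm x) ^ n * cmod (k (x - y)) \<le> (1 + R) ^ n * (1 + norm (x - y)) ^ n * cmod (k (x - y))"
            by (rule mult_right_mono) simp
          also have "\<dots> \<le> (1 + R) ^ n * B"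
            using mult_left_mono[OF B[of "x - y"], of "(1 + R) ^ n"] R by (simp add: mult.assoc)
          finally have "cmod (h y) * ((1 + norm x) ^ n * cmod (k (x - y))) \<le> cmod (h y) * ((1 + R) ^ n * B)"
            by (rule mult_left_mono) simp
          then show ?thesis unfolding norm_mult norm_of_real by (simp add: mult_ac)
        qed (simp add: supp)
      qed
    qed
    finally show ?thesis .
  qed
  then show ?thesis by blast
qed

text \<open>It supplies the admissible test functions of \<open>duhamel_integral\<close>: a
  truncated L2 function smoothed by the heat kernel.\<close>

lemma conv_heat_schwartz:
  assumes e: "0 < e" and h: "integrable lborel h" and supp: "\<And>y. R < norm y \<Longrightarrow> h y = 0" and R: "0 \<le> R"
  shows "conv_heat e h \<in> schwartz"
proof -
  have e': "0 < 1 / e" using e by simp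
  have hp: "gauss_poly (1 / e) (heat e)"
    unfolding heat_def by (intro gauss_poly.intros)
  have c: "conv_heat e h = conv h (heat e)" by (simp add: fun_eq_iff conv_heat_def conv_def)
  have "iter_partial as (conv_heat e h) differentiable_on UNIV" for as
  proof -
    obtain k where k: "gauss_poly (1 / e) k" "iter_partial as (conv_heat e h) = conv h k"
      using iter_partial_conv[OF e' h hp, of as] c by auto
    obtain k1 k2 where d: "gauss_poly (1 / e) k1" "gauss_poly (1 / e) k2" "\<And>x. diff_with k k1 k2 x"
      using gauss_poly_derivative[OF k(1)] by blast
    show ?thesis unfolding k(2) differentiable_on_def
      using conv_diff_with[OF e' h k(1) d] by (auto simp: differentiable_def)
  qed
  moreover have "\<exists>B. \<forall>x. (1 + norm x) ^ n * cmod (iter_partial as (conv_heat e h) x) \<le> B" for as n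
  proof -
    obtain k where k: "gauss_poly (1 / e) k" "iter_partial as (conv_heat e h) = conv h k"
      using iter_partial_conv[OF e' h hp, of as] c by auto
    show ?thesis unfolding k(2) by (rule conv_decay[OF e' h supp k(1) R])
  qed
  ultimately show ?thesis unfolding schwartz_def smooth_fun_def by blast
qed

section \<open>Integrability from decay\<close>

text \<open>The product weight splits into two arctangent integrals, each equal to pi. As it is at
  most 1, the same domination gives a sup bound B, and L2 follows from L1.\<close>

lemma plane_dominated:
  fixes f :: "plane \<Rightarrow> complex"
  assumes [measurable]: "f \<in> borel_measurable borel"
    and B: "\<And>x. cmod (f x) \<le> B * (inverse (1 + (x $ 1)\<^sup>2) * inverse (1 + (x $ 2)\<^sup>2))"
  shows "integrable lborel f" "f \<in> L2"
    "(\<integral>\<^sup>+ x. ennreal (cmod (f x)) \<partial>lborel) \<le> ennreal (B * pi\<^sup>2)"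
proof -
  let ?w = "\<lambda>x::plane. inverse (1 + (x $ 1)\<^sup>2) * inverse (1 + (x $ 2)\<^sup>2)"
  have w0: "0 \<le> ?w x" "?w x \<le> 1" for x
    by (simp add: add_nonneg_nonneg) (intro mult_le_one; simp add: inverse_le_1_iff)
  have B0: "0 \<le> B"
  proof -
    have "0 \<le> B * ?w 0" using order_trans[OF norm_ge_zero B[of 0]] .
    then show ?thesis by simp
  qed
  have nn: "(\<integral>\<^sup>+ x. ennreal (?w x) \<partial>lborel) = ennreal (pi\<^sup>2)"
    by (subst nn_integral_plane, measurable)
       (simp add: ennreal_mult nn_integral_cmult nn_integral_multc nn_integral_inverse_1_plus_square power2_eq_square[of pi])
  have 1: "(\<integral>\<^sup>+ x. ennreal (cmod (f x)) \<partial>lborel) \<le> ennreal (B * pi\<^sup>2)"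
  proof -
    have "(\<integral>\<^sup>+ x. ennreal (cmod (f x)) \<partial>lborel) \<le> (\<integral>\<^sup>+ x. ennreal B * ennreal (?w x) \<partial>lborel)"
      using B B0 w0 by (intro nn_integral_mono) (simp add: ennreal_mult[symmetric] ennreal_leI)
    also have "\<dots> = ennreal (B * pi\<^sup>2)"
      using B0 by (subst nn_integral_cmult, measurable, subst nn) (simp add: ennreal_mult)
    finally show ?thesis .
  qed
  then show "(\<integral>\<^sup>+ x. ennreal (cmod (f x)) \<partial>lborel) \<le> ennreal (B * pi\<^sup>2)" .
  show "integrable lborel f"
    using le_less_trans[OF 1 ennreal_less_top] by (auto simp: integrable_iff_bounded)
  have "Lpow 2 f \<le> (\<integral>\<^sup>+ x. ennreal B * ennreal (cmod (f x)) \<partial>lborel)"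
    unfolding Lpow_def
  proof (intro nn_integral_mono)
    fix x
    have "cmod (f x) \<le> B" using B[of x] mult_left_mono[OF w0(2)[of x] B0] by linarith
    then have "(cmod (f x))\<^sup>2 \<le> B * cmod (f x)" by (simp add: power2_eq_square mult_right_mono)
    then show "ennreal ((cmod (f x))\<^sup>2) \<le> ennreal B * ennreal (cmod (f x))"
      using B0 by (simp add: ennreal_mult[symmetric] ennreal_leI)
  qed
  also have "\<dots> = ennreal B * (\<integral>\<^sup>+ x. ennreal (cmod (f x)) \<partial>lborel)" by (rule nn_integral_cmult) measurable
  also have "\<dots> < \<infinity>" using le_less_trans[OF 1 ennreal_less_top] by (simp add: ennreal_mult_less_top)
  finally show "f \<in> L2" by (intro L2I) auto
qed

lemma schwartz_integrable:
  assumes v: "v \<in> schwartz"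
  shows "integrable lborel v" "v \<in> L2"
proof -
  have "iter_partial [] v differentiable_on UNIV" using v unfolding schwartz_def smooth_fun_def by blast
  then have "continuous_on UNIV v" by (simp add: differentiable_imp_continuous_on)
  then have m: "v \<in> borel_measurable borel" by (rule borel_measurable_continuous_onI)
  have "\<exists>B. \<forall>x. (1 + norm x) ^ 4 * cmod (iter_partial [] v x) \<le> B" using v unfolding schwartz_def by blast
  then obtain B where B: "\<And>x. (1 + norm x) ^ 4 * cmod (v x) \<le> B" by auto
  have "cmod (v x) \<le> B * (inverse (1 + (x $ 1)\<^sup>2) * inverse (1 + (x $ 2)\<^sup>2))" for x
  proof -
    have p: "0 < 1 + (x $ 1)\<^sup>2" "0 < 1 + (x $ 2)\<^sup>2" by (simp_all add: add_pos_nonneg)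
    have q: "1 + (x $ i)\<^sup>2 \<le> (1 + norm x)\<^sup>2" for i
    proof -
      have "\<bar>x $ i\<bar>\<^sup>2 \<le> (norm x)\<^sup>2" by (intro power_mono component_le_norm_cart) auto
      then show ?thesis using norm_ge_zero[of x] unfolding power2_sum by (simp, linarith)
    qed
    have "(1 + (x $ 1)\<^sup>2) * (1 + (x $ 2)\<^sup>2) \<le> (1 + norm x)\<^sup>2 * (1 + norm x)\<^sup>2"
      using p by (intro mult_mono q) auto
    also have "\<dots> = (1 + norm x) ^ 4" by (simp flip: power_add)
    finally have "(1 + (x $ 1)\<^sup>2) * (1 + (x $ 2)\<^sup>2) * cmod (v x) \<le> B"
      using B[of x] mult_right_mono[of _ _ "cmod (v x)"] by (meson norm_ge_zero order_trans)
    then have "cmod (v x) \<le> B / ((1 + (x $ 1)\<^sup>2) * (1 + (x $ 2)\<^sup>2))"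
      using mult_pos_pos[OF p] by (simp only: pos_le_divide_eq mult.commute[of "cmod _"])
    then show ?thesis by (simp add: divide_inverse)
  qed
  from plane_dominated[OF m this] show "integrable lborel v" "v \<in> L2" by auto
qed

section \<open>Solutions in the interaction picture\<close>

lemma ift_evol:
  "ift (\<lambda>\<xi>. cis (- (t * (norm \<xi>)\<^sup>2)) * b \<xi>) x = evol b t x / complex_of_real ((2 * pi)\<^sup>2)"
proof -
  have "fourier (\<lambda>\<xi>. cis (- (t * (norm \<xi>)\<^sup>2)) * b \<xi>) (- x) = evol b t x"
    unfolding fourier_def evol_def
  proof (intro Bochner_Integration.integral_cong refl)
    fix \<xi>
    have "cis (- (t * (norm \<xi>)\<^sup>2)) * cis (- (\<xi> \<bullet> - x)) = cis (x \<bullet> \<xi> - t * (norm \<xi>)\<^sup>2)"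
      unfolding cis_mult by (simp add: inner_commute)
    then show "cis (- (t * (norm \<xi>)\<^sup>2)) * b \<xi> * cis (- (\<xi> \<bullet> - x)) = b \<xi> * cis (x \<bullet> \<xi> - t * (norm \<xi>)\<^sup>2)"
      by (simp only: mult.assoc mult.left_commute)
  qed
  then show ?thesis by (simp add: ift_def)
qed

lemma L2_cis_mult:
  assumes "f \<in> L2" "g \<in> borel_measurable borel"
  shows "(\<lambda>\<xi>. cis (g \<xi>) * f \<xi>) \<in> L2"
  using assms by (intro L2_mult[where C = 1]) auto

lemma Lpow_cis_mult: "Lpow p (\<lambda>\<xi>. cis (g \<xi>) * f \<xi>) = Lpow p f"
  by (simp add: Lpow_def norm_mult)

text \<open>The bridge from the propagator, which only sees L2 classes, to the wave integral, which
  needs an integrable amplitude.\<close>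

lemma schrodinger_eq_evol:
  assumes f: "f \<in> L2" and b: "b \<in> L2" "integrable lborel b" and fb: "AE \<xi> in lborel. fourier_L2 f \<xi> = b \<xi>"
  shows "AE x in lborel. schrodinger t f x = evol b t x / complex_of_real ((2 * pi)\<^sup>2)"
proof -
  have "schrodinger t f = inv_fourier_L2 (\<lambda>\<xi>. cis (- (t * (norm \<xi>)\<^sup>2)) * b \<xi>)"
    unfolding schrodinger_def multiplier_def using fb
    by (intro inv_fourier_L2_cong L2_cis_mult fourier_L2_spec f b) (auto elim!: eventually_mono)
  moreover have "AE x in lborel. inv_fourier_L2 (\<lambda>\<xi>. cis (- (t * (norm \<xi>)\<^sup>2)) * b \<xi>) x = ift (\<lambda>\<xi>. cis (- (t * (norm \<xi>)\<^sup>2)) * b \<xi>) x"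
    using b by (intro inv_fourier_L2_eq_ift L2_cis_mult) auto
  ultimately show ?thesis by (simp add: ift_evol)
qed

text \<open>Convolution with the heat kernel multiplies the transform by a Gaussian, and this makes
  the amplitude integrable, as \<open>strichartz_evol\<close> requires.\<close>

lemma fourier_L2_conv_heat:
  assumes h: "h \<in> L2" "integrable lborel h" and e: "0 < e"
  defines "b \<equiv> \<lambda>\<xi>. gauss e \<xi> * fourier h \<xi>"
  shows "b \<in> L2" "integrable lborel b" "AE \<xi> in lborel. fourier_L2 (conv_heat e h) \<xi> = b \<xi>"
    "Lpow 2 b \<le> ennreal ((2 * pi)\<^sup>2) * Lpow 2 h"
proof -
  have [measurable]: "h \<in> borel_measurable borel" using h by auto
  show b: "b \<in> L2"
    unfolding b_def using e norm_gauss_le[of e] by (intro L2_mult[OF fourier_L2_mem[OF h(2,1)], where C = 1]) auto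
  show bi: "integrable lborel b"
  proof (rule Bochner_Integration.integrable_bound)
    show "integrable lborel (\<lambda>x. complex_of_real (LINT x|lborel. cmod (h x)) * gauss e x)"
      using integrable_gauss[OF e] by simp
    show "AE x in lborel. cmod (b x) \<le> cmod (complex_of_real (LINT x|lborel. cmod (h x)) * gauss e x)"
    proof (rule AE_I2)
      fix x
      have "cmod (gauss e x) * cmod (fourier h x) \<le> cmod (gauss e x) * (LINT x|lborel. cmod (h x))"
        by (intro mult_left_mono fourier_bound h) auto
      then show "cmod (b x) \<le> cmod (complex_of_real (LINT x|lborel. cmod (h x)) * gauss e x)"
        using order_trans[OF norm_ge_zero fourier_bound[OF h(2), of x]]
        unfolding b_def norm_mult norm_of_real by (simp add: mult.commute)
    qed
  qed (simp add: b_def)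
  have "conv_heat e h x = ift b x" for x
  proof -
    have "fourier (\<lambda>x. gauss e x * fourier h (- x)) x = fourier b (- x)"
      unfolding fourier_def[of "\<lambda>x. gauss e x * fourier h (- x)"] fourier_def[of b]
      using integral_lborel_reflect[of "\<lambda>y. b y * cis (- (y \<bullet> (- x)))" 0]
      by (simp add: b_def gauss_def)
    then show ?thesis
      using fourier_gauss_fourier[OF e h(2), of x] by (simp add: ift_def eq_divide_eq mult.commute)
  qed
  then have "AE x in lborel. conv_heat e h x = inv_fourier_L2 b x"
    using inv_fourier_L2_eq_ift[OF b bi] by (auto elim!: eventually_mono)
  then have "fourier_L2 (conv_heat e h) = fourier_L2 (inv_fourier_L2 b)"
    by (intro fourier_L2_cong inv_fourier_L2_mem b inversion_integrable(4) h e)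
  then show "AE \<xi> in lborel. fourier_L2 (conv_heat e h) \<xi> = b \<xi>"
    using fourier_L2_inv_fourier_L2[OF b] by simp
  have "Lpow 2 b \<le> Lpow 2 (fourier h)"
    unfolding b_def using e norm_gauss_le[of e] by (intro Lpow_mono) (auto simp: norm_mult mult_left_le_one_le)
  also have "\<dots> \<le> ennreal ((2 * pi)\<^sup>2) * Lpow 2 h" by (rule bessel_plane[OF h(2)])
  finally show "Lpow 2 b \<le> ennreal ((2 * pi)\<^sup>2) * Lpow 2 h" .
qed

text \<open>The witness n records that the norm is measurable in t. The definition of
  \<open>schrodinger\<close> does not show this, since a representative is chosen separately at each
  time.\<close>

lemma strichartz_conv_heat:
  assumes h: "h \<in> L2" "integrable lborel h" and e: "0 < e"
  shows "\<exists>n\<in>borel_measurable borel. (\<forall>t. Lpow 4 (schrodinger (t - s) (conv_heat e h)) = n t) \<and>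
     (\<integral>\<^sup>+ t. n t \<partial>lborel) \<le> (Lpow 2 h)\<^sup>2"
proof -
  define b where "b = (\<lambda>\<xi>. gauss e \<xi> * fourier h \<xi>)"
  have bb: "b \<in> L2" "integrable lborel b" "AE \<xi> in lborel. fourier_L2 (conv_heat e h) \<xi> = b \<xi>"
    "Lpow 2 b \<le> ennreal ((2 * pi)\<^sup>2) * Lpow 2 h"
    unfolding b_def by (rule fourier_L2_conv_heat[OF h e])+
  have [measurable]: "b \<in> borel_measurable borel" using bb(2) by auto
  define c where "c = 1 / complex_of_real ((2 * pi)\<^sup>2)"
  have cn: "cmod c = 1 / (2 * pi)\<^sup>2" unfolding c_def norm_divide norm_of_real by simp
  define n where "n = (\<lambda>t. ennreal (cmod c ^ 4) * Lpow 4 (evol b (t - s)))"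
  have n0 [measurable]: "(\<lambda>t. Lpow 4 (evol b t)) \<in> borel_measurable borel"
    unfolding Lpow_def by measurable
  have "Lpow 4 (schrodinger (t - s) (conv_heat e h)) = n t" for t
  proof -
    have "Lpow 4 (schrodinger (t - s) (conv_heat e h)) = Lpow 4 (\<lambda>x. c * evol b (t - s) x)"
      using schrodinger_eq_evol[OF inversion_integrable(4)[OF h e] bb(1,2,3), of "t - s"]
      by (intro Lpow_cong_AE) (auto elim!: eventually_mono simp: c_def)
    then show ?thesis unfolding n_def by (subst (asm) Lpow_cmult) auto
  qed
  moreover have "(\<integral>\<^sup>+ t. n t \<partial>lborel) \<le> (Lpow 2 h)\<^sup>2"
  proof -
    have "(\<integral>\<^sup>+ t. n t \<partial>lborel) = ennreal (cmod c ^ 4) * (\<integral>\<^sup>+ t. Lpow 4 (evol b t) \<partial>lborel)"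
      unfolding n_def using nn_integral_lborel_translate[OF n0, of "- s"]
      by (subst nn_integral_cmult) auto
    also have "\<dots> \<le> ennreal (cmod c ^ 4) * (ennreal (8 * pi ^ 4) * (ennreal ((2 * pi)\<^sup>2) * Lpow 2 h)\<^sup>2)"
      by (intro mult_left_mono order_trans[OF strichartz_evol[OF bb(2)]] power_mono bb(4)) auto
    also have "\<dots> = ennreal (cmod c ^ 4 * (8 * pi ^ 4 * ((2 * pi)\<^sup>2)\<^sup>2)) * (Lpow 2 h)\<^sup>2"
      unfolding power_mult_distrib[of "ennreal _"] ennreal_power[OF zero_le_power2]
      by (subst ennreal_mult, simp, simp, subst ennreal_mult, simp, simp, simp only: mult.assoc)
    also have "\<dots> \<le> 1 * (Lpow 2 h)\<^sup>2"
    proof (rule mult_right_mono)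
      \<comment> \<open>The factors (2 pi)^-8 of the inverse transforms, 8 pi^4 of Strichartz and (2
        pi)^4 of Bessel multiply to 1 / 2.\<close>
      have "cmod c ^ 4 * (8 * pi ^ 4 * ((2 * pi)\<^sup>2)\<^sup>2) = 1 / 2"
        unfolding cn using pi_gt_zero
        by (simp add: power_divide power_mult_distrib field_simps flip: power_mult power_add)
      then show "ennreal (cmod c ^ 4 * (8 * pi ^ 4 * ((2 * pi)\<^sup>2)\<^sup>2)) \<le> 1"
        using ennreal_leI[of "1 / 2" 1] by simp
    qed simp
    finally show ?thesis by simp
  qed
  moreover have "n \<in> borel_measurable borel" unfolding n_def by measurable
  ultimately show ?thesis by blast
qed

section \<open>The nonlinearity paired with a test function\<close>

text \<open>Two completed squares, the first for V against u g / \<delta>, the second for u^2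
  against (g / \<delta>)^2: their mixed terms u^2 g^2 / \<delta> cancel.\<close>

lemma young_three:
  fixes V u g :: real
  assumes "0 < \<delta>" "0 \<le> V" "0 \<le> u" "0 \<le> g"
  shows "V * u * g \<le> \<delta> * V\<^sup>2 + \<delta> * u ^ 4 + g ^ 4 / \<delta> ^ 3"
proof -
  define Z where "Z = g ^ 4 / \<delta> ^ 3"
  have "0 \<le> \<delta> * (V - u * g / \<delta>)\<^sup>2 + \<delta> * (u\<^sup>2 - (g / \<delta>)\<^sup>2)\<^sup>2 / 2"
    using assms by (intro add_nonneg_nonneg) auto
  also have "\<dots> = \<delta> * V\<^sup>2 - 2 * (V * u * g) + \<delta> * u ^ 4 / 2 + Z / 2"
    using assms(1) by (simp add: Z_def power2_eq_square power4_eq_xxxx power3_eq_cube field_simps)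
  finally have 1: "2 * (V * u * g) \<le> \<delta> * V\<^sup>2 + \<delta> * u ^ 4 / 2 + Z / 2" by simp
  have "0 \<le> \<delta> * V\<^sup>2" "0 \<le> \<delta> * u ^ 4" "0 \<le> Z" using assms by (auto simp: Z_def)
  with 1 have "V * u * g \<le> \<delta> * V\<^sup>2 + \<delta> * u ^ 4 + Z" by linarith
  then show ?thesis by (simp add: Z_def)
qed

lemma E_op_bound:
  assumes "f \<in> L2"
  shows "E_op f \<in> L2" "Lpow 2 (E_op f) \<le> ennreal (16 * pi\<^sup>2) * Lpow 2 f"
proof -
  \<comment> \<open>At the origin the symbol is 0 / 0, which is 0 here.\<close>
  have "cmod (complex_of_real ((\<xi> $ 1)\<^sup>2 / (norm \<xi>)\<^sup>2)) \<le> 1" for \<xi> :: plane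
    unfolding norm_of_real pl_norm_sq by (auto simp: divide_le_eq_1 add_nonneg_pos sum_power2_gt_zero_iff)
  then show "E_op f \<in> L2" "Lpow 2 (E_op f) \<le> ennreal (16 * pi\<^sup>2) * Lpow 2 f"
    unfolding E_op_def using multiplier_props[OF assms, of "\<lambda>\<xi>. complex_of_real ((\<xi> $ 1)\<^sup>2 / (norm \<xi>)\<^sup>2)"]
    by auto
qed

text \<open>Bounds \<open>1 + Lpow 2 V / Lpow 4 f\<close> for the potential \<open>V = \<mu> |f|\<^sup>2 -
  \<E>(|f|\<^sup>2)\<close>.\<close>

definition nonlin_const :: real where "nonlin_const = 3 + 32 * pi\<^sup>2"

lemma nonlin_const_pos: "0 < nonlin_const" by (simp add: nonlin_const_def add_pos_nonneg)

text \<open>When \<open>Lpow 4 f\<close> is finite, |f|^2 lies in L2 and the potential is bounded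
  there, so Young's inequality applies to one L2 and two L4 factors. Otherwise the right side is
  infinite. The parameter \<delta> stays free until it is optimised over the whole time
  interval.\<close>

lemma nonlin_pairing:
  assumes f: "f \<in> L2" and g [measurable]: "g \<in> borel_measurable borel" and mu: "\<bar>\<mu>\<bar> \<le> 1" and \<delta>: "0 < \<delta>"
  shows "ennreal (cmod (LINT x|lborel. nonlin \<mu> f x * cnj (g x)))
     \<le> ennreal (\<delta> * nonlin_const) * Lpow 4 f + ennreal (1 / \<delta> ^ 3) * Lpow 4 g"
proof (cases "Lpow 4 f = \<infinity>")
  case True
  then show ?thesis using \<delta> nonlin_const_pos by (simp add: ennreal_mult_top)
next
  case False
  have [measurable]: "f \<in> borel_measurable borel" using L2D[OF f] by simp
  define s where "s = (\<lambda>x. complex_of_real ((cmod (f x))\<^sup>2))"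
  have [measurable]: "s \<in> borel_measurable borel" unfolding s_def by measurable
  have sL: "Lpow 2 s = Lpow 4 f"
    unfolding Lpow_def s_def norm_of_real by (simp flip: power_mult)
  then have s: "s \<in> L2" using False by (intro L2I) (auto simp: top.not_eq_extremum)
  note E = E_op_bound[OF s]
  have [measurable]: "E_op s \<in> borel_measurable borel" using L2D[OF E(1)] by simp
  define V where "V = (\<lambda>x. complex_of_real \<mu> * s x - E_op s x)"
  have [measurable]: "V \<in> borel_measurable borel" unfolding V_def by measurable
  have VL: "Lpow 2 V \<le> ennreal (nonlin_const - 1) * Lpow 4 f"
  proof -
    have "Lpow 2 V \<le> 2 * Lpow 2 (\<lambda>x. complex_of_real \<mu> * s x) + 2 * Lpow 2 (E_op s)"
      unfolding V_def by (rule Lpow2_diff) measurable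
    also have "\<dots> \<le> 2 * Lpow 2 s + 2 * (ennreal (16 * pi\<^sup>2) * Lpow 2 s)"
      using mu by (intro add_mono mult_left_mono Lpow_mono E) (auto simp: norm_mult mult_left_le_one_le)
    also have "\<dots> = ennreal (2 + 2 * (16 * pi\<^sup>2)) * Lpow 4 f"
      unfolding sL by (subst ennreal_plus, simp, simp, subst ennreal_mult, simp, simp)
        (simp add: distrib_right mult.assoc)
    finally show ?thesis by (simp add: nonlin_const_def)
  qed
  have "ennreal (cmod (LINT x|lborel. nonlin \<mu> f x * cnj (g x)))
      \<le> (\<integral>\<^sup>+ x. ennreal (cmod (nonlin \<mu> f x * cnj (g x))) \<partial>lborel)"
    by (rule norm_integral_le_nn)
  also have "\<dots> \<le> (\<integral>\<^sup>+ x. (ennreal \<delta> * ennreal (cmod (V x) ^ 2) + ennreal \<delta> * ennreal (cmod (f x) ^ 4)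
       + ennreal (1 / \<delta> ^ 3) * ennreal (cmod (g x) ^ 4)) \<partial>lborel)"
  proof (rule nn_integral_mono)
    fix x
    have "nonlin \<mu> f x = V x * f x"
      by (simp add: nonlin_def V_def s_def)
    then have "cmod (nonlin \<mu> f x * cnj (g x)) = cmod (V x) * cmod (f x) * cmod (g x)"
      by (simp add: norm_mult)
    also have "\<dots> \<le> \<delta> * (cmod (V x))\<^sup>2 + \<delta> * cmod (f x) ^ 4 + cmod (g x) ^ 4 / \<delta> ^ 3"
      by (rule young_three[OF \<delta>]) auto
    finally have "ennreal (cmod (nonlin \<mu> f x * cnj (g x)))
       \<le> ennreal (\<delta> * (cmod (V x))\<^sup>2 + \<delta> * cmod (f x) ^ 4 + 1 / \<delta> ^ 3 * cmod (g x) ^ 4)"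
      by (intro ennreal_leI) simp
    also have "\<dots> = ennreal \<delta> * ennreal (cmod (V x) ^ 2) + ennreal \<delta> * ennreal (cmod (f x) ^ 4)
       + ennreal (1 / \<delta> ^ 3) * ennreal (cmod (g x) ^ 4)"
      using \<delta> by (simp only: ennreal_mult[symmetric] ennreal_plus[symmetric] less_imp_le zero_le_power norm_ge_zero
          mult_nonneg_nonneg add_nonneg_nonneg zero_le_divide_1_iff)
    finally show "ennreal (cmod (nonlin \<mu> f x * cnj (g x)))
       \<le> ennreal \<delta> * ennreal (cmod (V x) ^ 2) + ennreal \<delta> * ennreal (cmod (f x) ^ 4)
       + ennreal (1 / \<delta> ^ 3) * ennreal (cmod (g x) ^ 4)" .
  qed
  also have "\<dots> = ennreal \<delta> * Lpow 2 V + ennreal \<delta> * Lpow 4 f + ennreal (1 / \<delta> ^ 3) * Lpow 4 g"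
    unfolding Lpow_def by (simp add: nn_integral_add nn_integral_cmult)
  also have "\<dots> \<le> ennreal \<delta> * (ennreal (nonlin_const - 1) * Lpow 4 f) + ennreal \<delta> * Lpow 4 f + ennreal (1 / \<delta> ^ 3) * Lpow 4 g"
    by (intro add_mono mult_left_mono VL order_refl) auto
  also have "ennreal \<delta> * (ennreal (nonlin_const - 1) * Lpow 4 f) + ennreal \<delta> * Lpow 4 f = ennreal (\<delta> * nonlin_const) * Lpow 4 f"
  proof -
    have "ennreal (\<delta> * nonlin_const) = ennreal (\<delta> * (nonlin_const - 1) + \<delta>)" by (simp add: algebra_simps)
    also have "\<dots> = ennreal \<delta> * ennreal (nonlin_const - 1) + ennreal \<delta>"
      using \<delta> by (subst ennreal_plus) (auto simp: nonlin_const_def ennreal_mult)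
    finally show ?thesis by (simp only: distrib_right mult.assoc)
  qed
  finally show ?thesis .
qed

section \<open>Duhamel's formula and the increments of a solution\<close>

lemma solution_L4_measurable:
  assumes sol: "solution \<mu> I u"
  shows "(\<lambda>t. Lpow 4 (u t) * indicator I t) \<in> borel_measurable borel"
proof -
  have m: "(\<lambda>z. indicator (I \<times> UNIV) z *\<^sub>R (case z of (t, x) \<Rightarrow> u t x)) \<in> borel_measurable (lborel :: (real \<times> plane) measure)"
    using sol unfolding solution_def set_borel_measurable_def by blast
  have "(\<lambda>z. indicator (I \<times> UNIV) z *\<^sub>R (case z of (t, x) \<Rightarrow> u t x)) \<in> borel_measurable (lborel \<Otimes>\<^sub>M (lborel :: plane measure))"
    using m by (simp add: lborel_prod)
  then have "(\<lambda>z. ennreal (cmod (indicator (I \<times> UNIV) z *\<^sub>R (case z of (t, x) \<Rightarrow> u t x)) ^ 4)) \<in> borel_measurable (lborel \<Otimes>\<^sub>M (lborel :: plane measure))"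
    by measurable
  then have "(\<lambda>t. \<integral>\<^sup>+ x. ennreal (cmod (indicator (I \<times> UNIV) (t, x) *\<^sub>R u t x) ^ 4) \<partial>lborel) \<in> borel_measurable lborel"
    using lborel.borel_measurable_nn_integral_fst by fastforce
  moreover have "(\<lambda>t. \<integral>\<^sup>+ x. ennreal (cmod (indicator (I \<times> UNIV) (t, x) *\<^sub>R u t x) ^ 4) \<partial>lborel)
     = (\<lambda>t. Lpow 4 (u t) * indicator I t)"
    by (auto simp: fun_eq_iff Lpow_def indicator_def)
  ultimately show ?thesis by simp
qed

text \<open>Duhamel terms can be tested only against Schwartz functions, hence the Gaussian regularisation
  of the truncated \<open>w\<close>; the exponent \<open>3\<close> comes from optimising
  \<open>\<delta>\<close> in Young's inequality.\<close>

lemma duhamel_bound: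
  assumes sol: "solution \<mu> I u" and mu: "\<bar>\<mu>\<bar> \<le> 1" and t: "t0 \<in> I" "t1 \<in> I" "t0 \<le> t1"
    and w: "duhamel_integral \<mu> u t0 t1 w"
  shows "(Lpow 2 w)\<^sup>2 \<le> ennreal (16 * nonlin_const ^ 3) * (Lpow_st 4 {t0..t1} u) ^ 3"
proof -
  have wL: "w \<in> L2" using w by (simp add: duhamel_integral_def)
  have [measurable]: "w \<in> borel_measurable borel" using L2D[OF wL] by simp
  have int: "is_interval I" and uL: "\<And>t. t \<in> I \<Longrightarrow> u t \<in> L2"
    and fin: "\<And>K. compact K \<Longrightarrow> K \<subseteq> I \<Longrightarrow> Lpow_st 4 K u < \<infinity>"
    using sol unfolding solution_def by blast+
  have sub: "{t0..t1} \<subseteq> I"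
    using mem_is_interval_1_I[OF int t(1,2)] by auto
  define A where "A = Lpow_st 4 {t0..t1} u"
  have Af: "A < \<infinity>" unfolding A_def by (rule fin[OF _ sub]) simp
  define m where "m = (\<lambda>t. Lpow 4 (u t) * indicator {t0..t1} t)"
  have m [measurable]: "m \<in> borel_measurable borel"
  proof -
    have "m = (\<lambda>t. (Lpow 4 (u t) * indicator I t) * indicator {t0..t1} t)"
      using sub by (auto simp: m_def fun_eq_iff indicator_def)
    then show ?thesis using solution_L4_measurable[OF sol] by simp
  qed
  have Am: "A = (\<integral>\<^sup>+ t. m t \<partial>lborel)" by (simp add: A_def Lpow_st_def m_def)
  have key: "(Lpow 2 (trunc R w))\<^sup>2 \<le> ennreal (16 * nonlin_const ^ 3) * A ^ 3" if R: "0 \<le> R" for R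
  proof -
    define h where "h = trunc R w"
    have h: "h \<in> L2" "integrable lborel h" unfolding h_def by (rule trunc_L2[OF wL] trunc_integrable[OF wL])+
    have [measurable]: "h \<in> borel_measurable borel" using h by auto
    have supp: "R < norm y \<Longrightarrow> h y = 0" for y by (simp add: h_def trunc_def)
    define W where "W = enn2real (Lpow 2 h)"
    have W: "Lpow 2 h = ennreal W" "0 \<le> W" using L2D[OF h(1)] by (auto simp: W_def)
    have bd: "ennreal (cmod (LINT x|lborel. w x * cnj (conv_heat e h x)))
        \<le> ennreal (\<delta> * nonlin_const) * A + ennreal (1 / \<delta> ^ 3 * W\<^sup>2)" if e: "0 < e" and \<delta>: "0 < \<delta>" for e \<delta>
    proof -
      define g where "g = conv_heat e h"
      have gS: "g \<in> schwartz" unfolding g_def by (rule conv_heat_schwartz[OF e h(2) supp R])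
      have gL: "g \<in> L2" unfolding g_def by (rule inversion_integrable(4)[OF h e])
      obtain n where n [measurable]: "n \<in> borel_measurable borel"
        and nt: "\<And>t. Lpow 4 (schrodinger (t - t1) g) = n t" and nb: "(\<integral>\<^sup>+ t. n t \<partial>lborel) \<le> (Lpow 2 h)\<^sup>2"
        using strichartz_conv_heat[OF h e, of t1] unfolding g_def by blast
      have sm: "schrodinger t g \<in> borel_measurable borel" for t
        unfolding schrodinger_def by (rule L2D(1), rule multiplier_props(1)[OF gL]) auto
      have "(LINT x|lborel. w x * cnj (g x)) = (LBINT t=ereal t0..ereal t1.
           (LINT x|lborel. nonlin \<mu> (u t) x * cnj (schrodinger (t - t1) g x)))"
        using w gS unfolding duhamel_integral_def by blast
      also have "\<dots> = (LINT t|lborel. indicator {t0<..<t1} t *\<^sub>R (LINT x|lborel. nonlin \<mu> (u t) x * cnj (schrodinger (t - t1) g x)))"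
        using t by (simp add: interval_lebesgue_integral_def set_lebesgue_integral_def einterval_eq)
      finally have "ennreal (cmod (LINT x|lborel. w x * cnj (g x)))
         \<le> (\<integral>\<^sup>+ t. ennreal (cmod (indicator {t0<..<t1} t *\<^sub>R (LINT x|lborel. nonlin \<mu> (u t) x * cnj (schrodinger (t - t1) g x)))) \<partial>lborel)"
        by (simp only: norm_integral_le_nn)
      also have "\<dots> \<le> (\<integral>\<^sup>+ t. (ennreal (\<delta> * nonlin_const) * m t + ennreal (1 / \<delta> ^ 3) * n t) \<partial>lborel)"
      proof (rule nn_integral_mono)
        fix t
        show "ennreal (cmod (indicator {t0<..<t1} t *\<^sub>R (LINT x|lborel. nonlin \<mu> (u t) x * cnj (schrodinger (t - t1) g x))))
          \<le> ennreal (\<delta> * nonlin_const) * m t + ennreal (1 / \<delta> ^ 3) * n t"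
        proof (cases "t \<in> {t0<..<t1}")
          case True
          then have "t \<in> I" using sub by auto
          from nonlin_pairing[OF uL[OF this] sm[of "t - t1"] mu \<delta>] show ?thesis
            using True by (simp add: m_def nt)
        qed simp
      qed
      also have "\<dots> = ennreal (\<delta> * nonlin_const) * A + ennreal (1 / \<delta> ^ 3) * (\<integral>\<^sup>+ t. n t \<partial>lborel)"
        unfolding Am by (simp add: nn_integral_add nn_integral_cmult)
      also have "\<dots> \<le> ennreal (\<delta> * nonlin_const) * A + ennreal (1 / \<delta> ^ 3) * (Lpow 2 h)\<^sup>2"
        by (intro add_mono mult_left_mono nb order_refl) auto
      also have "ennreal (1 / \<delta> ^ 3) * (Lpow 2 h)\<^sup>2 = ennreal (1 / \<delta> ^ 3 * W\<^sup>2)"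
        using \<delta> W by (subst ennreal_mult) (auto simp: ennreal_power)
      finally show ?thesis unfolding g_def .
    qed
    define a where "a = enn2real A"
    have a: "A = ennreal a" "0 \<le> a" using Af by (auto simp: a_def)
    have bd': "cmod (LINT x|lborel. w x * cnj (conv_heat e h x)) \<le> \<delta> * nonlin_const * a + W\<^sup>2 / \<delta> ^ 3"
      if "0 < e" "0 < \<delta>" for e \<delta>
    proof -
      have "ennreal (cmod (LINT x|lborel. w x * cnj (conv_heat e h x))) \<le> ennreal (\<delta> * nonlin_const * a + 1 / \<delta> ^ 3 * W\<^sup>2)"
        using bd[OF that] that nonlin_const_pos a by (simp add: ennreal_mult ennreal_plus)
      then show ?thesis
        using that nonlin_const_pos a by (subst (asm) ennreal_le_iff) auto
    qed
    \<comment> \<open>The bound is available only for smoothed test functions. Smoothing converges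
      in L2 and pairing with w is continuous there, so the limit is the pairing of w with its own
      truncation h.\<close>
    have lim: "(\<lambda>n. LINT x|lborel. w x * cnj (conv_heat (1 / real (Suc n)) h x)) \<longlonglongrightarrow> (LINT x|lborel. w x * cnj (h x))"
    proof -
      have wi: "integrable lborel (\<lambda>x. w x * cnj (f x))" if f: "f \<in> L2" for f
      proof (rule integrableI_bounded)
        have [measurable]: "f \<in> borel_measurable borel" using L2D[OF f] by simp
        show "(\<lambda>x. w x * cnj (f x)) \<in> borel_measurable lborel" by measurable
        have "(\<integral>\<^sup>+ x. ennreal (norm (w x * cnj (f x))) \<partial>lborel) \<le> (\<integral>\<^sup>+ x. (ennreal ((cmod (w x))\<^sup>2) + ennreal ((cmod (f x))\<^sup>2)) \<partial>lborel)"
        proof (rule nn_integral_mono)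
          fix x
          have "cmod (w x) * cmod (f x) \<le> (cmod (w x))\<^sup>2 + (cmod (f x))\<^sup>2"
            using sum_squares_bound[of "cmod (w x)" "cmod (f x)"]
              mult_nonneg_nonneg[OF norm_ge_zero[of "w x"] norm_ge_zero[of "f x"]] by linarith
          then show "ennreal (norm (w x * cnj (f x))) \<le> ennreal ((cmod (w x))\<^sup>2) + ennreal ((cmod (f x))\<^sup>2)"
            by (simp add: norm_mult ennreal_plus[symmetric] ennreal_leI del: ennreal_plus)
        qed
        also have "\<dots> = Lpow 2 w + Lpow 2 f" unfolding Lpow_def by (rule nn_integral_add) measurable
        also have "\<dots> < \<infinity>" using L2D[OF wL] L2D[OF f] by simp
        finally show "(\<integral>\<^sup>+ x. ennreal (norm (w x * cnj (f x))) \<partial>lborel) < \<infinity>" .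
      qed
      define D where "D = (\<lambda>n. (LINT x|lborel. w x * cnj (conv_heat (1 / real (Suc n)) h x)) - (LINT x|lborel. w x * cnj (h x)))"
      have cL: "conv_heat (1 / real (Suc n)) h \<in> L2" for n by (rule inversion_integrable(4)[OF h]) simp
      have "(\<lambda>n. (ennreal (cmod (D n)))\<^sup>2) \<longlonglongrightarrow> 0"
      proof (rule tendsto_0_ennreal_bound1[OF _ inversion_integrable(3)[OF h]])
        fix n
        have "D n = (LINT x|lborel. w x * cnj (conv_heat (1 / real (Suc n)) h x - h x))"
          unfolding D_def complex_cnj_diff right_diff_distrib
          by (rule Bochner_Integration.integral_diff[symmetric]) (intro wi cL h)+
        then have "(ennreal (cmod (D n)))\<^sup>2 \<le> Lpow 2 w * Lpow 2 (\<lambda>x. cnj (conv_heat (1 / real (Suc n)) h x - h x))"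
          using L2_pairing[of w "\<lambda>x. cnj (conv_heat (1 / real (Suc n)) h x - h x)"] by simp
        also have "Lpow 2 (\<lambda>x. cnj (conv_heat (1 / real (Suc n)) h x - h x)) = Lpow 2 (\<lambda>x. conv_heat (1 / real (Suc n)) h x - h x)"
          unfolding Lpow_def complex_mod_cnj ..
        also have "Lpow 2 w = ennreal (enn2real (Lpow 2 w))" using L2D[OF wL] by simp
        finally show "(ennreal (cmod (D n)))\<^sup>2 \<le> ennreal (enn2real (Lpow 2 w)) * Lpow 2 (\<lambda>x. conv_heat (1 / real (Suc n)) h x - h x)" .
      qed
      then have "(\<lambda>n. ennreal ((cmod (D n))\<^sup>2)) \<longlonglongrightarrow> ennreal 0" by (simp add: ennreal_power)
      then have "(\<lambda>n. (cmod (D n))\<^sup>2) \<longlonglongrightarrow> 0" by (subst (asm) tendsto_ennreal_iff) auto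
      then have "(\<lambda>n. sqrt ((cmod (D n))\<^sup>2)) \<longlonglongrightarrow> sqrt 0" by (rule tendsto_real_sqrt)
      then have "D \<longlonglongrightarrow> 0" by (simp add: tendsto_norm_zero_iff)
      then show ?thesis unfolding D_def by (rule LIM_zero_cancel)
    qed
    have wh: "(LINT x|lborel. w x * cnj (h x)) = complex_of_real W"
    proof -
      have "(LINT x|lborel. w x * cnj (h x)) = (LINT x|lborel. complex_of_real ((cmod (h x))\<^sup>2))"
        by (intro Bochner_Integration.integral_cong refl)
           (auto simp: h_def trunc_def indicator_def complex_norm_square simp del: of_real_power)
      also have "\<dots> = complex_of_real (LINT x|lborel. (cmod (h x))\<^sup>2)" by (rule integral_complex_of_real)
      also have "(LINT x|lborel. (cmod (h x))\<^sup>2) = W"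
        unfolding W_def Lpow_def by (rule integral_eq_nn_integral) auto
      finally show ?thesis .
    qed
    \<comment> \<open>Pairing w with h reproduces W on the left, while W^2 on the right comes from
      Strichartz for the test function.\<close>
    have WW: "W \<le> \<delta> * nonlin_const * a + W\<^sup>2 / \<delta> ^ 3" if "0 < \<delta>" for \<delta>
    proof -
      have "cmod (LINT x|lborel. w x * cnj (h x)) \<le> \<delta> * nonlin_const * a + W\<^sup>2 / \<delta> ^ 3"
        by (rule LIMSEQ_le_const2[OF tendsto_norm[OF lim]]) (use bd'[OF _ that] in auto)
      then show ?thesis using W(2) unfolding wh norm_of_real by simp
    qed
    have "W\<^sup>2 \<le> 16 * nonlin_const ^ 3 * a ^ 3"
    proof (cases "W = 0")
      case False
      then have Wp: "0 < W" using W(2) by simp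
      \<comment> \<open>With \<delta>^3 = 2 W the last term of \<open>WW\<close> is W / 2 and is
        absorbed. Cubing the rest gives W^3 / 8 <= 2 W (...), hence the factor 16.\<close>
      define \<delta> where "\<delta> = root 3 (2 * W)"
      have d: "0 < \<delta>" "\<delta> ^ 3 = 2 * W" using Wp by (auto simp: \<delta>_def)
      have "W\<^sup>2 / \<delta> ^ 3 = W / 2" using Wp unfolding d(2) by (simp add: power2_eq_square)
      then have "W / 2 \<le> \<delta> * nonlin_const * a" using WW[OF d(1)] by simp
      then have "(W / 2) ^ 3 \<le> (\<delta> * nonlin_const * a) ^ 3" using Wp by (intro power_mono) auto
      also have "\<dots> = 2 * W * (nonlin_const ^ 3 * a ^ 3)" by (simp only: power_mult_distrib d(2) mult.assoc)
      finally have "W * W\<^sup>2 \<le> W * (16 * nonlin_const ^ 3 * a ^ 3)"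
        by (simp add: power3_eq_cube power2_eq_square field_simps)
      then show ?thesis using Wp by simp
    qed (use a nonlin_const_pos in simp)
    then have "ennreal (W\<^sup>2) \<le> ennreal (16 * nonlin_const ^ 3 * a ^ 3)" by (rule ennreal_leI)
    then show ?thesis
      using a W nonlin_const_pos by (simp add: h_def[symmetric] ennreal_mult ennreal_power)
  qed
  define B where "B = ennreal (16 * nonlin_const ^ 3) * A ^ 3"
  have Bf: "B < \<infinity>"
    using Af by (auto simp: B_def ennreal_mult_less_top power_less_top_ennreal)
  \<comment> \<open>The bound is uniform in the truncation radius, so Fatou's lemma removes it; the
    real square root of B makes the bound linear in \<open>Lpow 2\<close> first.\<close>
  have "(Lpow 2 w)\<^sup>2 \<le> B"
  proof -
    have b: "Lpow 2 (trunc (real n) w) \<le> ennreal (sqrt (enn2real B))" for n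
    proof -
      define x where "x = enn2real (Lpow 2 (trunc (real n) w))"
      have x: "Lpow 2 (trunc (real n) w) = ennreal x" "0 \<le> x" using L2D[OF trunc_L2[OF wL]] by (auto simp: x_def)
      have "ennreal (x\<^sup>2) \<le> ennreal (enn2real B)"
        using key[of "real n"] Bf x by (simp add: B_def[symmetric] ennreal_power)
      then have "x\<^sup>2 \<le> enn2real B" by (subst (asm) ennreal_le_iff) auto
      then have "x \<le> sqrt (enn2real B)" by (rule real_le_rsqrt)
      then show ?thesis unfolding x by (rule ennreal_leI)
    qed
    have "Lpow 2 w \<le> liminf (\<lambda>n. Lpow 2 (trunc (real n) w))"
    proof (rule Lpow2_Fatou)
      show "AE x in lborel. (\<lambda>n. trunc (real n) w x) \<longlonglongrightarrow> w x"
      proof (intro AE_I2 tendsto_eventually)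
        fix x :: plane
        show "\<forall>\<^sub>F n in sequentially. trunc (real n) w x = w x"
          using eventually_ge_at_top[of "nat \<lceil>norm x\<rceil>"]
          by eventually_elim (auto simp: trunc_def indicator_def nat_ceiling_le_eq)
      qed
    qed auto
    also have "\<dots> \<le> ennreal (sqrt (enn2real B))"
      by (rule Liminf_le) (use b in auto)
    finally have "(Lpow 2 w)\<^sup>2 \<le> (ennreal (sqrt (enn2real B)))\<^sup>2" by (rule power_mono) simp
    also have "\<dots> = B" using Bf by (simp add: ennreal_power)
    finally show ?thesis .
  qed
  then show ?thesis by (simp add: A_def B_def)
qed

text \<open>The phase undoes the symbol of \<open>schrodinger\<close>, so a free solution has a
  profile that is constant in t almost everywhere.\<close>

definition profile :: "(real \<Rightarrow> plane \<Rightarrow> complex) \<Rightarrow> real \<Rightarrow> plane \<Rightarrow> complex" where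
  "profile u t \<xi> = cis (t * (norm \<xi>)\<^sup>2) * fourier_L2 (u t) \<xi>"

text \<open>By Duhamel's formula the free part of \<open>u t1\<close> has the profile of
  \<open>u t0\<close>, so the increment is the transform of the Duhamel term w up to a factor of
  modulus 1.\<close>

lemma solution_increment:
  assumes sol: "solution \<mu> I u" and mu: "\<bar>\<mu>\<bar> \<le> 1" and t: "t0 \<in> I" "t1 \<in> I" "t0 \<le> t1"
  shows "(Lpow 2 (\<lambda>\<xi>. profile u t1 \<xi> - profile u t0 \<xi>))\<^sup>2
     \<le> ennreal ((16 * pi\<^sup>2)\<^sup>2 * (16 * nonlin_const ^ 3)) * (Lpow_st 4 {t0..t1} u) ^ 3"
proof -
  obtain w where w: "duhamel_integral \<mu> u t0 t1 w"
    and eq: "AE x in lborel. u t1 x = schrodinger (t1 - t0) (u t0) x - \<i> * w x"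
    using sol t unfolding solution_def by blast
  have uL: "u t0 \<in> L2" "u t1 \<in> L2" using sol t unfolding solution_def by blast+
  have wL: "w \<in> L2" using w by (simp add: duhamel_integral_def)
  define S where "S = schrodinger (t1 - t0) (u t0)"
  have SL: "S \<in> L2" and SF: "AE \<xi> in lborel. fourier_L2 S \<xi> = cis (- ((t1 - t0) * (norm \<xi>)\<^sup>2)) * fourier_L2 (u t0) \<xi>"
    unfolding S_def schrodinger_def by (rule multiplier_props[OF uL(1)]; simp)+
  have "fourier_L2 (u t1) = fourier_L2 (\<lambda>x. S x - \<i> * w x)"
    using eq by (intro fourier_L2_cong L2_diff L2_cmult SL wL uL) (simp add: S_def)
  then have F1: "AE \<xi> in lborel. fourier_L2 (u t1) \<xi> = fourier_L2 S \<xi> - fourier_L2 (\<lambda>x. \<i> * w x) \<xi>"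
    using fourier_L2_diff[OF SL L2_cmult[OF wL, of "\<i>"]] by simp
  have F2: "AE \<xi> in lborel. fourier_L2 (\<lambda>x. \<i> * w x) \<xi> = \<i> * fourier_L2 w \<xi>"
    by (rule fourier_L2_cmult[OF wL])
  from F1 F2 SF have "AE \<xi> in lborel. profile u t1 \<xi> - profile u t0 \<xi> = cis (t1 * (norm \<xi>)\<^sup>2) * ((- \<i>) * fourier_L2 w \<xi>)"
  proof eventually_elim
    case (elim \<xi>)
    have c: "cis (t1 * (norm \<xi>)\<^sup>2) * cis (- ((t1 - t0) * (norm \<xi>)\<^sup>2)) = cis (t0 * (norm \<xi>)\<^sup>2)"
      unfolding cis_mult by (simp add: algebra_simps)
    show ?case
      unfolding profile_def elim c[symmetric] by (simp only: right_diff_distrib mult.assoc) simp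
  qed
  then have "Lpow 2 (\<lambda>\<xi>. profile u t1 \<xi> - profile u t0 \<xi>) = Lpow 2 (\<lambda>\<xi>. cis (t1 * (norm \<xi>)\<^sup>2) * ((- \<i>) * fourier_L2 w \<xi>))"
    by (rule Lpow_cong_AE)
  also have "\<dots> = Lpow 2 (fourier_L2 w)" by (simp add: Lpow_def norm_mult)
  also have "\<dots> \<le> ennreal (16 * pi\<^sup>2) * Lpow 2 w" by (rule fourier_L2_bound[OF wL])
  finally have "(Lpow 2 (\<lambda>\<xi>. profile u t1 \<xi> - profile u t0 \<xi>))\<^sup>2 \<le> (ennreal (16 * pi\<^sup>2) * Lpow 2 w)\<^sup>2"
    by (rule power_mono) simp
  also have "\<dots> = ennreal ((16 * pi\<^sup>2)\<^sup>2) * (Lpow 2 w)\<^sup>2"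
    unfolding power_mult_distrib[of "ennreal _"] by (subst ennreal_power) auto
  also have "\<dots> \<le> ennreal ((16 * pi\<^sup>2)\<^sup>2) * (ennreal (16 * nonlin_const ^ 3) * (Lpow_st 4 {t0..t1} u) ^ 3)"
    by (intro mult_left_mono duhamel_bound[OF sol mu t w]) auto
  also have "\<dots> = ennreal ((16 * pi\<^sup>2)\<^sup>2 * (16 * nonlin_const ^ 3)) * (Lpow_st 4 {t0..t1} u) ^ 3"
    using nonlin_const_pos by (subst ennreal_mult) (auto simp: mult.assoc)
  finally show ?thesis .
qed

section \<open>Convolution kernels of the cutoffs\<close>

lemma compact_support_dominated:
  fixes f :: "plane \<Rightarrow> complex"
  assumes c: "continuous_on UNIV f" and z: "\<And>x. 2 < norm x \<Longrightarrow> f x = 0"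
  shows "integrable lborel f" "f \<in> L2"
proof -
  have m: "f \<in> borel_measurable borel" by (rule borel_measurable_continuous_onI[OF c])
  define F where "F = (\<lambda>x. cmod (f x) * ((1 + (x $ 1)\<^sup>2) * (1 + (x $ 2)\<^sup>2)))"
  have "continuous_on (cball 0 2) F"
    unfolding F_def by (intro continuous_intros continuous_on_subset[OF c]) auto
  then have "bounded (F ` cball 0 2)"
    by (intro compact_imp_bounded compact_continuous_image) auto
  then obtain B where "\<forall>x\<in>cball 0 2. norm (F x) \<le> B" unfolding bounded_iff by blast
  then have B: "\<And>x. x \<in> cball 0 2 \<Longrightarrow> norm (F x) \<le> B" by blast
  have B0: "0 \<le> B" using order_trans[OF norm_ge_zero B[of 0]] by simp
  have "cmod (f x) \<le> B * (inverse (1 + (x $ 1)\<^sup>2) * inverse (1 + (x $ 2)\<^sup>2))" for x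
  proof (cases "norm x \<le> 2")
    case True
    have p: "0 < (1 + (x $ 1)\<^sup>2) * (1 + (x $ 2)\<^sup>2)" by (intro mult_pos_pos add_pos_nonneg) auto
    have "F x \<le> B" using B[of x] True by simp
    then have "cmod (f x) \<le> B / ((1 + (x $ 1)\<^sup>2) * (1 + (x $ 2)\<^sup>2))"
      using p by (simp only: pos_le_divide_eq F_def)
    then show ?thesis by (simp add: divide_inverse)
  next
    case False
    then show ?thesis using z[of x] B0 by (simp add: add_nonneg_nonneg)
  qed
  from plane_dominated[OF m this] show "integrable lborel f" "f \<in> L2" by auto
qed

abbreviation pd :: "2 \<Rightarrow> (plane \<Rightarrow> real) \<Rightarrow> plane \<Rightarrow> real" where
  "pd a \<psi> \<equiv> \<lambda>x. frechet_derivative \<psi> (at x) (axis a 1)"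

text \<open>Integrate first along the lines in direction a: each line integral is a difference of
  boundary values of G, and both vanish.\<close>

lemma integral_partial_zero:
  fixes G G' :: "plane \<Rightarrow> complex"
  assumes d: "\<And>x. ((\<lambda>s. G (x + s *\<^sub>R axis a 1)) has_vector_derivative G' x) (at 0)"
    and c: "continuous_on UNIV G'" and z: "\<And>x. 2 < norm x \<Longrightarrow> G x = 0" "\<And>x. 2 < norm x \<Longrightarrow> G' x = 0"
  shows "(LINT x|lborel. G' x) = 0"
proof -
  have i: "integrable lborel G'" by (rule compact_support_dominated[OF c z(2)])
  have line: "(LINT s|lborel. G' (x + s *\<^sub>R axis a 1)) = 0" if x: "x $ a = 0" for x :: plane
  proof -
    have out: "2 < norm (x + s *\<^sub>R axis a 1)" if "2 < \<bar>s\<bar>" for s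
      using component_le_norm_cart[of "x + s *\<^sub>R axis a 1" a] x that by simp
    have vd: "((\<lambda>s. G (x + s *\<^sub>R axis a 1)) has_vector_derivative G' (x + s *\<^sub>R axis a 1)) (at s)" for s
    proof -
      have "((\<lambda>r. G ((x + s *\<^sub>R axis a 1) + (r - s) *\<^sub>R axis a 1)) has_vector_derivative (1 *\<^sub>R G' (x + s *\<^sub>R axis a 1))) (at s)"
        using d[of "x + s *\<^sub>R axis a 1"]
        by (intro vector_diff_chain_within[of "\<lambda>r. r - s" 1 s UNIV "\<lambda>s'. G ((x + s *\<^sub>R axis a 1) + s' *\<^sub>R axis a 1)", unfolded o_def])
           (auto intro!: derivative_eq_intros intro: has_vector_derivative_within_subset)
      then show ?thesis by (simp add: algebra_simps)
    qed
    \<comment> \<open>Base points with x $ a = 0 make s the a-th coordinate, so the line is outside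
      the support once |s| > 2, in particular at both ends -3 and 3.\<close>
    have "(LINT s|lborel. indicator {-3..3} s *\<^sub>R G' (x + s *\<^sub>R axis a 1)) = G (x + 3 *\<^sub>R axis a 1) - G (x + (-3) *\<^sub>R axis a 1)"
      by (rule integral_FTC_Icc[where F = "\<lambda>s. G (x + s *\<^sub>R axis a 1)"])
         (auto intro!: has_vector_derivative_at_within[OF vd] continuous_intros continuous_on_subset[OF c] continuous_on_compose2[OF c])
    also have "\<dots> = 0" using z(1)[OF out[of 3]] z(1)[OF out[of "-3"]] by simp
    also have "(LINT s|lborel. indicator {-3..3} s *\<^sub>R G' (x + s *\<^sub>R axis a 1)) = (LINT s|lborel. G' (x + s *\<^sub>R axis a 1))"
      by (intro Bochner_Integration.integral_cong refl) (use z(2)[OF out] in \<open>auto simp: indicator_def\<close>)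
    finally show ?thesis .
  qed
  have e1: "pl s t = pl 0 t + s *\<^sub>R axis 1 1" "pl t s = pl t 0 + s *\<^sub>R axis 2 1" for s t
    by (simp_all add: pl_eq_axis)
  consider "a = 1" | "a = 2" using exhaust_2[of a] by auto
  then show ?thesis
  proof cases
    case 1
    have "(LINT s|lborel. G' (pl s b)) = 0" for b
    proof -
      have "(LINT s|lborel. G' (pl s b)) = (LINT s|lborel. G' (pl 0 b + s *\<^sub>R axis 1 1))"
        by (intro Bochner_Integration.integral_cong refl arg_cong[where f = G'] e1)
      then show ?thesis using line[of "pl 0 b"] 1 by simp
    qed
    then show ?thesis by (simp add: integral_plane_swap[OF i])
  next
    case 2
    have "(LINT s|lborel. G' (pl b s)) = 0" for b
    proof -
      have "(LINT s|lborel. G' (pl b s)) = (LINT s|lborel. G' (pl b 0 + s *\<^sub>R axis 2 1))"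
        by (intro Bochner_Integration.integral_cong refl arg_cong[where f = G'] e1)
      then show ?thesis using line[of "pl b 0"] 2 by simp
    qed
    then show ?thesis by (simp add: integral_plane[OF i])
  qed
qed

lemma partial_support:
  assumes "\<And>x. 2 < norm x \<Longrightarrow> \<psi> x = 0" "2 < norm x"
  shows "pd a \<psi> x = 0"
proof -
  have "((\<lambda>_. 0) has_derivative (\<lambda>_. 0)) (at x)" by simp
  moreover have "open (- cball (0::plane) 2)" by auto
  ultimately have "(\<psi> has_derivative (\<lambda>_. 0)) (at x)"
    using assms by (rule_tac has_derivative_transform_within_open[of "\<lambda>_. 0" _ x UNIV "- cball 0 2"]) auto
  from frechet_derivative_at[OF this] show ?thesis by (metis (no_types))
qed

text \<open>Integration by parts: the a-th derivative of \<psi> times the character has integral 0,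
  and the product rule splits it.\<close>

lemma fourier_partial:
  fixes \<psi> :: "plane \<Rightarrow> real"
  assumes d: "\<psi> differentiable_on UNIV" and d': "pd a \<psi> differentiable_on UNIV"
    and z: "\<And>x. 2 < norm x \<Longrightarrow> \<psi> x = 0"
  shows "fourier (\<lambda>x. complex_of_real (pd a \<psi> x)) \<xi> = \<i> * complex_of_real (\<xi> $ a) * fourier (\<lambda>x. complex_of_real (\<psi> x)) \<xi>"
proof -
  have c: "continuous_on UNIV \<psi>" "continuous_on UNIV (pd a \<psi>)"
    using d d' by (auto intro: differentiable_imp_continuous_on)
  have cc: "continuous_on UNIV (\<lambda>x. complex_of_real (\<psi> x))" "continuous_on UNIV (\<lambda>x. complex_of_real (pd a \<psi> x))"
    using c by (auto intro: continuous_intros)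
  have zd: "2 < norm x \<Longrightarrow> pd a \<psi> x = 0" for x by (rule partial_support[OF z])
  have ccis: "continuous_on UNIV (\<lambda>x. cis (- (x \<bullet> \<xi>)))" by (intro continuous_intros)
  define G where "G = (\<lambda>x. complex_of_real (\<psi> x) * cis (- (x \<bullet> \<xi>)))"
  define G' where "G' = (\<lambda>x. complex_of_real (pd a \<psi> x) * cis (- (x \<bullet> \<xi>))
     - \<i> * complex_of_real (\<xi> $ a) * (complex_of_real (\<psi> x) * cis (- (x \<bullet> \<xi>))))"
  have i: "integrable lborel (\<lambda>x. complex_of_real (\<psi> x) * cis (- (x \<bullet> \<xi>)))"
    "integrable lborel (\<lambda>x. complex_of_real (pd a \<psi> x) * cis (- (x \<bullet> \<xi>)))"
    using z zd by (auto intro!: integrable_cis_mult compact_support_dominated(1)[OF cc(1)] compact_support_dominated(1)[OF cc(2)])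
  have "(LINT x|lborel. G' x) = 0"
  proof (rule integral_partial_zero[of G a G'])
    show "continuous_on UNIV G'" unfolding G'_def by (intro continuous_intros cc ccis)
    show "G x = 0" "G' x = 0" if "2 < norm x" for x using z[OF that] zd[OF that] by (auto simp: G_def G'_def)
    fix x
    have "(\<psi> has_derivative frechet_derivative \<psi> (at x)) (at x)"
      using d by (simp add: differentiable_on_def frechet_derivative_works)
    then have dx: "(\<psi> has_derivative frechet_derivative \<psi> (at x)) (at (x + 0 *\<^sub>R axis a 1))" by simp
    have "((\<lambda>s. x + s *\<^sub>R axis a 1) has_vector_derivative axis a 1) (at 0)"
      by (auto intro!: derivative_eq_intros)
    then have "((\<psi> \<circ> (\<lambda>s. x + s *\<^sub>R axis a 1)) has_vector_derivative frechet_derivative \<psi> (at x) (axis a 1)) (at 0)"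
      by (rule vector_derivative_diff_chain_within[of _ _ 0 UNIV \<psi>]) (rule has_derivative_at_withinI[OF dx])
    then have 1: "((\<lambda>s. complex_of_real (\<psi> (x + s *\<^sub>R axis a 1))) has_vector_derivative complex_of_real (pd a \<psi> x)) (at 0)"
      unfolding o_def by (rule bounded_linear.has_vector_derivative[OF bounded_linear_of_real])
    have 2: "((\<lambda>s. cis (- ((x + s *\<^sub>R axis a 1) \<bullet> \<xi>))) has_vector_derivative (- \<i> * complex_of_real (\<xi> $ a) * cis (- (x \<bullet> \<xi>)))) (at 0)"
    proof -
      have "((\<lambda>z. exp (\<i> * (- complex_of_real (x \<bullet> \<xi>) - z * complex_of_real (\<xi> $ a)))) has_field_derivative
          (- \<i> * complex_of_real (\<xi> $ a) * exp (- \<i> * complex_of_real (x \<bullet> \<xi>)))) (at (of_real 0))"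
        by (auto intro!: derivative_eq_intros)
      from has_vector_derivative_real_field[OF this]
      have "((\<lambda>s. exp (\<i> * (- complex_of_real (x \<bullet> \<xi>) - complex_of_real s * complex_of_real (\<xi> $ a)))) has_vector_derivative
          (- \<i> * complex_of_real (\<xi> $ a) * exp (- \<i> * complex_of_real (x \<bullet> \<xi>)))) (at 0)" .
      moreover have "axis a 1 \<bullet> \<xi> = \<xi> $ a" by (simp add: inner_axis' )
      ultimately show ?thesis by (simp add: cis_conv_exp inner_add_left)
    qed
    show "((\<lambda>s. G (x + s *\<^sub>R axis a 1)) has_vector_derivative G' x) (at 0)"
      unfolding G_def
      by (rule has_vector_derivative_eq_rhs[OF has_vector_derivative_mult[OF 1 2]]) (simp add: G'_def algebra_simps)
  qed
  then show ?thesis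
    unfolding G'_def fourier_def using i
    by (subst (asm) Bochner_Integration.integral_diff) auto
qed

text \<open>The point is that \<open>\<kappa>\<close> is independent of the translation \<open>\<xi>\<close>
  of the multiplier.\<close>

definition mult_kernel :: "(plane \<Rightarrow> complex) \<Rightarrow> real \<Rightarrow> bool" where
  "mult_kernel m A \<longleftrightarrow> (\<exists>\<kappa>\<in>borel_measurable borel. (\<integral>\<^sup>+ y. ennreal (\<kappa> y) \<partial>lborel) \<le> ennreal A \<and> (\<forall>y. 0 \<le> \<kappa> y) \<and>
     (\<forall>\<xi>. \<exists>k. integrable lborel k \<and> (\<forall>y. cmod (k y) \<le> \<kappa> y) \<and> (AE \<eta> in lborel. m (\<eta> - \<xi>) = fourier k \<eta>)))"

lemma mult_kernel_diff:
  assumes "mult_kernel m1 A1" "mult_kernel m2 A2" "0 \<le> A1" "0 \<le> A2"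
  shows "mult_kernel (\<lambda>\<eta>. m1 \<eta> - m2 \<eta>) (A1 + A2)"
proof -
  obtain \<kappa>1 where k1: "\<kappa>1 \<in> borel_measurable borel" "(\<integral>\<^sup>+ y. ennreal (\<kappa>1 y) \<partial>lborel) \<le> ennreal A1" "\<And>y. 0 \<le> \<kappa>1 y"
    "\<And>\<xi>. \<exists>k. integrable lborel k \<and> (\<forall>y. cmod (k y) \<le> \<kappa>1 y) \<and> (AE \<eta> in lborel. m1 (\<eta> - \<xi>) = fourier k \<eta>)"
    using assms(1) unfolding mult_kernel_def by blast
  obtain \<kappa>2 where k2: "\<kappa>2 \<in> borel_measurable borel" "(\<integral>\<^sup>+ y. ennreal (\<kappa>2 y) \<partial>lborel) \<le> ennreal A2" "\<And>y. 0 \<le> \<kappa>2 y"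
    "\<And>\<xi>. \<exists>k. integrable lborel k \<and> (\<forall>y. cmod (k y) \<le> \<kappa>2 y) \<and> (AE \<eta> in lborel. m2 (\<eta> - \<xi>) = fourier k \<eta>)"
    using assms(2) unfolding mult_kernel_def by blast
  note [measurable] = k1(1) k2(1)
  show ?thesis
    unfolding mult_kernel_def
  proof (intro bexI[of _ "\<lambda>y. \<kappa>1 y + \<kappa>2 y"] conjI allI)
    have "(\<integral>\<^sup>+ y. ennreal (\<kappa>1 y + \<kappa>2 y) \<partial>lborel) = (\<integral>\<^sup>+ y. ennreal (\<kappa>1 y) \<partial>lborel) + (\<integral>\<^sup>+ y. ennreal (\<kappa>2 y) \<partial>lborel)"
      using k1(3) k2(3) by (subst nn_integral_add[symmetric]) (auto simp: ennreal_plus)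
    also have "\<dots> \<le> ennreal (A1 + A2)"
      using assms(3,4) k1(2) k2(2) by (simp add: ennreal_plus add_mono)
    finally show "(\<integral>\<^sup>+ y. ennreal (\<kappa>1 y + \<kappa>2 y) \<partial>lborel) \<le> ennreal (A1 + A2)" .
    show "0 \<le> \<kappa>1 y + \<kappa>2 y" for y using k1(3) k2(3) by simp
    fix \<xi>
    obtain g1 where g1: "integrable lborel g1" "\<And>y. cmod (g1 y) \<le> \<kappa>1 y" "AE \<eta> in lborel. m1 (\<eta> - \<xi>) = fourier g1 \<eta>"
      using k1(4) by blast
    obtain g2 where g2: "integrable lborel g2" "\<And>y. cmod (g2 y) \<le> \<kappa>2 y" "AE \<eta> in lborel. m2 (\<eta> - \<xi>) = fourier g2 \<eta>"
      using k2(4) by blast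
    show "\<exists>k. integrable lborel k \<and> (\<forall>y. cmod (k y) \<le> \<kappa>1 y + \<kappa>2 y) \<and> (AE \<eta> in lborel. m1 (\<eta> - \<xi>) - m2 (\<eta> - \<xi>) = fourier k \<eta>)"
    proof (intro exI[of _ "\<lambda>y. g1 y - g2 y"] conjI allI)
      show "cmod (g1 y - g2 y) \<le> \<kappa>1 y + \<kappa>2 y" for y
        using g1(2)[of y] g2(2)[of y] norm_triangle_ineq4[of "g1 y" "g2 y"] by linarith
      show "AE \<eta> in lborel. m1 (\<eta> - \<xi>) - m2 (\<eta> - \<xi>) = fourier (\<lambda>y. g1 y - g2 y) \<eta>"
        using g1(3) g2(3) by eventually_elim (simp add: fourier_diff g1(1) g2(1))
    qed (use g1 g2 in auto)
  qed measurable
qed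

lemma mult_kernel_mono:
  assumes "mult_kernel m A" "A \<le> B"
  shows "mult_kernel m B"
proof -
  obtain \<kappa> where k: "\<kappa> \<in> borel_measurable borel" "(\<integral>\<^sup>+ y. ennreal (\<kappa> y) \<partial>lborel) \<le> ennreal A" "\<forall>y. 0 \<le> \<kappa> y"
    "\<forall>\<xi>. \<exists>k. integrable lborel k \<and> (\<forall>y. cmod (k y) \<le> \<kappa> y) \<and> (AE \<eta> in lborel. m (\<eta> - \<xi>) = fourier k \<eta>)"
    using assms(1) unfolding mult_kernel_def by blast
  have "(\<integral>\<^sup>+ y. ennreal (\<kappa> y) \<partial>lborel) \<le> ennreal B"
    using k(2) ennreal_leI[OF assms(2)] by (rule order_trans)
  with k show ?thesis unfolding mult_kernel_def by blast
qed

text \<open>Translating the multiplier by \<xi> multiplies its kernel by a phase and leaves the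
  modulus unchanged, and the dilation preserves the L1 norm. So the weight serves every \<xi> and
  the bound A every scale.\<close>

lemma mult_kernel_scale:
  assumes k: "integrable lborel k" and A: "(\<integral>\<^sup>+ y. ennreal (cmod (k y)) \<partial>lborel) \<le> ennreal A"
    and m: "AE \<eta> in lborel. m \<eta> = fourier k \<eta>" and s: "0 < s"
  shows "mult_kernel (\<lambda>\<eta>. m ((1 / s) *\<^sub>R \<eta>)) A"
  unfolding mult_kernel_def
proof (intro bexI[of _ "\<lambda>y. s\<^sup>2 * cmod (k (s *\<^sub>R y))"] conjI allI)
  have [measurable]: "k \<in> borel_measurable borel" using k by auto
  show "(\<lambda>y. s\<^sup>2 * cmod (k (s *\<^sub>R y))) \<in> borel_measurable borel" by measurable
  have "(\<integral>\<^sup>+ y. ennreal (s\<^sup>2 * cmod (k (s *\<^sub>R y))) \<partial>lborel) = (\<integral>\<^sup>+ y. ennreal (cmod (k y)) \<partial>lborel)"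
    using s by (subst nn_integral_lborel_affine[of "\<lambda>y. ennreal (cmod (k y))" s 0])
      (auto simp: nn_integral_cmult[symmetric] ennreal_mult)
  then show "(\<integral>\<^sup>+ y. ennreal (s\<^sup>2 * cmod (k (s *\<^sub>R y))) \<partial>lborel) \<le> ennreal A" using A by simp
  fix \<xi> :: plane
  have ks: "integrable lborel (\<lambda>y. k (s *\<^sub>R y))" using integrable_lborel_affine[OF k, of s 0] s by simp
  show "\<exists>g. integrable lborel g \<and> (\<forall>y. cmod (g y) \<le> s\<^sup>2 * cmod (k (s *\<^sub>R y))) \<and>
      (AE \<eta> in lborel. m ((1 / s) *\<^sub>R (\<eta> - \<xi>)) = fourier g \<eta>)"
  proof (intro exI[of _ "\<lambda>y. (complex_of_real (s\<^sup>2) * k (s *\<^sub>R y)) * cis (y \<bullet> \<xi>)"] conjI allI)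
    show "integrable lborel (\<lambda>y. (complex_of_real (s\<^sup>2) * k (s *\<^sub>R y)) * cis (y \<bullet> \<xi>))"
      using ks by (intro integrable_cis_mult integrable_mult_right) auto
    show "cmod ((complex_of_real (s\<^sup>2) * k (s *\<^sub>R y)) * cis (y \<bullet> \<xi>)) \<le> s\<^sup>2 * cmod (k (s *\<^sub>R y))" for y
      unfolding norm_mult norm_of_real by simp
    have "fourier (\<lambda>y. (complex_of_real (s\<^sup>2) * k (s *\<^sub>R y)) * cis (y \<bullet> \<xi>)) \<eta> = fourier k ((1 / s) *\<^sub>R (\<eta> - \<xi>))" for \<eta>
    proof -
      have "fourier (\<lambda>y. (complex_of_real (s\<^sup>2) * k (s *\<^sub>R y)) * cis (y \<bullet> \<xi>)) \<eta>
         = fourier (\<lambda>y. complex_of_real (s\<^sup>2) * k (s *\<^sub>R y)) (\<eta> - \<xi>)"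
        unfolding fourier_def by (intro Bochner_Integration.integral_cong refl)
          (simp add: mult.assoc cis_mult inner_diff_right)
      also have "\<dots> = complex_of_real (s\<^sup>2) * (complex_of_real (1 / s\<^sup>2) * fourier k ((1 / s) *\<^sub>R (\<eta> - \<xi>)))"
        using s by (simp only: fourier_cmult) (subst fourier_scale, auto)
      also have "\<dots> = fourier k ((1 / s) *\<^sub>R (\<eta> - \<xi>))" using s by simp
      finally show ?thesis .
    qed
    moreover have "AE \<eta> in lborel. m ((1 / s) *\<^sub>R (\<eta> - \<xi>)) = fourier k ((1 / s) *\<^sub>R (\<eta> - \<xi>))"
      using AE_affine_plane[OF m, of "1 / s" "- (1 / s) *\<^sub>R \<xi>"] s by (simp add: algebra_simps)
    ultimately show "AE \<eta> in lborel. m ((1 / s) *\<^sub>R (\<eta> - \<xi>)) = fourier (\<lambda>y. (complex_of_real (s\<^sup>2) * k (s *\<^sub>R y)) * cis (y \<bullet> \<xi>)) \<eta>"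
      by simp
  qed
qed simp

text \<open>Integration by parts makes the transform of the cutoff decay like the product weight of
  \<open>plane_dominated\<close>, hence integrable; inversion then exhibits the cutoff as the
  transform of an integrable function.\<close>

lemma cutoff_kernel:
  assumes \<phi>: "lp_cutoff \<phi>"
  shows "\<exists>k A. 0 \<le> A \<and> integrable lborel k \<and> (\<integral>\<^sup>+ y. ennreal (cmod (k y)) \<partial>lborel) \<le> ennreal A \<and>
     (AE \<eta> in lborel. complex_of_real (\<phi> \<eta>) = fourier k \<eta>)"
proof -
  have d: "iter_partial as \<phi> differentiable_on UNIV" for as
    using \<phi> unfolding lp_cutoff_def smooth_fun_def by blast
  have z0: "2 < norm x \<Longrightarrow> \<phi> x = 0" for x using \<phi> unfolding lp_cutoff_def by blast
  have z: "2 < norm x \<Longrightarrow> iter_partial as \<phi> x = 0" for as x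
  proof (induction as arbitrary: x)
    case (Cons a as)
    show ?case using partial_support[of "iter_partial as \<phi>", OF Cons.IH Cons.prems] by simp
  qed (use z0 in simp)
  have ci: "integrable lborel (\<lambda>x. complex_of_real (iter_partial as \<phi> x))" "(\<lambda>x. complex_of_real (iter_partial as \<phi> x)) \<in> L2" for as
    using z by (auto intro!: compact_support_dominated continuous_on_of_real differentiable_imp_continuous_on[OF d])
  define F where "F = (\<lambda>as. fourier (\<lambda>x. complex_of_real (iter_partial as \<phi> x)))"
  have FS: "F (a # as) \<xi> = \<i> * complex_of_real (\<xi> $ a) * F as \<xi>" for a as \<xi>
    using fourier_partial[of "iter_partial as \<phi>" a \<xi>] d[of as] d[of "a # as"] z by (simp add: F_def)
  define B where "B = (\<lambda>as. LINT x|lborel. cmod (complex_of_real (iter_partial as \<phi> x)))"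
  have FB: "cmod (F as \<xi>) \<le> B as" for as \<xi>
    unfolding F_def B_def by (rule fourier_bound[OF ci(1)])
  \<comment> \<open>One L1 norm for each term in the expansion of (1 + x^2) (1 + y^2), where x and y
    are the coordinates of the frequency.\<close>
  define B' where "B' = B [] + B [1,1] + B [2,2] + B [1,1,2,2]"
  have dec: "cmod (F [] \<xi>) \<le> B' * (inverse (1 + (\<xi> $ 1)\<^sup>2) * inverse (1 + (\<xi> $ 2)\<^sup>2))" for \<xi>
  proof -
    have p: "0 < (1 + (\<xi> $ 1)\<^sup>2) * (1 + (\<xi> $ 2)\<^sup>2)" by (intro mult_pos_pos add_pos_nonneg) auto
    have n: "cmod (F [] \<xi>) = cmod (F [] \<xi>)" "cmod (F [1,1] \<xi>) = (\<xi> $ 1)\<^sup>2 * cmod (F [] \<xi>)"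
      "cmod (F [2,2] \<xi>) = (\<xi> $ 2)\<^sup>2 * cmod (F [] \<xi>)" "cmod (F [1,1,2,2] \<xi>) = (\<xi> $ 1)\<^sup>2 * ((\<xi> $ 2)\<^sup>2 * cmod (F [] \<xi>))"
      by (simp_all add: FS norm_mult power2_eq_square)
    have "cmod (F [] \<xi>) * ((1 + (\<xi> $ 1)\<^sup>2) * (1 + (\<xi> $ 2)\<^sup>2))
       = cmod (F [] \<xi>) + cmod (F [1,1] \<xi>) + cmod (F [2,2] \<xi>) + cmod (F [1,1,2,2] \<xi>)"
      unfolding n(2-4) by (simp add: algebra_simps)
    also have "\<dots> \<le> B'" unfolding B'_def by (intro add_mono FB)
    finally have "cmod (F [] \<xi>) \<le> B' / ((1 + (\<xi> $ 1)\<^sup>2) * (1 + (\<xi> $ 2)\<^sup>2))"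
      using p by (simp only: pos_le_divide_eq)
    then show ?thesis by (simp add: divide_inverse)
  qed
  define g where "g = (\<lambda>x. complex_of_real (\<phi> x))"
  have g: "integrable lborel g" "g \<in> L2" using ci[of "[]"] by (simp_all add: g_def)
  have [measurable]: "g \<in> borel_measurable borel" using g by auto
  define c where "c = complex_of_real ((2 * pi)\<^sup>2)"
  have c0: "c \<noteq> 0" by (simp add: c_def)
  define k0 where "k0 = (\<lambda>x. fourier g (- x))"
  define k where "k = (\<lambda>x. (1 / c) * k0 x)"
  have k0m: "k0 \<in> borel_measurable borel" unfolding k0_def by measurable
  have k0d: "cmod (k0 x) \<le> B' * (inverse (1 + (x $ 1)\<^sup>2) * inverse (1 + (x $ 2)\<^sup>2))" for x
    using dec[of "- x"] by (simp add: k0_def F_def g_def)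
  note k0 = plane_dominated[OF k0m k0d]
  have ki: "integrable lborel k" unfolding k_def using k0(1) by simp
  have kL: "k \<in> L2" unfolding k_def by (rule L2_cmult[OF k0(2)])
  have "AE x in lborel. fourier_L2 k x = (1 / c) * fourier_L2 k0 x"
    unfolding k_def by (rule fourier_L2_cmult[OF k0(2)])
  moreover have "AE x in lborel. fourier_L2 k0 x = c * g x"
    using inversion_integrable(2)[OF g(2,1)] by (simp add: k0_def c_def)
  moreover have "AE x in lborel. fourier_L2 k x = fourier k x"
    by (rule fourier_L2_eq_fourier[OF kL ki])
  ultimately have gk: "AE x in lborel. g x = fourier k x"
    by eventually_elim (use c0 in simp)
  have "(\<integral>\<^sup>+ y. ennreal (cmod (k y)) \<partial>lborel) < \<infinity>"
    using ki by (auto simp: integrable_iff_bounded)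
  then have "(\<integral>\<^sup>+ y. ennreal (cmod (k y)) \<partial>lborel) \<le> ennreal (enn2real (\<integral>\<^sup>+ y. ennreal (cmod (k y)) \<partial>lborel))"
    by simp
  then show ?thesis using ki gk unfolding g_def by (blast intro: enn2real_nonneg)
qed

lemma lp_symbol_sum:
  assumes "0 \<le> l"
  shows "(\<Sum>j\<in>{0..l}. lp_symbol \<phi> j \<xi>) = \<phi> ((2 powi (- l)) *\<^sub>R \<xi>)"
proof -
  have "(\<Sum>j\<in>{0..int n}. lp_symbol \<phi> j \<xi>) = \<phi> ((2 powi (- int n)) *\<^sub>R \<xi>)" for n
  proof (induction n)
    case (Suc n)
    have "{0..int (Suc n)} = insert (int (Suc n)) {0..int n}" by auto
    then have "(\<Sum>j\<in>{0..int (Suc n)}. lp_symbol \<phi> j \<xi>) = lp_symbol \<phi> (int (Suc n)) \<xi> + (\<Sum>j\<in>{0..int n}. lp_symbol \<phi> j \<xi>)"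
      by simp
    then show ?case using Suc by (simp add: lp_symbol_def)
  qed (simp add: lp_symbol_def)
  from this[of "nat l"] show ?thesis using assms by simp
qed

text \<open>Every symbol is a dilate of the cutoff or a difference of two dilates, so the L1 norm of
  one kernel, doubled for the difference, bounds them all.\<close>

theorem lp_kernels:
  assumes \<phi>: "lp_cutoff \<phi>"
  shows "\<exists>A\<ge>0. \<forall>l\<ge>0. mult_kernel (\<lambda>\<eta>. complex_of_real (\<Sum>j\<in>{0..l}. lp_symbol \<phi> j \<eta>)) A
     \<and> mult_kernel (\<lambda>\<eta>. complex_of_real (lp_symbol \<phi> l \<eta>)) A"
proof -
  obtain k A where k: "0 \<le> A" "integrable lborel k" "(\<integral>\<^sup>+ y. ennreal (cmod (k y)) \<partial>lborel) \<le> ennreal A"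
    "AE \<eta> in lborel. complex_of_real (\<phi> \<eta>) = fourier k \<eta>"
    using cutoff_kernel[OF \<phi>] by blast
  have s: "mult_kernel (\<lambda>\<eta>. complex_of_real (\<phi> ((2 powi n) *\<^sub>R \<eta>))) A" for n
    using mult_kernel_scale[OF k(2-4), of "2 powi (- n)"] by (simp add: power_int_minus field_simps)
  show ?thesis
  proof (intro exI[of _ "A + A"] conjI allI impI)
    fix l :: int assume l: "0 \<le> l"
    show "mult_kernel (\<lambda>\<eta>. complex_of_real (\<Sum>j\<in>{0..l}. lp_symbol \<phi> j \<eta>)) (A + A)"
      unfolding lp_symbol_sum[OF l] by (rule mult_kernel_mono[OF s]) (use k(1) in simp)
    show "mult_kernel (\<lambda>\<eta>. complex_of_real (lp_symbol \<phi> l \<eta>)) (A + A)"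
    proof (cases "l = 0")
      case True
      then show ?thesis using mult_kernel_mono[OF s[of 0], of "A + A"] k(1) by (simp add: lp_symbol_def)
    next
      case False
      then show ?thesis using mult_kernel_diff[OF s s k(1) k(1), of "- l" "- l + 1"] l by (simp add: lp_symbol_def)
    qed
  qed (use k in auto)
qed

section \<open>Bilinear estimate under bounded variation\<close>

lemma integrable_evol_integrand:
  assumes b: "integrable lborel b"
  shows "integrable lborel (\<lambda>\<eta>. b \<eta> * cis (x \<bullet> \<eta> - t * (norm \<eta>)\<^sup>2))"
  using b by (intro integrable_cis_mult) auto

lemma evol_add:
  assumes "integrable lborel b" "integrable lborel c"
  shows "evol (\<lambda>\<eta>. b \<eta> + c \<eta>) t x = evol b t x + evol c t x"
  unfolding evol_def distrib_right by (intro Bochner_Integration.integral_add integrable_evol_integrand assms)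

lemma evol_diff:
  assumes "integrable lborel b" "integrable lborel c"
  shows "evol (\<lambda>\<eta>. b \<eta> - c \<eta>) t x = evol b t x - evol c t x"
  unfolding evol_def left_diff_distrib by (intro Bochner_Integration.integral_diff integrable_evol_integrand assms)

lemma evol_shift: "evol b t (x - y) = evol (\<lambda>\<eta>. cis (- (y \<bullet> \<eta>)) * b \<eta>) t x"
  unfolding evol_def
proof (intro Bochner_Integration.integral_cong refl)
  fix \<eta>
  have "cis (- (y \<bullet> \<eta>)) * cis (x \<bullet> \<eta> - t * (norm \<eta>)\<^sup>2) = cis ((x - y) \<bullet> \<eta> - t * (norm \<eta>)\<^sup>2)"
    unfolding cis_mult by (rule arg_cong[where f = cis]) (simp add: inner_diff_left)
  then show "b \<eta> * cis ((x - y) \<bullet> \<eta> - t * (norm \<eta>)\<^sup>2) = cis (- (y \<bullet> \<eta>)) * b \<eta> * cis (x \<bullet> \<eta> - t * (norm \<eta>)\<^sup>2)"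
    by (simp add: mult_ac)
qed

text \<open>With the multiplier written as a Fourier integral, exchanging integrals shows the
  filtered wave as a superposition of translates of the wave with amplitude b. Taking moduli leaves
  only the weight \<kappa>.\<close>

lemma evol_kernel_bound:
  assumes b: "integrable lborel b" and k: "integrable lborel k" "\<And>y. cmod (k y) \<le> \<kappa> y"
    and m [measurable]: "m \<in> borel_measurable borel" and mk: "AE \<eta> in lborel. m \<eta> = fourier k \<eta>"
  shows "ennreal (cmod (evol (\<lambda>\<eta>. m \<eta> * b \<eta>) t x)) \<le> (\<integral>\<^sup>+ y. ennreal (\<kappa> y) * ennreal (cmod (evol b t (x - y))) \<partial>lborel)"
proof -
  have [measurable]: "b \<in> borel_measurable borel" "k \<in> borel_measurable borel" using b k by auto
  let ?e = "\<lambda>\<eta>. cis (x \<bullet> \<eta> - t * (norm \<eta>)\<^sup>2)"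
  have "evol (\<lambda>\<eta>. m \<eta> * b \<eta>) t x = (LINT \<eta>|lborel. (b \<eta> * ?e \<eta>) * (LINT y|lborel. k y * cis (- (y \<bullet> \<eta>))))"
    unfolding evol_def fourier_def[symmetric]
    by (rule integral_cong_AE) (use mk in \<open>auto elim!: eventually_mono simp: mult_ac\<close>)
  also have "\<dots> = (LINT y|lborel. k y * (LINT \<eta>|lborel. (b \<eta> * ?e \<eta>) * cis (- (y \<bullet> \<eta>))))"
    by (rule integrable_product_kernel(2)[OF sigma_finite_lborel sigma_finite_lborel integrable_evol_integrand[OF b] k(1),
          where C = 1]) auto
  also have "\<dots> = (LINT y|lborel. k y * evol b t (x - y))"
    unfolding evol_shift unfolding evol_def by (simp add: mult_ac)
  finally have "ennreal (cmod (evol (\<lambda>\<eta>. m \<eta> * b \<eta>) t x)) \<le> (\<integral>\<^sup>+ y. ennreal (cmod (k y * evol b t (x - y))) \<partial>lborel)"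
    by (simp only: norm_integral_le_nn)
  also have "\<dots> \<le> (\<integral>\<^sup>+ y. ennreal (\<kappa> y) * ennreal (cmod (evol b t (x - y))) \<partial>lborel)"
    using k(2) order_trans[OF norm_ge_zero k(2)]
    by (intro nn_integral_mono) (simp add: norm_mult ennreal_mult[symmetric] ennreal_leI mult_right_mono)
  finally show ?thesis .
qed

lemma nn_integral_weighted_square:
  fixes \<kappa> :: "'a \<Rightarrow> real"
  assumes [measurable]: "\<kappa> \<in> borel_measurable M" "f \<in> borel_measurable M" and k0: "\<And>y. 0 \<le> \<kappa> y"
    and A: "(\<integral>\<^sup>+ y. ennreal (\<kappa> y) \<partial>M) \<le> A"
  shows "(\<integral>\<^sup>+ y. ennreal (\<kappa> y) * f y \<partial>M)\<^sup>2 \<le> A * (\<integral>\<^sup>+ y. ennreal (\<kappa> y) * (f y)\<^sup>2 \<partial>M)"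
proof -
  have s: "ennreal (sqrt (\<kappa> y)) * ennreal (sqrt (\<kappa> y)) = ennreal (\<kappa> y)" for y
    using k0[of y] by (simp add: ennreal_mult[symmetric])
  have "(\<integral>\<^sup>+ y. ennreal (\<kappa> y) * f y \<partial>M)\<^sup>2 = (\<integral>\<^sup>+ y. ennreal (sqrt (\<kappa> y)) * (ennreal (sqrt (\<kappa> y)) * f y) \<partial>M)\<^sup>2"
    by (simp only: s mult.assoc[symmetric])
  also have "\<dots> \<le> (\<integral>\<^sup>+ y. (ennreal (sqrt (\<kappa> y)))\<^sup>2 \<partial>M) * (\<integral>\<^sup>+ y. (ennreal (sqrt (\<kappa> y)) * f y)\<^sup>2 \<partial>M)"
    by (rule Cauchy_Schwarz_nn_integral) measurable
  also have "\<dots> = (\<integral>\<^sup>+ y. ennreal (\<kappa> y) \<partial>M) * (\<integral>\<^sup>+ y. ennreal (\<kappa> y) * (f y)\<^sup>2 \<partial>M)"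
    unfolding power_mult_distrib power2_eq_square[of "ennreal (sqrt _)"] s ..
  also have "\<dots> \<le> A * (\<integral>\<^sup>+ y. ennreal (\<kappa> y) * (f y)\<^sup>2 \<partial>M)"
    by (intro mult_right_mono A) auto
  finally show ?thesis .
qed

text \<open>The weight \<open>(16/9)\<^sup>n\<close> leaves the room needed below: \<open>16/9 * 4 * 1/8 <
  1\<close> for \<open>4\<^sup>n\<close> steps of squared size \<open>8\<^sup>-\<^sup>n\<close>.\<close>

lemma suminf_weighted_square:
  fixes x :: "nat \<Rightarrow> ennreal"
  shows "(\<Sum>n. x n)\<^sup>2 \<le> ennreal (16 / 7) * (\<Sum>n. ennreal ((16 / 9) ^ n) * (x n)\<^sup>2)"
proof -
  have w: "ennreal ((3 / 4) ^ n) * ennreal ((4 / 3) ^ n) = 1" for n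
    by (subst ennreal_mult[symmetric]) (auto simp flip: power_mult_distrib)
  have sq: "(ennreal (r ^ n))\<^sup>2 = ennreal ((r\<^sup>2) ^ n)" if "0 \<le> r" for r :: real and n :: nat
    using that by (simp add: ennreal_power power_mult[symmetric] mult.commute)
  have "(\<Sum>n. x n)\<^sup>2 = (\<integral>\<^sup>+ n. ennreal ((3 / 4) ^ n) * (ennreal ((4 / 3) ^ n) * x n) \<partial>count_space UNIV)\<^sup>2"
    unfolding nn_integral_count_space_nat mult.assoc[symmetric] w by simp
  also have "\<dots> \<le> (\<integral>\<^sup>+ n. (ennreal ((3 / 4) ^ n))\<^sup>2 \<partial>count_space UNIV) * (\<integral>\<^sup>+ n. (ennreal ((4 / 3) ^ n) * x n)\<^sup>2 \<partial>count_space UNIV)"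
    by (rule Cauchy_Schwarz_nn_integral) auto
  also have "(\<integral>\<^sup>+ n. (ennreal ((3 / 4) ^ n))\<^sup>2 \<partial>count_space UNIV) = (\<Sum>n. ennreal ((9 / 16) ^ n))"
    unfolding nn_integral_count_space_nat
    using sq[of "3 / 4"] by (intro suminf_cong) (simp add: power2_eq_square[of "3 / 4 :: real"])
  also have "\<dots> = ennreal (\<Sum>n. (9 / 16) ^ n)"
    by (intro suminf_ennreal2) (auto intro: summable_geometric)
  also have "(\<Sum>n. (9 / 16 :: real) ^ n) = 16 / 7" by (subst suminf_geometric) auto
  also have "(\<integral>\<^sup>+ n. (ennreal ((4 / 3) ^ n) * x n)\<^sup>2 \<partial>count_space UNIV) = (\<Sum>n. ennreal ((16 / 9) ^ n) * (x n)\<^sup>2)"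
    unfolding nn_integral_count_space_nat
    unfolding power_mult_distrib using sq[of "4 / 3"] by (intro suminf_cong) (simp add: power2_eq_square[of "4 / 3 :: real"])
  finally show ?thesis .
qed

text \<open>Translating a wave by y multiplies its amplitude by a phase. Support and L2 norm are
  unchanged, so the bilinear estimate holds for each y with the same constant and can be
  averaged.\<close>

lemma bilinear_evol_average:
  assumes a: "integrable lborel a" and f: "integrable lborel f"
    and \<kappa> [measurable]: "\<kappa> \<in> borel_measurable borel" and \<kappa>A: "(\<integral>\<^sup>+ y. ennreal (\<kappa> y) \<partial>lborel) \<le> ennreal A"
    and q0: "0 \<le> q" and osc: "\<And>p. osc_bound {z. a (p - z) \<noteq> 0 \<and> f (p + z) \<noteq> 0} q"
  shows "(\<integral>\<^sup>+ t. \<integral>\<^sup>+ x. ennreal ((cmod (evol a t x))\<^sup>2) * (\<integral>\<^sup>+ y. ennreal (\<kappa> y) * (ennreal (cmod (evol f t (x - y))))\<^sup>2 \<partial>lborel) \<partial>lborel \<partial>lborel)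
    \<le> ennreal A * (ennreal ((2 * pi)\<^sup>2 * q) * (Lpow 2 a * Lpow 2 f))"
proof -
  define b where "b = (\<lambda>y \<eta>. cis (- (y \<bullet> \<eta>)) * f \<eta>)"
  have [measurable]: "a \<in> borel_measurable borel" "f \<in> borel_measurable borel" using a f by auto
  have bi: "integrable lborel (b y)" for y unfolding b_def using f by (intro integrable_cis_mult) auto
  have bL: "Lpow 2 (b y) = Lpow 2 f" for y unfolding b_def by (rule Lpow_cis_mult)
  have bo: "osc_bound {z. a (p - z) \<noteq> 0 \<and> b y (p + z) \<noteq> 0} q" for y p using osc[of p] by (simp add: b_def)
  define E where "E = (\<lambda>t x y. evol (f) t (x - y))"
  have Em [measurable]: "(\<lambda>z. E (fst (fst z)) (snd (fst z)) (snd z)) \<in> borel_measurable ((borel \<Otimes>\<^sub>M borel) \<Otimes>\<^sub>M borel)"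
    unfolding E_def
    using evol_measurable(2)[of "f", THEN measurable_compose[rotated], of "\<lambda>z. (fst (fst z), snd (fst z) - snd z)"]
    by measurable
  have Ee: "evol (f) t (x - y) = E t x y" for t x y by (simp add: E_def)
  define F where "F = (\<lambda>t x y. ennreal (\<kappa> y) * ennreal ((cmod (evol a t x * E t x y))\<^sup>2))"
  have am: "(\<lambda>z. evol a (fst (fst z)) (snd (fst z))) \<in> borel_measurable ((borel \<Otimes>\<^sub>M borel) \<Otimes>\<^sub>M borel)"
    using measurable_compose[OF measurable_fst evol_measurable(2)[of a]] by simp
  have Fm: "(\<lambda>z. F (fst (fst z)) (snd (fst z)) (snd z)) \<in> borel_measurable ((borel \<Otimes>\<^sub>M borel) \<Otimes>\<^sub>M borel)"
    unfolding F_def using am by measurable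
  have Fp: "(\<lambda>w. F (f w) (g w) (h w)) \<in> borel_measurable M"
    if "f \<in> borel_measurable M" "g \<in> borel_measurable M" "h \<in> borel_measurable M" for f g h and M :: "'b measure"
    using measurable_compose[OF _ Fm, of "\<lambda>w. ((f w, g w), h w)"] that by simp
  have "(\<integral>\<^sup>+ t. \<integral>\<^sup>+ x. ennreal ((cmod (evol a t x))\<^sup>2) * (\<integral>\<^sup>+ y. ennreal (\<kappa> y) * (ennreal (cmod (evol f t (x - y))))\<^sup>2 \<partial>lborel) \<partial>lborel \<partial>lborel)
     = (\<integral>\<^sup>+ t. \<integral>\<^sup>+ x. \<integral>\<^sup>+ y. F t x y \<partial>lborel \<partial>lborel \<partial>lborel)"
  proof (intro nn_integral_cong)
    fix t :: real and x :: plane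
    have em: "(\<lambda>y. E t x y) \<in> borel_measurable borel"
      using measurable_compose[OF _ Em, of "\<lambda>y. ((t, x), y)"] by simp
    have "ennreal ((cmod (evol a t x))\<^sup>2) * (\<integral>\<^sup>+ y. ennreal (\<kappa> y) * (ennreal (cmod (evol f t (x - y))))\<^sup>2 \<partial>lborel)
       = (\<integral>\<^sup>+ y. ennreal ((cmod (evol a t x))\<^sup>2) * (ennreal (\<kappa> y) * (ennreal (cmod (E t x y)))\<^sup>2) \<partial>lborel)"
      unfolding Ee using em by (subst nn_integral_cmult[symmetric]) auto
    also have "\<dots> = (\<integral>\<^sup>+ y. F t x y \<partial>lborel)"
      unfolding F_def by (intro nn_integral_cong)
        (simp add: norm_mult power_mult_distrib ennreal_mult ennreal_power mult_ac)
    finally show "ennreal ((cmod (evol a t x))\<^sup>2) * (\<integral>\<^sup>+ y. ennreal (\<kappa> y) * (ennreal (cmod (evol f t (x - y))))\<^sup>2 \<partial>lborel) = (\<integral>\<^sup>+ y. F t x y \<partial>lborel)" .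
  qed
  also have "\<dots> = (\<integral>\<^sup>+ t. \<integral>\<^sup>+ y. \<integral>\<^sup>+ x. F t x y \<partial>lborel \<partial>lborel \<partial>lborel)"
    by (intro nn_integral_cong lborel_pair.Fubini') (simp add: case_prod_beta' Fp)
  also have "\<dots> = (\<integral>\<^sup>+ y. \<integral>\<^sup>+ t. \<integral>\<^sup>+ x. F t x y \<partial>lborel \<partial>lborel \<partial>lborel)"
  proof (rule lborel_pair.Fubini')
    have "(\<lambda>(z, x). F (snd z) x (fst z)) \<in> borel_measurable ((lborel \<Otimes>\<^sub>M lborel) \<Otimes>\<^sub>M lborel)"
      by (simp add: case_prod_beta' Fp)
    from lborel.borel_measurable_nn_integral[OF this]
    show "(\<lambda>(y, t). \<integral>\<^sup>+ x. F t x y \<partial>lborel) \<in> borel_measurable (lborel \<Otimes>\<^sub>M lborel)"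
      by (simp add: case_prod_beta')
  qed
  also have "\<dots> \<le> (\<integral>\<^sup>+ y. ennreal (\<kappa> y) * (ennreal ((2 * pi)\<^sup>2 * q) * (Lpow 2 a * Lpow 2 f)) \<partial>lborel)"
  proof (rule nn_integral_mono)
    fix y
    have Eb: "E t x y = evol (b y) t x" for t x unfolding E_def b_def by (rule evol_shift)
    have bm [measurable]: "b y \<in> borel_measurable borel" using bi[of y] by auto
    have pm: "(\<lambda>z. ennreal ((cmod (evol a (fst z) (snd z) * evol (b y) (fst z) (snd z)))\<^sup>2)) \<in> borel_measurable (borel \<Otimes>\<^sub>M borel)"
      using evol_measurable(2)[of a] evol_measurable(2)[OF bm] by measurable
    have "(\<integral>\<^sup>+ t. \<integral>\<^sup>+ x. F t x y \<partial>lborel \<partial>lborel) = (\<integral>\<^sup>+ t. ennreal (\<kappa> y) * Lpow 2 (\<lambda>x. evol a t x * evol (b y) t x) \<partial>lborel)"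
    proof (intro nn_integral_cong)
      fix t
      show "(\<integral>\<^sup>+ x. F t x y \<partial>lborel) = ennreal (\<kappa> y) * Lpow 2 (\<lambda>x. evol a t x * evol (b y) t x)"
      proof -
        have "(\<lambda>x. ennreal ((cmod (evol a t x * evol (b y) t x))\<^sup>2)) \<in> borel_measurable lborel"
          using measurable_compose[OF measurable_Pair1' pm, of t] by simp
        then show ?thesis unfolding F_def Eb Lpow_def by (rule nn_integral_cmult)
      qed
    qed
    also have "\<dots> = ennreal (\<kappa> y) * (\<integral>\<^sup>+ t. Lpow 2 (\<lambda>x. evol a t x * evol (b y) t x) \<partial>lborel)"
      unfolding Lpow_def
      by (rule nn_integral_cmult) (use lborel.borel_measurable_nn_integral[of "\<lambda>t x. ennreal ((cmod (evol a t x * evol (b y) t x))\<^sup>2)" borel] pm in \<open>simp add: case_prod_beta'\<close>)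
    also have "\<dots> \<le> ennreal (\<kappa> y) * (ennreal ((2 * pi)\<^sup>2 * q) * (Lpow 2 a * Lpow 2 f))"
      unfolding bL[of y, symmetric] by (intro mult_left_mono bilinear_evol[OF a bi q0 bo]) auto
    finally show "(\<integral>\<^sup>+ t. \<integral>\<^sup>+ x. F t x y \<partial>lborel \<partial>lborel)
       \<le> ennreal (\<kappa> y) * (ennreal ((2 * pi)\<^sup>2 * q) * (Lpow 2 a * Lpow 2 f))" .
  qed
  also have "\<dots> = (\<integral>\<^sup>+ y. ennreal (\<kappa> y) \<partial>lborel) * (ennreal ((2 * pi)\<^sup>2 * q) * (Lpow 2 a * Lpow 2 f))"
    by (rule nn_integral_multc) measurable
  also have "\<dots> \<le> ennreal A * (ennreal ((2 * pi)\<^sup>2 * q) * (Lpow 2 a * Lpow 2 f))"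
    by (intro mult_right_mono \<kappa>A) auto
  finally show ?thesis .
qed

text \<open>\<open>W n\<close> is constant on the level sets of \<open>\<lfloor>4\<^sup>n
  \<alpha>\<rfloor>\<close>, and \<open>G n i\<close> is the increment \<open>W n - W (n - 1)\<close> on the
  \<open>i\<close>-th of them.\<close>

theorem bilinear_bounded_variation:
  fixes U :: "real \<Rightarrow> plane \<Rightarrow> complex" and \<alpha> :: "real \<Rightarrow> real" and \<xi> :: "real \<Rightarrow> plane"
  assumes a: "integrable lborel a"
    and B [measurable]: "B \<in> sets borel" and Bb: "bounded B" and q0: "0 \<le> q"
    and osc: "\<And>(b :: plane \<Rightarrow> complex) p. (\<And>\<eta>. b \<eta> \<noteq> 0 \<Longrightarrow> \<eta> \<in> B) \<Longrightarrow> osc_bound {z. a (p - z) \<noteq> 0 \<and> b (p + z) \<noteq> 0} q"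
    and U: "\<And>t. t \<in> J \<Longrightarrow> U t \<in> L2" and C0: "0 \<le> C"
    and UC: "\<And>t. t \<in> J \<Longrightarrow> Lpow 2 (U t) \<le> ennreal C"
    and \<alpha>: "\<And>t. t \<in> J \<Longrightarrow> 0 \<le> \<alpha> t \<and> \<alpha> t \<le> 1"
    and inc: "\<And>s t n. s \<in> J \<Longrightarrow> t \<in> J \<Longrightarrow> \<bar>\<alpha> t - \<alpha> s\<bar> \<le> (1 / 4) ^ n \<Longrightarrow>
        Lpow 2 (\<lambda>\<eta>. U t \<eta> - U s \<eta>) \<le> ennreal (C * (1 / 8) ^ n)"
    and m [measurable]: "m \<in> borel_measurable borel" and m1: "\<And>\<eta>. cmod (m \<eta>) \<le> 1" and mk: "mult_kernel m A" and A0: "0 \<le> A"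
    and mB: "\<And>t \<eta>. t \<in> J \<Longrightarrow> m (\<eta> - \<xi> t) \<noteq> 0 \<Longrightarrow> \<eta> \<in> B"
  shows "(\<integral>\<^sup>+ t\<in>J. Lpow 2 (\<lambda>x. evol a t x * evol (\<lambda>\<eta>. m (\<eta> - \<xi> t) * U t \<eta>) t x) \<partial>lborel)
     \<le> ennreal (60000 * q * A\<^sup>2 * C) * Lpow 2 a"
proof -
  have [measurable]: "a \<in> borel_measurable borel" using a by auto
  obtain \<kappa> where \<kappa> [measurable]: "\<kappa> \<in> borel_measurable borel" and \<kappa>A: "(\<integral>\<^sup>+ y. ennreal (\<kappa> y) \<partial>lborel) \<le> ennreal A"
    and \<kappa>0: "\<And>y. 0 \<le> \<kappa> y"
    and \<kappa>k: "\<And>\<xi>. \<exists>k. integrable lborel k \<and> (\<forall>y. cmod (k y) \<le> \<kappa> y) \<and> (AE \<eta> in lborel. m (\<eta> - \<xi>) = fourier k \<eta>)"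
    using mk unfolding mult_kernel_def by blast
  define idx where "idx = (\<lambda>n t. \<lfloor>4 ^ n * \<alpha> t\<rfloor>)"
  \<comment> \<open>One time of J is picked in each level set; the curve at that time is the value
    of the step function there.\<close>
  define rep where "rep = (\<lambda>n i. SOME t. t \<in> J \<and> idx n t = i)"
  have rep: "rep n (idx n t) \<in> J \<and> idx n (rep n (idx n t)) = idx n t" if "t \<in> J" for n t
    unfolding rep_def by (rule someI[of _ t]) (use that in simp)
  have close: "\<bar>\<alpha> t - \<alpha> (rep n (idx n t))\<bar> \<le> (1 / 4) ^ n" if "t \<in> J" for n t
  proof -
    have "\<lfloor>4 ^ n * \<alpha> (rep n (idx n t))\<rfloor> = \<lfloor>4 ^ n * \<alpha> t\<rfloor>" using rep[OF that, of n] by (simp add: idx_def)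
    then have "\<bar>4 ^ n * \<alpha> t - 4 ^ n * \<alpha> (rep n (idx n t))\<bar> \<le> 1" by linarith
    then have "4 ^ n * \<bar>\<alpha> t - \<alpha> (rep n (idx n t))\<bar> \<le> 1"
      by (simp add: abs_mult right_diff_distrib[symmetric])
    then show ?thesis by (simp add: power_divide field_simps)
  qed
  \<comment> \<open>Level sets are nested: the index at level n is the one at level n + 1 divided by
    4. Therefore the increment \<open>G (Suc n) i\<close> is determined by i.\<close>
  have idx_div: "idx (Suc n) t div 4 = idx n t" for n t
    using floor_divide_real_eq_div[of 4 "4 ^ Suc n * \<alpha> t"] by (simp add: idx_def)
  define W where "W = (\<lambda>n t. U (rep n (idx n t)))"
  define G where "G = (\<lambda>n i. case n of 0 \<Rightarrow> U (rep 0 i) | Suc n \<Rightarrow> (\<lambda>\<eta>. U (rep (Suc n) i) \<eta> - U (rep n (i div 4)) \<eta>))"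
  have G0: "G 0 (idx 0 t) = W 0 t" and GS: "G (Suc n) (idx (Suc n) t) = (\<lambda>\<eta>. W (Suc n) t \<eta> - W n t \<eta>)" for n t
    by (simp_all add: G_def W_def idx_div)
  have WL: "W n t \<in> L2" if "t \<in> J" for n t unfolding W_def using rep[OF that] by (intro U) auto
  have Wd: "Lpow 2 (\<lambda>\<eta>. U t \<eta> - W n t \<eta>) \<le> ennreal (C * (1 / 8) ^ n)" if "t \<in> J" for n t
    unfolding W_def using rep[OF that] close[OF that] that by (intro inc) auto
  have GL: "G n i \<in> L2" if i: "i \<in> idx n ` J" for n i
  proof -
    obtain t where t: "t \<in> J" "i = idx n t" using i by auto
    show ?thesis
    proof (cases n)
      case 0
      then show ?thesis using G0 WL[OF t(1)] t(2) by simp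
    next
      case (Suc n')
      then show ?thesis using GS L2_diff[OF WL[OF t(1)] WL[OF t(1)]] t(2) by simp
    qed
  qed
  \<comment> \<open>The triangle inequality through \<open>U t\<close> gives 2 + 2 * 8 = 18 times C
    / 8^(n + 1); 36 leaves room.\<close>
  have GC: "Lpow 2 (G n i) \<le> ennreal (36 * C * (1 / 8) ^ n)" if i: "i \<in> idx n ` J" for n i
  proof -
    obtain t where t: "t \<in> J" "i = idx n t" using i by auto
    show ?thesis
    proof (cases n)
      case 0
      have "Lpow 2 (W 0 t) \<le> ennreal C" unfolding W_def using rep[OF t(1)] by (intro UC) auto
      also have "\<dots> \<le> ennreal (36 * C)" using C0 by (intro ennreal_leI) auto
      finally show ?thesis using 0 t(2) G0 by simp
    next
      case (Suc n')
      have [measurable]: "U t \<in> borel_measurable borel" "W n t \<in> borel_measurable borel" for n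
        using L2D[OF U[OF t(1)]] L2D[OF WL[OF t(1)]] by auto
      have "Lpow 2 (\<lambda>\<eta>. W (Suc n') t \<eta> - W n' t \<eta>)
         \<le> 2 * Lpow 2 (\<lambda>\<eta>. W (Suc n') t \<eta> - U t \<eta>) + 2 * Lpow 2 (\<lambda>\<eta>. U t \<eta> - W n' t \<eta>)"
        by (rule Lpow2_triangle) measurable
      also have "\<dots> \<le> 2 * ennreal (C * (1 / 8) ^ Suc n') + 2 * ennreal (C * (1 / 8) ^ n')"
        unfolding Lpow2_minus_commute[of "W (Suc n') t"] by (intro add_mono mult_left_mono Wd t(1)) auto
      also have "\<dots> = ennreal (2 * (C * (1 / 8) ^ Suc n') + 2 * (C * (1 / 8) ^ n'))"
      proof -
        have x: "0 \<le> C * (1 / 8) ^ Suc n'" "0 \<le> C * (1 / 8) ^ n'" using C0 by simp_all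
        have two: "2 * ennreal r = ennreal (2 * r)" if "0 \<le> r" for r using that by (simp add: ennreal_mult)
        show ?thesis
          unfolding two[OF x(1)] two[OF x(2)] by (rule ennreal_plus[symmetric]) (use x in simp_all)
      qed
      also have "\<dots> \<le> ennreal (36 * C * (1 / 8) ^ Suc n')"
        using C0 by (intro ennreal_leI) simp
      finally show ?thesis using Suc t(2) GS by simp
    qed
  qed
  \<comment> \<open>The last index 4^n occurs when \<open>\<alpha> t\<close> is 1, so there are up
    to 4^n + 1 steps, at most 2 * 4^n.\<close>
  have idx_sub: "idx n ` J \<subseteq> {0..4 ^ n}" for n
  proof
    fix i assume "i \<in> idx n ` J"
    then obtain t where t: "t \<in> J" "i = \<lfloor>4 ^ n * \<alpha> t\<rfloor>" by (auto simp: idx_def)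
    have "\<lfloor>4 ^ n * \<alpha> t\<rfloor> \<le> \<lfloor>real_of_int (4 ^ n)\<rfloor>"
      using \<alpha>[OF t(1)] by (intro floor_mono) simp
    moreover have "\<lfloor>real_of_int (4 ^ n)\<rfloor> = 4 ^ n" by (rule floor_of_int)
    moreover have "0 \<le> \<lfloor>4 ^ n * \<alpha> t\<rfloor>" using \<alpha>[OF t(1)] by simp
    ultimately show "i \<in> {0..4 ^ n}" unfolding t(2) by (simp only: atLeastAtMost_iff)
  qed
  have fin: "finite (idx n ` J)" for n by (rule finite_subset[OF idx_sub]) simp
  have card: "real (card (idx n ` J)) \<le> 2 * 4 ^ n" for n
  proof -
    have "card (idx n ` J) \<le> card {0..(4::int) ^ n}" by (rule card_mono[OF _ idx_sub]) simp
    also have "\<dots> = 4 ^ n + 1" by (simp add: nat_add_distrib nat_power_eq)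
    finally have "real (card (idx n ` J)) \<le> real (4 ^ n + 1)" by (simp only: of_nat_le_iff)
    also have "\<dots> \<le> 2 * 4 ^ n" by simp
    finally show ?thesis .
  qed
  define \<beta> where "\<beta> = measure lborel B"
  have \<beta>: "emeasure lborel B = ennreal \<beta>"
    unfolding \<beta>_def using emeasure_bounded_finite[OF Bb] by (simp add: emeasure_eq_ennreal_measure)
  \<comment> \<open>Steps lie only in L2; restricted to the bounded set B they become integrable
    amplitudes. The multiplier vanishes off B, so it does not notice the restriction.\<close>
  define cut where "cut = (\<lambda>f (\<eta>::plane). indicator B \<eta> * f \<eta> :: complex)"
  have cut_int: "integrable lborel (cut f)" if "f \<in> L2" for f
    unfolding cut_def by (rule L2_indicator_integrable[OF that B emeasure_bounded_finite[OF Bb]])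
  have cut_m: "m (\<eta> - \<xi> t) * f \<eta> = m (\<eta> - \<xi> t) * cut f \<eta>" if "t \<in> J" for t \<eta> f
  proof (cases "\<eta> \<in> B")
    case False
    then have "m (\<eta> - \<xi> t) = 0" using mB[OF that] by blast
    then show ?thesis by simp
  qed (simp add: cut_def)
  have cut_fun: "(\<lambda>\<eta>. m (\<eta> - \<xi> t) * f \<eta>) = (\<lambda>\<eta>. m (\<eta> - \<xi> t) * cut f \<eta>)" if "t \<in> J" for t f
    by (rule ext) (rule cut_m[OF that])
  have mint: "integrable lborel (\<lambda>\<eta>. m (\<eta> - \<xi> t) * f \<eta>)" if "t \<in> J" "f \<in> L2" for t f
    unfolding cut_fun[OF that(1), of f]
  proof (rule Bochner_Integration.integrable_bound[OF cut_int[OF that(2)]])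
    have [measurable]: "f \<in> borel_measurable borel" using L2D[OF that(2)] by simp
    show "(\<lambda>\<eta>. m (\<eta> - \<xi> t) * cut f \<eta>) \<in> borel_measurable lborel" unfolding cut_def by measurable
    show "AE \<eta> in lborel. cmod (m (\<eta> - \<xi> t) * cut f \<eta>) \<le> cmod (cut f \<eta>)"
      using m1 by (intro AE_I2) (simp add: norm_mult mult_left_le_one_le)
  qed
  define Y where "Y = (\<lambda>f t x. evol (\<lambda>\<eta>. m (\<eta> - \<xi> t) * f \<eta>) t x)"
  have Ydiff: "Y (\<lambda>\<eta>. f \<eta> - g \<eta>) t x = Y f t x - Y g t x" if "t \<in> J" "f \<in> L2" "g \<in> L2" for f g t x
    unfolding Y_def right_diff_distrib by (intro evol_diff mint that)
  \<comment> \<open>Cauchy-Schwarz on B bounds the wave at every point x. This makes the telescoping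
    sum of steps converge pointwise to the wave of \<open>U t\<close>, and not merely in L2.\<close>
  have Ybound: "(cmod (Y f t x))\<^sup>2 \<le> \<beta> * c" if t: "t \<in> J" and f: "f \<in> L2" and c: "Lpow 2 f \<le> ennreal c" "0 \<le> c" for f t x c
  proof -
    have [measurable]: "f \<in> borel_measurable borel" using L2D[OF f] by simp
    have "ennreal (cmod (Y f t x)) \<le> (\<integral>\<^sup>+ \<eta>. ennreal (cmod (m (\<eta> - \<xi> t) * f \<eta> * cis (x \<bullet> \<eta> - t * (norm \<eta>)\<^sup>2))) \<partial>lborel)"
      unfolding Y_def evol_def by (rule norm_integral_le_nn)
    also have "\<dots> \<le> (\<integral>\<^sup>+ \<eta>. indicator B \<eta> * ennreal (cmod (f \<eta>)) \<partial>lborel)"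
    proof (rule nn_integral_mono)
      fix \<eta>
      have "cmod (m (\<eta> - \<xi> t)) * cmod (f \<eta>) \<le> 1 * cmod (f \<eta>)" by (intro mult_right_mono m1) auto
      then show "ennreal (cmod (m (\<eta> - \<xi> t) * f \<eta> * cis (x \<bullet> \<eta> - t * (norm \<eta>)\<^sup>2))) \<le> indicator B \<eta> * ennreal (cmod (f \<eta>))"
        using mB[OF t, of \<eta>] by (cases "\<eta> \<in> B") (auto simp: norm_mult intro: ennreal_leI)
    qed
    finally have "(ennreal (cmod (Y f t x)))\<^sup>2 \<le> (\<integral>\<^sup>+ \<eta>. indicator B \<eta> * ennreal (cmod (f \<eta>)) \<partial>lborel)\<^sup>2"
      by (rule power_mono) simp
    also have "\<dots> \<le> (\<integral>\<^sup>+ \<eta>. (indicator B \<eta>)\<^sup>2 \<partial>lborel) * (\<integral>\<^sup>+ \<eta>. (ennreal (cmod (f \<eta>)))\<^sup>2 \<partial>lborel)"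
      by (rule Cauchy_Schwarz_nn_integral) measurable
    also have "(\<integral>\<^sup>+ \<eta>. (indicator B \<eta>)\<^sup>2 \<partial>lborel) = (\<integral>\<^sup>+ \<eta>. indicator B \<eta> \<partial>lborel)"
      by (intro nn_integral_cong) (auto simp: indicator_def)
    also have "\<dots> = ennreal \<beta>" by (simp add: \<beta>)
    also have "(\<integral>\<^sup>+ \<eta>. (ennreal (cmod (f \<eta>)))\<^sup>2 \<partial>lborel) = Lpow 2 f" by (simp add: Lpow_def ennreal_power)
    also have "ennreal \<beta> * Lpow 2 f \<le> ennreal \<beta> * ennreal c" by (intro mult_left_mono c) auto
    also have "\<dots> = ennreal (\<beta> * c)" using c by (simp add: ennreal_mult \<beta>_def)
    finally have "ennreal ((cmod (Y f t x))\<^sup>2) \<le> ennreal (\<beta> * c)" by (simp add: ennreal_power)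
    then show ?thesis using c by (subst (asm) ennreal_le_iff) (auto simp: \<beta>_def)
  qed
  have Ylim: "(\<lambda>N. Y (W N t) t x) \<longlonglongrightarrow> Y (U t) t x" if t: "t \<in> J" for t x
  proof -
    have "(\<lambda>N. Y (\<lambda>\<eta>. U t \<eta> - W N t \<eta>) t x) \<longlonglongrightarrow> 0"
    proof -
      have b: "(cmod (Y (\<lambda>\<eta>. U t \<eta> - W N t \<eta>) t x))\<^sup>2 \<le> \<beta> * (C * (1 / 8) ^ N)" for N
        using C0 by (intro Ybound t L2_diff U WL Wd) auto
      have "(\<lambda>N. \<beta> * (C * (1 / 8) ^ N)) \<longlonglongrightarrow> \<beta> * (C * 0)"
        by (intro tendsto_mult tendsto_const LIMSEQ_realpow_zero) auto
      then have lim0: "(\<lambda>N. \<beta> * (C * (1 / 8) ^ N)) \<longlonglongrightarrow> 0" by simp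
      have "(\<lambda>N. (cmod (Y (\<lambda>\<eta>. U t \<eta> - W N t \<eta>) t x))\<^sup>2) \<longlonglongrightarrow> 0"
        by (rule tendsto_sandwich[OF _ _ tendsto_const lim0]; rule always_eventually; intro allI; (rule b)?; simp)
      then have "(\<lambda>N. sqrt ((cmod (Y (\<lambda>\<eta>. U t \<eta> - W N t \<eta>) t x))\<^sup>2)) \<longlonglongrightarrow> sqrt 0" by (rule tendsto_real_sqrt)
      then show ?thesis by (simp add: tendsto_norm_zero_iff)
    qed
    then have "(\<lambda>N. Y (U t) t x - Y (W N t) t x) \<longlonglongrightarrow> 0"
      by (simp only: Ydiff[OF t U[OF t] WL[OF t]])
    from tendsto_diff[OF tendsto_const[of "Y (U t) t x"] this] show ?thesis by simp
  qed
  have Ysum: "ennreal (cmod (Y (U t) t x)) \<le> (\<Sum>n. ennreal (cmod (Y (G n (idx n t)) t x)))" if t: "t \<in> J" for t x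
  proof (rule LIMSEQ_le_const2)
    show "(\<lambda>N. ennreal (cmod (Y (W N t) t x))) \<longlonglongrightarrow> ennreal (cmod (Y (U t) t x))"
      by (intro tendsto_ennrealI tendsto_norm Ylim t)
    have "ennreal (cmod (Y (W N t) t x)) \<le> (\<Sum>n<Suc N. ennreal (cmod (Y (G n (idx n t)) t x)))" for N
    proof (induction N)
      case 0
      then show ?case by (simp add: G0)
    next
      case (Suc N)
      have "Y (W (Suc N) t) t x = Y (W N t) t x + Y (G (Suc N) (idx (Suc N) t)) t x"
        unfolding GS Ydiff[OF t WL[OF t] WL[OF t]] by simp
      then have "ennreal (cmod (Y (W (Suc N) t) t x)) \<le> ennreal (cmod (Y (W N t) t x) + cmod (Y (G (Suc N) (idx (Suc N) t)) t x))"
        by (intro ennreal_leI) (simp add: norm_triangle_ineq)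
      also have "\<dots> = ennreal (cmod (Y (W N t) t x)) + ennreal (cmod (Y (G (Suc N) (idx (Suc N) t)) t x))"
        by (rule ennreal_plus) auto
      also have "\<dots> \<le> (\<Sum>n<Suc N. ennreal (cmod (Y (G n (idx n t)) t x))) + ennreal (cmod (Y (G (Suc N) (idx (Suc N) t)) t x))"
        by (intro add_right_mono Suc)
      finally show ?case by simp
    qed
    also have "(\<Sum>n<Suc N. ennreal (cmod (Y (G n (idx n t)) t x))) \<le> (\<Sum>n. ennreal (cmod (Y (G n (idx n t)) t x)))" for N
      by (rule sum_le_suminf) auto
    finally show "\<exists>N. \<forall>n\<ge>N. ennreal (cmod (Y (W n t) t x)) \<le> (\<Sum>n. ennreal (cmod (Y (G n (idx n t)) t x)))" by blast
  qed
  define R where "R = (\<lambda>n i t x. \<integral>\<^sup>+ y. ennreal (\<kappa> y) * (ennreal (cmod (evol (cut (G n i)) t (x - y))))\<^sup>2 \<partial>lborel)"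
  have YR: "(ennreal (cmod (Y f t x)))\<^sup>2 \<le> ennreal A * (\<integral>\<^sup>+ y. ennreal (\<kappa> y) * (ennreal (cmod (evol (cut f) t (x - y))))\<^sup>2 \<partial>lborel)"
    if t: "t \<in> J" and f: "f \<in> L2" for f t x
  proof -
    have [measurable]: "cut f \<in> borel_measurable borel" using cut_int[OF f] by auto
    obtain k where k: "integrable lborel k" "\<And>y. cmod (k y) \<le> \<kappa> y" "AE \<eta> in lborel. m (\<eta> - \<xi> t) = fourier k \<eta>"
      using \<kappa>k by blast
    have "ennreal (cmod (Y f t x)) \<le> (\<integral>\<^sup>+ y. ennreal (\<kappa> y) * ennreal (cmod (evol (cut f) t (x - y))) \<partial>lborel)"
      unfolding Y_def cut_fun[OF t, of f] by (rule evol_kernel_bound[OF cut_int[OF f] k(1,2) _ k(3)]) measurable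
    then have "(ennreal (cmod (Y f t x)))\<^sup>2 \<le> (\<integral>\<^sup>+ y. ennreal (\<kappa> y) * ennreal (cmod (evol (cut f) t (x - y))) \<partial>lborel)\<^sup>2"
      by (rule power_mono) simp
    also have "\<dots> \<le> ennreal A * (\<integral>\<^sup>+ y. ennreal (\<kappa> y) * (ennreal (cmod (evol (cut f) t (x - y))))\<^sup>2 \<partial>lborel)"
      by (rule nn_integral_weighted_square) (use \<kappa>0 \<kappa>A in auto)
    finally show ?thesis .
  qed
  \<comment> \<open>The term with index \<open>idx n t\<close> is replaced by the sum over all i,
    each a fixed amplitude. The bound becomes jointly measurable in t and x, whereas nothing is
    known about how \<open>idx n t\<close> and \<open>\<xi> t\<close> depend on t.\<close>
  define S where "S = (\<lambda>t x. ennreal (16 / 7 * A) * (\<Sum>n. ennreal ((16 / 9) ^ n) * (\<Sum>i\<in>idx n ` J. R n i t x)))"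
  have YS: "(ennreal (cmod (Y (U t) t x)))\<^sup>2 \<le> S t x" if t: "t \<in> J" for t x
  proof -
    have "(ennreal (cmod (Y (U t) t x)))\<^sup>2 \<le> (\<Sum>n. ennreal (cmod (Y (G n (idx n t)) t x)))\<^sup>2"
      by (intro power_mono Ysum t) simp
    also have "\<dots> \<le> ennreal (16 / 7) * (\<Sum>n. ennreal ((16 / 9) ^ n) * (ennreal (cmod (Y (G n (idx n t)) t x)))\<^sup>2)"
      by (rule suminf_weighted_square)
    also have "\<dots> \<le> ennreal (16 / 7) * (\<Sum>n. ennreal A * (ennreal ((16 / 9) ^ n) * (\<Sum>i\<in>idx n ` J. R n i t x)))"
    proof (intro mult_left_mono suminf_le)
      fix n
      have i: "idx n t \<in> idx n ` J" using t by simp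
      have "(ennreal (cmod (Y (G n (idx n t)) t x)))\<^sup>2 \<le> ennreal A * R n (idx n t) t x"
        unfolding R_def by (rule YR[OF t GL[OF i]])
      also have "\<dots> \<le> ennreal A * (\<Sum>i\<in>idx n ` J. R n i t x)"
        by (intro mult_left_mono member_le_sum[OF i] fin) auto
      finally show "ennreal ((16 / 9) ^ n) * (ennreal (cmod (Y (G n (idx n t)) t x)))\<^sup>2
         \<le> ennreal A * (ennreal ((16 / 9) ^ n) * (\<Sum>i\<in>idx n ` J. R n i t x))"
        unfolding mult.left_commute[of "ennreal A"] by (rule mult_left_mono) simp
    qed auto
    also have "\<dots> = S t x"
    proof -
      have e: "ennreal (16 / 7 * A) = ennreal (16 / 7) * ennreal A"
        using A0 by (intro ennreal_mult) auto
      show ?thesis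
        unfolding S_def e ennreal_suminf_cmult by (rule mult.assoc[symmetric])
    qed
    finally show ?thesis .
  qed
  have Rm [measurable]: "(\<lambda>(t, x). R n i t x) \<in> borel_measurable (borel \<Otimes>\<^sub>M borel)" if i: "i \<in> idx n ` J" for n i
  proof -
    have [measurable]: "cut (G n i) \<in> borel_measurable borel" using cut_int[OF GL[OF i]] by auto
    have "(\<lambda>(z, y). ennreal (\<kappa> y) * (ennreal (cmod (evol (cut (G n i)) (fst z) (snd z - y))))\<^sup>2) \<in> borel_measurable ((borel \<Otimes>\<^sub>M borel) \<Otimes>\<^sub>M lborel)"
      using evol_measurable(2)[of "cut (G n i)", THEN measurable_compose[rotated], of "\<lambda>z. (fst (fst z), snd (fst z) - snd z)"]
      by measurable
    from lborel.borel_measurable_nn_integral[OF this] show ?thesis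
      by (simp add: R_def case_prod_beta')
  qed
  have Rint: "(\<integral>\<^sup>+ t. \<integral>\<^sup>+ x. ennreal ((cmod (evol a t x))\<^sup>2) * R n i t x \<partial>lborel \<partial>lborel)
      \<le> ennreal ((2 * pi)\<^sup>2 * q * A * (36 * C * (1 / 8) ^ n)) * Lpow 2 a" if i: "i \<in> idx n ` J" for n i
  proof -
    have "osc_bound {z. a (p - z) \<noteq> 0 \<and> cut (G n i) (p + z) \<noteq> 0} q" for p
      by (rule osc) (auto simp: cut_def indicator_def split: if_splits)
    note average = bilinear_evol_average[OF a cut_int[OF GL[OF i]] \<kappa> \<kappa>A q0 this]
    have "Lpow 2 (cut (G n i)) \<le> ennreal (36 * C * (1 / 8) ^ n)"
      by (rule order_trans[OF Lpow_mono GC[OF i]]) (auto simp: cut_def norm_mult indicator_def)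
    then have "ennreal A * (ennreal ((2 * pi)\<^sup>2 * q) * (Lpow 2 a * Lpow 2 (cut (G n i))))
        \<le> ennreal A * (ennreal ((2 * pi)\<^sup>2 * q) * (Lpow 2 a * ennreal (36 * C * (1 / 8) ^ n)))"
      by (intro mult_left_mono) auto
    also have "\<dots> = (ennreal ((2 * pi)\<^sup>2 * q) * ennreal A * ennreal (36 * C * (1 / 8) ^ n)) * Lpow 2 a"
      by (simp only: mult_ac)
    also have "ennreal ((2 * pi)\<^sup>2 * q) * ennreal A * ennreal (36 * C * (1 / 8) ^ n) = ennreal ((2 * pi)\<^sup>2 * q * A * (36 * C * (1 / 8) ^ n))"
      using q0 A0 C0 by (simp only: ennreal_mult[symmetric] mult_nonneg_nonneg zero_le_power2 zero_le_power zero_le_divide_1_iff zero_le_numeral)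
    finally show ?thesis unfolding R_def by (rule order_trans[OF average])
  qed
  have Rm': "(\<lambda>x. R n i t x) \<in> borel_measurable borel" if "i \<in> idx n ` J" for n i t
    using measurable_compose[OF measurable_Pair1' Rm[OF that], of t] by simp
  have am': "(\<lambda>x. evol a t x) \<in> borel_measurable borel" for t using evol_measurable(3)[of a t] by simp
  define P where "P = (\<lambda>n i t. \<integral>\<^sup>+ x. ennreal ((cmod (evol a t x))\<^sup>2) * R n i t x \<partial>lborel)"
  have Pm: "P n i \<in> borel_measurable borel" if i: "i \<in> idx n ` J" for n i
  proof -
    have "(\<lambda>(t, x). ennreal ((cmod (evol a t x))\<^sup>2) * R n i t x) \<in> borel_measurable (borel \<Otimes>\<^sub>M lborel)"
      using Rm[OF i] evol_measurable(2)[of a] by (simp add: case_prod_beta')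
    from lborel.borel_measurable_nn_integral[OF this] show ?thesis by (simp add: P_def)
  qed
  have "(\<integral>\<^sup>+ t\<in>J. Lpow 2 (\<lambda>x. evol a t x * Y (U t) t x) \<partial>lborel)
     \<le> (\<integral>\<^sup>+ t. ennreal (16 / 7 * A) * (\<Sum>n. ennreal ((16 / 9) ^ n) * (\<Sum>i\<in>idx n ` J. P n i t)) \<partial>lborel)"
  proof (rule nn_integral_mono)
    fix t
    show "Lpow 2 (\<lambda>x. evol a t x * Y (U t) t x) * indicator J t
       \<le> ennreal (16 / 7 * A) * (\<Sum>n. ennreal ((16 / 9) ^ n) * (\<Sum>i\<in>idx n ` J. P n i t))"
    proof (cases "t \<in> J")
      case True
      have "Lpow 2 (\<lambda>x. evol a t x * Y (U t) t x) \<le> (\<integral>\<^sup>+ x. ennreal ((cmod (evol a t x))\<^sup>2) * S t x \<partial>lborel)"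
        unfolding Lpow_def using YS[OF True]
        by (intro nn_integral_mono) (simp add: norm_mult power_mult_distrib ennreal_mult ennreal_power mult_left_mono)
      also have "\<dots> = (\<integral>\<^sup>+ x. ennreal (16 / 7 * A) * (\<Sum>n. ennreal ((16 / 9) ^ n) * (\<Sum>i\<in>idx n ` J. ennreal ((cmod (evol a t x))\<^sup>2) * R n i t x)) \<partial>lborel)"
        unfolding S_def by (intro nn_integral_cong)
          (simp only: mult.left_commute[of "ennreal ((cmod (evol a t _))\<^sup>2)"] ennreal_suminf_cmult[symmetric] sum_distrib_left)
      also have "\<dots> = ennreal (16 / 7 * A) * (\<integral>\<^sup>+ x. (\<Sum>n. ennreal ((16 / 9) ^ n) * (\<Sum>i\<in>idx n ` J. ennreal ((cmod (evol a t x))\<^sup>2) * R n i t x)) \<partial>lborel)"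
        using Rm' am' by (intro nn_integral_cmult) measurable
      also have "(\<integral>\<^sup>+ x. (\<Sum>n. ennreal ((16 / 9) ^ n) * (\<Sum>i\<in>idx n ` J. ennreal ((cmod (evol a t x))\<^sup>2) * R n i t x)) \<partial>lborel)
         = (\<Sum>n. \<integral>\<^sup>+ x. ennreal ((16 / 9) ^ n) * (\<Sum>i\<in>idx n ` J. ennreal ((cmod (evol a t x))\<^sup>2) * R n i t x) \<partial>lborel)"
        using Rm' am' by (intro nn_integral_suminf) measurable
      also have "\<dots> = (\<Sum>n. ennreal ((16 / 9) ^ n) * (\<Sum>i\<in>idx n ` J. P n i t))"
      proof (intro suminf_cong)
        fix n
        have "(\<integral>\<^sup>+ x. ennreal ((16 / 9) ^ n) * (\<Sum>i\<in>idx n ` J. ennreal ((cmod (evol a t x))\<^sup>2) * R n i t x) \<partial>lborel)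
           = ennreal ((16 / 9) ^ n) * (\<integral>\<^sup>+ x. (\<Sum>i\<in>idx n ` J. ennreal ((cmod (evol a t x))\<^sup>2) * R n i t x) \<partial>lborel)"
          using Rm' am' by (intro nn_integral_cmult) measurable
        also have "(\<integral>\<^sup>+ x. (\<Sum>i\<in>idx n ` J. ennreal ((cmod (evol a t x))\<^sup>2) * R n i t x) \<partial>lborel) = (\<Sum>i\<in>idx n ` J. P n i t)"
          unfolding P_def using Rm' am' by (intro nn_integral_sum) measurable
        finally show "(\<integral>\<^sup>+ x. ennreal ((16 / 9) ^ n) * (\<Sum>i\<in>idx n ` J. ennreal ((cmod (evol a t x))\<^sup>2) * R n i t x) \<partial>lborel)
           = ennreal ((16 / 9) ^ n) * (\<Sum>i\<in>idx n ` J. P n i t)" .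
      qed
      finally show ?thesis using True by simp
    qed simp
  qed
  also have "\<dots> = ennreal (16 / 7 * A) * (\<integral>\<^sup>+ t. (\<Sum>n. ennreal ((16 / 9) ^ n) * (\<Sum>i\<in>idx n ` J. P n i t)) \<partial>lborel)"
    using Pm by (intro nn_integral_cmult) measurable
  also have "(\<integral>\<^sup>+ t. (\<Sum>n. ennreal ((16 / 9) ^ n) * (\<Sum>i\<in>idx n ` J. P n i t)) \<partial>lborel)
     = (\<Sum>n. \<integral>\<^sup>+ t. ennreal ((16 / 9) ^ n) * (\<Sum>i\<in>idx n ` J. P n i t) \<partial>lborel)"
    using Pm by (intro nn_integral_suminf) measurable
  finally have main: "(\<integral>\<^sup>+ t\<in>J. Lpow 2 (\<lambda>x. evol a t x * Y (U t) t x) \<partial>lborel)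
     \<le> ennreal (16 / 7 * A) * (\<Sum>n. \<integral>\<^sup>+ t. ennreal ((16 / 9) ^ n) * (\<Sum>i\<in>idx n ` J. P n i t) \<partial>lborel)" .
  define c where "c = (2 * pi)\<^sup>2 * q * A * (36 * C)"
  have c0: "0 \<le> c" using q0 A0 C0 by (simp add: c_def)
  have level: "(\<integral>\<^sup>+ t. ennreal ((16 / 9) ^ n) * (\<Sum>i\<in>idx n ` J. P n i t) \<partial>lborel) \<le> ennreal (2 * c * (8 / 9) ^ n) * Lpow 2 a" for n
  proof -
    have "(\<integral>\<^sup>+ t. ennreal ((16 / 9) ^ n) * (\<Sum>i\<in>idx n ` J. P n i t) \<partial>lborel)
       = ennreal ((16 / 9) ^ n) * (\<integral>\<^sup>+ t. (\<Sum>i\<in>idx n ` J. P n i t) \<partial>lborel)"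
      using Pm by (intro nn_integral_cmult) measurable
    also have "(\<integral>\<^sup>+ t. (\<Sum>i\<in>idx n ` J. P n i t) \<partial>lborel) = (\<Sum>i\<in>idx n ` J. \<integral>\<^sup>+ t. P n i t \<partial>lborel)"
      using Pm by (intro nn_integral_sum) auto
    also have "ennreal ((16 / 9) ^ n) * \<dots> \<le> ennreal ((16 / 9) ^ n) * (\<Sum>i\<in>idx n ` J. ennreal (c * (1 / 8) ^ n) * Lpow 2 a)"
    proof (intro mult_left_mono sum_mono)
      fix i assume "i \<in> idx n ` J"
      from Rint[OF this] show "(\<integral>\<^sup>+ t. P n i t \<partial>lborel) \<le> ennreal (c * (1 / 8) ^ n) * Lpow 2 a"
        by (simp add: P_def c_def mult.assoc)
    qed simp
    also have "(\<Sum>i\<in>idx n ` J. ennreal (c * (1 / 8) ^ n) * Lpow 2 a) = ennreal (real (card (idx n ` J))) * (ennreal (c * (1 / 8) ^ n) * Lpow 2 a)"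
      by (simp add: ennreal_of_nat_eq_real_of_nat)
    also have "ennreal ((16 / 9) ^ n) * (ennreal (real (card (idx n ` J))) * (ennreal (c * (1 / 8) ^ n) * Lpow 2 a))
       \<le> ennreal ((16 / 9) ^ n) * (ennreal (2 * 4 ^ n) * (ennreal (c * (1 / 8) ^ n) * Lpow 2 a))"
      by (intro mult_left_mono mult_right_mono ennreal_leI card) auto
    also have "\<dots> = (ennreal ((16 / 9) ^ n) * ennreal (2 * 4 ^ n) * ennreal (c * (1 / 8) ^ n)) * Lpow 2 a"
      by (simp only: mult.assoc)
    also have "ennreal ((16 / 9) ^ n) * ennreal (2 * 4 ^ n) * ennreal (c * (1 / 8) ^ n) = ennreal ((16 / 9) ^ n * (2 * 4 ^ n) * (c * (1 / 8) ^ n))"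
      using c0 by (simp only: ennreal_mult[symmetric] mult_nonneg_nonneg zero_le_power divide_nonneg_nonneg zero_le_numeral zero_le_one)
    also have "(16 / 9) ^ n * (2 * 4 ^ n) * (c * (1 / 8) ^ n) = 2 * c * ((16 / 9) * 4 * (1 / 8)) ^ n"
      by (simp only: power_mult_distrib mult_ac)
    finally show ?thesis by simp
  qed
  have "(\<Sum>n. \<integral>\<^sup>+ t. ennreal ((16 / 9) ^ n) * (\<Sum>i\<in>idx n ` J. P n i t) \<partial>lborel)
     \<le> (\<Sum>n. ennreal (2 * c * (8 / 9) ^ n) * Lpow 2 a)"
    by (intro suminf_le level) auto
  also have "\<dots> = (\<Sum>n. ennreal (2 * c * (8 / 9) ^ n)) * Lpow 2 a" by (rule ennreal_suminf_multc)
  also have "(\<Sum>n. ennreal (2 * c * (8 / 9) ^ n)) = ennreal (\<Sum>n. 2 * c * (8 / 9) ^ n)"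
    using c0 by (intro suminf_ennreal2) (auto intro!: summable_mult summable_geometric)
  also have "(\<Sum>n. 2 * c * (8 / 9) ^ n) = 18 * c"
    by (subst suminf_mult) (auto simp: suminf_geometric intro: summable_geometric)
  finally have "(\<integral>\<^sup>+ t\<in>J. Lpow 2 (\<lambda>x. evol a t x * Y (U t) t x) \<partial>lborel) \<le> ennreal (16 / 7 * A) * (ennreal (18 * c) * Lpow 2 a)"
    by (intro order_trans[OF main] mult_left_mono) auto
  also have "\<dots> = ennreal (16 / 7 * A * (18 * c)) * Lpow 2 a"
  proof -
    have e: "ennreal (16 / 7 * A * (18 * c)) = ennreal (16 / 7 * A) * ennreal (18 * c)"
      using A0 c0 by (intro ennreal_mult) auto
    show ?thesis unfolding e by (rule mult.assoc[symmetric])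
  qed
  also have "\<dots> \<le> ennreal (60000 * q * A\<^sup>2 * C) * Lpow 2 a"
  proof (intro mult_right_mono ennreal_leI)
    have pi2: "(2 * pi)\<^sup>2 \<le> 40"
    proof -
      have "pi \<le> 3.15" using pi_approx by simp
      then have "(2 * pi)\<^sup>2 \<le> (6.3)\<^sup>2" by (intro power_mono) auto
      then show ?thesis by (simp add: power2_eq_square)
    qed
    \<comment> \<open>The number 40 * (16 / 7) * 18 * 36 is about 59246. Here 40 bounds (2 pi)^2, 16
      / 7 is from \<open>suminf_weighted_square\<close>, 36 from \<open>GC\<close>, and 18 = 2 * 9
      from the count of steps and the series of ratio 8 / 9.\<close>
    have "16 / 7 * A * (18 * c) = (2 * pi)\<^sup>2 * (16 / 7 * 18 * 36) * (q * A\<^sup>2 * C)"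
      by (simp add: c_def power2_eq_square)
    also have "\<dots> \<le> 40 * (16 / 7 * 18 * 36) * (q * A\<^sup>2 * C)"
      using q0 C0 pi2 by (intro mult_right_mono) auto
    also have "\<dots> \<le> 60000 * (q * A\<^sup>2 * C)"
      using q0 C0 by (intro mult_right_mono) auto
    finally show "16 / 7 * A * (18 * c) \<le> 60000 * q * A\<^sup>2 * C" by (simp add: mult.assoc)
  qed simp
  finally show ?thesis unfolding Y_def .
qed

section \<open>Littlewood--Paley pieces of rescaled solutions\<close>

lemma Lpow2_eq_mass:
  assumes f: "f \<in> L2"
  shows "Lpow 2 f = ennreal (mass f)"
proof -
  have [measurable]: "f \<in> borel_measurable borel" using L2D[OF f] by simp
  have "mass f = enn2real (Lpow 2 f)"
    unfolding mass_def Lpow_def by (rule integral_eq_nn_integral) auto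
  then show ?thesis using L2D[OF f] by simp
qed

lemma mass_nonneg: "0 \<le> mass f"
  unfolding mass_def by (intro Bochner_Integration.integral_nonneg) auto

lemma L2_norm_sq: "(L2_norm f)\<^sup>2 = mass f"
  by (simp add: L2_norm_def mass_nonneg)

text \<open>Modulating before and after translates the symbol by \<xi>, and its bounded support
  makes the amplitude integrable. The phase in t is inserted only to cancel the one in
  \<open>evol\<close>; it turns the transform of f into a profile.\<close>

lemma shifted_multiplier_eq_evol:
  assumes f: "f \<in> L2" and m [measurable]: "m \<in> borel_measurable borel"
    and m1: "\<And>\<eta>. cmod (m \<eta>) \<le> 1" and supp: "\<And>\<eta>. \<rho> < norm \<eta> \<Longrightarrow> m \<eta> = 0"
  shows "AE x in lborel. shifted \<xi> (multiplier m) f x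
      = evol (\<lambda>\<eta>. m (\<eta> - \<xi>) * (cis (t * (norm \<eta>)\<^sup>2) * fourier_L2 f \<eta>)) t x / complex_of_real ((2 * pi)\<^sup>2)"
    and "integrable lborel (\<lambda>\<eta>. m (\<eta> - \<xi>) * (cis (t * (norm \<eta>)\<^sup>2) * fourier_L2 f \<eta>))"
proof -
  have [measurable]: "f \<in> borel_measurable borel" "fourier_L2 f \<in> borel_measurable borel"
    using L2D[OF f] fourier_L2_measurable[OF f] by auto
  define g where "g = (\<lambda>y. cis (- (y \<bullet> \<xi>)) * f y)"
  have g: "g \<in> L2" unfolding g_def by (rule L2_cis_mult[OF f]) measurable
  define b where "b = (\<lambda>\<eta>. m \<eta> * fourier_L2 f (\<xi> + \<eta>))"
  have FL: "(\<lambda>\<eta>. fourier_L2 f (\<xi> + \<eta>)) \<in> L2"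
    using L2_affine[OF fourier_L2_spec(1)[OF f], of 1 \<xi>] by simp
  have b: "b \<in> L2" unfolding b_def by (rule L2_mult[OF FL m m1])
  have [measurable]: "b \<in> borel_measurable borel" using L2D[OF b] by simp
  have bi: "integrable lborel b"
  proof -
    have "integrable lborel (\<lambda>\<eta>. indicator (cball 0 \<rho>) \<eta> * b \<eta>)"
      by (rule L2_indicator_integrable[OF b _ emeasure_bounded_finite[OF bounded_cball]]) simp
    moreover have "(\<lambda>\<eta>. indicator (cball 0 \<rho>) \<eta> * b \<eta>) = b"
      using supp by (auto simp: fun_eq_iff b_def indicator_def)
    ultimately show ?thesis by simp
  qed
  have h: "integrable lborel (\<lambda>\<eta>. m (\<eta> - \<xi>) * fourier_L2 f \<eta>)"
    using integrable_lborel_translate[OF bi, of "- \<xi>"] by (simp add: b_def)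
  have "integrable lborel (\<lambda>\<eta>. cis (t * (norm \<eta>)\<^sup>2) * (m (\<eta> - \<xi>) * fourier_L2 f \<eta>))"
    by (rule integrable_cis_mult(2)[OF h]) measurable
  then show "integrable lborel (\<lambda>\<eta>. m (\<eta> - \<xi>) * (cis (t * (norm \<eta>)\<^sup>2) * fourier_L2 f \<eta>))"
    by (simp only: mult.left_commute)
  have "multiplier m g = inv_fourier_L2 b"
    unfolding multiplier_def
  proof (rule inv_fourier_L2_cong[OF _ b])
    show "(\<lambda>\<eta>. m \<eta> * fourier_L2 g \<eta>) \<in> L2" by (rule L2_mult[OF fourier_L2_spec(1)[OF g] m m1])
    show "AE \<eta> in lborel. m \<eta> * fourier_L2 g \<eta> = b \<eta>"
      using fourier_L2_modulate[OF f, of \<xi>] unfolding g_def[symmetric]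
      by eventually_elim (simp add: b_def)
  qed
  then have "AE x in lborel. multiplier m g x = ift b x"
    using inv_fourier_L2_eq_ift[OF b bi] by simp
  moreover have "cis (x \<bullet> \<xi>) * ift b x
      = evol (\<lambda>\<eta>. m (\<eta> - \<xi>) * (cis (t * (norm \<eta>)\<^sup>2) * fourier_L2 f \<eta>)) t x / complex_of_real ((2 * pi)\<^sup>2)" for x
  proof -
    have "evol (\<lambda>\<eta>. m (\<eta> - \<xi>) * (cis (t * (norm \<eta>)\<^sup>2) * fourier_L2 f \<eta>)) t x
      = (LINT \<eta>|lborel. m (\<eta> - \<xi>) * fourier_L2 f \<eta> * cis (x \<bullet> \<eta>))"
      unfolding evol_def
    proof (intro Bochner_Integration.integral_cong refl)
      fix \<eta>
      have "cis (t * (norm \<eta>)\<^sup>2) * cis (x \<bullet> \<eta> - t * (norm \<eta>)\<^sup>2) = cis (x \<bullet> \<eta>)"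
        by (simp add: cis_mult)
      then show "m (\<eta> - \<xi>) * (cis (t * (norm \<eta>)\<^sup>2) * fourier_L2 f \<eta>) * cis (x \<bullet> \<eta> - t * (norm \<eta>)\<^sup>2)
        = m (\<eta> - \<xi>) * fourier_L2 f \<eta> * cis (x \<bullet> \<eta>)"
        by (simp only: mult.assoc mult.left_commute[of "cis (t * (norm \<eta>)\<^sup>2)"])
    qed
    also have "\<dots> = (LINT \<eta>|lborel. m (\<xi> + \<eta> - \<xi>) * fourier_L2 f (\<xi> + \<eta>) * cis (x \<bullet> (\<xi> + \<eta>)))"
      by (rule integral_lborel_translate[symmetric]) measurable
    also have "\<dots> = (LINT \<eta>|lborel. cis (x \<bullet> \<xi>) * (b \<eta> * cis (- (\<eta> \<bullet> - x))))"
    proof (intro Bochner_Integration.integral_cong refl)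
      fix \<eta>
      have "cis (x \<bullet> (\<xi> + \<eta>)) = cis (x \<bullet> \<xi>) * cis (- (\<eta> \<bullet> - x))"
        by (simp add: cis_mult inner_add_right inner_commute)
      then show "m (\<xi> + \<eta> - \<xi>) * fourier_L2 f (\<xi> + \<eta>) * cis (x \<bullet> (\<xi> + \<eta>)) = cis (x \<bullet> \<xi>) * (b \<eta> * cis (- (\<eta> \<bullet> - x)))"
        by (simp add: b_def mult_ac)
    qed
    also have "\<dots> = cis (x \<bullet> \<xi>) * fourier b (- x)"
      unfolding fourier_def by (rule integral_mult_right_zero)
    finally show ?thesis by (simp add: ift_def)
  qed
  ultimately show "AE x in lborel. shifted \<xi> (multiplier m) f x
      = evol (\<lambda>\<eta>. m (\<eta> - \<xi>) * (cis (t * (norm \<eta>)\<^sup>2) * fourier_L2 f \<eta>)) t x / complex_of_real ((2 * pi)\<^sup>2)"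
    by (auto elim!: eventually_mono simp: shifted_def g_def)
qed

section \<open>Symbols of the Littlewood-Paley projections\<close>

lemma cutoff_props:
  assumes \<phi>: "lp_cutoff \<phi>"
  shows "\<phi> \<in> borel_measurable borel" "0 \<le> \<phi> x" "\<phi> x \<le> 1" "norm x \<le> norm y \<Longrightarrow> \<phi> y \<le> \<phi> x" "2 < norm x \<Longrightarrow> \<phi> x = 0"
proof -
  have "iter_partial [] \<phi> differentiable_on UNIV" using \<phi> unfolding lp_cutoff_def smooth_fun_def by blast
  then have "continuous_on UNIV \<phi>" by (simp add: differentiable_imp_continuous_on)
  then show "\<phi> \<in> borel_measurable borel" by (rule borel_measurable_continuous_onI)
  show "0 \<le> \<phi> x" "\<phi> x \<le> 1" "norm x \<le> norm y \<Longrightarrow> \<phi> y \<le> \<phi> x" "2 < norm x \<Longrightarrow> \<phi> x = 0"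
    using \<phi> unfolding lp_cutoff_def by blast+
qed

lemma lp_symbol_props:
  assumes \<phi>: "lp_cutoff \<phi>" and j: "0 \<le> j"
  shows "lp_symbol \<phi> j \<in> borel_measurable borel" "\<bar>lp_symbol \<phi> j \<eta>\<bar> \<le> 1" "2 powi (j + 1) < norm \<eta> \<Longrightarrow> lp_symbol \<phi> j \<eta> = 0"
proof -
  note c = cutoff_props[OF \<phi>]
  note [measurable] = c(1)
  show "lp_symbol \<phi> j \<in> borel_measurable borel"
  proof (cases "j = 0")
    case True
    then have "lp_symbol \<phi> j = \<phi>" by (simp add: fun_eq_iff lp_symbol_def)
    then show ?thesis by simp
  next
    case False
    then have "lp_symbol \<phi> j = (\<lambda>\<xi>. \<phi> ((2 powi (- j)) *\<^sub>R \<xi>) - \<phi> ((2 powi (- j + 1)) *\<^sub>R \<xi>))"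
      using j by (simp add: fun_eq_iff lp_symbol_def)
    then show ?thesis by simp
  qed
  show "\<bar>lp_symbol \<phi> j \<eta>\<bar> \<le> 1"
    using c(2)[of \<eta>] c(3)[of \<eta>] c(2)[of "(2 powi (- j)) *\<^sub>R \<eta>"] c(3)[of "(2 powi (- j)) *\<^sub>R \<eta>"]
      c(2)[of "(2 powi (- j + 1)) *\<^sub>R \<eta>"] c(3)[of "(2 powi (- j + 1)) *\<^sub>R \<eta>"]
    unfolding lp_symbol_def abs_le_iff by (auto split: if_splits)
  show "lp_symbol \<phi> j \<eta> = 0" if n: "2 powi (j + 1) < norm \<eta>"
  proof -
    have e: "(2::real) powi (j + 1) = 2 * 2 powi j" by (simp add: power_int_add)
    have "2 powi (- j) * (2 * 2 powi j) < 2 powi (- j) * norm \<eta>"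
      using n unfolding e by (intro mult_strict_left_mono) auto
    moreover have "2 powi (- j) * (2 * 2 powi j) = (2::real)" by (simp add: power_int_minus field_simps)
    ultimately have a: "2 < norm ((2 powi (- j)) *\<^sub>R \<eta>)" by simp
    have p1: "(2::real) powi (- j + 1) = 2 * 2 powi (- j)" using power_int_add[of "2::real" "- j" 1] by simp
    have "norm ((2 powi (- j + 1)) *\<^sub>R \<eta>) = 2 * norm ((2 powi (- j)) *\<^sub>R \<eta>)"
      unfolding p1 scaleR_scaleR[symmetric] norm_scaleR[of 2] by simp
    with a have b: "2 < norm ((2 powi (- j + 1)) *\<^sub>R \<eta>)" by linarith
    show ?thesis
    proof (cases "j = 0")
      case True
      then show ?thesis using c(5) a by (simp add: lp_symbol_def)
    next
      case False
      then show ?thesis using c(5)[OF a] c(5)[OF b] j by (simp add: lp_symbol_def)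
    qed
  qed
qed

definition lp_le_symbol :: "(plane \<Rightarrow> real) \<Rightarrow> int \<Rightarrow> plane \<Rightarrow> real" where
  "lp_le_symbol \<phi> l \<eta> = (\<Sum>j\<in>{0..l}. lp_symbol \<phi> j \<eta>)"

lemma lp_le_symbol_props:
  assumes \<phi>: "lp_cutoff \<phi>" and l: "0 \<le> l"
  shows "lp_le_symbol \<phi> l \<in> borel_measurable borel" "\<bar>lp_le_symbol \<phi> l \<eta>\<bar> \<le> 1" "2 powi (l + 1) < norm \<eta> \<Longrightarrow> lp_le_symbol \<phi> l \<eta> = 0"
proof -
  note c = cutoff_props[OF \<phi>]
  note [measurable] = c(1)
  have e: "lp_le_symbol \<phi> l = (\<lambda>\<eta>. \<phi> ((2 powi (- l)) *\<^sub>R \<eta>))"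
    by (simp add: fun_eq_iff lp_le_symbol_def lp_symbol_sum[OF l])
  show "lp_le_symbol \<phi> l \<in> borel_measurable borel" unfolding e by measurable
  show "\<bar>lp_le_symbol \<phi> l \<eta>\<bar> \<le> 1" unfolding e using c(2,3) by simp
  show "lp_le_symbol \<phi> l \<eta> = 0" if n: "2 powi (l + 1) < norm \<eta>"
  proof -
    have e2: "(2::real) powi (l + 1) = 2 * 2 powi l" by (simp add: power_int_add)
    have "2 powi (- l) * (2 * 2 powi l) < 2 powi (- l) * norm \<eta>"
      using n unfolding e2 by (intro mult_strict_left_mono) auto
    moreover have "2 powi (- l) * (2 * 2 powi l) = (2::real)" by (simp add: power_int_minus field_simps)
    ultimately have "2 < norm ((2 powi (- l)) *\<^sub>R \<eta>)" by simp
    then show ?thesis unfolding e by (rule c(5))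
  qed
qed

lemma evol_sum:
  assumes "finite S" "\<And>j. j \<in> S \<Longrightarrow> integrable lborel (b j)"
  shows "evol (\<lambda>\<eta>. \<Sum>j\<in>S. b j \<eta>) t x = (\<Sum>j\<in>S. evol (b j) t x)"
  using assms
proof (induction S rule: finite_induct)
  case empty
  then show ?case by (simp add: evol_def)
next
  case (insert j S)
  then show ?case by (simp add: evol_add)
qed

lemma shifted_lp_proj_eq_evol:
  assumes \<phi>: "lp_cutoff \<phi>" and j: "0 \<le> j" and f: "f \<in> L2"
  shows "AE x in lborel. shifted \<xi> (lp_proj \<phi> j) f x
      = evol (\<lambda>\<eta>. complex_of_real (lp_symbol \<phi> j (\<eta> - \<xi>)) * (cis (t * (norm \<eta>)\<^sup>2) * fourier_L2 f \<eta>)) t x / complex_of_real ((2 * pi)\<^sup>2)"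
    and "integrable lborel (\<lambda>\<eta>. complex_of_real (lp_symbol \<phi> j (\<eta> - \<xi>)) * (cis (t * (norm \<eta>)\<^sup>2) * fourier_L2 f \<eta>))"
proof -
  note p = lp_symbol_props[OF \<phi> j]
  note [measurable] = p(1)
  have m: "(\<lambda>\<eta>. complex_of_real (lp_symbol \<phi> j \<eta>)) \<in> borel_measurable borel" by measurable
  have 1: "cmod (complex_of_real (lp_symbol \<phi> j \<eta>)) \<le> 1" for \<eta> using p(2) by simp
  have 2: "complex_of_real (lp_symbol \<phi> j \<eta>) = 0" if "2 powi (j + 1) < norm \<eta>" for \<eta> using p(3)[OF that] by simp
  show "AE x in lborel. shifted \<xi> (lp_proj \<phi> j) f x
      = evol (\<lambda>\<eta>. complex_of_real (lp_symbol \<phi> j (\<eta> - \<xi>)) * (cis (t * (norm \<eta>)\<^sup>2) * fourier_L2 f \<eta>)) t x / complex_of_real ((2 * pi)\<^sup>2)"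
    unfolding lp_proj_def by (rule shifted_multiplier_eq_evol(1)[OF f m 1 2])
  show "integrable lborel (\<lambda>\<eta>. complex_of_real (lp_symbol \<phi> j (\<eta> - \<xi>)) * (cis (t * (norm \<eta>)\<^sup>2) * fourier_L2 f \<eta>))"
    by (rule shifted_multiplier_eq_evol(2)[OF f m 1 2])
qed

lemma shifted_lp_le_eq_evol:
  assumes \<phi>: "lp_cutoff \<phi>" and f: "f \<in> L2"
  shows "AE x in lborel. shifted \<xi> (lp_le \<phi> l) f x
      = evol (\<lambda>\<eta>. complex_of_real (lp_le_symbol \<phi> l (\<eta> - \<xi>)) * (cis (t * (norm \<eta>)\<^sup>2) * fourier_L2 f \<eta>)) t x / complex_of_real ((2 * pi)\<^sup>2)"
proof -
  define b where "b = (\<lambda>j \<eta>. complex_of_real (lp_symbol \<phi> j (\<eta> - \<xi>)) * (cis (t * (norm \<eta>)\<^sup>2) * fourier_L2 f \<eta>))"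
  have "AE x in lborel. \<forall>j\<in>{0..l}. shifted \<xi> (lp_proj \<phi> j) f x = evol (b j) t x / complex_of_real ((2 * pi)\<^sup>2)"
    unfolding b_def by (rule AE_finite_allI) (simp, rule shifted_lp_proj_eq_evol(1)[OF \<phi> _ f], simp)
  then show ?thesis
  proof eventually_elim
    case (elim x)
    have "shifted \<xi> (lp_le \<phi> l) f x = (\<Sum>j\<in>{0..l}. shifted \<xi> (lp_proj \<phi> j) f x)"
      by (simp add: shifted_def lp_le_def sum_distrib_left)
    also have "\<dots> = (\<Sum>j\<in>{0..l}. evol (b j) t x / complex_of_real ((2 * pi)\<^sup>2))"
      using elim by (intro sum.cong refl) simp
    also have "\<dots> = (\<Sum>j\<in>{0..l}. evol (b j) t x) / complex_of_real ((2 * pi)\<^sup>2)"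
      by (rule sum_divide_distrib[symmetric])
    also have "(\<Sum>j\<in>{0..l}. evol (b j) t x) = evol (\<lambda>\<eta>. \<Sum>j\<in>{0..l}. b j \<eta>) t x"
      by (rule evol_sum[symmetric]) (auto simp: b_def intro: shifted_lp_proj_eq_evol(2)[OF \<phi> _ f])
    also have "(\<lambda>\<eta>. \<Sum>j\<in>{0..l}. b j \<eta>)
       = (\<lambda>\<eta>. complex_of_real (lp_le_symbol \<phi> l (\<eta> - \<xi>)) * (cis (t * (norm \<eta>)\<^sup>2) * fourier_L2 f \<eta>))"
      by (simp add: fun_eq_iff b_def lp_le_symbol_def sum_distrib_right)
    finally show ?case .
  qed
qed

section \<open>Behaviour under rescaling\<close>

text \<open>The product t |\<xi>|^2 is invariant under the parabolic scaling, so the profile is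
  merely dilated; the amplitude r is the one that preserves mass in two dimensions.\<close>

lemma rescale_props:
  assumes r: "0 < r" and u: "u (r\<^sup>2 * t) \<in> L2"
  shows "rescale r u t \<in> L2"
    and "AE \<xi> in lborel. profile (rescale r u) t \<xi> = complex_of_real (1 / r) * profile u (r\<^sup>2 * t) ((1 / r) *\<^sub>R \<xi>)"
    and "Lpow 4 (rescale r u t) = ennreal (r\<^sup>2) * Lpow 4 (u (r\<^sup>2 * t))"
    and "Lpow 2 (rescale r u t) = Lpow 2 (u (r\<^sup>2 * t))"
proof -
  define f where "f = u (r\<^sup>2 * t)"
  have f: "f \<in> L2" using u by (simp add: f_def)
  have [measurable]: "f \<in> borel_measurable borel" using L2D[OF f] by simp
  have e: "rescale r u t = (\<lambda>x. complex_of_real r * f (r *\<^sub>R x))"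
    by (simp add: rescale_def f_def fun_eq_iff)
  have r0: "r \<noteq> 0" using r by simp
  have fs: "(\<lambda>x. f (r *\<^sub>R x)) \<in> L2" using L2_affine[OF f r0, of 0] by simp
  show "rescale r u t \<in> L2" unfolding e by (rule L2_cmult[OF fs])
  have "AE \<xi> in lborel. fourier_L2 (rescale r u t) \<xi> = complex_of_real r * fourier_L2 (\<lambda>x. f (r *\<^sub>R x)) \<xi>"
    unfolding e by (rule fourier_L2_cmult[OF fs])
  with fourier_L2_scale[OF f r0]
  show "AE \<xi> in lborel. profile (rescale r u) t \<xi> = complex_of_real (1 / r) * profile u (r\<^sup>2 * t) ((1 / r) *\<^sub>R \<xi>)"
  proof eventually_elim
    case (elim \<xi>)
    have n: "r\<^sup>2 * t * (norm ((1 / r) *\<^sub>R \<xi>))\<^sup>2 = t * (norm \<xi>)\<^sup>2"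
      using r by (simp add: power_divide)
    have "complex_of_real r * complex_of_real (1 / r\<^sup>2) = complex_of_real (1 / r)"
      unfolding of_real_mult[symmetric] using r by (simp add: power2_eq_square)
    then have "complex_of_real r * (complex_of_real (1 / r\<^sup>2) * z) = complex_of_real (1 / r) * z" for z
      by (simp only: mult.assoc[symmetric])
    then show ?case
      unfolding profile_def n elim f_def[symmetric] by (simp only: mult.left_commute)
  qed
  have L: "Lpow p (rescale r u t) = ennreal (r ^ p) * Lpow p (\<lambda>x. f (r *\<^sub>R x))" for p
    unfolding e using r by (subst Lpow_cmult) auto
  have A: "Lpow p f = ennreal (r\<^sup>2) * Lpow p (\<lambda>x. f (r *\<^sub>R x))" for p
    using Lpow_affine[of f r p 0] r by simp
  show "Lpow 4 (rescale r u t) = ennreal (r\<^sup>2) * Lpow 4 (u (r\<^sup>2 * t))"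
    unfolding L f_def[symmetric] A[of 4] mult.assoc[symmetric] using r
    by (simp add: ennreal_mult[symmetric] flip: power_add)
  show "Lpow 2 (rescale r u t) = Lpow 2 (u (r\<^sup>2 * t))"
    unfolding L f_def[symmetric] A[of 2] ..
qed

text \<open>Both sides are scale invariant, so the increment estimate is transported from u instead
  of being proved again.\<close>

lemma rescale_increment:
  assumes r: "0 < r" and sol: "solution \<mu> I u" and mu: "\<bar>\<mu>\<bar> \<le> 1" and I: "{0..} \<subseteq> I" and s: "0 \<le> s" "s \<le> t"
  shows "(Lpow 2 (\<lambda>\<xi>. profile (rescale r u) t \<xi> - profile (rescale r u) s \<xi>))\<^sup>2
     \<le> ennreal ((16 * pi\<^sup>2)\<^sup>2 * (16 * nonlin_const ^ 3)) * (Lpow_st 4 {s..t} (rescale r u)) ^ 3"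
proof -
  have uL: "u (r\<^sup>2 * t) \<in> L2" if "0 \<le> t" for t
  proof -
    have "r\<^sup>2 * t \<in> I" using I that by auto
    then show ?thesis using sol unfolding solution_def by blast
  qed
  have P: "profile u (r\<^sup>2 * t) \<in> L2" if "0 \<le> t" for t
    unfolding profile_def using fourier_L2_spec(1)[OF uL[OF that]] by (intro L2_cis_mult) auto
  have t: "0 \<le> t" using s by simp
  have nn: "0 \<le> r\<^sup>2 * s" "0 \<le> r\<^sup>2 * t" using s(1) t by simp_all
  have rt: "r\<^sup>2 * s \<in> I" "r\<^sup>2 * t \<in> I" "r\<^sup>2 * s \<le> r\<^sup>2 * t"
    using subsetD[OF I] nn s(2) by (simp_all add: mult_left_mono)
  define D where "D = (\<lambda>\<xi>. profile u (r\<^sup>2 * t) \<xi> - profile u (r\<^sup>2 * s) \<xi>)"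
  have [measurable]: "D \<in> borel_measurable borel" unfolding D_def using L2D[OF L2_diff[OF P[OF t] P[OF s(1)]]] by simp
  have "AE \<xi> in lborel. profile (rescale r u) t \<xi> - profile (rescale r u) s \<xi> = complex_of_real (1 / r) * D ((1 / r) *\<^sub>R \<xi>)"
    using rescale_props(2)[where u = u and t = t, OF r uL[OF t]] rescale_props(2)[where u = u and t = s, OF r uL[OF s(1)]]
    by eventually_elim (simp only: D_def right_diff_distrib)
  then have "Lpow 2 (\<lambda>\<xi>. profile (rescale r u) t \<xi> - profile (rescale r u) s \<xi>) = Lpow 2 (\<lambda>\<xi>. complex_of_real (1 / r) * D ((1 / r) *\<^sub>R \<xi>))"
    by (rule Lpow_cong_AE)
  also have "\<dots> = ennreal ((1 / r)\<^sup>2) * Lpow 2 (\<lambda>\<xi>. D ((1 / r) *\<^sub>R \<xi>))"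
    by (subst Lpow_cmult, measurable, simp only: norm_of_real power2_abs)
  also have "\<dots> = Lpow 2 D"
    using Lpow_affine[of D "1 / r" 2 0] r by simp
  finally have 1: "Lpow 2 (\<lambda>\<xi>. profile (rescale r u) t \<xi> - profile (rescale r u) s \<xi>) = Lpow 2 D" .
  have 2: "Lpow_st 4 {s..t} (rescale r u) = Lpow_st 4 {r\<^sup>2 * s..r\<^sup>2 * t} u"
  proof -
    define m where "m = (\<lambda>\<tau>. Lpow 4 (u \<tau>) * indicator {r\<^sup>2 * s..r\<^sup>2 * t} \<tau>)"
    have m: "m \<in> borel_measurable borel"
    proof -
      have sub: "{r\<^sup>2 * s..r\<^sup>2 * t} \<subseteq> I" 
        using I nn(1) by (meson atLeastAtMost_iff atLeast_iff order_trans subsetD subsetI)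
      have "m = (\<lambda>\<tau>. (Lpow 4 (u \<tau>) * indicator I \<tau>) * indicator {r\<^sup>2 * s..r\<^sup>2 * t} \<tau>)"
        using sub by (auto simp: m_def fun_eq_iff indicator_def)
      then show ?thesis using solution_L4_measurable[OF sol] by simp
    qed
    have r2: "r\<^sup>2 \<noteq> 0" using r by simp
    have "Lpow_st 4 {r\<^sup>2 * s..r\<^sup>2 * t} u = (\<integral>\<^sup>+ \<tau>. m \<tau> \<partial>lborel)" by (simp add: Lpow_st_def m_def)
    also have "\<dots> = \<bar>r\<^sup>2\<bar> * (\<integral>\<^sup>+ \<tau>. m (0 + r\<^sup>2 * \<tau>) \<partial>lborel)"
      by (rule nn_integral_real_affine[OF m r2])
    also have "\<dots> = (\<integral>\<^sup>+ \<tau>. ennreal (r\<^sup>2) * m (r\<^sup>2 * \<tau>) \<partial>lborel)"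
      using m by (subst nn_integral_cmult) auto
    also have "\<dots> = (\<integral>\<^sup>+ \<tau>. Lpow 4 (rescale r u \<tau>) * indicator {s..t} \<tau> \<partial>lborel)"
    proof (intro nn_integral_cong)
      fix \<tau>
      show "ennreal (r\<^sup>2) * m (r\<^sup>2 * \<tau>) = Lpow 4 (rescale r u \<tau>) * indicator {s..t} \<tau>"
      proof (cases "\<tau> \<in> {s..t}")
        case True
        then have "0 \<le> \<tau>" using s by simp
        then show ?thesis using rescale_props(3)[where u = u and t = \<tau>, OF r uL] True by (simp add: m_def mult_left_mono)
      next
        case False
        then show ?thesis using r by (auto simp: m_def)
      qed
    qed
    finally show ?thesis by (simp add: Lpow_st_def)
  qed
  show ?thesis
    unfolding 1 2 unfolding D_def by (rule solution_increment[OF sol mu rt])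
qed

lemma rescale_L4_measurable:
  assumes r: "0 < r" and sol: "solution \<mu> I u" and I: "{0..} \<subseteq> I"
  shows "(\<lambda>t. Lpow 4 (rescale r u t) * indicator {0..} t) \<in> borel_measurable borel"
proof -
  have uL: "u (r\<^sup>2 * t) \<in> L2" if "0 \<le> t" for t
  proof -
    have "r\<^sup>2 * t \<in> I" using I that by auto
    then show ?thesis using sol unfolding solution_def by blast
  qed
  have "(\<lambda>t. Lpow 4 (rescale r u t) * indicator {0..} t)
     = (\<lambda>t. ennreal (r\<^sup>2) * ((Lpow 4 (u (r\<^sup>2 * t)) * indicator I (r\<^sup>2 * t)) * indicator {0..} t))"
  proof
    fix t
    show "Lpow 4 (rescale r u t) * indicator {0..} t = ennreal (r\<^sup>2) * ((Lpow 4 (u (r\<^sup>2 * t)) * indicator I (r\<^sup>2 * t)) * indicator {0..} t)"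
    proof (cases "0 \<le> t")
      case True
      then have "r\<^sup>2 * t \<in> I" using I by auto
      then show ?thesis using rescale_props(3)[where u = u and t = t, OF r uL[OF True]] True by simp
    qed simp
  qed
  moreover have "(\<lambda>t. Lpow 4 (u (r\<^sup>2 * t)) * indicator I (r\<^sup>2 * t)) \<in> borel_measurable borel"
    using measurable_compose[OF _ solution_L4_measurable[OF sol], of "\<lambda>t. r\<^sup>2 * t"] by simp
  ultimately show ?thesis by simp
qed

section \<open>Frequency geometry and the frequency centre\<close>

lemma powi_2_shift:
  fixes i :: int
  shows "(2 :: real) powi (i + int n) = 2 ^ n * 2 powi i"
  using power_int_add[of "2::real" i "int n"] by simp

text \<open>If p - z is a frequency of a and p + z one of b, their distance 2 |z| is comparable to
  2^i, while z varies in a reflected cube of side 2^k: so \<open>osc_bound_far\<close> applies. If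
  the cube is too large for that, 2^(k - i) is bounded below and \<open>osc_bound_UNIV\<close> is
  enough.\<close>

lemma osc_bound_cube:
  fixes K :: "plane set" and k i :: int
  assumes K: "is_cube (2 powi k) K" and ne: "K \<inter> annulus c (2 powi (i - 6)) R \<noteq> {}" and k: "k \<le> i - 8"
    and a: "\<And>\<eta>. a \<eta> \<noteq> 0 \<Longrightarrow> \<eta> \<in> K" and b: "\<And>\<eta>. b \<eta> \<noteq> 0 \<Longrightarrow> norm (\<eta> - c) \<le> 2 powi (i - 8)"
  shows "osc_bound {z. a (p - z) \<noteq> (0::complex) \<and> b (p + z) \<noteq> (0::complex)} (65536 * 2 powi (k - i))"
proof -
  define D where "D = (2::real) powi k"
  define P where "P = (2::real) powi (i - 9)"
  have D0: "0 < D" and P0: "0 < P" by (simp_all add: D_def P_def)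
  have e6: "2 powi (i - 6) = 8 * P" using powi_2_shift[of "i - 9" 3] by (simp add: P_def)
  have e8: "2 powi (i - 8) = 2 * P" using powi_2_shift[of "i - 9" 1] by (simp add: P_def)
  have DP: "D \<le> 2 * P" unfolding D_def e8[symmetric] using k by (rule power_int_increasing) simp
  have dp: "2 powi (k - i) = D / (512 * P)"
  proof -
    have "(2::real) powi i = 512 * P" using powi_2_shift[of "i - 9" 9] by (simp add: P_def)
    then show ?thesis by (simp add: power_int_diff D_def)
  qed
  obtain y0 where y0: "K = cbox y0 (y0 + D *\<^sub>R One)" using K by (auto simp: is_cube_def D_def)
  have One_nth: "(One :: plane) $ n = 1" for n
    unfolding cart_eq_inner_axis by (rule inner_sum_Basis) (simp add: axis_in_Basis_iff)
  have coord: "\<bar>x $ n - y $ n\<bar> \<le> D" if "x \<in> K" "y \<in> K" for x y n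
    using that[unfolded y0 mem_box_cart vector_add_component vector_scaleR_component One_nth, rule_format, of n]
    by (simp add: abs_le_iff)
  obtain x0 where x0: "x0 \<in> K" "8 * P \<le> norm (x0 - c)"
    using ne unfolding e6 annulus_def by auto
  define S where "S = {z. a (p - z) \<noteq> 0 \<and> b (p + z) \<noteq> 0}"
  have far: "P \<le> norm z" if "z \<in> S" for z
  proof -
    have 1: "p - z \<in> K" and 2: "norm (p + z - c) \<le> 2 * P"
      using that a b unfolding e8 S_def by auto
    have "norm (x0 - (p - z)) \<le> \<bar>(x0 - (p - z)) $ 1\<bar> + \<bar>(x0 - (p - z)) $ 2\<bar>"
      using norm_le_l1_cart[of "x0 - (p - z)"] by (simp add: sum_2)
    also have "\<dots> \<le> 2 * D" using coord[OF x0(1) 1, of 1] coord[OF x0(1) 1, of 2] by simp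
    finally have 3: "norm (x0 - (p - z)) \<le> 4 * P" using DP by simp
    \<comment> \<open>In units of P the triangle inequality reads 8 P <= 4 P + 2 P + 2 |z|: the
      point x0 is far from c, the cube has diameter at most 4 P, and b lives within 2 P of
      c.\<close>
    have "x0 - c = (x0 - (p - z)) + (p + z - c) - 2 *\<^sub>R z" by (simp add: algebra_simps scaleR_2)
    then have "norm (x0 - c) \<le> norm ((x0 - (p - z)) + (p + z - c)) + norm (2 *\<^sub>R z)"
      by (simp only: norm_triangle_ineq4)
    also have "\<dots> \<le> norm (x0 - (p - z)) + norm (p + z - c) + norm (2 *\<^sub>R z)"
      by (intro add_right_mono norm_triangle_ineq)
    finally have "norm (x0 - c) \<le> norm (x0 - (p - z)) + norm (p + z - c) + 2 * norm z" by simp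
    then show ?thesis using x0(2) 2 3 by simp
  qed
  have "osc_bound S (65536 * 2 powi (k - i))"
  proof (cases "8 * D \<le> P")
    case True
    have "osc_bound S (16 * D / P)"
    proof (rule osc_bound_far[OF P0 D0 True _ far])
      fix q q' n
      assume "q \<in> S" "q' \<in> S"
      then have "p - q \<in> K" "p - q' \<in> K" unfolding S_def mem_Collect_eq by (blast intro: a)+
      from coord[OF this, of n] show "\<bar>q $ n - q' $ n\<bar> \<le> D" by (simp add: abs_minus_commute)
    qed
    then show ?thesis
    proof (rule osc_bound_mono[OF _ order_refl])
      \<comment> \<open>As 2^i = 512 P, the left side is 8192 * 2^(k - i).\<close>
      show "16 * D / P \<le> 65536 * 2 powi (k - i)" unfolding dp using D0 P0 by (simp add: divide_simps)
    qed
  next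
    case False
    show ?thesis
    proof (rule osc_bound_mono[OF osc_bound_UNIV subset_UNIV])
      \<comment> \<open>Since 8 D > P, k is at least i - 11, so 2^(k - i) >= 1 / 2048. The constant
        65536 is 2048 * 32, where 32 bounds 2 pi^2.\<close>
      have "\<not> k \<le> i - 12"
      proof
        assume "k \<le> i - 12"
        then have "D \<le> 2 powi (i - 12)" unfolding D_def by (rule power_int_increasing) simp
        moreover have "P = 8 * 2 powi (i - 12)" using powi_2_shift[of "i - 12" 3] by (simp add: P_def)
        ultimately show False using False by simp
      qed
      then have "- 11 \<le> k - i" by simp
      then have "(2::real) powi (- 11) \<le> 2 powi (k - i)" by (rule power_int_increasing) simp
      moreover have "(2::real) powi (- 11) = 1 / 2048"
        unfolding power_int_minus power_int_numeral by simp
      ultimately have "(1::real) / 2048 \<le> 2 powi (k - i)" by (simp only:)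
      moreover have "2 * pi\<^sup>2 \<le> 2 * (4 * 4)" unfolding power2_eq_square using pi_less_4 pi_gt_zero
        by (intro mult_left_mono mult_mono) auto
      ultimately show "2 * pi\<^sup>2 \<le> 65536 * 2 powi (k - i)" by simp
    qed
  qed
  then show ?thesis by (simp add: S_def)
qed

section \<open>Motion of the frequency centre and the L4 clock\<close>

lemma norm_increment_le:
  fixes f :: "real \<Rightarrow> 'b::euclidean_space"
  assumes ab: "a \<le> b" and f: "\<And>x. x \<in> {a..b} \<Longrightarrow> (f has_vector_derivative f' x) (at x within {a..b})"
    and g: "\<And>x. x \<in> {a..b} \<Longrightarrow> norm (f' x) \<le> g x" and gc: "continuous_on {a..b} g"
  shows "ennreal (norm (f b - f a)) \<le> (\<integral>\<^sup>+ x\<in>{a..b}. ennreal (g x) \<partial>lborel)"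
proof -
  have i: "(f' has_integral (f b - f a)) {a..b}"
    by (rule fundamental_theorem_of_calculus[OF ab f])
  have gi: "(g has_integral integral {a..b} g) {a..b}"
    using integrable_continuous_real[OF gc] by (rule integrable_integral)
  have "norm (integral {a..b} f') \<le> integral {a..b} g"
    using i gi g by (intro integral_norm_bound_integral) auto
  moreover have "integral {a..b} f' = f b - f a" using i by (rule integral_unique)
  moreover have "integral\<^sup>N lborel (\<lambda>x. indicator {a..b} x * g x) = integral {a..b} g"
    by (rule nn_integral_has_integral_lebesgue[OF order_trans[OF norm_ge_zero g] gi])
  moreover have "(\<lambda>x. ennreal (indicator {a..b} x * g x)) = (\<lambda>x. ennreal (g x) * indicator {a..b} x)"
    by (auto simp: fun_eq_iff indicator_def)
  ultimately show ?thesis by (simp add: ennreal_leI)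
qed

text \<open>On each of the 2^i pieces of G the integral of N^3 is at most 2 \<epsilon>3, so the
  centre moves by at most c * 2 \<epsilon>3 there, and the pieces are chained from the left.\<close>

lemma G_int_center_bound:
  assumes p: "interval_partition u N \<epsilon>3 T k0 \<tau>" and i: "i \<le> k0" and \<alpha>: "\<alpha> < 2 ^ (k0 - i)" and t: "t \<in> G_int \<tau> i \<alpha>"
    and \<epsilon>: "0 < \<epsilon>3" and c: "0 \<le> c"
    and lip: "\<And>a b. 0 \<le> a \<Longrightarrow> a \<le> b \<Longrightarrow> ennreal (norm (\<xi> b - \<xi> a)) \<le> ennreal c * (\<integral>\<^sup>+ t\<in>{a..b}. ennreal (N t ^ 3) \<partial>lborel)"
  shows "norm (\<xi> t - center \<xi> (G_int \<tau> i \<alpha>)) \<le> 2 ^ i * (c * (2 * \<epsilon>3))" and "0 \<le> t"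
proof -
  define s where "s = \<alpha> * 2 ^ i"
  define d where "d = c * (2 * \<epsilon>3)"
  have d0: "0 \<le> d" using \<epsilon> c by (simp add: d_def)
  have "(\<alpha> + 1) * 2 ^ i \<le> 2 ^ (k0 - i) * 2 ^ i" using \<alpha> by (intro mult_right_mono) auto
  also have "\<dots> = (2::nat) ^ k0" using i by (simp add: power_add[symmetric])
  finally have top: "s + 2 ^ i \<le> 2 ^ k0" by (simp add: s_def)
  have G: "G_int \<tau> i \<alpha> = (\<Union>a\<in>{s..<s + 2 ^ i}. {\<tau> a..\<tau> (Suc a)})" by (simp add: G_int_def s_def algebra_simps)
  have step: "\<tau> a \<le> \<tau> (Suc a)" if "a < 2 ^ k0" for a using p that by (simp add: interval_partition_def)
  have mono: "\<tau> a \<le> \<tau> b" if "a \<le> b" "b \<le> 2 ^ k0" for a b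
    using that
  proof (induction b rule: dec_induct)
    case (step n)
    then show ?case using \<open>\<And>a. a < 2 ^ k0 \<Longrightarrow> \<tau> a \<le> \<tau> (Suc a)\<close>[of n] by simp
  qed simp
  have \<tau>0: "\<tau> 0 = 0" using p by (simp add: interval_partition_def)
  have nn: "0 \<le> \<tau> a" if "a \<le> 2 ^ k0" for a using mono[of 0 a] that \<tau>0 by simp
  have piece: "norm (\<xi> y - \<xi> (\<tau> a)) \<le> d" if a: "a < 2 ^ k0" and y: "\<tau> a \<le> y" "y \<le> \<tau> (Suc a)" for a y
  proof -
    have "(\<integral>\<^sup>+ t\<in>{\<tau> a..y}. ennreal (N t ^ 3) \<partial>lborel)
        \<le> (\<integral>\<^sup>+ t\<in>{\<tau> a..\<tau> (Suc a)}. (ennreal (N t ^ 3) + ennreal \<epsilon>3 * Lpow 4 (u t)) \<partial>lborel)"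
      using y by (intro nn_integral_mono) (auto simp: indicator_def)
    also have "\<dots> = ennreal (2 * \<epsilon>3)" using p a by (simp add: interval_partition_def)
    finally have "ennreal c * (\<integral>\<^sup>+ t\<in>{\<tau> a..y}. ennreal (N t ^ 3) \<partial>lborel) \<le> ennreal c * ennreal (2 * \<epsilon>3)"
      by (rule mult_left_mono) simp
    also have "\<dots> = ennreal d" unfolding d_def using \<epsilon> c by (subst ennreal_mult) auto
    finally have "ennreal (norm (\<xi> y - \<xi> (\<tau> a))) \<le> ennreal d"
      using lip[OF nn[of a] y(1)] a by (meson order_trans less_imp_le)
    then show ?thesis using d0 by (simp add: ennreal_le_iff)
  qed
  have chain: "norm (\<xi> (\<tau> (s + n)) - \<xi> (\<tau> s)) \<le> real n * d" if "s + n \<le> 2 ^ k0" for n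
    using that
  proof (induction n)
    case (Suc n)
    have "norm (\<xi> (\<tau> (s + Suc n)) - \<xi> (\<tau> s))
      \<le> norm (\<xi> (\<tau> (Suc (s + n))) - \<xi> (\<tau> (s + n))) + norm (\<xi> (\<tau> (s + n)) - \<xi> (\<tau> s))"
      using norm_triangle_ineq[of "\<xi> (\<tau> (Suc (s + n))) - \<xi> (\<tau> (s + n))" "\<xi> (\<tau> (s + n)) - \<xi> (\<tau> s)"] by simp
    also have "\<dots> \<le> d + real n * d"
      using Suc piece[of "s + n" "\<tau> (Suc (s + n))"] step[of "s + n"] by (intro add_mono) auto
    finally show ?case by (simp add: algebra_simps)
  qed simp
  obtain a where a: "s \<le> a" "a < s + 2 ^ i" "\<tau> a \<le> t" "t \<le> \<tau> (Suc a)" using t unfolding G by auto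
  \<comment> \<open>The infimum of G is attained at the left end of its first piece, so
    \<open>center\<close> is the value of \<xi> there.\<close>
  have "\<tau> s \<in> G_int \<tau> i \<alpha>" unfolding G using step[of s] top
    by (intro UN_I[of s]) (auto simp: less_le_trans[OF _ top])
  moreover have "\<tau> s \<le> y" if "y \<in> G_int \<tau> i \<alpha>" for y
  proof -
    obtain b where b: "s \<le> b" "b < s + 2 ^ i" "\<tau> b \<le> y" using \<open>y \<in> _\<close> unfolding G by auto
    have "\<tau> s \<le> \<tau> b" by (rule mono) (use b top in auto)
    then show ?thesis using b(3) by simp
  qed
  ultimately have "Inf (G_int \<tau> i \<alpha>) = \<tau> s" by (rule cInf_eq_minimum)
  then have cen: "center \<xi> (G_int \<tau> i \<alpha>) = \<xi> (\<tau> s)" by (simp add: center_def)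
  have a2: "a < 2 ^ k0" using a top by simp
  show "0 \<le> t" using nn[of a] a a2 by simp
  obtain n where n: "a = s + n" using a(1) le_Suc_ex by blast
  have "norm (\<xi> t - \<xi> (\<tau> s)) \<le> norm (\<xi> t - \<xi> (\<tau> a)) + norm (\<xi> (\<tau> a) - \<xi> (\<tau> s))"
    using norm_triangle_ineq[of "\<xi> t - \<xi> (\<tau> a)" "\<xi> (\<tau> a) - \<xi> (\<tau> s)"] by simp
  also have "\<dots> \<le> d + real n * d"
    using piece[OF a2 a(3,4)] chain[of n] a2 unfolding n by (intro add_mono) auto
  also have "\<dots> = real (n + 1) * d" by (simp add: algebra_simps)
  also have "\<dots> \<le> 2 ^ i * d"
  proof (rule mult_right_mono[OF _ d0])
    have "n + 1 \<le> 2 ^ i" using a(2) n by simp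
    then have "real (n + 1) \<le> real (2 ^ i)" by (rule of_nat_mono)
    then show "real (n + 1) \<le> 2 ^ i" by simp
  qed
  finally show "norm (\<xi> t - center \<xi> (G_int \<tau> i \<alpha>)) \<le> 2 ^ i * (c * (2 * \<epsilon>3))" unfolding cen d_def .
qed

text \<open>The clock at t is the integral of h over the part of J up to t. It takes values in
  [0, 1] by the normalisation, and its increments are integrals over half-open intervals, which a
  single point does not affect.\<close>

lemma interval_clock:
  fixes h :: "real \<Rightarrow> ennreal"
  assumes J: "is_interval J" and h [measurable]: "(\<lambda>t. h t * indicator J t) \<in> borel_measurable borel"
    and h1: "(\<integral>\<^sup>+ t\<in>J. h t \<partial>lborel) = 1"
  shows "\<exists>\<alpha> :: real \<Rightarrow> real. (\<forall>t\<in>J. 0 \<le> \<alpha> t \<and> \<alpha> t \<le> 1) \<and>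
    (\<forall>s\<in>J. \<forall>t\<in>J. s \<le> t \<longrightarrow> (\<integral>\<^sup>+ \<tau>\<in>{s..t}. h \<tau> \<partial>lborel) \<le> ennreal (\<alpha> t - \<alpha> s))"
proof -
  define H where "H = (\<lambda>t. h t * indicator J t)"
  have [measurable]: "H \<in> borel_measurable borel" using h by (simp add: H_def)
  define F where "F = (\<lambda>t. \<integral>\<^sup>+ \<tau>. H \<tau> * indicator {..t} \<tau> \<partial>lborel)"
  have F1: "F t \<le> 1" for t
  proof -
    have "F t \<le> (\<integral>\<^sup>+ \<tau>. H \<tau> \<partial>lborel)" unfolding F_def by (intro nn_integral_mono) (auto simp: indicator_def)
    then show ?thesis using h1 by (simp add: H_def)
  qed
  define \<alpha> where "\<alpha> = (\<lambda>t. enn2real (F t))"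
  have fin: "F t < top" for t using le_less_trans[OF F1 ennreal_one_less_top] .
  have F\<alpha>: "F t = ennreal (\<alpha> t)" for t using fin[of t] by (simp add: \<alpha>_def)
  have \<alpha>0: "0 \<le> \<alpha> t" for t by (simp add: \<alpha>_def)
  have \<alpha>1: "\<alpha> t \<le> 1" for t using F1[of t] unfolding F\<alpha> by (simp add: ennreal_le_1)
  have "(\<integral>\<^sup>+ \<tau>\<in>{s..t}. h \<tau> \<partial>lborel) \<le> ennreal (\<alpha> t - \<alpha> s)" if s: "s \<in> J" and t: "t \<in> J" and st: "s \<le> t" for s t
  proof -
    have sub: "{s..t} \<subseteq> J" by (meson J s t atLeastAtMost_iff mem_is_interval_1_I subsetI)
    have "(\<integral>\<^sup>+ \<tau>\<in>{s..t}. h \<tau> \<partial>lborel) = (\<integral>\<^sup>+ \<tau>. H \<tau> * indicator {s..t} \<tau> \<partial>lborel)"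
      using sub by (intro nn_integral_cong) (auto simp: H_def indicator_def)
    also have "\<dots> = (\<integral>\<^sup>+ \<tau>. H \<tau> * indicator {s<..t} \<tau> \<partial>lborel)"
      by (rule nn_integral_cong_AE, rule AE_mp[OF AE_lborel_singleton[of s]]) (auto simp: indicator_def)
    finally have e: "(\<integral>\<^sup>+ \<tau>\<in>{s..t}. h \<tau> \<partial>lborel) = (\<integral>\<^sup>+ \<tau>. H \<tau> * indicator {s<..t} \<tau> \<partial>lborel)" .
    have "F t = (\<integral>\<^sup>+ \<tau>. H \<tau> * indicator {..s} \<tau> + H \<tau> * indicator {s<..t} \<tau> \<partial>lborel)"
      unfolding F_def using st by (intro nn_integral_cong) (auto simp: indicator_def)
    also have "\<dots> = F s + (\<integral>\<^sup>+ \<tau>. H \<tau> * indicator {s<..t} \<tau> \<partial>lborel)"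
      unfolding F_def by (rule nn_integral_add) measurable
    finally have "F t - F s = (\<integral>\<^sup>+ \<tau>. H \<tau> * indicator {s<..t} \<tau> \<partial>lborel)"
      using fin[of s] by (simp add: ennreal_add_diff_cancel_left)
    then show ?thesis unfolding e F\<alpha> using \<alpha>0[of s] by (simp add: ennreal_minus)
  qed
  then show ?thesis using \<alpha>0 \<alpha>1 by (intro exI[of _ \<alpha>]) auto
qed

section \<open>The estimate on a small interval\<close>

lemma power2_le_imp_le_ennreal:
  assumes "X\<^sup>2 \<le> (ennreal y)\<^sup>2" and y: "0 \<le> y"
  shows "X \<le> ennreal y"
proof (cases X)
  case (real x)
  have "ennreal (x\<^sup>2) \<le> ennreal (y\<^sup>2)"
    using assms(1) unfolding real(2) ennreal_power[OF real(1)] ennreal_power[OF y] .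
  then have "x\<^sup>2 \<le> y\<^sup>2" by (rule ennreal_le_iff[THEN iffD1, rotated]) simp
  then have "x \<le> y" using y by (rule power2_le_imp_le)
  then show ?thesis unfolding real(2) by (rule ennreal_leI)
next
  case top
  then show ?thesis using assms by (simp add: ennreal_power top_unique)
qed

text \<open>The sum of two bounds for the profile: the first summand controls its squared size, the
  second its squared increments. The modulus of M keeps it positive for every real argument.\<close>

definition transfer_constant :: "real \<Rightarrow> real" where
  "transfer_constant M = 16 * pi\<^sup>2 * \<bar>M\<bar> + sqrt ((16 * pi\<^sup>2)\<^sup>2 * (16 * nonlin_const ^ 3))"

lemma transfer_constant_pos: "0 < transfer_constant M"
proof -
  have "0 < (16 * pi\<^sup>2)\<^sup>2 * (16 * nonlin_const ^ 3)" using nonlin_const_pos by simp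
  then have "0 < sqrt ((16 * pi\<^sup>2)\<^sup>2 * (16 * nonlin_const ^ 3))" by simp
  then show ?thesis unfolding transfer_constant_def by (intro add_nonneg_pos) auto
qed

text \<open>Here the profile of the rescaled solution becomes the curve U of
  \<open>bilinear_bounded_variation\<close>. The symbol m is kept general so that both kinds of
  projection are covered at once.\<close>

lemma frequency_localized_bilinear:
  fixes m :: "plane \<Rightarrow> real" and P :: "(plane \<Rightarrow> complex) \<Rightarrow> plane \<Rightarrow> complex"
  assumes r: "0 < r" and sol: "solution \<mu> I u" and mu: "\<bar>\<mu>\<bar> \<le> 1" and I: "{0..} \<subseteq> I"
    and mass: "\<And>t. 0 \<le> t \<Longrightarrow> mass (u t) = M"
    and J: "is_interval J" "J \<subseteq> {0..}" and small: "Lpow_st 4 J (rescale r u) = 1"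
    and v: "v \<in> schwartz" and supp: "\<And>\<eta>. fourier v \<eta> \<noteq> 0 \<Longrightarrow> \<eta> \<in> K" and K: "bounded K" "K \<in> sets borel"
    and B: "B \<in> sets borel" "bounded B" and q0: "0 \<le> q"
    and osc: "\<And>(b :: plane \<Rightarrow> complex) p. (\<And>\<eta>. b \<eta> \<noteq> 0 \<Longrightarrow> \<eta> \<in> B) \<Longrightarrow> osc_bound {z. fourier v (p - z) \<noteq> 0 \<and> b (p + z) \<noteq> 0} q"
    and m [measurable]: "m \<in> borel_measurable borel" and m1: "\<And>\<eta>. \<bar>m \<eta>\<bar> \<le> 1"
    and mk: "mult_kernel (\<lambda>\<eta>. of_real (m \<eta>)) A" and A0: "0 \<le> A"
    and mB: "\<And>t \<eta>. t \<in> J \<Longrightarrow> m (\<eta> - \<xi> t) \<noteq> 0 \<Longrightarrow> \<eta> \<in> B"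
    and P: "\<And>t f. f \<in> L2 \<Longrightarrow> AE x in lborel. shifted (\<xi> t) P f x
      = evol (\<lambda>\<eta>. complex_of_real (m (\<eta> - \<xi> t)) * (cis (t * (norm \<eta>)\<^sup>2) * fourier_L2 f \<eta>)) t x / complex_of_real ((2 * pi)\<^sup>2)"
  shows "Lpow_st 2 J (\<lambda>t x. schrodinger t v x * shifted (\<xi> t) P (rescale r u t) x)
     \<le> ennreal (60000 * q * A\<^sup>2 * transfer_constant M * ((2 * pi)\<^sup>2 * (L2_norm v)\<^sup>2))"
proof -
  define w where "w = rescale r u"
  define U where "U = profile w"
  define C where "C = transfer_constant M"
  define c where "c = complex_of_real (1 / ((2 * pi)\<^sup>2 * (2 * pi)\<^sup>2))"
  define a where "a = fourier v"
  have C0: "0 \<le> C" unfolding C_def using transfer_constant_pos[of M] by simp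
  have uL: "u (r\<^sup>2 * t) \<in> L2" if "0 \<le> t" for t
  proof -
    have "r\<^sup>2 * t \<in> I" using I that by auto
    then show ?thesis using sol unfolding solution_def by blast
  qed
  have w: "w t \<in> L2" if "0 \<le> t" for t unfolding w_def by (rule rescale_props(1)[where u = u and t = t, OF r uL[OF that]])
  have wM: "Lpow 2 (w t) = ennreal M" if "0 \<le> t" for t
    unfolding w_def rescale_props(4)[where u = u and t = t, OF r uL[OF that]]
    using Lpow2_eq_mass[OF uL[OF that]] mass[of "r\<^sup>2 * t"] that by simp
  have tJ: "0 \<le> t" if "t \<in> J" for t using J(2) that by auto
  have UL: "U t \<in> L2" if "0 \<le> t" for t
    unfolding U_def profile_def using fourier_L2_spec(1)[OF w[OF that]] by (intro L2_cis_mult) auto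
  have UM: "Lpow 2 (U t) \<le> ennreal C" if "0 \<le> t" for t
  proof -
    have "Lpow 2 (U t) = Lpow 2 (fourier_L2 (w t))" unfolding U_def profile_def by (rule Lpow_cis_mult)
    also have "\<dots> \<le> ennreal (16 * pi\<^sup>2) * ennreal M" using fourier_L2_bound[OF w[OF that]] unfolding wM[OF that] .
    also have "\<dots> = ennreal (16 * pi\<^sup>2 * M)"
      using mass_nonneg[of "u 0"] mass[of 0] by (subst ennreal_mult) auto
    also have "\<dots> \<le> ennreal C"
    proof (rule ennreal_leI)
      have "16 * pi\<^sup>2 * M \<le> 16 * pi\<^sup>2 * \<bar>M\<bar>" by (intro mult_left_mono) auto
      moreover have "0 \<le> sqrt ((16 * pi\<^sup>2)\<^sup>2 * (16 * nonlin_const ^ 3))" using nonlin_const_pos by simp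
      ultimately show "16 * pi\<^sup>2 * M \<le> C" unfolding C_def transfer_constant_def by linarith
    qed
    finally show ?thesis .
  qed
  have Jm: "J \<in> sets borel" by (rule real_interval_borel_measurable[OF J(1)])
  have hm: "(\<lambda>t. Lpow 4 (w t) * indicator J t) \<in> borel_measurable borel"
  proof -
    have [measurable]: "J \<in> sets borel" by (rule Jm)
    have [measurable]: "(\<lambda>t. Lpow 4 (w t) * indicator {0..} t) \<in> borel_measurable borel"
      unfolding w_def by (rule rescale_L4_measurable[OF r sol I])
    have "(\<lambda>t. Lpow 4 (w t) * indicator J t) = (\<lambda>t. (Lpow 4 (w t) * indicator {0..} t) * indicator J t)"
      using tJ by (auto simp: fun_eq_iff indicator_def)
    then show ?thesis by simp
  qed
  \<comment> \<open>The clock is the fourth power of the L4 norm used up to time t; the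
    normalisation of a small interval makes its range lie in [0, 1].\<close>
  obtain \<alpha> where \<alpha>: "\<And>t. t \<in> J \<Longrightarrow> 0 \<le> \<alpha> t \<and> \<alpha> t \<le> 1"
    and \<alpha>i: "\<And>s t. s \<in> J \<Longrightarrow> t \<in> J \<Longrightarrow> s \<le> t \<Longrightarrow> Lpow_st 4 {s..t} w \<le> ennreal (\<alpha> t - \<alpha> s)"
    using interval_clock[OF J(1) hm] small unfolding Lpow_st_def w_def by auto
  have inc1: "Lpow 2 (\<lambda>\<eta>. U t \<eta> - U s \<eta>) \<le> ennreal (C * (1 / 8) ^ n)"
    if st: "s \<in> J" "t \<in> J" "s \<le> t" and n: "\<bar>\<alpha> t - \<alpha> s\<bar> \<le> (1 / 4) ^ n" for s t n
  proof -
    define D where "D = (16 * pi\<^sup>2)\<^sup>2 * (16 * nonlin_const ^ 3)"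
    define X where "X = Lpow 2 (\<lambda>\<eta>. U t \<eta> - U s \<eta>)"
    have D0: "0 \<le> D" using nonlin_const_pos by (simp add: D_def)
    have "X\<^sup>2 \<le> ennreal D * (Lpow_st 4 {s..t} w) ^ 3"
      unfolding X_def U_def w_def D_def by (rule rescale_increment[OF r sol mu I tJ[OF st(1)] st(3)])
    also have "\<dots> \<le> ennreal D * (ennreal ((1 / 4) ^ n)) ^ 3"
    proof (rule mult_left_mono[OF power_mono])
      have "ennreal (\<alpha> t - \<alpha> s) \<le> ennreal ((1 / 4) ^ n)" using n by (intro ennreal_leI) auto
      with \<alpha>i[OF st] show "Lpow_st 4 {s..t} w \<le> ennreal ((1 / 4) ^ n)" by (rule order_trans)
    qed auto
    also have "\<dots> = ennreal (D * ((1 / 4) ^ n) ^ 3)"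
      using D0 by (subst ennreal_power, simp, subst ennreal_mult) auto
    \<comment> \<open>The cube of 4^-n under a square root: the exponent 3 / 2 turns clock length
      4^-n into 8^-n, the rate that \<open>bilinear_bounded_variation\<close> asks for.\<close>
    also have "D * ((1 / 4) ^ n) ^ 3 = (sqrt D * (1 / 8) ^ n)\<^sup>2"
    proof -
      have "((1 / 4 :: real) ^ n) ^ 3 = ((1 / 8) ^ n)\<^sup>2"
        unfolding power_mult[symmetric] mult.commute[of n] unfolding power_mult by (simp add: power3_eq_cube power2_eq_square)
      then show ?thesis using D0 by (simp add: power_mult_distrib)
    qed
    also have "ennreal ((sqrt D * (1 / 8) ^ n)\<^sup>2) = (ennreal (sqrt D * (1 / 8) ^ n))\<^sup>2"
      using D0 by (subst ennreal_power) auto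
    finally have "X \<le> ennreal (sqrt D * (1 / 8) ^ n)"
      by (rule power2_le_imp_le_ennreal) (use D0 in simp)
    also have "\<dots> \<le> ennreal (C * (1 / 8) ^ n)"
      by (intro ennreal_leI mult_right_mono) (auto simp: C_def transfer_constant_def D_def)
    finally show ?thesis unfolding X_def .
  qed
  have inc: "Lpow 2 (\<lambda>\<eta>. U t \<eta> - U s \<eta>) \<le> ennreal (C * (1 / 8) ^ n)"
    if st: "s \<in> J" "t \<in> J" and n: "\<bar>\<alpha> t - \<alpha> s\<bar> \<le> (1 / 4) ^ n" for s t n
  proof (cases "s \<le> t")
    case True
    then show ?thesis by (rule inc1[OF st _ n])
  next
    case False
    then have "t \<le> s" by simp
    from inc1[OF st(2,1) this, of n] n show ?thesis
      by (simp only: Lpow2_minus_commute[of "U t"] abs_minus_commute[of "\<alpha> t"])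
  qed
  have vI: "integrable lborel v" and vL: "v \<in> L2" using schwartz_integrable[OF v] by auto
  have aL: "a \<in> L2" unfolding a_def by (rule fourier_L2_mem[OF vI vL])
  have aI: "integrable lborel a"
  proof -
    have "integrable lborel (\<lambda>\<eta>. indicator K \<eta> * a \<eta>)"
      by (rule L2_indicator_integrable[OF aL K(2) emeasure_bounded_finite[OF K(1)]])
    moreover have "(\<lambda>\<eta>. indicator K \<eta> * a \<eta>) = a"
      using supp by (auto simp: fun_eq_iff a_def indicator_def)
    ultimately show ?thesis by simp
  qed
  have a2: "Lpow 2 a \<le> ennreal ((2 * pi)\<^sup>2 * (L2_norm v)\<^sup>2)"
  proof -
    have "Lpow 2 a \<le> ennreal ((2 * pi)\<^sup>2) * Lpow 2 v" unfolding a_def by (rule bessel_plane[OF vI])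
    also have "\<dots> = ennreal ((2 * pi)\<^sup>2 * (L2_norm v)\<^sup>2)"
      unfolding Lpow2_eq_mass[OF vL] L2_norm_sq by (rule ennreal_mult[symmetric]) (auto simp: mass_nonneg)
    finally show ?thesis .
  qed
  define E where "E = (\<lambda>t x. evol a t x * evol (\<lambda>\<eta>. complex_of_real (m (\<eta> - \<xi> t)) * U t \<eta>) t x)"
  \<comment> \<open>The two inverse transforms contribute c = (2 pi)^-4, which is simply bounded by
    1.\<close>
  have c1: "cmod c \<le> 1"
  proof -
    have "1 * 1 \<le> (2 * pi)\<^sup>2 * (2 * pi)\<^sup>2"
      using pi_ge_two by (intro mult_mono one_le_power) auto
    then show ?thesis unfolding c_def norm_of_real by (simp add: divide_le_eq_1)
  qed
  have pt: "Lpow 2 (\<lambda>x. schrodinger t v x * shifted (\<xi> t) P (w t) x) \<le> Lpow 2 (E t)" if t: "t \<in> J" for t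
  proof -
    have "AE x in lborel. schrodinger t v x * shifted (\<xi> t) P (w t) x = c * E t x"
      using schrodinger_eq_evol[OF vL aL aI fourier_L2_eq_fourier[OF vL vI, folded a_def], of t] P[OF w[OF tJ[OF t]], of t]
    proof eventually_elim
      case (elim x)
      have q: "X / p * (Y / p) = 1 / (p * p) * (X * Y)" for X Y p :: complex by simp
      have "c = 1 / (complex_of_real ((2 * pi)\<^sup>2) * complex_of_real ((2 * pi)\<^sup>2))"
        unfolding c_def by (simp only: of_real_divide of_real_mult of_real_1)
      then show ?case
        unfolding elim E_def U_def profile_def by (simp only: q)
    qed
    then have "Lpow 2 (\<lambda>x. schrodinger t v x * shifted (\<xi> t) P (w t) x) = Lpow 2 (\<lambda>x. c * E t x)" by (rule Lpow_cong_AE)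
    also have "\<dots> \<le> Lpow 2 (E t)" using c1 by (intro Lpow_mono) (simp add: norm_mult mult_left_le_one_le)
    finally show ?thesis .
  qed
  have "Lpow_st 2 J (\<lambda>t x. schrodinger t v x * shifted (\<xi> t) P (rescale r u t) x) \<le> (\<integral>\<^sup>+ t\<in>J. Lpow 2 (E t) \<partial>lborel)"
    unfolding Lpow_st_def w_def[symmetric] using pt by (intro nn_integral_mono) (auto simp: indicator_def)
  also have "\<dots> \<le> ennreal (60000 * q * A\<^sup>2 * C) * Lpow 2 a"
    unfolding E_def
  proof (rule bilinear_bounded_variation[OF aI B q0 _ UL[OF tJ] C0 UM[OF tJ] \<alpha> inc _ _ mk A0])
    show "osc_bound {z. a (p - z) \<noteq> 0 \<and> b (p + z) \<noteq> 0} q" if "\<And>\<eta>. b \<eta> \<noteq> 0 \<Longrightarrow> \<eta> \<in> B" for b :: "plane \<Rightarrow> complex" and p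
      unfolding a_def by (rule osc[OF that])
    show "\<eta> \<in> B" if "t \<in> J" "complex_of_real (m (\<eta> - \<xi> t)) \<noteq> 0" for t \<eta> using mB that by simp
  qed (use m1 in auto)
  also have "\<dots> \<le> ennreal (60000 * q * A\<^sup>2 * C) * ennreal ((2 * pi)\<^sup>2 * (L2_norm v)\<^sup>2)"
    by (rule mult_left_mono[OF a2]) simp
  also have "\<dots> = ennreal (60000 * q * A\<^sup>2 * C * ((2 * pi)\<^sup>2 * (L2_norm v)\<^sup>2))"
    using q0 C0 by (intro ennreal_mult[symmetric]) auto
  finally show ?thesis unfolding C_def .
qed

lemma set_integral_cube_pos:
  fixes N :: "real \<Rightarrow> real"
  assumes N: "continuous_on {0..T} N" "\<And>t. t \<in> {0..T} \<Longrightarrow> 0 < N t" and T: "0 < T"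
  shows "0 < (LBINT t:{0..T}. N t ^ 3)"
proof -
  obtain c where c: "c \<in> {0..T}" "\<And>y. y \<in> {0..T} \<Longrightarrow> N c \<le> N y"
    using continuous_attains_inf[OF compact_Icc _ N(1)] T by force
  have "0 < T * N c ^ 3" using N(2)[OF c(1)] T by simp
  also have "T * N c ^ 3 = (LBINT t:{0..T}. N c ^ 3)"
    using T by (simp add: set_lebesgue_integral_def)
  also have "\<dots> \<le> (LBINT t:{0..T}. N t ^ 3)"
  proof (rule set_integral_mono)
    show "set_integrable lborel {0..T} (\<lambda>t. N c ^ 3)" by (rule borel_integrable_atLeastAtMost') (rule continuous_on_const)
    show "set_integrable lborel {0..T} (\<lambda>t. N t ^ 3)" by (rule borel_integrable_atLeastAtMost') (intro continuous_intros N(1))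
    show "N c ^ 3 \<le> N t ^ 3" if "t \<in> {0..T}" for t
      by (rule power_mono[OF c(2)[OF that] less_imp_le[OF N(2)[OF c(1)]]])
  qed
  finally show ?thesis .
qed

text \<open>The chain rule produces r * r^2 = r^3, exactly the factor that turns N^3 into the cube
  of the rescaled frequency scale. So the constant c is unchanged by the scaling.\<close>

lemma rescaled_center_lipschitz:
  fixes \<xi> :: "real \<Rightarrow> plane"
  assumes r: "0 < r" and \<xi>: "C1_halfline \<xi>" and N: "continuous_on {0..} N" and c: "0 \<le> c"
    and le: "\<And>t. 0 \<le> t \<Longrightarrow> norm (deriv0 \<xi> t) \<le> c * N t ^ 3" and N0: "\<And>t. 0 \<le> t \<Longrightarrow> 0 \<le> N t"
    and ab: "0 \<le> a" "a \<le> b"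
  shows "ennreal (norm (r *\<^sub>R \<xi> (r\<^sup>2 * b) - r *\<^sub>R \<xi> (r\<^sup>2 * a)))
     \<le> ennreal c * (\<integral>\<^sup>+ t\<in>{a..b}. ennreal ((r * N (r\<^sup>2 * t)) ^ 3) \<partial>lborel)"
proof -
  have nn: "0 \<le> r\<^sup>2 * x" if "x \<in> {a..b}" for x using that ab by simp
  have img: "(\<lambda>t. r\<^sup>2 * t) ` {a..b} \<subseteq> {0..}" using nn by auto
  have cN: "continuous_on {a..b} (\<lambda>t. N (r\<^sup>2 * t))"
    by (rule continuous_on_compose2[OF N _ img]) (intro continuous_intros)
  have cm: "(\<lambda>t. ennreal ((r * N (r\<^sup>2 * t)) ^ 3) * indicator {a..b} t) \<in> borel_measurable lborel"
  proof -
    have "(\<lambda>t. indicator {a..b} t *\<^sub>R ((r * N (r\<^sup>2 * t)) ^ 3)) \<in> borel_measurable borel"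
      by (rule borel_measurable_continuous_on_indicator) (auto intro!: continuous_intros cN)
    then have "(\<lambda>t. ennreal (indicator {a..b} t *\<^sub>R ((r * N (r\<^sup>2 * t)) ^ 3))) \<in> borel_measurable borel" by measurable
    moreover have "(\<lambda>t. ennreal (indicator {a..b} t *\<^sub>R ((r * N (r\<^sup>2 * t)) ^ 3))) = (\<lambda>t. ennreal ((r * N (r\<^sup>2 * t)) ^ 3) * indicator {a..b} t)"
      by (auto simp: fun_eq_iff indicator_def)
    ultimately show ?thesis by simp
  qed
  have "ennreal (norm (r *\<^sub>R \<xi> (r\<^sup>2 * b) - r *\<^sub>R \<xi> (r\<^sup>2 * a)))
     \<le> (\<integral>\<^sup>+ t\<in>{a..b}. ennreal (c * (r * N (r\<^sup>2 * t)) ^ 3) \<partial>lborel)"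
  proof (rule norm_increment_le[OF ab(2), where f = "\<lambda>t. r *\<^sub>R \<xi> (r\<^sup>2 * t)"])
    fix x assume x: "x \<in> {a..b}"
    have "\<xi> differentiable (at (r\<^sup>2 * x) within {0..})"
      using \<xi> nn[OF x] by (simp add: C1_halfline_def differentiable_on_def)
    then have "(\<xi> has_vector_derivative deriv0 \<xi> (r\<^sup>2 * x)) (at (r\<^sup>2 * x) within {0..})"
      by (simp only: vector_derivative_works)
    then have 1: "(\<xi> has_vector_derivative deriv0 \<xi> (r\<^sup>2 * x)) (at (r\<^sup>2 * x) within (\<lambda>t. r\<^sup>2 * t) ` {a..b})"
      by (rule has_vector_derivative_within_subset[OF _ img])
    have 2: "((\<lambda>t. r\<^sup>2 * t) has_vector_derivative r\<^sup>2) (at x within {a..b})"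
      by (auto intro!: derivative_eq_intros simp: has_real_derivative_iff_has_vector_derivative[symmetric])
    from vector_diff_chain_within[OF 2 1]
    have "((\<lambda>t. \<xi> (r\<^sup>2 * t)) has_vector_derivative r\<^sup>2 *\<^sub>R deriv0 \<xi> (r\<^sup>2 * x)) (at x within {a..b})"
      by (simp add: o_def)
    then show "((\<lambda>t. r *\<^sub>R \<xi> (r\<^sup>2 * t)) has_vector_derivative r *\<^sub>R (r\<^sup>2 *\<^sub>R deriv0 \<xi> (r\<^sup>2 * x))) (at x within {a..b})"
      by (rule bounded_linear.has_vector_derivative[OF bounded_linear_scaleR_right])
    have "norm (r *\<^sub>R (r\<^sup>2 *\<^sub>R deriv0 \<xi> (r\<^sup>2 * x))) = r ^ 3 * norm (deriv0 \<xi> (r\<^sup>2 * x))"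
      using r by (simp add: power3_eq_cube power2_eq_square)
    also have "\<dots> \<le> r ^ 3 * (c * N (r\<^sup>2 * x) ^ 3)"
      using le[OF nn[OF x]] r by (intro mult_left_mono) auto
    also have "\<dots> = c * (r * N (r\<^sup>2 * x)) ^ 3" by (simp add: power_mult_distrib)
    finally show "norm (r *\<^sub>R (r\<^sup>2 *\<^sub>R deriv0 \<xi> (r\<^sup>2 * x))) \<le> c * (r * N (r\<^sup>2 * x)) ^ 3" .
  qed (intro continuous_intros cN)
  also have "\<dots> = (\<integral>\<^sup>+ t. ennreal c * (ennreal ((r * N (r\<^sup>2 * t)) ^ 3) * indicator {a..b} t) \<partial>lborel)"
  proof (intro nn_integral_cong)
    fix t
    show "ennreal (c * (r * N (r\<^sup>2 * t)) ^ 3) * indicator {a..b} t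
      = ennreal c * (ennreal ((r * N (r\<^sup>2 * t)) ^ 3) * indicator {a..b} t)"
    proof (cases "t \<in> {a..b}")
      case True
      have "0 \<le> (r * N (r\<^sup>2 * t)) ^ 3" using r N0[OF nn[OF True]] by simp
      then show ?thesis using c True by (simp add: ennreal_mult)
    qed simp
  qed
  also have "\<dots> = ennreal c * (\<integral>\<^sup>+ t\<in>{a..b}. ennreal ((r * N (r\<^sup>2 * t)) ^ 3) \<partial>lborel)"
    by (rule nn_integral_cmult[OF cm])
  finally show ?thesis .
qed

text \<open>The product of the constants of \<open>bilinear_bounded_variation\<close>,
  \<open>osc_bound_cube\<close> and Bessel's inequality; the summand 1 makes it positive even for A
  = 0.\<close>

definition bilinear_constant :: "real \<Rightarrow> real \<Rightarrow> real" where
  "bilinear_constant A M = 1 + 60000 * 65536 * A\<^sup>2 * transfer_constant M * (2 * pi)\<^sup>2"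

lemma bilinear_constant_pos: "0 < bilinear_constant A M"
  unfolding bilinear_constant_def using transfer_constant_pos[of M] by (intro add_pos_nonneg) auto

text \<open>The common core of both assertions: m is the symbol and P the operator of either
  projection. What remains is to locate the frequencies of the projected solution around the centre
  of G.\<close>

lemma rescaled_bilinear_bound:
  fixes i j k0 :: nat and l2 k :: int and m :: "plane \<Rightarrow> real" and P :: "(plane \<Rightarrow> complex) \<Rightarrow> plane \<Rightarrow> complex"
  assumes mu: "\<mu> = 1 \<or> \<mu> = -1"
    and adm: "admissible_blowup \<mu> Q I u\<^sub>0 x\<^sub>0 \<xi>\<^sub>0 N\<^sub>0" and tup: "admissible_tuple u\<^sub>0 x\<^sub>0 \<xi>\<^sub>0 N\<^sub>0 \<epsilon>1 \<epsilon>2 \<epsilon>3"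
    and T: "0 < T\<^sub>0" and r_def: "r = \<epsilon>3 * 2 ^ k0 / (LBINT t:{0..T\<^sub>0}. N\<^sub>0 t ^ 3)"
    and part: "interval_partition (rescale r u\<^sub>0) (\<lambda>t. r * N\<^sub>0 (r\<^sup>2 * t)) \<epsilon>3 (T\<^sub>0 / r\<^sup>2) k0 \<tau>"
    and l2: "0 \<le> l2" "l2 \<le> int i - 10" and ij: "i < j" "j \<le> k0" and \<alpha>: "\<alpha> < 2 ^ (k0 - i)"
    and small: "small_interval (rescale r u\<^sub>0) (T\<^sub>0 / r\<^sup>2) J" and JG: "J \<subseteq> G_int \<tau> i \<alpha>"
    and k: "k \<le> l2 + 2" and v: "v \<in> schwartz"
    and K: "is_cube (2 powi k) K" "fourier_support v \<subseteq> K"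
      "K \<inter> annulus (center (\<lambda>t. r *\<^sub>R \<xi>\<^sub>0 (r\<^sup>2 * t)) (G_int \<tau> i \<alpha>)) (2 powi (int i - 6)) (2 powi (int i + 6)) \<noteq> {}"
    and m: "m \<in> borel_measurable borel" "\<And>\<eta>. \<bar>m \<eta>\<bar> \<le> 1" "\<And>\<eta>. 2 powi (l2 + 1) < norm \<eta> \<Longrightarrow> m \<eta> = 0"
    and mk: "mult_kernel (\<lambda>\<eta>. of_real (m \<eta>)) A" and A0: "0 \<le> A"
    and P: "\<And>\<xi> t f. f \<in> L2 \<Longrightarrow> AE x in lborel. shifted \<xi> P f x
      = evol (\<lambda>\<eta>. complex_of_real (m (\<eta> - \<xi>)) * (cis (t * (norm \<eta>)\<^sup>2) * fourier_L2 f \<eta>)) t x / complex_of_real ((2 * pi)\<^sup>2)"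
  shows "Lpow_st 2 J (\<lambda>t x. schrodinger t v x * shifted (r *\<^sub>R \<xi>\<^sub>0 (r\<^sup>2 * t)) P (rescale r u\<^sub>0 t) x)
     \<le> bilinear_bound \<phi> (rescale r u\<^sub>0) (\<lambda>t. r *\<^sub>R \<xi>\<^sub>0 (r\<^sup>2 * t)) (bilinear_constant A (mass (u\<^sub>0 0))) k (int i) l2 J v"
proof -
  define \<xi> where "\<xi> = (\<lambda>t. r *\<^sub>R \<xi>\<^sub>0 (r\<^sup>2 * t))"
  define M where "M = mass (u\<^sub>0 0)"
  define c where "c = 2 powi (-20) * \<epsilon>1 powr (-1/2)"
  define cen where "cen = center \<xi> (G_int \<tau> i \<alpha>)"
  note adm' = adm[unfolded admissible_blowup_def maximal_solution_def]
  from adm' have I: "{0..} \<subseteq> I" by (elim conjE)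
  from adm' have sol: "solution \<mu> I u\<^sub>0" by (elim conjE)
  from adm' have C1N: "C1_halfline N\<^sub>0" by (elim conjE)
  from adm' have C1\<xi>: "C1_halfline \<xi>\<^sub>0" by (elim conjE)
  from adm' have "\<forall>t\<in>I. 0 < N\<^sub>0 t" by (elim conjE)
  then have N0: "0 < N\<^sub>0 t" if "t \<in> I" for t using that by (rule bspec)
  from adm' have "\<forall>t\<in>I. ennreal (mass (u\<^sub>0 t)) = critical_mass \<mu> Q" by (elim conjE)
  then have crit: "ennreal (mass (u\<^sub>0 t)) = critical_mass \<mu> Q" if "t \<in> I" for t using that by (rule bspec)
  have pos: "t \<in> I" if "0 \<le> t" for t using I that by auto
  note tup' = tup[unfolded admissible_tuple_def]
  from tup' have \<epsilon>30: "0 < \<epsilon>3" by (elim conjE)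
  from tup' have \<epsilon>1: "\<epsilon>1 \<le> 2 powi (-100)" by (elim conjE)
  from tup' have \<epsilon>31: "\<epsilon>3 < \<epsilon>1" by (elim conjE) (rule less_trans)
  from tup' have "\<forall>t\<ge>0. norm (deriv0 \<xi>\<^sub>0 t) + \<bar>deriv0 N\<^sub>0 t\<bar> \<le> c * N\<^sub>0 t ^ 3"
    unfolding c_def by (elim conjE)
  then have d\<xi>: "norm (deriv0 \<xi>\<^sub>0 t) + \<bar>deriv0 N\<^sub>0 t\<bar> \<le> c * N\<^sub>0 t ^ 3" if "0 \<le> t" for t
    using that by blast
  have Nc: "continuous_on {0..} N\<^sub>0" using C1N by (simp add: C1_halfline_def differentiable_imp_continuous_on)
  have r: "0 < r"
  proof -
    have "0 < (LBINT t:{0..T\<^sub>0}. N\<^sub>0 t ^ 3)"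
      by (rule set_integral_cube_pos[OF continuous_on_subset[OF Nc] _ T]) (auto intro: N0 pos)
    then show ?thesis unfolding r_def using \<epsilon>30 by simp
  qed
  have c0: "0 \<le> c" by (simp add: c_def)
  \<comment> \<open>All masses equal \<open>critical_mass\<close> by admissibility, and
    \<open>ennreal\<close> is injective on nonnegative reals.\<close>
  have mass: "mass (u\<^sub>0 t) = M" if "0 \<le> t" for t
    using crit[OF pos[OF that]] crit[OF pos[OF order_refl]] mass_nonneg unfolding M_def by (metis ennreal_inj)
  \<comment> \<open>As \<epsilon>3 < \<epsilon>1, the product of \<epsilon>1^(-1/2) and \<epsilon>3
    is at most \<epsilon>1^(1/2), hence at most 1. Multiplied by the 2^i pieces of G, the centre
    drifts by at most 2^(i - 19).\<close>
  have c\<epsilon>: "c * (2 * \<epsilon>3) \<le> 2 powi (-19)"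
  proof -
    have e1: "0 < \<epsilon>1" "\<epsilon>1 \<le> 1"
    proof -
      have "(2::real) powi (-100) \<le> 2 powi 0" by (rule power_int_increasing) auto
      then show "\<epsilon>1 \<le> 1" using \<epsilon>1 by simp
    qed (use \<epsilon>30 \<epsilon>31 in simp)
    have "\<epsilon>1 powr (-1/2) * \<epsilon>3 \<le> \<epsilon>1 powr (-1/2) * \<epsilon>1 powr 1" using \<epsilon>31 e1 by (intro mult_left_mono) auto
    also have "\<dots> = \<epsilon>1 powr (1/2)" by (simp only: powr_add[symmetric]) simp
    also have "\<dots> \<le> 1" using e1 by (simp add: powr_le1)
    finally have "2 * 2 powi (-20) * (\<epsilon>1 powr (-1/2) * \<epsilon>3) \<le> 2 * 2 powi (-20) * 1" by (intro mult_left_mono) auto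
    moreover have "(2::real) * 2 powi (-20) = 2 powi (-19)" using powi_2_shift[of "-20" 1] by simp
    moreover have "c * (2 * \<epsilon>3) = 2 * 2 powi (-20) * (\<epsilon>1 powr (-1/2) * \<epsilon>3)" unfolding c_def by (simp only: mult_ac)
    ultimately show ?thesis by (simp only: mult_1_right)
  qed
  have lip: "ennreal (norm (\<xi> b - \<xi> a)) \<le> ennreal c * (\<integral>\<^sup>+ t\<in>{a..b}. ennreal ((r * N\<^sub>0 (r\<^sup>2 * t)) ^ 3) \<partial>lborel)" if "0 \<le> a" "a \<le> b" for a b
    unfolding \<xi>_def
  proof (rule rescaled_center_lipschitz[OF r C1\<xi> Nc c0 _ _ that])
    show "norm (deriv0 \<xi>\<^sub>0 t) \<le> c * N\<^sub>0 t ^ 3" if "0 \<le> t" for t using d\<xi>[OF that] by linarith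
    show "0 \<le> N\<^sub>0 t" if "0 \<le> t" for t using N0[OF pos[OF that]] by simp
  qed
  have ik: "i \<le> k0" using ij by simp
  have near: "norm (\<xi> t - cen) \<le> 2 powi (int i - 9)" if "t \<in> J" for t
  proof -
    have "norm (\<xi> t - cen) \<le> 2 ^ i * (c * (2 * \<epsilon>3))"
      unfolding cen_def by (rule G_int_center_bound(1)[OF part ik \<alpha> _ \<epsilon>30 c0 lip]) (use that JG in auto)
    also have "\<dots> \<le> 2 ^ i * 2 powi (-19)" using c\<epsilon> by (rule mult_left_mono) simp
    also have "\<dots> = 2 powi (-19 + int i)" by (rule powi_2_shift[symmetric])
    also have "\<dots> \<le> 2 powi (int i - 9)" by (rule power_int_increasing) auto
    finally show ?thesis .
  qed
  \<comment> \<open>The radius 2^(i - 8) is twice 2^(i - 9): one half covers the drift of the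
    centre, the other the support of the symbol, since l2 + 1 <= i - 9.\<close>
  define B where "B = cball cen (2 powi (int i - 8))"
  have mB: "\<eta> \<in> B" if t: "t \<in> J" and \<eta>: "m (\<eta> - \<xi> t) \<noteq> 0" for t \<eta>
  proof -
    have "norm (\<eta> - \<xi> t) \<le> 2 powi (l2 + 1)" using m(3)[of "\<eta> - \<xi> t"] \<eta> by force
    also have "\<dots> \<le> 2 powi (int i - 9)" using l2 by (intro power_int_increasing) auto
    finally have "norm (\<eta> - \<xi> t) + norm (\<xi> t - cen) \<le> 2 * 2 powi (int i - 9)" using near[OF t] by simp
    moreover have "(2::real) * 2 powi (int i - 9) = 2 powi (int i - 8)" using powi_2_shift[of "int i - 9" 1] by simp
    moreover have "norm (\<eta> - cen) \<le> norm (\<eta> - \<xi> t) + norm (\<xi> t - cen)"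
      using norm_triangle_ineq[of "\<eta> - \<xi> t" "\<xi> t - cen"] by simp
    ultimately show ?thesis by (simp add: B_def dist_norm norm_minus_commute)
  qed
  have supp: "\<eta> \<in> K" if "fourier v \<eta> \<noteq> 0" for \<eta>
    using K(2) closure_subset[of "{\<xi>. fourier v \<xi> \<noteq> 0}"] that unfolding fourier_support_def by blast
  obtain y0 where y0: "K = cbox y0 (y0 + 2 powi k *\<^sub>R One)" using K(1) unfolding is_cube_def by blast
  have Kb: "bounded K" "K \<in> sets borel" unfolding y0 by (auto intro: bounded_cbox)
  have J: "is_interval J" "J \<subseteq> {0..}" "Lpow_st 4 J (rescale r u\<^sub>0) = 1"
    using small unfolding small_interval_def by auto
  have "Lpow_st 2 J (\<lambda>t x. schrodinger t v x * shifted (\<xi> t) P (rescale r u\<^sub>0 t) x)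
     \<le> ennreal (60000 * (65536 * 2 powi (k - int i)) * A\<^sup>2 * transfer_constant M * ((2 * pi)\<^sup>2 * (L2_norm v)\<^sup>2))"
  proof (rule frequency_localized_bilinear[OF r sol _ I mass J v supp Kb])
    show "\<bar>\<mu>\<bar> \<le> 1" using mu by auto
    show "B \<in> sets borel" "bounded B" by (auto simp: B_def)
    show "osc_bound {z. fourier v (p - z) \<noteq> 0 \<and> b (p + z) \<noteq> 0} (65536 * 2 powi (k - int i))"
      if b: "\<And>\<eta>. b \<eta> \<noteq> 0 \<Longrightarrow> \<eta> \<in> B" for b :: "plane \<Rightarrow> complex" and p
    proof (rule osc_bound_cube[OF K(1) K(3)[folded \<xi>_def, folded cen_def] _ supp])
      show "k \<le> int i - 8" using k l2 by simp
      show "norm (\<eta> - cen) \<le> 2 powi (int i - 8)" if "b \<eta> \<noteq> 0" for \<eta>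
        using b[OF that] by (simp add: B_def dist_norm norm_minus_commute)
    qed
    show "AE x in lborel. shifted (\<xi> t) P f x
      = evol (\<lambda>\<eta>. complex_of_real (m (\<eta> - \<xi> t)) * (cis (t * (norm \<eta>)\<^sup>2) * fourier_L2 f \<eta>)) t x / complex_of_real ((2 * pi)\<^sup>2)"
      if "f \<in> L2" for t f by (rule P[OF that])
  qed (use m(1,2) mk A0 mB in auto)
  also have "\<dots> \<le> ennreal (bilinear_constant A M * 2 powi (k - int i) * (L2_norm v)\<^sup>2)"
  proof (rule ennreal_leI)
    have "60000 * (65536 * 2 powi (k - int i)) * A\<^sup>2 * transfer_constant M * ((2 * pi)\<^sup>2 * (L2_norm v)\<^sup>2)
      = (60000 * 65536 * A\<^sup>2 * transfer_constant M * (2 * pi)\<^sup>2) * (2 powi (k - int i) * (L2_norm v)\<^sup>2)"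
      by (simp only: mult_ac)
    also have "\<dots> \<le> bilinear_constant A M * (2 powi (k - int i) * (L2_norm v)\<^sup>2)"
      unfolding bilinear_constant_def by (intro mult_right_mono) auto
    finally show "60000 * (65536 * 2 powi (k - int i)) * A\<^sup>2 * transfer_constant M * ((2 * pi)\<^sup>2 * (L2_norm v)\<^sup>2)
      \<le> bilinear_constant A M * 2 powi (k - int i) * (L2_norm v)\<^sup>2" by (simp only: mult.assoc)
  qed
  also have "\<dots> \<le> bilinear_bound \<phi> (rescale r u\<^sub>0) \<xi> (bilinear_constant A M) k (int i) l2 J v"
    unfolding bilinear_bound_def by (rule le_iff_add[THEN iffD2, OF exI, OF refl])
  finally show ?thesis unfolding \<xi>_def M_def .
qed

theorem proposition5p10:
  fixes \<mu> :: real and Q \<phi> :: "plane \<Rightarrow> real"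
  assumes "\<mu> = 1 \<or> \<mu> = -1"
    and "\<mu> = -1 \<Longrightarrow> ground_state Q"
    and "standing_assumption \<mu> Q"
    and "lp_cutoff \<phi>"
  shows "\<exists>C :: real \<Rightarrow> real. (\<forall>m. 0 < C m) \<and>
    (\<forall>I u\<^sub>0 x\<^sub>0 \<xi>\<^sub>0 N\<^sub>0 \<epsilon>1 \<epsilon>2 \<epsilon>3 (k0 :: nat) T\<^sub>0.
       admissible_blowup \<mu> Q I u\<^sub>0 x\<^sub>0 \<xi>\<^sub>0 N\<^sub>0 \<longrightarrow>
       admissible_tuple u\<^sub>0 x\<^sub>0 \<xi>\<^sub>0 N\<^sub>0 \<epsilon>1 \<epsilon>2 \<epsilon>3 \<longrightarrow>
       20 \<le> k0 \<longrightarrow> 0 < T\<^sub>0 \<longrightarrow> Lpow_st 4 {0..T\<^sub>0} u\<^sub>0 = 2 ^ k0 \<longrightarrow>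
       (let r = \<epsilon>3 * 2 ^ k0 / (LBINT t:{0..T\<^sub>0}. N\<^sub>0 t ^ 3);
            u = rescale r u\<^sub>0;
            \<xi> = (\<lambda>t. r *\<^sub>R \<xi>\<^sub>0 (r\<^sup>2 * t));
            N = (\<lambda>t. r * N\<^sub>0 (r\<^sup>2 * t));
            T = T\<^sub>0 / r\<^sup>2
        in \<forall>\<tau> (l2 :: int) (i :: nat) (j :: nat) \<alpha> \<kappa> J (k :: int) v\<^sub>0.
          interval_partition u N \<epsilon>3 T k0 \<tau> \<longrightarrow>
          0 \<le> l2 \<longrightarrow> l2 \<le> int i - 10 \<longrightarrow> 20 \<le> i \<longrightarrow> i < j \<longrightarrow> 20 \<le> j \<longrightarrow> j \<le> k0 \<longrightarrow>
          \<alpha> < 2 ^ (k0 - i) \<longrightarrow> \<kappa> < 2 ^ (k0 - j) \<longrightarrow>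
          small_interval u T J \<longrightarrow> J \<subseteq> G_int \<tau> i \<alpha> \<longrightarrow> G_int \<tau> i \<alpha> \<subseteq> G_int \<tau> j \<kappa> \<longrightarrow>
          k \<le> l2 + 2 \<longrightarrow> v\<^sub>0 \<in> schwartz \<longrightarrow>
          (\<exists>K. is_cube (2 powi k) K \<and> fourier_support v\<^sub>0 \<subseteq> K \<and>
             K \<inter> annulus (center \<xi> (G_int \<tau> i \<alpha>)) (2 powi (int i - 6)) (2 powi (int i + 6)) \<noteq> {}) \<longrightarrow>
          Lpow_st 2 J (\<lambda>t x. schrodinger t v\<^sub>0 x * shifted (\<xi> t) (lp_le \<phi> l2) (u t) x)
            \<le> bilinear_bound \<phi> u \<xi> (C (mass (u\<^sub>0 0))) k (int i) l2 J v\<^sub>0 \<and>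
          Lpow_st 2 J (\<lambda>t x. schrodinger t v\<^sub>0 x * shifted (\<xi> t) (lp_proj \<phi> l2) (u t) x)
            \<le> bilinear_bound \<phi> u \<xi> (C (mass (u\<^sub>0 0))) k (int i) l2 J v\<^sub>0))"
proof -
  note \<phi> = assms(4)
  obtain A where A0: "0 \<le> A"
    and A: "\<And>l. 0 \<le> l \<Longrightarrow> mult_kernel (\<lambda>\<eta>. complex_of_real (lp_le_symbol \<phi> l \<eta>)) A
        \<and> mult_kernel (\<lambda>\<eta>. complex_of_real (lp_symbol \<phi> l \<eta>)) A"
    using lp_kernels[OF \<phi>] unfolding lp_le_symbol_def by blast
  \<comment> \<open>A depends on the cutoff alone, so \<open>bilinear_constant A\<close> is a
    function of the mass fixed before the solution, the tuple and the scales are chosen.\<close>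
  show ?thesis
    unfolding Let_def
  proof (intro exI[of _ "bilinear_constant A"] conjI allI impI bilinear_constant_pos, goal_cases)
    case (1 I u\<^sub>0 x\<^sub>0 \<xi>\<^sub>0 N\<^sub>0 \<epsilon>1 \<epsilon>2 \<epsilon>3 k0 T\<^sub>0 \<tau> l2 i j \<alpha> \<kappa> J k v\<^sub>0)
    from 1(20) obtain K where K: "is_cube (2 powi k) K" "fourier_support v\<^sub>0 \<subseteq> K"
      "K \<inter> annulus (center (\<lambda>t. (\<epsilon>3 * 2 ^ k0 / (LBINT t:{0..T\<^sub>0}. N\<^sub>0 t ^ 3)) *\<^sub>R \<xi>\<^sub>0 ((\<epsilon>3 * 2 ^ k0 / (LBINT t:{0..T\<^sub>0}. N\<^sub>0 t ^ 3))\<^sup>2 * t)) (G_int \<tau> i \<alpha>)) (2 powi (int i - 6)) (2 powi (int i + 6)) \<noteq> {}"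
      by (elim exE conjE)
    show ?case
      by (rule rescaled_bilinear_bound[OF assms(1) 1(1,2,4) refl 1(6,7,8,10,12,13,15,16,18,19) K
        lp_le_symbol_props[OF \<phi> 1(7)] conjunct1[OF A[OF 1(7)]] A0 shifted_lp_le_eq_evol[OF \<phi>]])
  next
    case (2 I u\<^sub>0 x\<^sub>0 \<xi>\<^sub>0 N\<^sub>0 \<epsilon>1 \<epsilon>2 \<epsilon>3 k0 T\<^sub>0 \<tau> l2 i j \<alpha> \<kappa> J k v\<^sub>0)
    from 2(20) obtain K where K: "is_cube (2 powi k) K" "fourier_support v\<^sub>0 \<subseteq> K"
      "K \<inter> annulus (center (\<lambda>t. (\<epsilon>3 * 2 ^ k0 / (LBINT t:{0..T\<^sub>0}. N\<^sub>0 t ^ 3)) *\<^sub>R \<xi>\<^sub>0 ((\<epsilon>3 * 2 ^ k0 / (LBINT t:{0..T\<^sub>0}. N\<^sub>0 t ^ 3))\<^sup>2 * t)) (G_int \<tau> i \<alpha>)) (2 powi (int i - 6)) (2 powi (int i + 6)) \<noteq> {}"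
      by (elim exE conjE)
    show ?case
      by (rule rescaled_bilinear_bound[OF assms(1) 2(1,2,4) refl 2(6,7,8,10,12,13,15,16,18,19) K
        lp_symbol_props[OF \<phi> 2(7)] conjunct2[OF A[OF 2(7)]] A0 shifted_lp_proj_eq_evol(1)[OF \<phi> 2(7)]])
  qed
qed

end
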